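(* Let $n=1$, $q=3$, $d\in\mathbb{R}$, and let $a=1+b>0$ satisfy the standing assumptions listed in the context. Suppose $u_0\in L^1(\mathbb{R};1+|x|)\cap L^\infty(\mathbb{R})$ and let $u(x,t)$ be the solution of the Cauchy problem $$\partial_t u-\partial_x(a(x)\partial_x u)=d\,\partial_x(|u|^{2}u),\quad x\in\mathbb{R},\ t>0,\qquad u(x,0)=u_0(x).$$ Then, for any $p\in[1,\infty]$, $$\lim_{t\to\infty}t^{\frac12\left(1-\frac1p\right)+\frac12}\Big\|u(t)-MG(t)-\left(K(t)+\alpha_1dM^3\right)(\log t)\,\partial_xG(t)-(\mathcal{M}-m)\partial_xG(t)-M^3\Psi(t)-\Phi(t)\Big\|_{L^p}=0,$$ where $G$, $M$, $m$, $\alpha_1$, $K$, $\mathcal{M}$, $\Psi$ and $\Phi$ are defined in the context.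
   Context: Standing assumptions on the diffusion: $a(x)=1+b(x)>0$ with $b\in L^1(\mathbb{R})\cap C^{1,\alpha}(\mathbb{R})$ for some $0<\alpha<1$, $\|b\|_{L^\infty}<1$, and there are constants $C>0$, $\delta>0$ such that $|b(x)|+(1+|x|^2)^{1/2}|b'(x)|\le C(1+|x|^2)^{-\delta/2}$ for all $x\in\mathbb{R}$. Solution: for $u_0\in L^1(\mathbb{R})$ the solution is the unique global (real-valued) solution $u\in C([0,\infty);L^1(\mathbb{R}))$ with $u\in C((0,\infty);W^{2,p}(\mathbb{R}))\cap C^1((0,\infty);L^p(\mathbb{R}))$ for all $p\in(1,\infty)$ (known to exist); if also $u_0\in L^\infty$, then $u\in L^\infty(\mathbb{R}\times(0,\infty))$. Notation: $L^1(\mathbb{R};1+|x|)$ is the set of $f\in L^1(\mathbb{R})$ with $\int_{\mathbb{R}}|f(x)|(1+|x|)\,dx<\infty$. $*$ denotes convolution in the space variable; $1/p=0$ if $p=\infty$; $\partial_xu(y,\tau)$ is the spatial derivative of $u$ evaluated at $(y,\tau)$. $G(x,t)=(4\pi t)^{-1/2}e^{-x^2/(4t)}$; $M=\int_{\mathbb{R}}u_0(x)\,dx$; $m=\int_{\mathbb{R}}xu_0(x)\,dx$; $\alpha_1=\frac{1}{4\pi}3^{-1/2}$; $$K(t)=\frac1{\log t}\int_0^t\!\int_{\mathbb{R}}b(y)\partial_xu(y,\tau)\,dy\,d\tau\quad(t>1),$$ $$\mathcal{M}=d\int_0^1\!\int_{\mathbb{R}}(|u|^2u)(y,\tau)\,dy\,d\tau+d\int_1^\infty\!\int_{\mathbb{R}}\left(|u|^2u-|MG|^2MG\right)(y,\tau)\,dy\,d\tau.$$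 $\Psi(x,t)=t^{-1}\Psi_*\!\left(\frac{x}{\sqrt t}\right)$, $\Psi_*(x)=d\,\partial_x\left(\int_0^1(G(1-s)*F(s))(x)\,ds\right)$, where $F(y,s)=s^{-\frac32}F_*\!\left(\frac{y}{\sqrt s}\right)$ and $F_*(y)=\frac{1}{8\pi^{3/2}}\left\{e^{-\frac{3y^2}{4}}-3^{-\frac12}e^{-\frac{y^2}{4}}\right\}$. $\Phi(x,t)=t^{-1}\Phi_*\!\left(\frac{x}{\sqrt t},t\right)$, $\Phi_*(x,t)=t^{\frac32}\,\partial_x\left(\int_0^1\left(G(1-s)*\phi(\sqrt t\,\cdot,ts)\right)(x)\,ds\right)$, where $$\phi(y,\tau)=b(y)\partial_xu(y,\tau)-\left(\int_{\mathbb{R}}b(z)\partial_xu(z,\tau)\,dz\right)G(y,\tau).$$ *)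

theory Defs
  imports "HOL-Probability.Essential_Supremum"
begin

section \<open>Lebesgue and Sobolev spaces on the real line\<close>

text \<open>
  Elements of Lebesgue spaces are represented by Borel functions; every notion below depends
  only on the almost-everywhere class.  As for \<^const>\<open>esssup\<close>, the norm of a non-measurable
  function is \<open>\<infinity>\<close>.  The convention \<open>1/\<infinity> = 0\<close> is that of \<^typ>\<open>ennreal\<close>.
\<close>

definition Lp_norm :: "ennreal \<Rightarrow> (real \<Rightarrow> real) \<Rightarrow> ennreal" where
  "Lp_norm p f =
     (if f \<notin> borel_measurable lborel then \<infinity>
      else if p = \<infinity> then esssup lborel (\<lambda>x. ennreal \<bar>f x\<bar>)
      else (let I = (\<integral>\<^sup>+ x. ennreal (\<bar>f x\<bar> powr enn2real p) \<partial>lborel)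
            in if I = \<infinity> then \<infinity> else ennreal (enn2real I powr enn2real (1 / p))))"

definition in_Lp :: "ennreal \<Rightarrow> (real \<Rightarrow> real) \<Rightarrow> bool" where
  "in_Lp p f \<longleftrightarrow> Lp_norm p f < \<infinity>"

definition in_weighted_L1 :: "(real \<Rightarrow> real) \<Rightarrow> bool" where
  "in_weighted_L1 f \<longleftrightarrow> in_Lp 1 f \<and> integrable lborel (\<lambda>x. \<bar>f x\<bar> * (1 + \<bar>x\<bar>))"

definition locally_L1 :: "(real \<Rightarrow> real) \<Rightarrow> bool" where
  "locally_L1 f \<longleftrightarrow> (\<forall>r. set_integrable lborel {-r..r} f)"

definition test_function :: "(real \<Rightarrow> real) \<Rightarrow> bool" where
  "test_function \<phi> \<longleftrightarrow>
     (\<forall>k x. ((deriv ^^ k) \<phi>) differentiable (at x)) \<and> compact (closure {x. \<phi> x \<noteq> 0})"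

definition has_weak_deriv :: "(real \<Rightarrow> real) \<Rightarrow> (real \<Rightarrow> real) \<Rightarrow> bool" where
  "has_weak_deriv f g \<longleftrightarrow> locally_L1 f \<and> locally_L1 g \<and>
     (\<forall>\<phi>. test_function \<phi> \<longrightarrow>
        (LINT x|lborel. f x * deriv \<phi> x) = - (LINT x|lborel. g x * \<phi> x))"

text \<open>
  A representative of the weak derivative, which is unique up to null sets.  It is applied
  only to functions that do have a weak derivative.
\<close>

definition weak_deriv :: "(real \<Rightarrow> real) \<Rightarrow> real \<Rightarrow> real" where
  "weak_deriv f = (SOME g. has_weak_deriv f g)"

definition in_W2p :: "ennreal \<Rightarrow> (real \<Rightarrow> real) \<Rightarrow> bool" where
  "in_W2p p f \<longleftrightarrow> in_Lp p f \<and>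
     (\<exists>g h. has_weak_deriv f g \<and> in_Lp p g \<and> has_weak_deriv g h \<and> in_Lp p h)"

definition W2p_norm :: "ennreal \<Rightarrow> (real \<Rightarrow> real) \<Rightarrow> ennreal" where
  "W2p_norm p f = Lp_norm p f + Lp_norm p (weak_deriv f) + Lp_norm p (weak_deriv (weak_deriv f))"

text \<open>
  Continuity and differentiability of a curve \<open>v\<close> of functions with respect to a norm \<open>N\<close>.
  Here and below a function of space and time is written with the time variable first, so
  that \<open>v t\<close> is a function of space.
\<close>

definition norm_continuous_on ::
    "((real \<Rightarrow> real) \<Rightarrow> ennreal) \<Rightarrow> real set \<Rightarrow> (real \<Rightarrow> real \<Rightarrow> real) \<Rightarrow> bool" where
  "norm_continuous_on N J v \<longleftrightarrow>
     (\<forall>t\<in>J. ((\<lambda>s. N (\<lambda>x. v s x - v t x)) \<longlongrightarrow> 0) (at t within J))"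

definition norm_has_deriv_on ::
    "((real \<Rightarrow> real) \<Rightarrow> ennreal) \<Rightarrow> real set \<Rightarrow> (real \<Rightarrow> real \<Rightarrow> real) \<Rightarrow> (real \<Rightarrow> real \<Rightarrow> real) \<Rightarrow> bool"
  where
  "norm_has_deriv_on N J v w \<longleftrightarrow>
     (\<forall>t\<in>J. ((\<lambda>s. N (\<lambda>x. (v s x - v t x) / (s - t) - w t x)) \<longlongrightarrow> 0) (at t within J))"

section \<open>The Cauchy problem\<close>

definition in_C1_Hoelder :: "real \<Rightarrow> (real \<Rightarrow> real) \<Rightarrow> bool" where
  "in_C1_Hoelder \<alpha> f \<longleftrightarrow>
     (\<forall>x. f differentiable (at x)) \<and> bounded (range f) \<and> bounded (range (deriv f)) \<and>
     (\<exists>H. \<forall>x y. \<bar>deriv f x - deriv f y\<bar> \<le> H * \<bar>x - y\<bar> powr \<alpha>)"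

definition standing_assumptions :: "(real \<Rightarrow> real) \<Rightarrow> (real \<Rightarrow> real) \<Rightarrow> bool" where
  "standing_assumptions a b \<longleftrightarrow>
     (\<forall>x. a x = 1 + b x \<and> a x > 0) \<and>
     in_Lp 1 b \<and> (\<exists>\<alpha>. 0 < \<alpha> \<and> \<alpha> < 1 \<and> in_C1_Hoelder \<alpha> b) \<and>
     Lp_norm \<infinity> b < 1 \<and>
     (\<exists>C>0. \<exists>\<delta>>0. \<forall>x. \<bar>b x\<bar> + (1 + \<bar>x\<bar>\<^sup>2) powr (1/2) * \<bar>deriv b x\<bar>
                         \<le> C * (1 + \<bar>x\<bar>\<^sup>2) powr (- \<delta> / 2))"

text \<open>
  The function \<open>ut\<close> is the time derivative of \<open>u\<close>; as the limits of the difference quotients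
  in different Lebesgue spaces agree almost everywhere, it can be chosen independently of \<open>p\<close>.
\<close>

definition is_solution ::
    "(real \<Rightarrow> real) \<Rightarrow> real \<Rightarrow> (real \<Rightarrow> real) \<Rightarrow> (real \<Rightarrow> real \<Rightarrow> real) \<Rightarrow> bool" where
  "is_solution a d u0 u \<longleftrightarrow>
     (\<forall>t\<ge>0. in_Lp 1 (u t)) \<and> norm_continuous_on (Lp_norm 1) {0..} u \<and>
     (\<forall>p. 1 < p \<and> p < \<infinity> \<longrightarrow>
        (\<forall>t>0. in_W2p p (u t)) \<and> norm_continuous_on (W2p_norm p) {0<..} u) \<and>
     (\<exists>ut.
        (\<forall>p. 1 < p \<and> p < \<infinity> \<longrightarrow>
           (\<forall>t>0. in_Lp p (ut t)) \<and> norm_continuous_on (Lp_norm p) {0<..} ut \<and>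
           norm_has_deriv_on (Lp_norm p) {0<..} u ut) \<and>
        (\<forall>t>0. AE x in lborel.
           ut t x - weak_deriv (\<lambda>y. a y * weak_deriv (u t) y) x
             = d * weak_deriv (\<lambda>y. \<bar>u t y\<bar>\<^sup>2 * u t y) x)) \<and>
     (AE x in lborel. u 0 x = u0 x)"

section \<open>The terms of the asymptotic expansion\<close>

definition convolution :: "(real \<Rightarrow> real) \<Rightarrow> (real \<Rightarrow> real) \<Rightarrow> real \<Rightarrow> real" where
  "convolution f g x = (LINT y|lborel. f (x - y) * g y)"

definition G :: "real \<Rightarrow> real \<Rightarrow> real" where
  "G t x = (4 * pi * t) powr (-1/2) * exp (- x\<^sup>2 / (4 * t))"

definition mass :: "(real \<Rightarrow> real) \<Rightarrow> real" where
  "mass u0 = (LINT x|lborel. u0 x)"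

definition first_moment :: "(real \<Rightarrow> real) \<Rightarrow> real" where
  "first_moment u0 = (LINT x|lborel. x * u0 x)"

definition \<alpha>\<^sub>1 :: real where
  "\<alpha>\<^sub>1 = 1 / (4 * pi) * 3 powr (-1/2)"

definition K :: "(real \<Rightarrow> real) \<Rightarrow> (real \<Rightarrow> real \<Rightarrow> real) \<Rightarrow> real \<Rightarrow> real" where
  "K b u t = 1 / ln t *
     (LINT \<tau>:{0<..<t}|lborel. (LINT y|lborel. b y * weak_deriv (u \<tau>) y))"

text \<open>The constant \<open>\<M>\<close>, with \<open>M\<close> the mass of the initial value.\<close>

definition calM :: "real \<Rightarrow> real \<Rightarrow> (real \<Rightarrow> real \<Rightarrow> real) \<Rightarrow> real" where
  "calM d M u =
     d * (LINT \<tau>:{0<..<1}|lborel. (LINT y|lborel. \<bar>u \<tau> y\<bar>\<^sup>2 * u \<tau> y)) +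
     d * (LINT \<tau>:{1<..}|lborel.
            (LINT y|lborel. \<bar>u \<tau> y\<bar>\<^sup>2 * u \<tau> y - \<bar>M * G \<tau> y\<bar>\<^sup>2 * (M * G \<tau> y)))"

definition F_star :: "real \<Rightarrow> real" where
  "F_star y = 1 / (8 * pi powr (3/2)) *
     (exp (- 3 * y\<^sup>2 / 4) - 3 powr (-1/2) * exp (- y\<^sup>2 / 4))"

definition F :: "real \<Rightarrow> real \<Rightarrow> real" where
  "F s y = s powr (-3/2) * F_star (y / sqrt s)"

definition Psi_star :: "real \<Rightarrow> real \<Rightarrow> real" where
  "Psi_star d x = d * deriv (\<lambda>z. LINT s:{0<..<1}|lborel. convolution (G (1 - s)) (F s) z) x"

definition Psi :: "real \<Rightarrow> real \<Rightarrow> real \<Rightarrow> real" where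
  "Psi d t x = 1 / t * Psi_star d (x / sqrt t)"

definition phi :: "(real \<Rightarrow> real) \<Rightarrow> (real \<Rightarrow> real \<Rightarrow> real) \<Rightarrow> real \<Rightarrow> real \<Rightarrow> real" where
  "phi b u \<tau> y =
     b y * weak_deriv (u \<tau>) y - (LINT z|lborel. b z * weak_deriv (u \<tau>) z) * G \<tau> y"

definition Phi_star :: "(real \<Rightarrow> real) \<Rightarrow> (real \<Rightarrow> real \<Rightarrow> real) \<Rightarrow> real \<Rightarrow> real \<Rightarrow> real" where
  "Phi_star b u t x = t powr (3/2) *
     deriv (\<lambda>z. LINT s:{0<..<1}|lborel.
                  convolution (G (1 - s)) (\<lambda>y. phi b u (t * s) (sqrt t * y)) z) x"

definition Phi :: "(real \<Rightarrow> real) \<Rightarrow> (real \<Rightarrow> real \<Rightarrow> real) \<Rightarrow> real \<Rightarrow> real \<Rightarrow> real" where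
  "Phi b u t x = 1 / t * Phi_star b u t (x / sqrt t)"

end

theory Submission
  imports Defs "HOL-Probability.Distributions" "HOL-Computational_Algebra.Polynomial"
begin

text \<open>
  Write \<open>v\<close> for the continuous representative of the solution and \<open>D\<close> for a constant depending on
  the data.  The equation is a conservation law, so that \<open>\<parallel>v\<parallel>\<^sub>1\<close> does not increase.  The energy
  identity \<open>(\<parallel>v\<parallel>\<^sub>2\<^sup>2)' = - 2 \<integral> a v\<^sub>x\<^sup>2\<close> and Nash's inequality give \<open>\<parallel>v\<parallel>\<^sub>2\<^sup>2 \<le> D t\<^bsup>-1/2\<^esup>\<close>; the weighted energy
  \<open>\<integral> a v\<^sub>x\<^sup>2\<close> is monotone up to a constant factor, whence \<open>\<parallel>v\<^sub>x\<parallel>\<^sub>2\<^sup>2 \<le> D t\<^bsup>-3/2\<^esup>\<close> and \<open>\<parallel>v\<parallel>\<^sub>\<infinity> \<le> D t\<^bsup>-1/2\<^esup>\<close>.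
  Of \<open>b\<close> only the \<open>L\<^sup>1\<close> and \<open>L\<^sup>\<infinity>\<close> norms enter the constants, and \<open>\<parallel>b v\<^sub>x\<parallel>\<^sub>1 \<le> D t\<^bsup>-3/4\<^esup>\<close>.

  Duhamel's formula, with the constant-coefficient heat kernel and the perturbation
  \<open>\<partial>\<^sub>x (b v\<^sub>x + d v\<^sup>3)\<close> as source, gives \<open>\<parallel>v - M G\<parallel>\<^sub>1 \<le> D t\<^bsup>-1/4\<^esup>\<close>, so that \<open>v\<^sup>3 - (M G)\<^sup>3\<close> is integrable over space
  and large times.  A source that is integrable over space-time contributes its total mass times
  \<open>\<partial>\<^sub>x G\<close> up to smaller terms.  The remaining source \<open>(M G)\<^sup>3\<close> is explicit: \<open>G(s)\<^sup>3 = (\<alpha>\<^sub>1 / s) G(s/3)\<close>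
  turns its potential into \<open>M\<^sup>3 \<alpha>\<^sub>1 \<integral> \<partial>\<^sub>x G(t - 2s/3) ds/s\<close> over \<open>1 \<le> s \<le> t\<close>, which splits into the logarithmic
  term and \<open>\<Psi>\<close>.  The source \<open>b v\<^sub>x\<close> is kept as it is and produces \<open>K\<close> and \<open>\<Phi>\<close> exactly.
\<close>

subsection \<open>Primitives and weak derivatives\<close>

text \<open>The known L1 bound of the source b v_x is of order t^(-3/4), which is not integrable in
  time and so gives no limit for its space-time mass; this is why the source is carried along
  exactly. The cubic source is borderline as well: its L1 norm is of order 1/t, the origin of the
  logarithm. Subtracting (M G)^3 gains the rate t^(-1/4) of v - M G, and t^(-5/4) is integrable at
  infinity. At time 0 the rate t^(-1/2) of the supremum would be too singular for v^3; the L2 bound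
  by the initial value gives t^(-1/3) instead. The remainders have to be o(1/t) in the supremum norm
  and o(t^(-1/2)) in L1. One moment of the initial value gives no rate in the first-order expansion,
  only smallness by dominated convergence. Recent times are the delicate ones for the supremum norm:
  there the kernel loses t^(1/2), and the supremum rate t^(-7/12) of v - M G leaves a gain of
  t^(-1/12). In time the solution is a differentiable curve in L2 and nothing more is known of v_x
  than continuity; each time derivative below is arranged so that only v is differenced.\<close>

text \<open>Absolutely continuous functions are represented as primitives of locally integrable densities.\<close>

definition prim :: "(real \<Rightarrow> real) \<Rightarrow> (real \<Rightarrow> real) \<Rightarrow> bool" where
  "prim H h \<longleftrightarrow> locally_L1 h \<and> (\<forall>x y. x \<le> y \<longrightarrow> H y - H x = (LINT z:{x..y}|lborel. h z))"

lemma locally_L1_set_integrable: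
  assumes "locally_L1 h"
  shows "set_integrable lborel {x..y} h"
proof -
  have "set_integrable lborel {-(max \<bar>x\<bar> \<bar>y\<bar>)..max \<bar>x\<bar> \<bar>y\<bar>} h"
    using assms by (auto simp: locally_L1_def)
  then show ?thesis
    by (rule set_integrable_subset) auto
qed

lemma locally_L1_measurable [measurable_dest]:
  assumes "locally_L1 h"
  shows "h \<in> borel_measurable borel"
proof -
  have *: "(\<lambda>x. indicator {- real n..real n} x *\<^sub>R h x) \<in> borel_measurable borel" for n :: nat
    using locally_L1_set_integrable[OF assms, of "- real n" "real n"]
    by (auto simp: set_integrable_def dest: borel_measurable_integrable)
  show ?thesis
  proof (rule borel_measurable_LIMSEQ_real[OF _ *])
    fix x :: real
    obtain N :: nat where N: "\<bar>x\<bar> \<le> real N" using real_arch_simple by blast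
    have "eventually (\<lambda>n. indicator {- real n..real n} x *\<^sub>R h x = h x) sequentially"
      using eventually_ge_at_top[of N]
    proof eventually_elim
      case (elim n)
      then have "\<bar>x\<bar> \<le> real n" using N by linarith
      then show ?case by (auto simp: indicator_def)
    qed
    then show "(\<lambda>n. indicator {- real n..real n} x *\<^sub>R h x) \<longlonglongrightarrow> h x"
      by (rule tendsto_eventually)
  qed
qed

lemma prim_set_integrable: "prim H h \<Longrightarrow> set_integrable lborel {x..y} h"
  by (simp add: prim_def locally_L1_set_integrable)

lemma prim_density_measurable: "prim H h \<Longrightarrow> h \<in> borel_measurable borel"
  by (simp add: prim_def locally_L1_measurable)

lemma prim_diff_eq: "prim H h \<Longrightarrow> x \<le> y \<Longrightarrow> H y - H x = (LINT z:{x..y}|lborel. h z)"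
  by (simp add: prim_def)

lemma locally_L1_continuous:
  assumes "continuous_on UNIV h" shows "locally_L1 h"
  unfolding locally_L1_def
  by (intro allI borel_integrable_atLeastAtMost'  continuous_on_subset[OF assms]) auto

lemma prim_continuous:
  assumes "prim H h"
  shows "continuous_on UNIV H"
proof -
  have "isCont H x" for x
  proof -
    have int: "set_integrable lborel {x-1..x+1} h" using prim_set_integrable[OF assms] .
    have eq: "integral {x-1..z} h = H z - H (x-1)" if "z \<in> {x-1..x+1}" for z
    proof -
      have "set_integrable lborel {x-1..z} h" using prim_set_integrable[OF assms] .
      from set_borel_integral_eq_integral(2)[OF this] show ?thesis
        using prim_diff_eq[OF assms, of "x-1" z] that by simp
    qed
    have "continuous_on {x-1..x+1} (\<lambda>z. integral {x-1..z} h)"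
      using set_borel_integral_eq_integral(1)[OF int]
      by (rule indefinite_integral_continuous_1)
    then have "continuous_on {x-1..x+1} (\<lambda>z. H z - H (x-1))"
      by (rule continuous_on_eq) (use eq in auto)
    then have "continuous_on {x-1..x+1} (\<lambda>z. (H z - H (x-1)) + H (x-1))"
      by (intro continuous_on_add continuous_on_const)
    then have "continuous_on {x-1..x+1} H" by (simp only: diff_add_cancel)
    then show ?thesis
      by (rule continuous_on_interior) simp
  qed
  then show ?thesis by (simp add: continuous_at_imp_continuous_on)
qed

lemma prim_measurable: "prim H h \<Longrightarrow> H \<in> borel_measurable borel"
  by (intro borel_measurable_continuous_onI prim_continuous)

lemma prim_C1:
  assumes "\<And>x. (H has_real_derivative h x) (at x)" "continuous_on UNIV h"
  shows "prim H h"
  unfolding prim_def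
proof (intro conjI allI impI)
  show "locally_L1 h" using assms(2) by (rule locally_L1_continuous)
  fix x y :: real assume "x \<le> y"
  have "integral\<^sup>L lborel (\<lambda>z. indicator {x..y} z *\<^sub>R h z) = H y - H x"
    using \<open>x \<le> y\<close> assms
    by (intro integral_FTC_atLeastAtMost)
       (auto intro: has_field_derivative_at_within continuous_on_subset
             simp flip: has_real_derivative_iff_has_vector_derivative)
  then show "H y - H x = (LINT z:{x..y}|lborel. h z)"
    by (simp add: set_lebesgue_integral_def)
qed

lemma prim_has_derivative:
  assumes "prim H h" "continuous_on UNIV h"
  shows "(H has_real_derivative h x) (at x)"
proof -
  have "((\<lambda>z. integral {x-1..z} h) has_real_derivative h x) (at x within {x-1..x+1})"
    by (rule integral_has_real_derivative) (use assms in \<open>auto intro: continuous_on_subset\<close>)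
  then have "((\<lambda>z. integral {x-1..z} h + H (x-1)) has_real_derivative h x) (at x within {x-1..x+1})"
    by (auto intro!: derivative_eq_intros)
  then have "(H has_real_derivative h x) (at x within {x-1..x+1})"
  proof (rule has_field_derivative_transform_within[OF _ zero_less_one])
    show "x \<in> {x-1..x+1}" by simp
    fix z assume "z \<in> {x-1..x+1}"
    then have "x-1 \<le> z" by simp
    have "set_integrable lborel {x-1..z} h" using prim_set_integrable[OF assms(1)] .
    from set_borel_integral_eq_integral(2)[OF this] show "integral {x-1..z} h + H (x-1) = H z"
      using prim_diff_eq[OF assms(1) \<open>x-1 \<le> z\<close>] by simp
  qed
  then show ?thesis
    by (subst (asm) at_within_Icc_at) auto
qed

lemma prim_add:
  assumes "prim P p" "prim Q q"
  shows "prim (\<lambda>x. P x + Q x) (\<lambda>x. p x + q x)"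
  unfolding prim_def
proof (intro conjI allI impI)
  show "locally_L1 (\<lambda>x. p x + q x)" using assms
    by (auto simp: prim_def locally_L1_def intro!: set_integral_add)
  fix x y :: real assume "x \<le> y"
  then show "P y + Q y - (P x + Q x) = (LINT z:{x..y}|lborel. p z + q z)"
    using prim_diff_eq[OF assms(1)] prim_diff_eq[OF assms(2)]
    by (subst set_integral_add)
       (auto intro: prim_set_integrable[OF assms(1)] prim_set_integrable[OF assms(2)] simp: field_simps)
qed

lemma prim_cmult:
  assumes "prim P p"
  shows "prim (\<lambda>x. c * P x) (\<lambda>x. c * p x)"
  unfolding prim_def
proof (intro conjI allI impI)
  show "locally_L1 (\<lambda>x. c * p x)" using assms
    by (auto simp: prim_def locally_L1_def)
  fix x y :: real assume "x \<le> y"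
  then show "c * P y - c * P x = (LINT z:{x..y}|lborel. c * p z)"
    using prim_diff_eq[OF assms(1)] by (simp flip: right_diff_distrib)
qed

lemma prim_diff:
  assumes "prim P p" "prim Q q"
  shows "prim (\<lambda>x. P x - Q x) (\<lambda>x. p x - q x)"
  using prim_add[OF assms(1) prim_cmult[OF assms(2), of "-1"]] by simp

lemma set_integrable_mult_continuous:
  fixes f g :: "real \<Rightarrow> real"
  assumes f: "set_integrable lborel {x..y} f" and g: "continuous_on UNIV g"
  shows "set_integrable lborel {x..y} (\<lambda>z. f z * g z)"
proof -
  have [measurable]: "g \<in> borel_measurable borel"
    using g by (rule borel_measurable_continuous_onI)
  have "compact (g ` {x..y})"
    by (intro compact_continuous_image continuous_on_subset[OF g]) auto
  then obtain B where B: "\<And>z. z \<in> {x..y} \<Longrightarrow> \<bar>g z\<bar> \<le> B"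
    using compact_imp_bounded bounded_iff by (metis imageI real_norm_def)
  have mf: "(\<lambda>z. indicator {x..y} z *\<^sub>R f z) \<in> borel_measurable lborel"
    using f unfolding set_integrable_def by (rule borel_measurable_integrable)
  have *: "(\<lambda>z. indicator {x..y} z *\<^sub>R (f z * g z)) = (\<lambda>z. (indicator {x..y} z *\<^sub>R f z) * g z)" by auto
  show ?thesis
    unfolding set_integrable_def *
  proof (rule Bochner_Integration.integrable_bound)
    show "integrable lborel (\<lambda>z. B * (indicator {x..y} z *\<^sub>R f z))"
      using f unfolding set_integrable_def by (rule integrable_mult_right)
    show "(\<lambda>z. (indicator {x..y} z *\<^sub>R f z) * g z) \<in> borel_measurable lborel"
      using mf by measurable
    show "AE z in lborel. norm ((indicator {x..y} z *\<^sub>R f z) * g z) \<le> norm (B * (indicator {x..y} z *\<^sub>R f z))"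
    proof (rule AE_I2)
      fix z
      show "norm ((indicator {x..y} z *\<^sub>R f z) * g z) \<le> norm (B * (indicator {x..y} z *\<^sub>R f z))"
        using B[of z] by (auto simp: indicator_def abs_mult mult.commute[of "\<bar>f z\<bar>"] intro!: mult_right_mono)
    qed
  qed
qed

lemma prim_mult:
  assumes P: "prim P p" and Q: "prim Q q"
  shows "prim (\<lambda>x. P x * Q x) (\<lambda>x. p x * Q x + P x * q x)"
proof -
  have cP: "continuous_on UNIV P" and cQ: "continuous_on UNIV Q"
    using prim_continuous P Q by auto
  have mP [measurable]: "P \<in> borel_measurable borel" "p \<in> borel_measurable borel"
    and mQ [measurable]: "Q \<in> borel_measurable borel" "q \<in> borel_measurable borel"
    using prim_measurable prim_density_measurable P Q by auto
  have i1: "set_integrable lborel {x..y} (\<lambda>z. p z * Q z)" for x y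
    by (rule set_integrable_mult_continuous[OF prim_set_integrable[OF P] cQ])
  have i2: "set_integrable lborel {x..y} (\<lambda>z. P z * q z)" for x y
    using set_integrable_mult_continuous[OF prim_set_integrable[OF Q] cP] by (simp add: mult.commute)
  show ?thesis
    unfolding prim_def
  proof (intro conjI allI impI)
    show "locally_L1 (\<lambda>x. p x * Q x + P x * q x)"
      unfolding locally_L1_def using i1 i2 by (auto intro!: set_integral_add)
    fix x y :: real assume xy: "x \<le> y"
    define f where "f = (\<lambda>z. indicator {x..y} z * p z)"
    define h where "h = (\<lambda>z. indicator {x..y} z * q z)"
    have f: "integrable lborel f" and h: "integrable lborel h"
      using prim_set_integrable[OF P, of x y] prim_set_integrable[OF Q, of x y]
      by (simp_all add: set_integrable_def f_def h_def)
    note [measurable] = borel_measurable_integrable[OF f] borel_measurable_integrable[OF h]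
    define A where "A = (\<lambda>(z, w). indicator {(z::real, w::real). w \<le> z} (z, w) * (f z * h w))"
    have mA [measurable]: "A \<in> borel_measurable (lborel \<Otimes>\<^sub>M lborel)"
      unfolding A_def by measurable
    have hz: "integrable lborel (\<lambda>w. \<bar>h w\<bar>)" using h by simp
    have Aint: "integrable (lborel \<Otimes>\<^sub>M lborel) A"
    proof (rule Bochner_Integration.integrable_bound)
      show "integrable (lborel \<Otimes>\<^sub>M lborel) (\<lambda>(z, w). f z * h w)"
      proof (rule lborel_pair.Fubini_integrable)
        show "(\<lambda>(z, w). f z * h w) \<in> borel_measurable (lborel \<Otimes>\<^sub>M lborel)" by measurable
        show "integrable lborel (\<lambda>z. LINT w|lborel. norm (case (z, w) of (z, w) \<Rightarrow> f z * h w))"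
          using f by (simp add: abs_mult)
        show "AE z in lborel. integrable lborel (\<lambda>w. case (z, w) of (z, w) \<Rightarrow> f z * h w)"
          using h by simp
      qed
      show "AE zw in lborel \<Otimes>\<^sub>M lborel. norm (A zw) \<le> norm (case zw of (z, w) \<Rightarrow> f z * h w)"
        by (rule AE_I2) (auto simp: A_def indicator_def)
    qed simp
    have inner1: "(LINT w|lborel. A (z, w)) = f z * (Q z - Q x)" for z
    proof (cases "z \<in> {x..y}")
      case True
      have "(LINT w|lborel. A (z, w)) = (LINT w|lborel. f z * (indicator {x..z} w * q w))"
        by (rule Bochner_Integration.integral_cong) (use True in \<open>auto simp: A_def h_def indicator_def\<close>)
      also have "\<dots> = f z * (LINT w:{x..z}|lborel. q w)"
        by (simp add: set_lebesgue_integral_def)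
      also have "\<dots> = f z * (Q z - Q x)"
        using prim_diff_eq[OF Q, of x z] True by simp
      finally show ?thesis .
    next
      case False
      then show ?thesis by (simp add: A_def f_def)
    qed
    have inner2: "(LINT z|lborel. A (z, w)) = h w * (P y - P w)" for w
    proof (cases "w \<in> {x..y}")
      case True
      have "(LINT z|lborel. A (z, w)) = (LINT z|lborel. h w * (indicator {w..y} z * p z))"
        by (rule Bochner_Integration.integral_cong) (use True in \<open>auto simp: A_def f_def indicator_def\<close>)
      also have "\<dots> = h w * (LINT z:{w..y}|lborel. p z)"
        by (simp add: set_lebesgue_integral_def)
      also have "\<dots> = h w * (P y - P w)"
        using prim_diff_eq[OF P, of w y] True by simp
      finally show ?thesis .
    next
      case False
      then show ?thesis by (simp add: A_def h_def)
    qed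
    have "(LINT z|lborel. f z * (Q z - Q x)) = (LINT w|lborel. h w * (P y - P w))"
      using lborel_pair.Fubini_integral[of "\<lambda>z w. A (z, w)"] Aint by (simp add: inner1 inner2)
    moreover have "(LINT z|lborel. f z * (Q z - Q x)) = (LINT z:{x..y}|lborel. p z * Q z) - Q x * (P y - P x)"
    proof -
      have "integrable lborel (\<lambda>z. f z * Q z)" "(LINT z:{x..y}|lborel. p z * Q z) = (LINT z|lborel. f z * Q z)"
        using i1[of x y] by (simp_all add: f_def set_integrable_def set_lebesgue_integral_def mult.assoc)
      moreover have "(LINT z|lborel. f z) = P y - P x"
        using prim_diff_eq[OF P xy] by (simp add: f_def set_lebesgue_integral_def)
      ultimately show ?thesis using f by (simp add: right_diff_distrib, simp add: algebra_simps)
    qed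
    moreover have "(LINT w|lborel. h w * (P y - P w)) = P y * (Q y - Q x) - (LINT z:{x..y}|lborel. P z * q z)"
    proof -
      have "integrable lborel (\<lambda>z. h z * P z)" "(LINT z:{x..y}|lborel. P z * q z) = (LINT z|lborel. h z * P z)"
        using i2[of x y] by (simp_all add: h_def set_integrable_def set_lebesgue_integral_def mult_ac)
      moreover have "(LINT z|lborel. h z) = Q y - Q x"
        using prim_diff_eq[OF Q xy] by (simp add: h_def set_lebesgue_integral_def)
      ultimately show ?thesis using h by (simp add: right_diff_distrib left_diff_distrib mult.commute)
    qed
    moreover have "(LINT z:{x..y}|lborel. p z * Q z + P z * q z)
        = (LINT z:{x..y}|lborel. p z * Q z) + (LINT z:{x..y}|lborel. P z * q z)"
      by (rule set_integral_add) (use i1 i2 in auto)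
    ultimately show "P y * Q y - P x * Q x = (LINT z:{x..y}|lborel. p z * Q z + P z * q z)"
      by (simp add: algebra_simps)
  qed
qed

text \<open>An integrable function need not tend to 0 at infinity, but it cannot exceed
  \<open>e\<close> on arbitrarily long intervals. The points found here replace limits at infinity
  wherever boundary terms have to vanish.\<close>

lemma integrable_small_values:
  fixes H :: "real \<Rightarrow> real"
  assumes "integrable lborel H" "0 < e"
  shows "\<exists>y>x. \<bar>H y\<bar> < e" "\<exists>y<x. \<bar>H y\<bar> < e"
proof -
  have no: False if A: "\<And>n::nat. \<exists>c. {c..c + real n} \<subseteq> A" and le: "\<And>y. y \<in> A \<Longrightarrow> e \<le> \<bar>H y\<bar>" for A
  proof -
    obtain n :: nat where n: "(LINT z|lborel. \<bar>H z\<bar>) < real n * e"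
      using reals_Archimedean3[OF assms(2)] by blast
    obtain c where c: "{c..c + real n} \<subseteq> A" using A by blast
    have "e * real n = (LINT z|lborel. e * indicator {c..c + real n} z)" by simp
    also have "\<dots> \<le> (LINT z|lborel. \<bar>H z\<bar>)"
      by (rule integral_mono) (use assms le c in \<open>auto split: split_indicator\<close>)
    finally show False using n by (simp add: mult.commute)
  qed
  have "\<exists>c. {c..c + real n} \<subseteq> {x<..}" for n by (rule exI[of _ "x + 1"]) auto
  then show "\<exists>y>x. \<bar>H y\<bar> < e"
    using no[of "{x<..}"] by force
  have "\<exists>c. {c..c + real n} \<subseteq> {..<x}" for n by (rule exI[of _ "x - real n - 1"]) auto
  then show "\<exists>y<x. \<bar>H y\<bar> < e"
    using no[of "{..<x}"] by force
qed

lemma integrable_imp_set_integrable: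
  "integrable lborel h \<Longrightarrow> A \<in> sets borel \<Longrightarrow> set_integrable lborel A (h :: real \<Rightarrow> real)"
  unfolding set_integrable_def by (intro integrable_mult_indicator) auto

text \<open>From a base point left of \<open>x\<close> at which |H| is below any given e, the
  increment of \<open>H\<close> is at most the total variation.\<close>

lemma prim_le_integral_abs:
  assumes "prim H h" "integrable lborel H" "integrable lborel h"
  shows "\<bar>H x\<bar> \<le> (LINT z|lborel. \<bar>h z\<bar>)"
proof (rule field_le_epsilon)
  fix e :: real assume "0 < e"
  obtain y where y: "y < x" "\<bar>H y\<bar> < e"
    using integrable_small_values(2)[OF assms(2) \<open>0 < e\<close>] by blast
  have "H x - H y = (LINT z|lborel. indicator {y..x} z * h z)"
    using prim_diff_eq[OF assms(1), of y x] y by (simp add: set_lebesgue_integral_def)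
  also have "\<bar>\<dots>\<bar> \<le> (LINT z|lborel. \<bar>indicator {y..x} z * h z\<bar>)"
    using integral_abs_bound by blast
  also have "\<dots> \<le> (LINT z|lborel. \<bar>h z\<bar>)"
    by (rule integral_mono)
       (use assms(3) integrable_imp_set_integrable[OF assms(3), of "{y..x}"] in
         \<open>auto simp: indicator_def set_integrable_def\<close>)
  finally show "\<bar>H x\<bar> \<le> (LINT z|lborel. \<bar>h z\<bar>) + e"
    using y by linarith
qed

text \<open>The intervals exhaust the line, with endpoints chosen where |H| is below 1/(n+1). The
  increments of \<open>H\<close> over them tend to 0 and, by dominated convergence, also to the
  integral of \<open>h\<close>.\<close>

lemma prim_integral_0:
  assumes "prim H h" "integrable lborel H" "integrable lborel h"
  shows "(LINT z|lborel. h z) = 0"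
proof -
  have "\<exists>y>real n. \<bar>H y\<bar> < 1 / Suc n" "\<exists>y. y < - real n \<and> \<bar>H y\<bar> < 1 / Suc n" for n
    using integrable_small_values[OF assms(2), of "1 / Suc n"] by auto
  then obtain b a where b: "\<And>n. b n > real n" "\<And>n. \<bar>H (b n)\<bar> < 1 / Suc n"
    and a: "\<And>n. a n < - real n" "\<And>n. \<bar>H (a n)\<bar> < 1 / Suc n" by metis
  have lim: "(\<lambda>n. LINT z|lborel. indicator {a n..b n} z * h z) \<longlonglongrightarrow> (LINT z|lborel. h z)"
  proof (rule integral_dominated_convergence[where w = "\<lambda>z. \<bar>h z\<bar>"])
    show "AE z in lborel. (\<lambda>n. indicator {a n..b n} z * h z) \<longlonglongrightarrow> h z"
    proof (rule AE_I2, rule tendsto_eventually)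
      fix z :: real
      obtain N :: nat where N: "\<bar>z\<bar> \<le> real N" using real_arch_simple by blast
      show "\<forall>\<^sub>F n in sequentially. indicator {a n..b n} z * h z = h z"
        using eventually_ge_at_top[of N]
      proof eventually_elim
        case (elim n)
        then have "\<bar>z\<bar> \<le> real n" using N by linarith
        then show ?case using a(1)[of n] b(1)[of n] by (auto simp: indicator_def)
      qed
    qed
  qed (use assms(3) prim_density_measurable[OF assms(1)] in \<open>auto simp: indicator_def\<close>)
  have "(\<lambda>n. LINT z|lborel. indicator {a n..b n} z * h z) \<longlonglongrightarrow> 0"
  proof (rule Lim_null_comparison)
    show "(\<lambda>n. 2 * (1 / real (Suc n))) \<longlonglongrightarrow> 0"
      using tendsto_mult_right_zero[OF LIMSEQ_inverse_real_of_nat, of 2] by (simp only: inverse_eq_divide)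
    show "\<forall>\<^sub>F n in sequentially. norm (LINT z|lborel. indicator {a n..b n} z * h z) \<le> 2 * (1 / real (Suc n))"
    proof (rule always_eventually, rule allI)
      fix n
      have "H (b n) - H (a n) = (LINT z|lborel. indicator {a n..b n} z * h z)"
        using prim_diff_eq[OF assms(1), of "a n" "b n"] a(1)[of n] b(1)[of n]
        by (simp add: set_lebesgue_integral_def)
      then show "norm (LINT z|lborel. indicator {a n..b n} z * h z) \<le> 2 * (1 / real (Suc n))"
        using a(2)[of n] b(2)[of n] by (simp add: abs_if split: if_splits)
    qed
  qed
  with lim show ?thesis by (rule LIMSEQ_unique)
qed

text \<open>On a bounded interval the positive and negative parts of \<open>h\<close> are densities
  of two finite measures. These agree on closed intervals, an intersection-stable generator of the
  Borel sets, hence coincide, and densities with respect to a sigma-finite measure are unique almost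
  everywhere.\<close>

lemma AE_zero_of_interval_integrals:
  fixes h :: "real \<Rightarrow> real"
  assumes h: "locally_L1 h" and z: "\<And>x y. x \<le> y \<Longrightarrow> (LINT z:{x..y}|lborel. h z) = 0"
  shows "AE x in lborel. h x = 0"
proof -
  have [measurable]: "h \<in> borel_measurable borel" using h by (rule locally_L1_measurable)
  have key: "AE x in lborel. x \<in> {-real n<..real n} \<longrightarrow> h x = 0" for n :: nat
  proof -
    define I where "I = {-real n<..real n}"
    have int: "integrable lborel (\<lambda>x. indicator I x * h x)"
      using locally_L1_set_integrable[OF h, of "-real n" "real n"]
      using set_integrable_subset[of lborel "{-real n..real n}" h I]
      by (simp add: set_integrable_def I_def greaterThanAtMost_subseteq_atLeastAtMost_iff)
    have mp: "integrable lborel (\<lambda>x. max 0 (indicator I x * h x))"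
      "integrable lborel (\<lambda>x. max 0 (- (indicator I x * h x)))"
      using int by (auto intro: integrable_max)
    define \<mu> where "\<mu> = density lborel (\<lambda>x. ennreal (max 0 (indicator I x * h x)))"
    define \<nu> where "\<nu> = density lborel (\<lambda>x. ennreal (max 0 (- (indicator I x * h x))))"
    have [simp]: "sets \<mu> = sets borel" "sets \<nu> = sets borel" "space \<mu> = UNIV" "space \<nu> = UNIV"
      by (auto simp: \<mu>_def \<nu>_def)
    have em: "emeasure \<mu> A = ennreal (LINT x|lborel. max 0 (indicator I x * h x) * indicator A x)"
      "emeasure \<nu> A = ennreal (LINT x|lborel. max 0 (- (indicator I x * h x)) * indicator A x)"
      if [measurable]: "A \<in> sets borel" for A
    proof -
      have e: "emeasure (density lborel (\<lambda>x. ennreal (g x))) A = ennreal (LINT x|lborel. g x * indicator A x)"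
        if g: "integrable lborel g" and nn: "\<And>x. 0 \<le> g x" for g :: "real \<Rightarrow> real"
      proof -
        have [measurable]: "g \<in> borel_measurable borel" using g by auto
        have "emeasure (density lborel (\<lambda>x. ennreal (g x))) A = (\<integral>\<^sup>+x. ennreal (g x) * indicator A x \<partial>lborel)"
          by (subst emeasure_density) auto
        also have "\<dots> = (\<integral>\<^sup>+x. ennreal (g x * indicator A x) \<partial>lborel)"
          by (intro nn_integral_cong) (auto simp: indicator_def)
        also have "\<dots> = ennreal (LINT x|lborel. g x * indicator A x)"
          by (rule nn_integral_eq_integral)
             (use g nn in \<open>auto intro!: integrable_real_mult_indicator\<close>)
        finally show ?thesis .
      qed
      show "emeasure \<mu> A = ennreal (LINT x|lborel. max 0 (indicator I x * h x) * indicator A x)"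
        unfolding \<mu>_def by (rule e) (use mp in auto)
      show "emeasure \<nu> A = ennreal (LINT x|lborel. max 0 (- (indicator I x * h x)) * indicator A x)"
        unfolding \<nu>_def by (rule e) (use mp in auto)
    qed
    have "\<mu> = \<nu>"
    proof (rule measure_eqI_generator_eq_countable[where E = "range (\<lambda>(a::real, b). {a..b})" and \<Omega> = UNIV and A = "range (\<lambda>k::nat. {- real k..real k})"])
      show "Int_stable (range (\<lambda>(a::real, b). {a..b}))"
        by (auto simp: Int_stable_def)
      show "range (\<lambda>(a::real, b). {a..b}) \<subseteq> Pow UNIV" by auto
      show "sets \<mu> = sigma_sets UNIV (range (\<lambda>(a::real, b). {a..b}))"
        "sets \<nu> = sigma_sets UNIV (range (\<lambda>(a::real, b). {a..b}))"
        by (simp_all add: borel_eq_atLeastAtMost split_def image_def)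
      show "\<Union> (range (\<lambda>k::nat. {- real k..real k})) = UNIV"
        by (auto, metis abs_le_iff real_arch_simple minus_le_iff)
      show "emeasure \<mu> a \<noteq> \<infinity>" if "a \<in> range (\<lambda>k::nat. {- real k..real k})" for a
        using that by (auto simp: em)
      fix X assume "X \<in> range (\<lambda>(a::real, b). {a..b})"
      then obtain a b where X: "X = {a..b}" by auto
      have "integrable lborel (\<lambda>x. max 0 (indicator I x * h x) * indicator X x)"
        "integrable lborel (\<lambda>x. max 0 (- (indicator I x * h x)) * indicator X x)"
        using mp by (auto intro!: integrable_real_mult_indicator simp: X)
      then have "(LINT x|lborel. max 0 (indicator I x * h x) * indicator X x)
          - (LINT x|lborel. max 0 (- (indicator I x * h x)) * indicator X x)
          = (LINT x|lborel. (max 0 (indicator I x * h x) - max 0 (- (indicator I x * h x))) * indicator X x)"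
        by (simp add: left_diff_distrib)
      also have "\<dots> = (LINT x|lborel. indicator I x * h x * indicator X x)"
        by (intro Bochner_Integration.integral_cong) (auto simp: max_def)
      also have "\<dots> = (LINT x|lborel. indicator {max a (- real n)..min b (real n)} x * h x)"
      proof (rule integral_cong_AE)
        have "AE x in lborel. x \<noteq> - real n" by (rule AE_lborel_singleton)
        then show "AE x in lborel. indicator I x * h x * indicator X x = indicator {max a (- real n)..min b (real n)} x * h x"
          by eventually_elim (auto simp: indicator_def I_def X)
      qed (auto simp: I_def X)
      also have "\<dots> = 0"
      proof (cases "max a (- real n) \<le> min b (real n)")
        case True
        then show ?thesis using z by (simp add: set_lebesgue_integral_def)
      next
        case False
        then have "{max a (- real n)..min b (real n)} = {}" by auto
        then show ?thesis by (simp only:) simp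
      qed
      finally show "emeasure \<mu> X = emeasure \<nu> X" by (simp add: em X)
    qed auto
    then have "AE x in lborel. ennreal (max 0 (indicator I x * h x)) = ennreal (max 0 (- (indicator I x * h x)))"
      unfolding \<mu>_def \<nu>_def by (intro sigma_finite_measure.density_unique[OF sigma_finite_lborel]) (auto simp: I_def)
    then show ?thesis
      by eventually_elim (auto simp: I_def max_def split: if_splits)
  qed
  then have "AE x in lborel. \<forall>n::nat. x \<in> {-real n<..real n} \<longrightarrow> h x = 0"
    unfolding AE_all_countable by blast
  then show ?thesis
  proof eventually_elim
    case (elim x)
    obtain n :: nat where "\<bar>x\<bar> < real n" using reals_Archimedean2 by blast
    then have "x \<in> {-real n<..real n}" by (simp add: abs_less_iff)
    then show ?case using elim by blast
  qed
qed

lemma AE_continuous_le: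
  fixes f g :: "real \<Rightarrow> real"
  assumes "AE x in lborel. f x \<le> g x" "continuous_on UNIV f" "continuous_on UNIV g"
  shows "f x \<le> g x"
proof (rule ccontr)
  assume "\<not> f x \<le> g x"
  then have x: "x \<in> {x. g x < f x}" by simp
  have "open {x. g x < f x}" using assms by (intro open_Collect_less) auto
  then obtain e where e: "0 < e" "{x - e<..<x + e} \<subseteq> {x. g x < f x}"
    using x unfolding open_dist
    by (metis (no_types, lifting) dist_real_def greaterThanLessThan_iff abs_diff_less_iff subsetI)
  have "AE y in lborel. y \<notin> {x - e<..<x + e}"
    using assms(1) by eventually_elim (use e in force)
  then have "emeasure lborel {x - e<..<x + e} = 0"
    by (subst (asm) AE_iff_measurable[of "{x - e<..<x + e}"]) auto
  then show False using e by simp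
qed

lemma AE_continuous_eq:
  fixes f g :: "real \<Rightarrow> real"
  assumes "AE x in lborel. f x = g x" "continuous_on UNIV f" "continuous_on UNIV g"
  shows "f x = g x"
proof (rule antisym)
  show "f x \<le> g x" by (rule AE_continuous_le) (use assms in auto)
  show "g x \<le> f x" by (rule AE_continuous_le) (use assms in auto)
qed

lemma prim_density_unique:
  assumes "prim H h" "prim H k"
  shows "AE x in lborel. h x = k x"
proof -
  have "prim (\<lambda>x. H x - H x) (\<lambda>x. h x - k x)" by (rule prim_diff[OF assms])
  then have "locally_L1 (\<lambda>x. h x - k x)" "\<And>x y. x \<le> y \<Longrightarrow> (LINT z:{x..y}|lborel. h z - k z) = 0"
    by (auto simp: prim_def)
  from AE_zero_of_interval_integrals[OF this] show ?thesis by auto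
qed

lemma locally_L1_ex_prim:
  assumes "locally_L1 h" shows "\<exists>H. prim H h"
proof (intro exI)
  have i: "interval_lebesgue_integrable lborel (ereal x) (ereal y) h" for x y
    unfolding interval_lebesgue_integrable_def
    using locally_L1_set_integrable[OF assms, of x y] locally_L1_set_integrable[OF assms, of y x]
    by (auto intro: set_integrable_subset simp: einterval_eq_Icc)
  show "prim (\<lambda>x. LBINT z=ereal 0..ereal x. h z) h"
    unfolding prim_def
  proof (intro conjI allI impI)
    fix x y :: real assume "x \<le> y"
    have "(LBINT z=ereal 0..ereal x. h z) + (LBINT z=ereal x..ereal y. h z) = (LBINT z=ereal 0..ereal y. h z)"
      by (rule interval_integral_sum) (use i[of "min 0 (min x y)" "max 0 (max x y)"] in simp)
    then show "(LBINT z=ereal 0..ereal y. h z) - (LBINT z=ereal 0..ereal x. h z) = (LINT z:{x..y}|lborel. h z)"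
      using interval_integral_Icc[OF \<open>x \<le> y\<close>, of h] by linarith
  qed (fact assms)
qed

lemma prim_cong_density:
  assumes "prim H h" "AE x in lborel. h x = k x" "k \<in> borel_measurable borel"
  shows "prim H k"
proof -
  have [measurable]: "h \<in> borel_measurable borel" "k \<in> borel_measurable borel"
    using assms prim_density_measurable by auto
  have si: "set_integrable lborel {x..y} k" for x y
  proof -
    have "integrable lborel (\<lambda>z. indicator {x..y} z *\<^sub>R k z) = integrable lborel (\<lambda>z. indicator {x..y} z *\<^sub>R h z)"
      by (rule integrable_cong_AE) (use assms(2) in auto)
    then show ?thesis using prim_set_integrable[OF assms(1), of x y] by (simp add: set_integrable_def)
  qed
  show ?thesis
    unfolding prim_def
  proof (intro conjI allI impI)
    show "locally_L1 k" using si by (simp add: locally_L1_def)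
    fix x y :: real assume "x \<le> y"
    have "(LINT z:{x..y}|lborel. k z) = (LINT z:{x..y}|lborel. h z)"
      unfolding set_lebesgue_integral_def
      by (rule integral_cong_AE) (use assms(2) in auto)
    then show "H y - H x = (LINT z:{x..y}|lborel. k z)"
      using prim_diff_eq[OF assms(1) \<open>x \<le> y\<close>] by simp
  qed
qed

subsection \<open>Smooth functions\<close>

text \<open>Finite-order version of the smoothness in \<open>test_function\<close>. It admits
  induction on the order, since one derivative can be peeled off from the inside.\<close>

definition n_times_diff :: "nat \<Rightarrow> (real \<Rightarrow> real) \<Rightarrow> bool" where
  "n_times_diff n f \<longleftrightarrow> (\<forall>k\<le>n. \<forall>x. ((deriv ^^ k) f) differentiable (at x))"

lemma n_times_diff_0: "n_times_diff 0 f \<longleftrightarrow> (\<forall>x. f differentiable (at x))"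
  by (simp add: n_times_diff_def)

lemma n_times_diff_Suc: "n_times_diff (Suc n) f \<longleftrightarrow> (\<forall>x. f differentiable (at x)) \<and> n_times_diff n (deriv f)"
proof
  assume f: "n_times_diff (Suc n) f"
  then show "(\<forall>x. f differentiable (at x)) \<and> n_times_diff n (deriv f)"
    unfolding n_times_diff_def by (metis Suc_le_mono comp_apply funpow_0 funpow_Suc_right le0)
next
  assume f: "(\<forall>x. f differentiable (at x)) \<and> n_times_diff n (deriv f)"
  show "n_times_diff (Suc n) f"
    unfolding n_times_diff_def
  proof (intro allI impI)
    fix k x assume "k \<le> Suc n"
    then show "((deriv ^^ k) f) differentiable (at x)"
      using f by (cases k) (auto simp: n_times_diff_def funpow_Suc_right simp del: funpow.simps)
  qed
qed

lemma n_times_diff_SucD: "n_times_diff (Suc n) f \<Longrightarrow> n_times_diff n f"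
  by (simp add: n_times_diff_def)

lemma deriv_at:
  fixes f :: "real \<Rightarrow> real"
  shows "f differentiable (at x) \<Longrightarrow> (f has_real_derivative deriv f x) (at x)"
  by (simp add: DERIV_deriv_iff_real_differentiable)

lemma n_times_diff_SucI:
  assumes "\<And>x. (f has_real_derivative g x) (at x)" "n_times_diff n g"
  shows "n_times_diff (Suc n) f"
proof -
  have "deriv f = g" using assms(1) by (auto intro: DERIV_imp_deriv)
  then show ?thesis
    using assms by (auto simp: n_times_diff_Suc real_differentiable_def)
qed

lemma n_times_diff_cmult: "n_times_diff n f \<Longrightarrow> n_times_diff n (\<lambda>x. c * f x)"
proof (induction n arbitrary: f)
  case 0 then show ?case by (auto simp: n_times_diff_0)
next
  case (Suc n)
  then show ?case
    by (intro n_times_diff_SucI[of _ "\<lambda>x. c * deriv f x"])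
       (auto simp: n_times_diff_Suc intro!: DERIV_cmult deriv_at)
qed

lemma n_times_diff_add: "n_times_diff n f \<Longrightarrow> n_times_diff n g \<Longrightarrow> n_times_diff n (\<lambda>x. f x + g x)"
proof (induction n arbitrary: f g)
  case 0 then show ?case by (auto simp: n_times_diff_0)
next
  case (Suc n)
  then show ?case
    by (intro n_times_diff_SucI[of _ "\<lambda>x. deriv f x + deriv g x"])
       (auto simp: n_times_diff_Suc intro!: DERIV_add deriv_at)
qed

lemma n_times_diff_mult: "n_times_diff n f \<Longrightarrow> n_times_diff n g \<Longrightarrow> n_times_diff n (\<lambda>x. f x * g x)"
proof (induction n arbitrary: f g)
  case 0 then show ?case by (auto simp: n_times_diff_0)
next
  case (Suc n)
  have "n_times_diff n (\<lambda>x. deriv f x * g x + deriv g x * f x)"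
    using Suc.IH Suc.prems n_times_diff_SucD by (intro n_times_diff_add) (auto simp: n_times_diff_Suc)
  moreover have "((\<lambda>x. f x * g x) has_real_derivative (deriv f x * g x + deriv g x * f x)) (at x)" for x
    using Suc.prems by (intro DERIV_mult deriv_at) (auto simp: n_times_diff_Suc)
  ultimately show ?case by (intro n_times_diff_SucI) auto
qed

lemma n_times_diff_affine: "n_times_diff n f \<Longrightarrow> n_times_diff n (\<lambda>x. f (c * x + e))"
proof (induction n arbitrary: f)
  case 0
  have "(\<lambda>x. f (c * x + e)) differentiable (at x)" for x
  proof -
    have "((\<lambda>x. c * x + e) has_real_derivative c) (at x)" by (auto intro!: derivative_eq_intros)
    from DERIV_chain'[OF this deriv_at[of f "c * x + e"]] show ?thesis
      using 0 by (auto simp: n_times_diff_0 real_differentiable_def)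
  qed
  then show ?case by (simp add: n_times_diff_0)
next
  case (Suc n)
  have "((\<lambda>x. f (c * x + e)) has_real_derivative c * deriv f (c * x + e)) (at x)" for x
  proof -
    have "((\<lambda>x. c * x + e) has_real_derivative c) (at x)" by (auto intro!: derivative_eq_intros)
    from DERIV_chain'[OF this deriv_at[of f "c * x + e"]] show ?thesis
      using Suc.prems by (simp add: n_times_diff_Suc mult.commute[of c "deriv f _"])
  qed
  moreover have "n_times_diff n (\<lambda>x. c * deriv f (c * x + e))"
    using Suc by (intro n_times_diff_cmult) (auto simp: n_times_diff_Suc)
  ultimately show ?case by (intro n_times_diff_SucI) auto
qed

text \<open>For \<open>p = 1\<close> this is the classical smooth function that is flat at 0. The
  polynomial factor makes the class closed under differentiation, so that smoothness follows by
  induction.\<close>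

definition expinv :: "real poly \<Rightarrow> real \<Rightarrow> real" where
  "expinv p x = (if 0 < x then poly p (1 / x) * exp (- (1 / x)) else 0)"

lemma poly_exp_tendsto_0: "((\<lambda>y::real. y ^ k * poly p y * exp (- y)) \<longlongrightarrow> 0) at_top"
proof (induction p arbitrary: k)
  case 0 then show ?case by simp
next
  case (pCons a p)
  have "((\<lambda>y. a * (y ^ k / exp y) + y ^ Suc k * poly p y * exp (- y)) \<longlongrightarrow> a * 0 + 0) at_top"
    by (intro tendsto_intros tendsto_power_div_exp_0 pCons.IH)
  then show ?case
    by (simp add: algebra_simps exp_minus divide_inverse)
qed

text \<open>With y = 1/x the chain rule gives y^2 (p(y) - p'(y)) exp(-y); the two leading
  \<open>pCons 0\<close> are the factor y^2. At 0 both one-sided difference quotients tend to 0, on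
  the right because the exponential beats every polynomial.\<close>

lemma expinv_deriv: "(expinv p has_real_derivative expinv (pCons 0 (pCons 0 (p - pderiv p))) x) (at x)"
proof -
  consider "x < 0" | "x = 0" | "x > 0" by linarith
  then show ?thesis
  proof cases
    case 1
    have "((\<lambda>x. 0) has_real_derivative 0) (at x)" by simp
    then have "(expinv p has_real_derivative 0) (at x)"
      by (rule has_field_derivative_transform_within_open[where S = "{..<0}"])
         (use 1 in \<open>auto simp: expinv_def\<close>)
    then show ?thesis using 1 by (simp add: expinv_def)
  next
    case 2
    have "((\<lambda>h. expinv p h / h) \<longlongrightarrow> 0) (at_right 0)"
    proof (rule Lim_transform_eventually)
      show "((\<lambda>h. inverse h * poly p (inverse h) * exp (- inverse h)) \<longlongrightarrow> 0) (at_right 0)"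
        using filterlim_compose[OF poly_exp_tendsto_0[of 1 p] filterlim_inverse_at_top_right] by simp
      show "\<forall>\<^sub>F h in at_right 0. inverse h * poly p (inverse h) * exp (- inverse h) = expinv p h / h"
        by (auto simp: eventually_at_filter expinv_def divide_inverse)
    qed
    moreover have "((\<lambda>h. expinv p h / h) \<longlongrightarrow> 0) (at_left 0)"
      by (rule tendsto_eventually) (auto simp: eventually_at_filter expinv_def)
    ultimately have "((\<lambda>h. expinv p h / h) \<longlongrightarrow> 0) (at 0)"
      by (rule filterlim_split_at_real[rotated])
    then show ?thesis using 2 by (simp add: DERIV_def expinv_def)
  next
    case 3
    have "((\<lambda>x. poly p (1 / x) * exp (- (1 / x))) has_real_derivative
       poly (pCons 0 (pCons 0 (p - pderiv p))) (1 / x) * exp (- (1 / x))) (at x)"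
      using 3 by (auto intro!: derivative_eq_intros simp: field_simps power2_eq_square)
    then have "(expinv p has_real_derivative poly (pCons 0 (pCons 0 (p - pderiv p))) (1 / x) * exp (- (1 / x))) (at x)"
      by (rule has_field_derivative_transform_within_open[where S = "{0<..}"])
         (use 3 in \<open>auto simp: expinv_def\<close>)
    then show ?thesis using 3 by (simp add: expinv_def)
  qed
qed

lemma n_times_diff_expinv: "n_times_diff n (expinv p)"
proof (induction n arbitrary: p)
  case 0 show ?case using expinv_deriv by (auto simp: n_times_diff_0 real_differentiable_def)
next
  case (Suc n) show ?case by (rule n_times_diff_SucI[OF expinv_deriv Suc.IH])
qed

lemma test_functionI:
  assumes "\<And>n. n_times_diff n f" "\<And>x. x \<notin> {a..b} \<Longrightarrow> f x = 0"
  shows "test_function f"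
proof -
  have "{x. f x \<noteq> 0} \<subseteq> {a..b}" using assms(2) by blast
  then have "closure {x. f x \<noteq> 0} \<subseteq> {a..b}" by (simp add: closure_minimal)
  then have "compact (closure {x. f x \<noteq> 0})"
    by (metis closed_closure compact_Icc compact_Int_closed inf.absorb2)
  moreover have "((deriv ^^ k) f) differentiable (at x)" for k x
    using assms(1)[of k] by (simp add: n_times_diff_def)
  ultimately show ?thesis by (simp add: test_function_def)
qed

lemma test_functionD:
  assumes "test_function f"
  shows "\<And>x. (f has_real_derivative deriv f x) (at x)" "continuous_on UNIV (deriv f)" "continuous_on UNIV f"
    "\<exists>r. \<forall>x. r \<le> \<bar>x\<bar> \<longrightarrow> f x = 0 \<and> deriv f x = 0"
proof -
  have 0: "f differentiable (at x)" for x
    using assms unfolding test_function_def by (metis funpow_0)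
  have 1: "deriv f differentiable (at x)" for x
  proof -
    have "((deriv ^^ 1) f) differentiable (at x)" using assms unfolding test_function_def by blast
    then show ?thesis by simp
  qed
  show d: "(f has_real_derivative deriv f x) (at x)" for x using 0 by (rule deriv_at)
  show "continuous_on UNIV (deriv f)"
    using 1 by (auto intro!: continuous_at_imp_continuous_on differentiable_imp_continuous_within)
  show "continuous_on UNIV f"
    using 0 by (auto intro!: continuous_at_imp_continuous_on differentiable_imp_continuous_within)
  have "bounded {x. f x \<noteq> 0}"
    using assms unfolding test_function_def by (meson bounded_subset closure_subset compact_imp_bounded)
  then obtain r where r: "\<And>x. f x \<noteq> 0 \<Longrightarrow> \<bar>x\<bar> \<le> r" unfolding bounded_iff by auto
  have z: "f x = 0" if "r < \<bar>x\<bar>" for x using r[of x] that by linarith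
  have "f x = 0 \<and> deriv f x = 0" if x: "r + 1 \<le> \<bar>x\<bar>" for x
  proof
    show "f x = 0" using z x by auto
    have "((\<lambda>x. 0) has_real_derivative 0) (at x)" by simp
    then have "(f has_real_derivative 0) (at x)"
    proof (rule has_field_derivative_transform_within_open[where S = "{y. r < \<bar>y\<bar>}"])
      show "open {y. r < \<bar>y\<bar>}" by (intro open_Collect_less continuous_intros)
    qed (use x z in auto)
    then show "deriv f x = 0" by (rule DERIV_imp_deriv)
  qed
  then show "\<exists>r. \<forall>x. r \<le> \<bar>x\<bar> \<longrightarrow> f x = 0 \<and> deriv f x = 0" by blast
qed

text \<open>The index \<open>n\<close> is a steepness: inside the interval both factors tend to 1 as
  n grows. These functions approximate the indicator of an open interval pointwise while staying
  between 0 and 1.\<close>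

definition bump :: "real \<Rightarrow> real \<Rightarrow> nat \<Rightarrow> real \<Rightarrow> real" where
  "bump a b n x = expinv 1 (real (Suc n) * (x - a)) * expinv 1 (real (Suc n) * (b - x))"

lemma n_times_diff_bump: "n_times_diff k (bump a b n)"
proof -
  have "n_times_diff k (\<lambda>x. expinv 1 (real (Suc n) * x + - real (Suc n) * a) * expinv 1 (- real (Suc n) * x + real (Suc n) * b))"
    by (intro n_times_diff_mult n_times_diff_affine n_times_diff_expinv)
  moreover have "bump a b n = (\<lambda>x. expinv 1 (real (Suc n) * x + - real (Suc n) * a) * expinv 1 (- real (Suc n) * x + real (Suc n) * b))"
    by (auto simp: bump_def algebra_simps)
  ultimately show ?thesis by simp
qed

lemma bump_nonneg: "0 \<le> bump a b n x"
  by (simp add: bump_def expinv_def)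

lemma bump_le_1: "bump a b n x \<le> 1"
proof -
  have "0 \<le> expinv 1 y \<and> expinv 1 y \<le> 1" for y by (auto simp: expinv_def)
  then show ?thesis unfolding bump_def by (metis mult_le_one)
qed

lemma bump_outside: "x \<notin> {a<..<b} \<Longrightarrow> bump a b n x = 0"
proof -
  assume "x \<notin> {a<..<b}"
  then consider "x \<le> a" | "b \<le> x" by fastforce
  then show ?thesis
  proof cases
    case 1
    then have "\<not> 0 < real (Suc n) * (x - a)" by (simp add: zero_less_mult_iff del: of_nat_Suc)
    then show ?thesis by (simp add: bump_def expinv_def del: of_nat_Suc)
  next
    case 2
    then have "\<not> 0 < real (Suc n) * (b - x)" by (simp add: zero_less_mult_iff del: of_nat_Suc)
    then show ?thesis by (simp add: bump_def expinv_def del: of_nat_Suc)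
  qed
qed

lemma bump_pos: "a < x \<Longrightarrow> x < b \<Longrightarrow> 0 < bump a b n x"
  by (simp add: bump_def expinv_def)

lemma bump_tendsto: "(\<lambda>n. bump a b n x) \<longlonglongrightarrow> indicator {a<..<b} x"
proof (cases "x \<in> {a<..<b}")
  case True
  have *: "(\<lambda>n. expinv 1 (real (Suc n) * c)) \<longlonglongrightarrow> 1" if "0 < c" for c
  proof -
    have "(\<lambda>n. exp (- (inverse (real (Suc n)) * (1/c)))) \<longlonglongrightarrow> exp (- (0 * (1/c)))"
      by (intro tendsto_intros LIMSEQ_inverse_real_of_nat)
    moreover have "expinv 1 (real (Suc n) * c) = exp (- (inverse (real (Suc n)) * (1/c)))" for n
      using that by (simp add: expinv_def divide_inverse del: of_nat_Suc)
    ultimately show ?thesis by simp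
  qed
  have "(\<lambda>n. bump a b n x) \<longlonglongrightarrow> 1 * 1"
    unfolding bump_def using True by (intro tendsto_mult *) auto
  then show ?thesis using True by simp
next
  case False
  then show ?thesis by (simp add: bump_outside)
qed

lemma continuous_bump: "continuous_on UNIV (bump a b n)"
  using n_times_diff_bump[of 0 a b n]
  by (auto simp: n_times_diff_0 intro!: continuous_at_imp_continuous_on differentiable_imp_continuous_within)

lemma integrable_bump: "integrable lborel (bump a b n)"
proof -
  have "set_integrable lborel {a..b} (bump a b n)"
    by (intro borel_integrable_atLeastAtMost' continuous_on_subset[OF continuous_bump]) auto
  moreover have "indicator {a..b} x *\<^sub>R bump a b n x = bump a b n x" for x
    using bump_outside[of x a b n] by (cases "x \<in> {a..b}") auto
  ultimately show ?thesis unfolding set_integrable_def by (simp only:)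
qed

lemma integral_bump_pos: "a < b \<Longrightarrow> 0 < (LINT x|lborel. bump a b n x)"
proof -
  assume "a < b"
  have "0 \<le> (LINT x|lborel. bump a b n x)" by (simp add: bump_nonneg)
  moreover have "(LINT x|lborel. bump a b n x) \<noteq> 0"
  proof
    assume "(LINT x|lborel. bump a b n x) = 0"
    then have "AE x in lborel. bump a b n x = 0"
      using integral_nonneg_eq_0_iff_AE[OF integrable_bump] bump_nonneg by auto
    then have "AE x in lborel. x \<notin> {a<..<b}"
      by eventually_elim (use bump_pos[of a _ b n] in force)
    then have "emeasure lborel {a<..<b} = 0"
      by (subst (asm) AE_iff_measurable[of "{a<..<b}"]) auto
    then show False using \<open>a < b\<close> by simp
  qed
  ultimately show ?thesis by simp
qed

text \<open>The primitive that starts at \<open>a\<close> vanishes to the left of the support; the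
  vanishing total integral makes it vanish to the right as well. Mean-zero bumps are therefore
  derivatives of test functions.\<close>

lemma test_function_antideriv:
  assumes smooth: "\<And>n. n_times_diff n g" and supp: "\<And>x. x \<notin> {a..b} \<Longrightarrow> g x = 0" and "a \<le> b"
    and z: "(LINT x|lborel. g x) = 0"
  shows "\<exists>f. test_function f \<and> deriv f = g"
proof -
  have c: "continuous_on UNIV g"
    using smooth[of 0]
    by (auto simp: n_times_diff_0 intro!: continuous_at_imp_continuous_on differentiable_imp_continuous_within)
  then obtain T0 where T0: "prim T0 g" using locally_L1_ex_prim locally_L1_continuous by blast
  define T where "T = (\<lambda>x. T0 x - T0 a)"
  have d: "(T has_real_derivative g x) (at x)" for x
    unfolding T_def using prim_has_derivative[OF T0 c] by (auto intro!: derivative_eq_intros)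
  have "T x = 0" if "x \<notin> {a..b}" for x
  proof (cases "x < a")
    case True
    have "(LINT z:{x..a}|lborel. g z) = 0"
      unfolding set_lebesgue_integral_def
    proof (rule integral_eq_zero_AE)
      have "AE z in lborel. z \<noteq> a" by (rule AE_lborel_singleton)
      then show "AE z in lborel. indicator {x..a} z *\<^sub>R g z = 0"
        by eventually_elim (auto simp: indicator_def supp)
    qed
    then show ?thesis using prim_diff_eq[OF T0, of x a] True by (simp add: T_def)
  next
    case False
    then have x: "b < x" using that \<open>a \<le> b\<close> by auto
    have "(LINT z:{a..x}|lborel. g z) = (LINT z|lborel. g z)"
      unfolding set_lebesgue_integral_def
    proof (rule Bochner_Integration.integral_cong[OF refl])
      fix z show "indicator {a..x} z *\<^sub>R g z = g z"
        using x supp[of z] by (cases "z \<in> {a..x}") auto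
    qed
    then show ?thesis using prim_diff_eq[OF T0, of a x] x \<open>a \<le> b\<close> z by (simp add: T_def)
  qed
  moreover have "n_times_diff n T" for n
    using n_times_diff_SucI[OF d smooth] n_times_diff_SucD by blast
  ultimately have "test_function T" by (intro test_functionI)
  moreover have "deriv T = g" using d by (auto intro: DERIV_imp_deriv)
  ultimately show ?thesis by blast
qed

lemma locally_L1_test_integrable:
  assumes "locally_L1 f" "continuous_on UNIV g" "\<And>x. r \<le> \<bar>x\<bar> \<Longrightarrow> g x = 0"
  shows "integrable lborel (\<lambda>x. f x * g x)"
proof -
  have "set_integrable lborel {-r..r} (\<lambda>x. f x * g x)"
    by (rule set_integrable_mult_continuous[OF locally_L1_set_integrable[OF assms(1)] assms(2)])
  moreover have "indicator {-r..r} x *\<^sub>R (f x * g x) = f x * g x" for x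
  proof (cases "r \<le> \<bar>x\<bar>")
    case True then show ?thesis using assms(3)[of x] by simp
  next
    case False then have "x \<in> {-r..r}" by auto
    then show ?thesis by simp
  qed
  ultimately show ?thesis unfolding set_integrable_def by (simp only:)
qed

lemma prim_test_function:
  assumes "prim H h" "test_function f"
  shows "(LINT x|lborel. H x * deriv f x) = - (LINT x|lborel. h x * f x)"
proof -
  obtain r0 where r0: "\<And>x. r0 \<le> \<bar>x\<bar> \<Longrightarrow> f x = 0 \<and> deriv f x = 0"
    using test_functionD(4)[OF assms(2)] by blast
  define r where "r = max r0 0"
  have r: "f x = 0" "deriv f x = 0" if "r \<le> \<bar>x\<bar>" for x using r0[of x] that by (auto simp: r_def)
  have "prim f (deriv f)" by (rule prim_C1) (use test_functionD[OF assms(2)] in auto)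
  from prim_diff_eq[OF prim_mult[OF assms(1) this], of "-r" r]
  have "(LINT z:{-r..r}|lborel. h z * f z + H z * deriv f z) = 0"
    using r(1)[of r] r(1)[of "-r"] by (simp add: r_def)
  also have "(LINT z:{-r..r}|lborel. h z * f z + H z * deriv f z) = (LINT z|lborel. h z * f z + H z * deriv f z)"
    unfolding set_lebesgue_integral_def
  proof (rule Bochner_Integration.integral_cong[OF refl])
    fix x show "indicator {-r..r} x *\<^sub>R (h x * f x + H x * deriv f x) = h x * f x + H x * deriv f x"
    proof (cases "r \<le> \<bar>x\<bar>")
      case True then show ?thesis using r[of x] by simp
    next
      case False then have "x \<in> {-r..r}" by auto
      then show ?thesis by simp
    qed
  qed
  also have "\<dots> = (LINT z|lborel. h z * f z) + (LINT z|lborel. H z * deriv f z)"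
  proof (rule Bochner_Integration.integral_add)
    show "integrable lborel (\<lambda>z. h z * f z)"
      using assms(1) r by (intro locally_L1_test_integrable[where r = r] test_functionD[OF assms(2)]) (auto simp: prim_def)
    show "integrable lborel (\<lambda>z. H z * deriv f z)"
      using r by (intro locally_L1_test_integrable[where r = r] test_functionD[OF assms(2)]
                   locally_L1_continuous prim_continuous[OF assms(1)]) auto
  qed
  finally show ?thesis by simp
qed

text \<open>A smooth function of compact support is the derivative of a test function once its
  integral is 0. Correcting each bump by a multiple of a fixed bump \<open>k\<close> of mass 1
  achieves this, so \<open>f\<close> acts on all bumps like the constant \<open>c\<close>. Letting
  the bumps steepen carries the identity over to integrals over intervals.\<close>

lemma du_Bois_Reymond:
  assumes f: "locally_L1 f" and z: "\<And>g. test_function g \<Longrightarrow> (LINT x|lborel. f x * deriv g x) = 0"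
  shows "\<exists>c. AE x in lborel. f x = c"
proof -
  have [measurable]: "f \<in> borel_measurable borel" using f by (rule locally_L1_measurable)
  define k where "k = (\<lambda>x. bump 0 1 0 x / (LINT x|lborel. bump 0 1 0 x))"
  have k: "integrable lborel k" "(LINT x|lborel. k x) = 1" "n_times_diff n k" "x \<notin> {0..1} \<Longrightarrow> k x = 0" for n x
    using integral_bump_pos[of 0 1 0] n_times_diff_cmult[OF n_times_diff_bump[of n 0 1 0], of "1 / (LINT x|lborel. bump 0 1 0 x)"]
    by (auto simp: k_def integrable_bump bump_outside)
  have ck: "continuous_on UNIV k"
    using k(3)[of 0]
    by (auto simp: n_times_diff_0 intro!: continuous_at_imp_continuous_on differentiable_imp_continuous_within)
  have fk: "integrable lborel (\<lambda>x. f x * k x)"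
    by (rule locally_L1_test_integrable[where r = 2, OF f ck], rule k(4)) auto
  \<comment> \<open>The value is forced: \<open>k\<close> has mass 1, so a constant function
    integrates against it to the constant.\<close>
  define c where "c = (LINT x|lborel. f x * k x)"
  have 1: "(LINT x|lborel. f x * bump a b n x) = c * (LINT x|lborel. bump a b n x)" for a b n
  proof -
    define I where "I = (LINT x|lborel. bump a b n x)"
    define g where "g = (\<lambda>x. bump a b n x + (- I) * k x)"
    have "n_times_diff m g" for m
      unfolding g_def by (intro n_times_diff_add n_times_diff_cmult n_times_diff_bump k)
    moreover have "(LINT x|lborel. g x) = 0"
      unfolding g_def using integrable_bump k by (subst Bochner_Integration.integral_add) (auto simp: I_def)
    moreover have "g x = 0" if "x \<notin> {min a 0..max b 1}" for x
    proof -
      have "x \<notin> {0..1}" "x \<notin> {a<..<b}" using that by auto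
      then show ?thesis using k(4) bump_outside by (simp add: g_def)
    qed
    moreover have "min a 0 \<le> max b 1" by linarith
    ultimately obtain t where t: "test_function t" "deriv t = g"
      using test_function_antideriv[of g "min a 0" "max b 1"] by blast
    have "0 = (LINT x|lborel. f x * g x)" using z[OF t(1)] t(2) by simp
    also have "\<dots> = (LINT x|lborel. f x * bump a b n x - I * (f x * k x))"
      by (intro Bochner_Integration.integral_cong) (auto simp: g_def algebra_simps)
    also have "\<dots> = (LINT x|lborel. f x * bump a b n x) - I * c"
    proof -
      have "integrable lborel (\<lambda>x. f x * bump a b n x)"
        by (rule locally_L1_test_integrable[where r = "max \<bar>a\<bar> \<bar>b\<bar>", OF f continuous_bump])
           (auto intro!: bump_outside)
      then show ?thesis using fk by (simp add: c_def)
    qed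
    finally show ?thesis by (simp add: I_def mult.commute)
  qed
  have 2: "(LINT x:{a..b}|lborel. f x - c) = 0" if "a \<le> b" for a b
  proof -
    have fi: "integrable lborel (\<lambda>x. indicator {a..b} x * f x)"
      using locally_L1_set_integrable[OF f, of a b] by (simp add: set_integrable_def)
    have "(\<lambda>n. LINT x|lborel. f x * bump a b n x) \<longlonglongrightarrow> (LINT x|lborel. f x * indicator {a<..<b} x)"
    proof (rule integral_dominated_convergence[where w = "\<lambda>x. indicator {a..b} x * \<bar>f x\<bar>"])
      show "integrable lborel (\<lambda>x. indicator {a..b} x * \<bar>f x\<bar>)"
        using integrable_abs[OF fi] by (simp add: abs_mult)
      show "AE x in lborel. (\<lambda>n. f x * bump a b n x) \<longlonglongrightarrow> f x * indicator {a<..<b} x"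
        by (intro AE_I2 tendsto_intros bump_tendsto)
      have [measurable]: "bump a b n \<in> borel_measurable borel" for n
        by (rule borel_measurable_continuous_onI[OF continuous_bump])
      show "(\<lambda>x. f x * bump a b n x) \<in> borel_measurable lborel" for n by measurable
      show "AE x in lborel. norm (f x * bump a b n x) \<le> indicator {a..b} x * \<bar>f x\<bar>" for n
      proof (rule AE_I2)
        fix x show "norm (f x * bump a b n x) \<le> indicator {a..b} x * \<bar>f x\<bar>"
          using bump_outside[of x a b n] bump_nonneg[of a b n x] bump_le_1[of a b n x]
          by (auto simp: indicator_def abs_mult mult_left_le)
      qed
    qed measurable
    moreover have "(\<lambda>n. LINT x|lborel. bump a b n x) \<longlonglongrightarrow> (LINT x|lborel. indicator {a<..<b} x)"
    proof (rule integral_dominated_convergence[where w = "\<lambda>x. indicator {a..b} x"])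
      show "AE x in lborel. (\<lambda>n. bump a b n x) \<longlonglongrightarrow> indicator {a<..<b} x"
        by (intro AE_I2 bump_tendsto)
      show "bump a b n \<in> borel_measurable lborel" for n
        using borel_measurable_continuous_onI[OF continuous_bump] by simp
      show "AE x in lborel. norm (bump a b n x) \<le> indicator {a..b} x" for n
      proof (rule AE_I2)
        fix x show "norm (bump a b n x) \<le> indicator {a..b} x"
          using bump_outside[of x a b n] bump_nonneg[of a b n x] bump_le_1[of a b n x]
          by (auto simp: indicator_def)
      qed
    qed (use that in \<open>auto simp: integrable_indicator_iff\<close>)
    then have "(\<lambda>n. c * (LINT x|lborel. bump a b n x)) \<longlonglongrightarrow> c * (LINT x|lborel. indicator {a<..<b} x)"
      by (intro tendsto_intros)
    ultimately have "(LINT x|lborel. f x * indicator {a<..<b} x) = c * (LINT x|lborel. indicator {a<..<b} x)"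
      unfolding 1 by (rule LIMSEQ_unique)
    then have "(LINT x|lborel. f x * indicator {a<..<b} x) = c * (b - a)" using that by simp
    moreover have "(LINT x|lborel. f x * indicator {a<..<b} x) = (LINT x|lborel. indicator {a..b} x * f x)"
    proof (rule integral_cong_AE)
      have "AE x in lborel. x \<noteq> a" "AE x in lborel. x \<noteq> b" by (rule AE_lborel_singleton)+
      then show "AE x in lborel. f x * indicator {a<..<b} x = indicator {a..b} x * f x"
        by eventually_elim (auto simp: indicator_def)
    qed auto
    moreover have "(LINT x:{a..b}|lborel. f x - c) = (LINT x:{a..b}|lborel. f x) - (LINT x:{a..b}|lborel. c)"
      by (rule set_integral_diff) (auto intro!: locally_L1_set_integrable[OF f] locally_L1_set_integrable[OF locally_L1_continuous])
    ultimately show ?thesis using that by (simp add: set_lebesgue_integral_def)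
  qed
  have "locally_L1 (\<lambda>x. f x - c)"
    using f locally_L1_continuous[of "\<lambda>x. c"] unfolding locally_L1_def by (auto intro!: set_integral_diff(1))
  from AE_zero_of_interval_integrals[OF this 2] show ?thesis by auto
qed

text \<open>Bridge from test functions to the fundamental theorem of calculus. \<open>f\<close>
  minus a primitive of \<open>g\<close> has weak derivative 0, hence is constant almost everywhere,
  and the constant is absorbed into the primitive. Measurability of \<open>f\<close> is stated
  separately because equality almost everywhere does not give Borel measurability.\<close>

lemma has_weak_deriv_iff_prim:
  "has_weak_deriv f g \<longleftrightarrow> f \<in> borel_measurable borel \<and> (\<exists>H. prim H g \<and> (AE x in lborel. f x = H x))"
proof
  assume w: "has_weak_deriv f g"
  then have f: "locally_L1 f" and g: "locally_L1 g" by (auto simp: has_weak_deriv_def)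
  obtain P where P: "prim P g" using locally_L1_ex_prim[OF g] by blast
  have l: "locally_L1 P" by (intro locally_L1_continuous prim_continuous[OF P])
  have "locally_L1 (\<lambda>x. f x - P x)"
    using f l by (auto simp: locally_L1_def intro!: set_integral_diff)
  moreover have "(LINT x|lborel. (f x - P x) * deriv t x) = 0" if t: "test_function t" for t
  proof -
    obtain r where r: "\<And>x. r \<le> \<bar>x\<bar> \<Longrightarrow> t x = 0 \<and> deriv t x = 0"
      using test_functionD(4)[OF t] by blast
    have "integrable lborel (\<lambda>x. f x * deriv t x)" "integrable lborel (\<lambda>x. P x * deriv t x)"
      using f l r by (auto intro!: locally_L1_test_integrable[where r = r] test_functionD[OF t])
    then show ?thesis
      using prim_test_function[OF P t] w t by (simp add: left_diff_distrib has_weak_deriv_def)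
  qed
  ultimately obtain c where c: "AE x in lborel. f x - P x = c" using du_Bois_Reymond by blast
  have "prim (\<lambda>x. P x + c) g" using P by (simp add: prim_def)
  moreover have "AE x in lborel. f x = P x + c" using c by eventually_elim auto
  ultimately show "f \<in> borel_measurable borel \<and> (\<exists>H. prim H g \<and> (AE x in lborel. f x = H x))"
    using locally_L1_measurable[OF f] by blast
next
  assume "f \<in> borel_measurable borel \<and> (\<exists>H. prim H g \<and> (AE x in lborel. f x = H x))"
  then obtain H where [measurable]: "f \<in> borel_measurable borel" and H: "prim H g" "AE x in lborel. f x = H x" by blast
  have [measurable]: "H \<in> borel_measurable borel" by (rule prim_measurable[OF H(1)])
  have l: "locally_L1 H" by (intro locally_L1_continuous prim_continuous[OF H(1)])
  have "set_integrable lborel {-r..r} f \<longleftrightarrow> set_integrable lborel {-r..r} H" for r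
    unfolding set_integrable_def by (rule integrable_cong_AE) (use H(2) in auto)
  then have "locally_L1 f" using l by (simp add: locally_L1_def)
  moreover have "(LINT x|lborel. f x * deriv t x) = - (LINT x|lborel. g x * t x)" if t: "test_function t" for t
  proof -
    have [measurable]: "deriv t \<in> borel_measurable borel"
      by (rule borel_measurable_continuous_onI[OF test_functionD(2)[OF t]])
    have "(LINT x|lborel. f x * deriv t x) = (LINT x|lborel. H x * deriv t x)"
      by (rule integral_cong_AE) (use H(2) in auto)
    then show ?thesis using prim_test_function[OF H(1) t] by simp
  qed
  ultimately show "has_weak_deriv f g" using H(1) by (simp add: has_weak_deriv_def prim_def)
qed

lemma has_weak_deriv_unique:
  assumes "has_weak_deriv f g" "has_weak_deriv f' g'" "AE x in lborel. f x = f' x"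
  shows "AE x in lborel. g x = g' x"
proof -
  obtain P where P: "prim P g" "AE x in lborel. f x = P x"
    using assms(1) by (auto simp: has_weak_deriv_iff_prim)
  obtain Q where Q: "prim Q g'" "AE x in lborel. f' x = Q x"
    using assms(2) by (auto simp: has_weak_deriv_iff_prim)
  have "AE x in lborel. P x = Q x" using P(2) Q(2) assms(3) by eventually_elim auto
  then have "P x = Q x" for x
    by (rule AE_continuous_eq[OF _ prim_continuous[OF P(1)] prim_continuous[OF Q(1)]])
  then have "P = Q" by blast
  then show ?thesis using prim_density_unique[of P g g'] P(1) Q(1) by simp
qed

text \<open>Replaces the representative picked by the choice operator by any weak derivative that is
  already known.\<close>

lemma weak_deriv_AE:
  assumes "has_weak_deriv f g"
  shows "has_weak_deriv f (weak_deriv f)" "AE x in lborel. weak_deriv f x = g x"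
proof -
  show *: "has_weak_deriv f (weak_deriv f)"
    unfolding weak_deriv_def by (rule someI[where P = "has_weak_deriv f", OF assms])
  show "AE x in lborel. weak_deriv f x = g x"
    by (rule has_weak_deriv_unique[OF * assms]) simp
qed

subsection \<open>Square-integrable functions\<close>

definition L2 :: "(real \<Rightarrow> real) \<Rightarrow> bool" where
  "L2 f \<longleftrightarrow> f \<in> borel_measurable borel \<and> integrable lborel (\<lambda>x. (f x)\<^sup>2)"

text \<open>The value is 0 when the square is not integrable, so convergence of \<open>sq\<close> to
  0 is informative only together with membership in \<open>L2\<close>.\<close>

definition sq :: "(real \<Rightarrow> real) \<Rightarrow> real" where
  "sq f = (LINT x|lborel. (f x)\<^sup>2)"

lemma L2_measurable: "L2 f \<Longrightarrow> f \<in> borel_measurable borel"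
  by (simp add: L2_def)

lemma L2_integrable: "L2 f \<Longrightarrow> integrable lborel (\<lambda>x. (f x)\<^sup>2)"
  by (simp add: L2_def)

lemma sq_nonneg [simp]: "0 \<le> sq f"
  by (simp add: sq_def)

lemma integrable_le:
  fixes f g :: "real \<Rightarrow> real"
  assumes "integrable lborel g" "f \<in> borel_measurable borel" "\<And>x. \<bar>f x\<bar> \<le> g x"
  shows "integrable lborel f"
proof (rule Bochner_Integration.integrable_bound[OF assms(1)])
  show "AE x in lborel. norm (f x) \<le> norm (g x)"
    using assms(3) by (intro AE_I2) (metis abs_of_nonneg abs_ge_zero order_trans real_norm_def)
qed (use assms in simp)

lemma L2_mult_integrable:
  assumes "L2 f" "L2 g" shows "integrable lborel (\<lambda>x. f x * g x)"
proof (rule integrable_le)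
  show "integrable lborel (\<lambda>x. (f x)\<^sup>2 + (g x)\<^sup>2)"
    using assms by (simp add: L2_def)
  show "(\<lambda>x. f x * g x) \<in> borel_measurable borel" using assms by (auto simp: L2_def)
  fix x
  have "2 * (\<bar>f x\<bar> * \<bar>g x\<bar>) \<le> (f x)\<^sup>2 + (g x)\<^sup>2"
    using sum_squares_bound[of "\<bar>f x\<bar>" "\<bar>g x\<bar>"] by simp
  moreover have "0 \<le> \<bar>f x\<bar> * \<bar>g x\<bar>" by simp
  ultimately show "\<bar>f x * g x\<bar> \<le> (f x)\<^sup>2 + (g x)\<^sup>2" unfolding abs_mult by linarith
qed

lemma L2_add:
  assumes "L2 f" "L2 g" shows "L2 (\<lambda>x. f x + g x)"
proof -
  have "integrable lborel (\<lambda>x. (f x)\<^sup>2 + (g x)\<^sup>2 + 2 * (f x * g x))"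
    using assms L2_mult_integrable[OF assms] by (simp add: L2_def)
  then show ?thesis using assms by (auto simp: L2_def power2_sum mult.assoc)
qed

lemma L2_cmult: "L2 f \<Longrightarrow> L2 (\<lambda>x. c * f x)"
  by (auto simp: L2_def power_mult_distrib)

lemma L2_diff: "L2 f \<Longrightarrow> L2 g \<Longrightarrow> L2 (\<lambda>x. f x - g x)"
  using L2_add[of f "\<lambda>x. -1 * g x"] L2_cmult[of g "-1"] by simp

lemma L2_bound:
  assumes "L2 g" "f \<in> borel_measurable borel" "\<And>x. \<bar>f x\<bar> \<le> c * \<bar>g x\<bar>"
  shows "L2 f"
proof -
  have "integrable lborel (\<lambda>x. (f x)\<^sup>2)"
  proof (rule integrable_le)
    show "integrable lborel (\<lambda>x. c\<^sup>2 * (g x)\<^sup>2)" using assms(1) by (simp add: L2_def)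
    fix x
    have "\<bar>f x\<bar>\<^sup>2 \<le> (c * \<bar>g x\<bar>)\<^sup>2" by (rule power_mono) (use assms(3) in auto)
    then show "\<bar>(f x)\<^sup>2\<bar> \<le> c\<^sup>2 * (g x)\<^sup>2" by (simp add: power_mult_distrib)
  qed (use assms in simp)
  then show ?thesis using assms by (simp add: L2_def)
qed

lemma L2_mult_bounded:
  assumes "L2 g" "f \<in> borel_measurable borel" "\<And>x. \<bar>f x\<bar> \<le> c"
  shows "L2 (\<lambda>x. f x * g x)"
  using assms by (intro L2_bound[OF assms(1), of _ c]) (auto simp: abs_mult L2_def intro!: mult_right_mono)

lemma L2_bounded_integrable:
  assumes "integrable lborel f" "\<And>x. \<bar>f x\<bar> \<le> c"
  shows "L2 f" "sq f \<le> c * (LINT x|lborel. \<bar>f x\<bar>)"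
proof -
  have le: "\<bar>(f x)\<^sup>2\<bar> \<le> c * \<bar>f x\<bar>" for x
    using mult_right_mono[OF assms(2)[of x], of "\<bar>f x\<bar>"] by (simp add: power2_eq_square abs_mult)
  have i: "integrable lborel (\<lambda>x. (f x)\<^sup>2)"
    by (rule integrable_le[OF _ _ le]) (use assms(1) in auto)
  then show "L2 f" using assms(1) by (auto simp: L2_def)
  have "sq f \<le> (LINT x|lborel. c * \<bar>f x\<bar>)" unfolding sq_def
    by (rule integral_mono) (use i assms(1) le in auto)
  then show "sq f \<le> c * (LINT x|lborel. \<bar>f x\<bar>)" using assms(1) by simp
qed

lemma Cauchy_Schwarz_L2:
  assumes "L2 f" "L2 g"
  shows "(LINT x|lborel. \<bar>f x * g x\<bar>) \<le> sqrt (sq f * sq g)"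
proof -
  have [measurable]: "f \<in> borel_measurable borel" "g \<in> borel_measurable borel"
    using assms by (auto simp: L2_def)
  define I where "I = (LINT x|lborel. \<bar>f x * g x\<bar>)"
  have "(\<integral>\<^sup>+x. ennreal \<bar>f x\<bar> * ennreal \<bar>g x\<bar> \<partial>lborel) = ennreal I"
    unfolding I_def by (subst nn_integral_eq_integral[symmetric])
      (use integrable_abs[OF L2_mult_integrable[OF assms]] in \<open>auto simp: ennreal_mult abs_mult\<close>)
  moreover have "(\<integral>\<^sup>+x. (ennreal \<bar>h x\<bar>)\<^sup>2 \<partial>lborel) = ennreal (sq h)" if "L2 h" for h
    unfolding sq_def by (subst nn_integral_eq_integral[symmetric])
      (use that in \<open>auto simp: ennreal_power L2_def\<close>)
  ultimately have "(ennreal I)\<^sup>2 \<le> ennreal (sq f) * ennreal (sq g)"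
    using Cauchy_Schwarz_nn_integral[of "\<lambda>x. ennreal \<bar>f x\<bar>" lborel "\<lambda>x. ennreal \<bar>g x\<bar>"] assms by simp
  moreover have "0 \<le> I" by (simp add: I_def)
  ultimately have "I\<^sup>2 \<le> sq f * sq g"
    by (simp add: ennreal_power flip: ennreal_mult)
  then show ?thesis unfolding I_def by (rule real_le_rsqrt)
qed

lemma abs_integral_mult_le:
  assumes "L2 f" "L2 g"
  shows "\<bar>LINT x|lborel. f x * g x\<bar> \<le> sqrt (sq f * sq g)"
  using integral_abs_bound[of lborel "\<lambda>x. f x * g x"] Cauchy_Schwarz_L2[OF assms] by linarith

lemma sq_cmult: "sq (\<lambda>x. c * f x) = c\<^sup>2 * sq f"
  by (simp add: sq_def power_mult_distrib)

lemma sq_add_le: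
  assumes "L2 f" "L2 g"
  shows "sq (\<lambda>x. f x + g x) \<le> 2 * sq f + 2 * sq g"
proof -
  have "sq (\<lambda>x. f x + g x) \<le> (LINT x|lborel. 2 * (f x)\<^sup>2 + 2 * (g x)\<^sup>2)"
    unfolding sq_def
  proof (rule integral_mono)
    fix x show "(f x + g x)\<^sup>2 \<le> 2 * (f x)\<^sup>2 + 2 * (g x)\<^sup>2"
      using sum_squares_bound[of "f x" "g x"] by (simp add: power2_sum)
  qed (use assms L2_add[OF assms] in \<open>auto simp: L2_def\<close>)
  also have "\<dots> = 2 * sq f + 2 * sq g" using assms by (simp add: sq_def L2_def)
  finally show ?thesis .
qed

text \<open>The difference f g - f0 g0 is split into (f - f0)(g - g0), (f - f0) g0 and f0 (g - g0),
  each controlled by Cauchy-Schwarz. Time derivatives of integrals of the solution are obtained as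
  limits of this kind.\<close>

lemma tendsto_integral_mult:
  assumes "((\<lambda>s. sq (\<lambda>x. f s x - f0 x)) \<longlongrightarrow> 0) A" "L2 f0" "eventually (\<lambda>s. L2 (f s)) A"
    and "((\<lambda>s. sq (\<lambda>x. g s x - g0 x)) \<longlongrightarrow> 0) A" "L2 g0" "eventually (\<lambda>s. L2 (g s)) A"
  shows "((\<lambda>s. LINT x|lborel. f s x * g s x) \<longlongrightarrow> (LINT x|lborel. f0 x * g0 x)) A"
proof -
  define e where "e s = sqrt (sq (\<lambda>x. f s x - f0 x) * sq (\<lambda>x. g s x - g0 x))
      + sqrt (sq (\<lambda>x. f s x - f0 x) * sq g0) + sqrt (sq f0 * sq (\<lambda>x. g s x - g0 x))" for s
  have "(e \<longlongrightarrow> sqrt (0 * 0) + sqrt (0 * sq g0) + sqrt (sq f0 * 0)) A"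
    unfolding e_def using assms by (intro tendsto_intros)
  then have e: "(e \<longlongrightarrow> 0) A" by simp
  have "((\<lambda>s. (LINT x|lborel. f s x * g s x) - (LINT x|lborel. f0 x * g0 x)) \<longlongrightarrow> 0) A"
  proof (rule Lim_null_comparison[OF _ e])
    show "\<forall>\<^sub>F s in A. norm ((LINT x|lborel. f s x * g s x) - (LINT x|lborel. f0 x * g0 x)) \<le> e s"
      using assms(3) assms(6)
    proof eventually_elim
      case (elim s)
      have d: "L2 (\<lambda>x. f s x - f0 x)" "L2 (\<lambda>x. g s x - g0 x)" using elim assms L2_diff by auto
      note i = L2_mult_integrable[OF d] L2_mult_integrable[OF d(1) assms(5)] L2_mult_integrable[OF assms(2) d(2)]
        L2_mult_integrable[OF assms(2) assms(5)]
      have "(LINT x|lborel. f s x * g s x) = (LINT x|lborel. ((f s x - f0 x) * (g s x - g0 x)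
         + (f s x - f0 x) * g0 x) + (f0 x * (g s x - g0 x) + f0 x * g0 x))"
        by (intro Bochner_Integration.integral_cong) (auto simp: algebra_simps)
      also have "\<dots> = (LINT x|lborel. (f s x - f0 x) * (g s x - g0 x)) + (LINT x|lborel. (f s x - f0 x) * g0 x)
         + (LINT x|lborel. f0 x * (g s x - g0 x)) + (LINT x|lborel. f0 x * g0 x)"
        using i by (subst Bochner_Integration.integral_add, simp_all)+
      finally show ?case
        using abs_integral_mult_le[OF d] abs_integral_mult_le[OF d(1) assms(5)] abs_integral_mult_le[OF assms(2) d(2)]
        unfolding e_def real_norm_def by linarith
    qed
  qed
  then show ?thesis by (rule LIM_zero_cancel)
qed

text \<open>The product of the two primitives and its density are integrable, so the boundary terms
  vanish without any assumption on limits at infinity.\<close>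

lemma prim_integral_by_parts:
  assumes "prim P p" "prim Q q" "L2 P" "L2 p" "L2 Q" "L2 q"
  shows "(LINT x|lborel. P x * q x) = - (LINT x|lborel. p x * Q x)"
proof -
  note i = L2_mult_integrable[OF assms(3) assms(5)] L2_mult_integrable[OF assms(4) assms(5)] L2_mult_integrable[OF assms(3) assms(6)]
  have "(LINT x|lborel. p x * Q x + P x * q x) = 0"
    by (rule prim_integral_0[OF prim_mult[OF assms(1) assms(2)]]) (use i in auto)
  then show ?thesis using i by simp
qed

text \<open>Agmon's inequality: H^2 has the density 2 H h, whose L1 norm bounds the supremum and is
  estimated by Cauchy-Schwarz.\<close>

lemma prim_sup_L2:
  assumes "prim H h" "L2 H" "L2 h"
  shows "(H x)\<^sup>2 \<le> 2 * sqrt (sq H * sq h)"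
proof -
  have "\<bar>H x * H x\<bar> \<le> (LINT z|lborel. \<bar>h z * H z + H z * h z\<bar>)"
    by (rule prim_le_integral_abs[OF prim_mult[OF assms(1) assms(1)]])
       (use L2_mult_integrable assms in auto)
  also have "\<dots> = 2 * (LINT z|lborel. \<bar>H z * h z\<bar>)"
    by (subst integral_mult_right_zero[symmetric], intro Bochner_Integration.integral_cong) (auto simp: abs_mult)
  also have "\<dots> \<le> 2 * sqrt (sq H * sq h)" using Cauchy_Schwarz_L2[OF assms(2) assms(3)] by simp
  finally show ?thesis by (simp add: power2_eq_square)
qed

text \<open>With N the supremum of |H|, the bound \<open>sq H\<close> \<le> N * (L1 norm of H) is
  inserted into the square of \<open>prim_sup_L2\<close>; in the resulting bound for N^4 one factor
  N cancels. This presupposes that N is finite, which \<open>prim_sup_L2\<close> provides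
  beforehand.\<close>

lemma prim_sup_L1_L2:
  assumes "prim H h" "L2 H" "L2 h" "integrable lborel H"
  shows "\<bar>H x\<bar> ^ 3 \<le> 4 * (LINT z|lborel. \<bar>H z\<bar>) * sq h"
proof -
  define N where "N = (SUP x. \<bar>H x\<bar>)"
  have "\<bar>H x\<bar> \<le> sqrt (2 * sqrt (sq H * sq h))" for x
    using prim_sup_L2[OF assms(1-3), of x] by (simp add: real_le_rsqrt)
  then have bdd: "bdd_above (range (\<lambda>x. \<bar>H x\<bar>))" by (auto simp: bdd_above_def)
  have N: "\<bar>H x\<bar> \<le> N" for x unfolding N_def by (rule cSUP_upper[OF _ bdd]) simp
  have N0: "0 \<le> N" using N[of 0] by linarith
  have s: "sq H \<le> N * (LINT z|lborel. \<bar>H z\<bar>)" by (rule L2_bounded_integrable(2)[OF assms(4) N])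
  have "\<bar>H x\<bar> \<le> root 4 (4 * (N * (LINT z|lborel. \<bar>H z\<bar>)) * sq h)" for x
  proof -
    have "\<bar>H x\<bar> ^ 4 = ((H x)\<^sup>2)\<^sup>2" by (simp add: power_even_abs flip: power_mult)
    also have "\<dots> \<le> (2 * sqrt (sq H * sq h))\<^sup>2"
      by (rule power_mono[OF prim_sup_L2[OF assms(1-3)]]) simp
    also have "\<dots> = 4 * sq H * sq h" by (simp add: power_mult_distrib)
    also have "\<dots> \<le> 4 * (N * (LINT z|lborel. \<bar>H z\<bar>)) * sq h"
      using s by (intro mult_right_mono) auto
    finally have "root 4 (\<bar>H x\<bar> ^ 4) \<le> root 4 (4 * (N * (LINT z|lborel. \<bar>H z\<bar>)) * sq h)"
      by (rule real_root_le_mono[rotated]) simp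
    moreover have "root 4 (\<bar>H x\<bar> ^ 4) = \<bar>H x\<bar>" by (rule real_root_power_cancel) auto
    ultimately show ?thesis by linarith
  qed
  then have "N \<le> root 4 (4 * (N * (LINT z|lborel. \<bar>H z\<bar>)) * sq h)"
    unfolding N_def by (intro cSUP_least) auto
  then have "N ^ 4 \<le> (root 4 (4 * (N * (LINT z|lborel. \<bar>H z\<bar>)) * sq h)) ^ 4"
    using N0 by (rule power_mono)
  also have "\<dots> = N * (4 * (LINT z|lborel. \<bar>H z\<bar>) * sq h)"
    using N0 by (subst real_root_pow_pos2) auto
  finally have "N * N ^ 3 \<le> N * (4 * (LINT z|lborel. \<bar>H z\<bar>) * sq h)"
    by (simp add: power_Suc[symmetric] numeral_eq_Suc)
  moreover have "\<bar>H x\<bar> ^ 3 \<le> N ^ 3" by (rule power_mono[OF N]) simp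
  ultimately show ?thesis
  proof (cases "N = 0")
    case True
    then have "\<bar>H x\<bar> = 0" using N[of x] by simp
    then show ?thesis by simp
  next
    case False
    with N0 have "N > 0" by simp
    then have "N ^ 3 \<le> 4 * (LINT z|lborel. \<bar>H z\<bar>) * sq h"
      using \<open>N * N ^ 3 \<le> _\<close> by simp
    then show ?thesis using \<open>\<bar>H x\<bar> ^ 3 \<le> N ^ 3\<close> by linarith
  qed
qed

subsection \<open>Lebesgue norms\<close>

lemma Lp_norm_cong_AE:
  assumes "AE x in lborel. f x = g x" "f \<in> borel_measurable borel" "g \<in> borel_measurable borel"
  shows "Lp_norm p f = Lp_norm p g"
proof -
  have [measurable]: "f \<in> borel_measurable borel" "g \<in> borel_measurable borel" by fact+
  have "(\<integral>\<^sup>+ x. ennreal (\<bar>f x\<bar> powr q) \<partial>lborel) = (\<integral>\<^sup>+ x. ennreal (\<bar>g x\<bar> powr q) \<partial>lborel)" for q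
    by (rule nn_integral_cong_AE) (use assms(1) in auto)
  moreover have "esssup lborel (\<lambda>x. ennreal \<bar>f x\<bar>) = esssup lborel (\<lambda>x. ennreal \<bar>g x\<bar>)"
    by (rule esssup_AE_cong) (use assms(1) in auto)
  ultimately show ?thesis by (simp add: Lp_norm_def)
qed

lemma in_Lp_measurable: "in_Lp p f \<Longrightarrow> f \<in> borel_measurable borel"
  by (auto simp: in_Lp_def Lp_norm_def split: if_splits)

lemma in_Lp_2_iff: "in_Lp 2 f \<longleftrightarrow> L2 f"
proof -
  have "(\<integral>\<^sup>+ x. ennreal (\<bar>f x\<bar> powr 2) \<partial>lborel) \<noteq> \<infinity> \<longleftrightarrow> integrable lborel (\<lambda>x. (f x)\<^sup>2)"
    if "f \<in> borel_measurable borel"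
    using that by (subst integrable_iff_bounded) (auto simp: powr_numeral less_top)
  then show ?thesis
    by (auto simp: in_Lp_def Lp_norm_def L2_def Let_def less_top[symmetric])
qed

lemma Lp_norm_2:
  assumes "L2 f" shows "Lp_norm 2 f = ennreal (sqrt (sq f))"
proof -
  have 1: "(\<integral>\<^sup>+ x. ennreal ((f x)\<^sup>2) \<partial>lborel) = ennreal (sq f)"
    using assms by (auto simp: L2_def sq_def nn_integral_eq_integral)
  have "enn2real (1 / 2) = enn2real (ennreal 1 / ennreal 2)" by simp
  also have "\<dots> = enn2real (ennreal (1 / 2))" by (subst divide_ennreal) auto
  also have "\<dots> = 1 / 2" by (rule enn2real_ennreal) simp
  finally have 2: "enn2real (1 / 2) = 1 / 2" .
  show ?thesis
    using assms by (simp add: Lp_norm_def L2_def Let_def powr_numeral 1 2 powr_half_sqrt)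
qed

lemma in_Lp_1_iff: "in_Lp 1 f \<longleftrightarrow> integrable lborel f"
proof -
  have "(\<integral>\<^sup>+ x. ennreal (\<bar>f x\<bar> powr 1) \<partial>lborel) \<noteq> \<infinity> \<longleftrightarrow> integrable lborel f"
    if "f \<in> borel_measurable borel"
    using that by (subst integrable_iff_bounded) (auto simp: less_top)
  then show ?thesis
    by (auto simp: in_Lp_def Lp_norm_def Let_def less_top[symmetric])
qed

lemma Lp_norm_1:
  assumes "integrable lborel f" shows "Lp_norm 1 f = ennreal (LINT x|lborel. \<bar>f x\<bar>)"
proof -
  have 1: "(\<integral>\<^sup>+ x. ennreal (\<bar>f x\<bar> powr 1) \<partial>lborel) = ennreal (LINT x|lborel. \<bar>f x\<bar>)"
    using assms by (simp add: nn_integral_eq_integral)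
  have 2: "enn2real (1 / 1) = 1" by simp
  have "f \<in> borel_measurable lborel" using assms by (rule borel_measurable_integrable)
  then show ?thesis
    using 1 by (simp add: Lp_norm_def Let_def)
qed

text \<open>\<open>Lp_norm\<close> is infinite for functions outside the space, so a norm that tends
  to 0 also yields eventual membership.\<close>

lemma Lp_norm_2_tendsto_0:
  assumes "((\<lambda>s. Lp_norm 2 (f s)) \<longlongrightarrow> 0) A"
  shows "eventually (\<lambda>s. L2 (f s)) A" "((\<lambda>s. sq (f s)) \<longlongrightarrow> 0) A"
proof -
  have "eventually (\<lambda>s. Lp_norm 2 (f s) < 1) A"
    using assms by (rule order_tendstoD) simp
  then show e: "eventually (\<lambda>s. L2 (f s)) A"
    by eventually_elim (auto simp flip: in_Lp_2_iff simp: in_Lp_def intro: less_trans)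
  have "((\<lambda>s. ennreal (sqrt (sq (f s)))) \<longlongrightarrow> 0) A"
    by (rule Lim_transform_eventually[OF assms])
       (use e in \<open>auto elim!: eventually_mono simp: Lp_norm_2\<close>)
  then have "((\<lambda>s. ennreal (sqrt (sq (f s)))) \<longlongrightarrow> ennreal 0) A" by simp
  then have "((\<lambda>s. sqrt (sq (f s))) \<longlongrightarrow> 0) A"
    by (subst (asm) tendsto_ennreal_iff) auto
  then have "((\<lambda>s. (sqrt (sq (f s)))\<^sup>2) \<longlongrightarrow> 0\<^sup>2) A" by (intro tendsto_intros)
  then show "((\<lambda>s. sq (f s)) \<longlongrightarrow> 0) A" by simp
qed

lemma Lp_norm_1_tendsto_0:
  assumes "((\<lambda>s. Lp_norm 1 (f s)) \<longlongrightarrow> 0) A"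
  shows "eventually (\<lambda>s. integrable lborel (f s)) A" "((\<lambda>s. LINT x|lborel. \<bar>f s x\<bar>) \<longlongrightarrow> 0) A"
proof -
  have "eventually (\<lambda>s. Lp_norm 1 (f s) < 1) A"
    using assms by (rule order_tendstoD) simp
  then show e: "eventually (\<lambda>s. integrable lborel (f s)) A"
    by eventually_elim (auto simp flip: in_Lp_1_iff simp: in_Lp_def intro: less_trans)
  have "((\<lambda>s. ennreal (LINT x|lborel. \<bar>f s x\<bar>)) \<longlongrightarrow> 0) A"
    by (rule Lim_transform_eventually[OF assms])
       (use e in \<open>auto elim!: eventually_mono simp: Lp_norm_1\<close>)
  then have "((\<lambda>s. ennreal (LINT x|lborel. \<bar>f s x\<bar>)) \<longlongrightarrow> ennreal 0) A" by simp
  then show "((\<lambda>s. LINT x|lborel. \<bar>f s x\<bar>) \<longlongrightarrow> 0) A"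
    by (subst (asm) tendsto_ennreal_iff) auto
qed

section \<open>The solution expressed by continuous representatives\<close>

text \<open>Interface between the weak formulation and the analysis: functions defined at every
  point, with space derivatives expressed by \<open>prim\<close> and time regularity by
  \<open>sq\<close>. The equation is stated as the flux being a primitive of the time derivative.
  The value 0 at nonpositive times makes the functions measurable on the whole plane; the initial
  value enters through the limit \<open>v_initial\<close>.\<close>

locale flow =
  fixes b b' :: "real \<Rightarrow> real" and d \<beta> B :: real and u0 :: "real \<Rightarrow> real"
    and v vx vxx vt :: "real \<Rightarrow> real \<Rightarrow> real"
  assumes b_deriv: "\<And>x. (b has_real_derivative b' x) (at x)"
    and b'_cont: "continuous_on UNIV b'"
    and b_int: "integrable lborel b"
    and b_bound: "\<And>x. \<bar>b x\<bar> \<le> \<beta>" and \<beta>_less: "\<beta> < 1"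
    and b'_bound: "\<And>x. \<bar>b' x\<bar> \<le> B"
    and u0_int: "integrable lborel u0" and u0_L2: "L2 u0"
    and u0_moment: "integrable lborel (\<lambda>x. \<bar>u0 x\<bar> * (1 + \<bar>x\<bar>))"
    and v_prim: "\<And>t. 0 < t \<Longrightarrow> prim (v t) (vx t)"
    and vx_prim: "\<And>t. 0 < t \<Longrightarrow> prim (vx t) (vxx t)"
    and v_int: "\<And>t. 0 < t \<Longrightarrow> integrable lborel (v t)"
    and v_L2: "\<And>t. 0 < t \<Longrightarrow> L2 (v t)" and vx_L2: "\<And>t. 0 < t \<Longrightarrow> L2 (vx t)"
    and vxx_L2: "\<And>t. 0 < t \<Longrightarrow> L2 (vxx t)" and vt_L2: "\<And>t. 0 < t \<Longrightarrow> L2 (vt t)"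
    and v_cont: "\<And>t. 0 < t \<Longrightarrow> ((\<lambda>s. sq (\<lambda>x. v s x - v t x)) \<longlongrightarrow> 0) (at t)"
    and vx_cont: "\<And>t. 0 < t \<Longrightarrow> ((\<lambda>s. sq (\<lambda>x. vx s x - vx t x)) \<longlongrightarrow> 0) (at t)"
    and vxx_cont: "\<And>t. 0 < t \<Longrightarrow> ((\<lambda>s. sq (\<lambda>x. vxx s x - vxx t x)) \<longlongrightarrow> 0) (at t)"
    and v_deriv: "\<And>t. 0 < t \<Longrightarrow> ((\<lambda>s. sq (\<lambda>x. (v s x - v t x) / (s - t) - vt t x)) \<longlongrightarrow> 0) (at t)"
    and v_initial: "((\<lambda>s. LINT x|lborel. \<bar>v s x - u0 x\<bar>) \<longlongrightarrow> 0) (at_right 0)"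
    and v_eq: "\<And>t. 0 < t \<Longrightarrow> prim (\<lambda>x. (1 + b x) * vx t x + d * v t x ^ 3) (vt t)"
    and v_nonpos: "\<And>t x. t \<le> 0 \<Longrightarrow> v t x = 0" and vx_nonpos: "\<And>t x. t \<le> 0 \<Longrightarrow> vx t x = 0"

lemma has_weak_deriv_measurable:
  "has_weak_deriv f g \<Longrightarrow> f \<in> borel_measurable borel" "has_weak_deriv f g \<Longrightarrow> g \<in> borel_measurable borel"
  by (auto simp: has_weak_deriv_def locally_L1_measurable)

lemma in_Lp_cong_AE:
  assumes "AE x in lborel. f x = g x" "f \<in> borel_measurable borel" "g \<in> borel_measurable borel"
  shows "in_Lp p f \<longleftrightarrow> in_Lp p g"
  using Lp_norm_cong_AE[OF assms] by (simp add: in_Lp_def)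

text \<open>A single predicate for the three functions, so that one application of choice makes all
  of them depend on time.\<close>

definition W22_rep :: "(real \<Rightarrow> real) \<Rightarrow> (real \<Rightarrow> real) \<Rightarrow> (real \<Rightarrow> real) \<Rightarrow> (real \<Rightarrow> real) \<Rightarrow> bool" where
  "W22_rep f V Vx Vxx \<longleftrightarrow> prim V Vx \<and> prim Vx Vxx \<and> L2 V \<and> L2 Vx \<and> L2 Vxx \<and> (AE x in lborel. f x = V x)
    \<and> has_weak_deriv f Vx \<and> f \<in> borel_measurable borel"

lemma W2p_representative:
  assumes "in_W2p 2 f"
  shows "\<exists>V Vx Vxx. W22_rep f V Vx Vxx"
proof -
  obtain g h where g: "has_weak_deriv f g" "in_Lp 2 g" and h: "has_weak_deriv g h" "in_Lp 2 h" and f: "in_Lp 2 f"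
    using assms by (auto simp: in_W2p_def)
  obtain V0 where V0: "prim V0 g" "AE x in lborel. f x = V0 x"
    using g(1) by (auto simp: has_weak_deriv_iff_prim)
  obtain Vx where Vx: "prim Vx h" "AE x in lborel. g x = Vx x"
    using h(1) by (auto simp: has_weak_deriv_iff_prim)
  have V: "prim V0 Vx" by (rule prim_cong_density[OF V0(1) Vx(2) prim_measurable[OF Vx(1)]])
  have "L2 V0" using in_Lp_cong_AE[OF V0(2) in_Lp_measurable[OF f] prim_measurable[OF V0(1)], of 2] f
    by (simp add: in_Lp_2_iff)
  moreover have "L2 Vx" using in_Lp_cong_AE[OF Vx(2) in_Lp_measurable[OF g(2)] prim_measurable[OF Vx(1)], of 2] g
    by (simp add: in_Lp_2_iff)
  moreover have "L2 h" using h by (simp add: in_Lp_2_iff)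
  moreover have "has_weak_deriv f Vx"
    using V V0(2) in_Lp_measurable[OF f] by (auto simp: has_weak_deriv_iff_prim)
  ultimately have "W22_rep f V0 Vx h" using V Vx V0 in_Lp_measurable[OF f] by (simp add: W22_rep_def)
  then show ?thesis by blast
qed

lemma tendsto_0_le_ennreal:
  fixes f g :: "'a \<Rightarrow> ennreal"
  assumes "(g \<longlongrightarrow> 0) A" "\<And>s. f s \<le> g s"
  shows "(f \<longlongrightarrow> 0) A"
  by (rule tendsto_sandwich[of "\<lambda>_. 0" f A g]) (use assms in auto)

text \<open>Continuity in the Sobolev norm with exponent 2 splits into three L2 limits for the
  representative and its two derivatives; continuity in L1 at time 0 gives the initial limit. The
  essential bound on \<open>b\<close> becomes pointwise because \<open>b\<close> is
  continuous.\<close>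

lemma solution_flow:
  assumes sa: "standing_assumptions a b" and u0w: "in_weighted_L1 u0" and u0inf: "in_Lp \<infinity> u0"
    and sol: "is_solution a d u0 u"
  shows "\<exists>b' \<beta> B v vx vxx vt. flow b b' d \<beta> B u0 v vx vxx vt \<and>
    (\<forall>t>0. u t \<in> borel_measurable borel \<and> (AE x in lborel. u t x = v t x) \<and>
       weak_deriv (u t) \<in> borel_measurable borel \<and> (AE x in lborel. weak_deriv (u t) x = vx t x))"
proof -
  from sa obtain \<alpha> where \<alpha>: "0 < \<alpha>" "in_C1_Hoelder \<alpha> b" and a: "\<And>x. a x = 1 + b x" and b1: "in_Lp 1 b"
    and binf: "Lp_norm \<infinity> b < 1"
    unfolding standing_assumptions_def by blast
  define b' where "b' = deriv b"
  have kernel_majorant: "(b has_real_derivative b' x) (at x)" for x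
    using \<alpha>(2) unfolding b'_def in_C1_Hoelder_def by (intro deriv_at) auto
  obtain H where H: "\<And>x y. \<bar>b' x - b' y\<bar> \<le> H * \<bar>x - y\<bar> powr \<alpha>"
    using \<alpha>(2) unfolding b'_def in_C1_Hoelder_def by blast
  have b'c: "continuous_on UNIV b'"
  proof (rule continuous_at_imp_continuous_on, intro ballI)
    fix x
    have "((\<lambda>y. \<bar>y - x\<bar> powr \<alpha>) \<longlongrightarrow> \<bar>x - x\<bar> powr \<alpha>) (at x)"
      using \<alpha>(1) by (intro tendsto_powr' tendsto_intros) auto
    then have "((\<lambda>y. H * \<bar>y - x\<bar> powr \<alpha>) \<longlongrightarrow> H * 0) (at x)" by (intro tendsto_intros) (use \<alpha> in simp)
    then have "((\<lambda>y. b' y - b' x) \<longlongrightarrow> 0) (at x)"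
      by (intro Lim_null_comparison[of "\<lambda>y. b' y - b' x" "\<lambda>y. H * \<bar>y - x\<bar> powr \<alpha>"]) (use H in auto)
    then show "isCont b' x" unfolding isCont_def by (rule LIM_zero_cancel)
  qed
  obtain B where B: "\<And>x. \<bar>b' x\<bar> \<le> B"
    using \<alpha>(2) unfolding b'_def in_C1_Hoelder_def bounded_iff by auto
  have bc: "continuous_on UNIV b" using kernel_majorant by (meson DERIV_isCont continuous_at_imp_continuous_on)
  have bvx_mass [measurable]: "b \<in> borel_measurable borel" using bc by (rule borel_measurable_continuous_onI)
  obtain \<beta> where \<beta>: "\<beta> < 1" "\<And>x. \<bar>b x\<bar> \<le> \<beta>"
  proof -
    define e where "e = esssup lborel (\<lambda>x. ennreal \<bar>b x\<bar>)"
    have e1: "e < 1" using binf by (simp add: Lp_norm_def e_def)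
    then have "e \<noteq> \<infinity>" by auto
    then obtain \<beta> where \<beta>: "e = ennreal \<beta>" "0 \<le> \<beta>" by (cases e) auto
    have "AE x in lborel. ennreal \<bar>b x\<bar> \<le> e" unfolding e_def by (rule esssup_AE)
    then have "AE x in lborel. \<bar>b x\<bar> \<le> \<beta>" by eventually_elim (use \<beta> in simp)
    then have "\<bar>b x\<bar> \<le> \<beta>" for x
      by (rule AE_continuous_le) (use bc in \<open>auto intro!: continuous_intros\<close>)
    moreover have "\<beta> < 1" using e1 \<beta> by (simp add: ennreal_less_one_iff)
    ultimately show ?thesis using that by blast
  qed
  have u0i: "integrable lborel u0" and u0m: "integrable lborel (\<lambda>x. \<bar>u0 x\<bar> * (1 + \<bar>x\<bar>))"
    using u0w by (auto simp: in_weighted_L1_def in_Lp_1_iff)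
  have [measurable]: "u0 \<in> borel_measurable borel" using u0i by auto
  have u0L2: "L2 u0"
  proof -
    define e where "e = esssup lborel (\<lambda>x. ennreal \<bar>u0 x\<bar>)"
    have "e < \<infinity>" using u0inf by (simp add: in_Lp_def Lp_norm_def e_def)
    then obtain c where c: "e = ennreal c" "0 \<le> c" by (cases e) auto
    have "AE x in lborel. ennreal \<bar>u0 x\<bar> \<le> e" unfolding e_def by (rule esssup_AE)
    then have "AE x in lborel. norm ((u0 x)\<^sup>2) \<le> norm (c * \<bar>u0 x\<bar>)"
    proof eventually_elim
      case (elim x)
      then have "\<bar>u0 x\<bar> \<le> c" using c by simp
      then show ?case using mult_right_mono[of "\<bar>u0 x\<bar>" c "\<bar>u0 x\<bar>"] c by (simp add: power2_eq_square abs_mult)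
    qed
    then have "integrable lborel (\<lambda>x. (u0 x)\<^sup>2)"
      by (rule Bochner_Integration.integrable_bound[rotated 2]) (use u0i in auto)
    then show ?thesis by (simp add: L2_def)
  qed
  have two: "1 < (2::ennreal)" "(2::ennreal) < \<infinity>" by auto
  note S = sol[unfolded is_solution_def]
  have W: "\<And>t. 0 < t \<Longrightarrow> in_W2p 2 (u t)" and Wc: "norm_continuous_on (W2p_norm 2) {0<..} u"
    using S two by blast+
  have ui: "\<And>t. 0 \<le> t \<Longrightarrow> integrable lborel (u t)" using S by (auto simp: in_Lp_1_iff)
  have uc: "norm_continuous_on (Lp_norm 1) {0..} u" using S by blast
  have ui0: "AE x in lborel. u 0 x = u0 x" using S by blast
  obtain ut where "\<And>p. 1 < p \<and> p < \<infinity> \<Longrightarrow> (\<forall>t>0. in_Lp p (ut t)) \<and> norm_has_deriv_on (Lp_norm p) {0<..} u ut"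
    and ute: "\<And>t. 0 < t \<Longrightarrow> AE x in lborel. ut t x - weak_deriv (\<lambda>y. a y * weak_deriv (u t) y) x
             = d * weak_deriv (\<lambda>y. \<bar>u t y\<bar>\<^sup>2 * u t y) x"
    using S by blast
  with two have utL: "\<And>t. 0 < t \<Longrightarrow> in_Lp 2 (ut t)" and utd: "norm_has_deriv_on (Lp_norm 2) {0<..} u ut" by blast+
  \<comment> \<open>The zero triple is prescribed for t \<le> 0, so that the choice also delivers
    the convention at nonpositive times.\<close>
  have "\<forall>t. \<exists>T. (0 < t \<longrightarrow> W22_rep (u t) (fst T) (fst (snd T)) (snd (snd T)))
      \<and> (t \<le> 0 \<longrightarrow> T = ((\<lambda>x. 0), (\<lambda>x. 0), (\<lambda>x. 0)))"
  proof
    fix t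
    show "\<exists>T. (0 < t \<longrightarrow> W22_rep (u t) (fst T) (fst (snd T)) (snd (snd T)))
      \<and> (t \<le> 0 \<longrightarrow> T = ((\<lambda>x. 0), (\<lambda>x. 0), (\<lambda>x. 0)))"
    proof (cases "0 < t")
      case True
      then obtain V Vx Vxx where "W22_rep (u t) V Vx Vxx" using W2p_representative[OF W] by blast
      then show ?thesis using True by (intro exI[of _ "(V, Vx, Vxx)"]) simp
    qed auto
  qed
  from choice[OF this] obtain T
    where T: "\<And>t. 0 < t \<Longrightarrow> W22_rep (u t) (fst (T t)) (fst (snd (T t))) (snd (snd (T t)))"
      and T0: "\<And>t. t \<le> 0 \<Longrightarrow> T t = ((\<lambda>x. 0), (\<lambda>x. 0), (\<lambda>x. 0))" by blast
  define v vx vxx where "v = (\<lambda>t. fst (T t))" and "vx = (\<lambda>t. fst (snd (T t)))" and "vxx = (\<lambda>t. snd (snd (T t)))"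
  have V: "prim (v t) (vx t) \<and> prim (vx t) (vxx t) \<and> L2 (v t) \<and> L2 (vx t)
     \<and> L2 (vxx t) \<and> (AE x in lborel. u t x = v t x)
    \<and> has_weak_deriv (u t) (vx t) \<and> u t \<in> borel_measurable borel" if "0 < t" for t
    using T[OF that] unfolding W22_rep_def v_def vx_def vxx_def by simp
  have v0: "v t x = 0" "vx t x = 0" if "t \<le> 0" for t x
    using T0[OF that] by (simp_all add: v_def vx_def)
  have wd: "has_weak_deriv (u t) (weak_deriv (u t))" "AE x in lborel. weak_deriv (u t) x = vx t x" if "0 < t" for t
    using weak_deriv_AE[of "u t" "vx t"] V[OF that] by auto
  have [measurable]: "v t \<in> borel_measurable borel" "vx t \<in> borel_measurable borel" "vxx t \<in> borel_measurable borel"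
     "u t \<in> borel_measurable borel" "weak_deriv (u t) \<in> borel_measurable borel" "ut t \<in> borel_measurable borel"
     if "0 < t" for t
    using V[OF that] L2_measurable has_weak_deriv_measurable(2)[OF wd(1)[OF that]] in_Lp_measurable[OF utL[OF that]] by blast+
  have at: "at t within {0<..} = at t" if "0 < t" for t :: real by (rule at_within_open) (use that in auto)
  have ev: "\<forall>\<^sub>F s in at t. 0 < s" if "0 < t" for t :: real
    using that by (auto simp: eventually_at dist_real_def intro!: exI[of _ t])
  have parts: "((\<lambda>s. sq (\<lambda>x. v s x - v t x)) \<longlongrightarrow> 0) (at t) \<and> ((\<lambda>s. sq (\<lambda>x. vx s x - vx t x)) \<longlongrightarrow> 0) (at t)
      \<and> ((\<lambda>s. sq (\<lambda>x. vxx s x - vxx t x)) \<longlongrightarrow> 0) (at t)" if t: "0 < t" for t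
  proof -
    have "((\<lambda>s. W2p_norm 2 (\<lambda>x. u s x - u t x)) \<longlongrightarrow> 0) (at t within {0<..})"
      using Wc t unfolding norm_continuous_on_def by blast
    then have lim: "((\<lambda>s. W2p_norm 2 (\<lambda>x. u s x - u t x)) \<longlongrightarrow> 0) (at t)"
      by (simp only: at[OF t])
    \<comment> \<open>The weak derivative of a difference is a fresh choice. Uniqueness almost
      everywhere identifies it with the difference of the densities, which is enough for equality of
      the norms.\<close>
    have eq: "Lp_norm 2 (\<lambda>x. u s x - u t x) = Lp_norm 2 (\<lambda>x. v s x - v t x)"
       "Lp_norm 2 (weak_deriv (\<lambda>x. u s x - u t x)) = Lp_norm 2 (\<lambda>x. vx s x - vx t x)"
       "Lp_norm 2 (weak_deriv (weak_deriv (\<lambda>x. u s x - u t x))) = Lp_norm 2 (\<lambda>x. vxx s x - vxx t x)" if s: "0 < s" for s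
    proof -
      note [measurable] = \<open>\<And>t. 0 < t \<Longrightarrow> v t \<in> borel_measurable borel\<close>[OF s] \<open>\<And>t. 0 < t \<Longrightarrow> v t \<in> borel_measurable borel\<close>[OF t]
       \<open>\<And>t. 0 < t \<Longrightarrow> vx t \<in> borel_measurable borel\<close>[OF s] \<open>\<And>t. 0 < t \<Longrightarrow> vx t \<in> borel_measurable borel\<close>[OF t]
       \<open>\<And>t. 0 < t \<Longrightarrow> vxx t \<in> borel_measurable borel\<close>[OF s] \<open>\<And>t. 0 < t \<Longrightarrow> vxx t \<in> borel_measurable borel\<close>[OF t]
       \<open>\<And>t. 0 < t \<Longrightarrow> u t \<in> borel_measurable borel\<close>[OF s] \<open>\<And>t. 0 < t \<Longrightarrow> u t \<in> borel_measurable borel\<close>[OF t]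
      have 1: "AE x in lborel. u s x - u t x = v s x - v t x"
      proof -
        have "AE x in lborel. u s x = v s x" "AE x in lborel. u t x = v t x" using V s t by auto
        then show ?thesis by eventually_elim auto
      qed
      then show "Lp_norm 2 (\<lambda>x. u s x - u t x) = Lp_norm 2 (\<lambda>x. v s x - v t x)"
        by (rule Lp_norm_cong_AE) auto
      have "prim (\<lambda>x. v s x - v t x) (\<lambda>x. vx s x - vx t x)" using V s t by (intro prim_diff) auto
      then have w: "has_weak_deriv (\<lambda>x. u s x - u t x) (\<lambda>x. vx s x - vx t x)"
        using 1 by (auto simp: has_weak_deriv_iff_prim)
      note w' = weak_deriv_AE[OF w]
      note [measurable] = has_weak_deriv_measurable(2)[OF w'(1)]
      show "Lp_norm 2 (weak_deriv (\<lambda>x. u s x - u t x)) = Lp_norm 2 (\<lambda>x. vx s x - vx t x)"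
        by (rule Lp_norm_cong_AE[OF w'(2)]) auto
      have "prim (\<lambda>x. vx s x - vx t x) (\<lambda>x. vxx s x - vxx t x)" using V s t by (intro prim_diff) auto
      then have w2: "has_weak_deriv (weak_deriv (\<lambda>x. u s x - u t x)) (\<lambda>x. vxx s x - vxx t x)"
        using w'(2) by (auto simp: has_weak_deriv_iff_prim)
      note w2' = weak_deriv_AE[OF w2]
      note [measurable] = has_weak_deriv_measurable(2)[OF w2'(1)]
      show "Lp_norm 2 (weak_deriv (weak_deriv (\<lambda>x. u s x - u t x))) = Lp_norm 2 (\<lambda>x. vxx s x - vxx t x)"
        by (rule Lp_norm_cong_AE[OF w2'(2)]) auto
    qed
    have "((\<lambda>s. Lp_norm 2 (\<lambda>x. v s x - v t x)) \<longlongrightarrow> 0) (at t)"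
      by (rule Lim_transform_eventually[OF tendsto_0_le_ennreal[OF lim, of "\<lambda>s. Lp_norm 2 (\<lambda>x. u s x - u t x)"]])
         (use ev[OF t] in \<open>auto simp: W2p_norm_def add.assoc intro!: add_increasing2 elim!: eventually_mono dest: eq\<close>)
    moreover have "((\<lambda>s. Lp_norm 2 (\<lambda>x. vx s x - vx t x)) \<longlongrightarrow> 0) (at t)"
      by (rule Lim_transform_eventually[OF tendsto_0_le_ennreal[OF lim, of "\<lambda>s. Lp_norm 2 (weak_deriv (\<lambda>x. u s x - u t x))"]])
         (use ev[OF t] in \<open>auto simp: W2p_norm_def intro!: add_increasing2 add_increasing elim!: eventually_mono dest: eq\<close>)
    moreover have "((\<lambda>s. Lp_norm 2 (\<lambda>x. vxx s x - vxx t x)) \<longlongrightarrow> 0) (at t)"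
      by (rule Lim_transform_eventually[OF tendsto_0_le_ennreal[OF lim, of "\<lambda>s. Lp_norm 2 (weak_deriv (weak_deriv (\<lambda>x. u s x - u t x)))"]])
         (use ev[OF t] in \<open>auto simp: W2p_norm_def intro!: add_increasing elim!: eventually_mono dest: eq\<close>)
    ultimately show ?thesis by (intro conjI Lp_norm_2_tendsto_0(2))
  qed
  have vtd: "((\<lambda>s. sq (\<lambda>x. (v s x - v t x) / (s - t) - ut t x)) \<longlongrightarrow> 0) (at t)" if t: "0 < t" for t
  proof (rule Lp_norm_2_tendsto_0(2), rule Lim_transform_eventually)
    have "((\<lambda>s. Lp_norm 2 (\<lambda>x. (u s x - u t x) / (s - t) - ut t x)) \<longlongrightarrow> 0) (at t within {0<..})"
      using utd t unfolding norm_has_deriv_on_def by blast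
    then show "((\<lambda>s. Lp_norm 2 (\<lambda>x. (u s x - u t x) / (s - t) - ut t x)) \<longlongrightarrow> 0) (at t)"
      by (simp only: at[OF t])
    show "\<forall>\<^sub>F s in at t. Lp_norm 2 (\<lambda>x. (u s x - u t x) / (s - t) - ut t x) = Lp_norm 2 (\<lambda>x. (v s x - v t x) / (s - t) - ut t x)"
      using ev[OF t]
    proof eventually_elim
      case (elim s)
      note [measurable] = \<open>\<And>t. 0 < t \<Longrightarrow> v t \<in> borel_measurable borel\<close>[OF elim] \<open>\<And>t. 0 < t \<Longrightarrow> v t \<in> borel_measurable borel\<close>[OF t]
       \<open>\<And>t. 0 < t \<Longrightarrow> u t \<in> borel_measurable borel\<close>[OF elim] \<open>\<And>t. 0 < t \<Longrightarrow> u t \<in> borel_measurable borel\<close>[OF t]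
       \<open>\<And>t. 0 < t \<Longrightarrow> ut t \<in> borel_measurable borel\<close>[OF t]
      have "AE x in lborel. u s x = v s x" "AE x in lborel. u t x = v t x" using V elim t by auto
      then have "AE x in lborel. (u s x - u t x) / (s - t) - ut t x = (v s x - v t x) / (s - t) - ut t x"
        by eventually_elim auto
      then show ?case by (rule Lp_norm_cong_AE) auto
    qed
  qed
  have vint: "integrable lborel (v t)" if "0 < t" for t
    using integrable_cong_AE[of "u t" lborel "v t"] ui[of t] V[OF that] that L2_measurable[of "v t"] by auto
  have init: "((\<lambda>s. LINT x|lborel. \<bar>v s x - u0 x\<bar>) \<longlongrightarrow> 0) (at_right 0)"
  proof -
    have "((\<lambda>s. Lp_norm 1 (\<lambda>x. u s x - u 0 x)) \<longlongrightarrow> 0) (at 0 within {0..})"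
      using uc by (auto simp: norm_continuous_on_def)
    then have "((\<lambda>s. Lp_norm 1 (\<lambda>x. u s x - u 0 x)) \<longlongrightarrow> 0) (at_right 0)"
      by (rule tendsto_within_subset) auto
    from Lp_norm_1_tendsto_0(2)[OF this]
    show ?thesis
    proof (rule Lim_transform_eventually)
      show "\<forall>\<^sub>F s in at_right 0. (LINT x|lborel. \<bar>u s x - u 0 x\<bar>) = (LINT x|lborel. \<bar>v s x - u0 x\<bar>)"
        using eventually_at_right_less[of 0]
      proof eventually_elim
        case (elim s)
        note [measurable] = \<open>\<And>t. 0 < t \<Longrightarrow> v t \<in> borel_measurable borel\<close>[OF elim]
          \<open>\<And>t. 0 < t \<Longrightarrow> u t \<in> borel_measurable borel\<close>[OF elim] borel_measurable_integrable[OF ui[OF order_refl]]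
        have "AE x in lborel. u s x = v s x" using V elim by auto
        with ui0 have "AE x in lborel. \<bar>u s x - u 0 x\<bar> = \<bar>v s x - u0 x\<bar>" by eventually_elim auto
        then show ?case by (intro integral_cong_AE) auto
      qed
    qed
  qed
  have eqn: "prim (\<lambda>x. (1 + b x) * vx t x + d * v t x ^ 3) (ut t)" if t: "0 < t" for t
  proof -
    note [measurable] = \<open>\<And>t. 0 < t \<Longrightarrow> weak_deriv (u t) \<in> borel_measurable borel\<close>[OF t]
       \<open>\<And>t. 0 < t \<Longrightarrow> u t \<in> borel_measurable borel\<close>[OF t] \<open>\<And>t. 0 < t \<Longrightarrow> ut t \<in> borel_measurable borel\<close>[OF t]
    have "prim (\<lambda>x. 1 + b x) b'"
      by (rule prim_C1) (use kernel_majorant b'c in \<open>auto intro!: derivative_eq_intros\<close>)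
    from prim_mult[OF this, of "vx t" "vxx t"] V[OF t]
    have q: "prim (\<lambda>x. (1 + b x) * vx t x) (\<lambda>x. b' x * vx t x + (1 + b x) * vxx t x)" by simp
    have "AE x in lborel. a x * weak_deriv (u t) x = (1 + b x) * vx t x"
      using wd(2)[OF t] by eventually_elim (simp add: a)
    moreover have "(\<lambda>x. a x * weak_deriv (u t) x) \<in> borel_measurable borel" unfolding a by measurable
    ultimately have wq: "has_weak_deriv (\<lambda>y. a y * weak_deriv (u t) y) (\<lambda>x. b' x * vx t x + (1 + b x) * vxx t x)"
      using q unfolding has_weak_deriv_iff_prim by blast
    have "prim (v t) (vx t)" using V[OF t] by simp
    from prim_mult[OF prim_mult[OF this this] this]
    have r: "prim (\<lambda>x. v t x ^ 3) (\<lambda>x. (vx t x * v t x + v t x * vx t x) * v t x + v t x * v t x * vx t x)" (is "prim _ ?r")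
      by (simp add: power3_eq_cube)
    have "AE x in lborel. u t x = v t x" using V[OF t] by simp
    then have "AE x in lborel. \<bar>u t x\<bar>\<^sup>2 * u t x = v t x ^ 3"
      by eventually_elim (simp add: power2_eq_square power3_eq_cube)
    then have wr: "has_weak_deriv (\<lambda>y. \<bar>u t y\<bar>\<^sup>2 * u t y) ?r"
      using r unfolding has_weak_deriv_iff_prim by (intro conjI exI[of _ "\<lambda>x. v t x ^ 3"]) auto
    \<comment> \<open>The product rule computes the two weak derivatives of the equation explicitly.
      Their combination equals the time derivative almost everywhere, so the density may be
      exchanged.\<close>
    have P: "prim (\<lambda>x. (1 + b x) * vx t x + d * v t x ^ 3) (\<lambda>x. (b' x * vx t x + (1 + b x) * vxx t x) + d * ?r x)"
      by (rule prim_add[OF q prim_cmult[OF r]])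
    have "AE x in lborel. (b' x * vx t x + (1 + b x) * vxx t x) + d * ?r x = ut t x"
      using ute[OF t] weak_deriv_AE(2)[OF wq] weak_deriv_AE(2)[OF wr]
      by eventually_elim auto
    then show ?thesis by (rule prim_cong_density[OF P]) auto
  qed
  have "flow b b' d \<beta> B u0 v vx vxx ut"
    by unfold_locales
      (use kernel_majorant b'c b1 \<beta> B u0i u0L2 u0m V vint parts vtd init eqn utL v0 in \<open>auto simp: in_Lp_1_iff in_Lp_2_iff\<close>)
  moreover have "\<forall>t>0. u t \<in> borel_measurable borel \<and> (AE x in lborel. u t x = v t x) \<and>
       weak_deriv (u t) \<in> borel_measurable borel \<and> (AE x in lborel. weak_deriv (u t) x = vx t x)"
    using V wd has_weak_deriv_measurable(2)[OF wd(1)] by auto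
  ultimately show ?thesis by blast
qed

subsection \<open>Decay of the solution\<close>

text \<open>The regularised modulus and its first two derivatives. The last function is the
  primitive of psi''(z) z^3 that vanishes at z = 0; composed with the solution it absorbs the
  convection term.\<close>

lemma pseudo_abs_deriv:
  fixes e z :: real
  assumes "0 < e"
  defines "r \<equiv> \<lambda>z. sqrt (e\<^sup>2 + z\<^sup>2)"
  shows "(r has_real_derivative z / r z) (at z)"
    and "((\<lambda>z. z / r z) has_real_derivative e\<^sup>2 / r z ^ 3) (at z)"
    and "((\<lambda>z. e\<^sup>2 * (r z - 2 * e + e\<^sup>2 / r z)) has_real_derivative e\<^sup>2 / r z ^ 3 * z ^ 3) (at z)"
proof -
  have p: "0 < e\<^sup>2 + z\<^sup>2" using assms(1) by (simp add: add_pos_nonneg)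
  then have r0: "0 < r z" by (simp add: r_def)
  have rr: "(r z)\<^sup>2 = e\<^sup>2 + z\<^sup>2" using p by (simp add: r_def)
  have r3: "r z ^ 3 = r z * (e\<^sup>2 + z\<^sup>2)" using rr by (simp add: power3_eq_cube power2_eq_square mult.assoc)
  show d1: "(r has_real_derivative z / r z) (at z)"
    unfolding r_def using p by (auto intro!: derivative_eq_intros simp: field_simps)
  show "((\<lambda>z. z / r z) has_real_derivative e\<^sup>2 / r z ^ 3) (at z)"
  proof -
    have "((\<lambda>z. z / r z) has_real_derivative (1 * r z - z * (z / r z)) / (r z * r z)) (at z)"
      by (intro DERIV_divide DERIV_ident d1) (use r0 in simp)
    moreover have "(1 * r z - z * (z / r z)) / (r z * r z) = e\<^sup>2 / r z ^ 3"
    proof -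
      have "(1 * r z - z * (z / r z)) = ((r z)\<^sup>2 - z\<^sup>2) / r z"
        using r0 by (simp add: field_simps power2_eq_square)
      then show ?thesis using r0 by (simp add: rr power3_eq_cube mult.assoc)
    qed
    ultimately show ?thesis by simp
  qed
  show "((\<lambda>z. e\<^sup>2 * (r z - 2 * e + e\<^sup>2 / r z)) has_real_derivative e\<^sup>2 / r z ^ 3 * z ^ 3) (at z)"
  proof -
    have "((\<lambda>z. e\<^sup>2 * (r z - 2 * e + e\<^sup>2 / r z)) has_real_derivative
       e\<^sup>2 * (z / r z - 0 + (0 * r z - e\<^sup>2 * (z / r z)) / (r z * r z))) (at z)"
      by (intro DERIV_cmult DERIV_add DERIV_diff DERIV_divide DERIV_const d1) (use r0 in simp)
    moreover have "e\<^sup>2 * (z / r z - 0 + (0 * r z - e\<^sup>2 * (z / r z)) / (r z * r z)) = e\<^sup>2 / r z ^ 3 * z ^ 3"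
    proof -
      have "z / r z - 0 + (0 * r z - e\<^sup>2 * (z / r z)) / (r z * r z) = z * ((r z)\<^sup>2 - e\<^sup>2) / r z ^ 3"
        using r0 by (simp add: field_simps power2_eq_square power3_eq_cube)
      also have "(r z)\<^sup>2 - e\<^sup>2 = z\<^sup>2" by (simp add: rr)
      finally show ?thesis by (simp add: power3_eq_cube power2_eq_square)
    qed
    ultimately show ?thesis by simp
  qed
qed

context flow
begin

lemma b_cont: "continuous_on UNIV b"
  using b_deriv by (meson DERIV_isCont continuous_at_imp_continuous_on)

lemma b_meas [measurable]: "b \<in> borel_measurable borel"
  by (rule borel_measurable_continuous_onI[OF b_cont])

lemma b'_meas [measurable]: "b' \<in> borel_measurable borel"
  by (rule borel_measurable_continuous_onI[OF b'_cont])

lemma u0_meas [measurable]: "u0 \<in> borel_measurable borel"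
  using u0_int by auto

lemma \<beta>_nonneg: "0 \<le> \<beta>" using b_bound[of 0] by linarith

lemma a_bounds: "1 - \<beta> \<le> 1 + b x" "1 + b x \<le> 1 + \<beta>" "0 < 1 + b x" "\<bar>1 + b x\<bar> \<le> 2"
  using b_bound[of x] \<beta>_less by auto

lemma v_cont_x: "0 < t \<Longrightarrow> continuous_on UNIV (v t)"
  using prim_continuous[OF v_prim] .

lemma vx_cont_x: "0 < t \<Longrightarrow> continuous_on UNIV (vx t)"
  using prim_continuous[OF vx_prim] .

lemma v_deriv_x: "0 < t \<Longrightarrow> (v t has_real_derivative vx t x) (at x)"
  using prim_has_derivative[OF v_prim vx_cont_x] .

lemma v_meas [measurable]: "0 < t \<Longrightarrow> v t \<in> borel_measurable borel"
  using L2_measurable[OF v_L2] .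

lemma vx_meas [measurable]: "0 < t \<Longrightarrow> vx t \<in> borel_measurable borel"
  using L2_measurable[OF vx_L2] .

lemma v_bounded: "0 < t \<Longrightarrow> \<exists>c\<ge>0. \<forall>x. \<bar>v t x\<bar> \<le> c"
  using prim_sup_L2[OF v_prim v_L2 vx_L2, of t]
  by (intro exI[of _ "sqrt (2 * sqrt (sq (v t) * sq (vx t)))"]) (auto intro!: real_le_rsqrt)

lemma ev_pos: "0 < t \<Longrightarrow> \<forall>\<^sub>F s in at t. 0 < (s::real)"
  by (auto simp: eventually_at dist_real_def intro!: exI[of _ t])

lemma quotient_L2:
  assumes "0 < t" shows "\<forall>\<^sub>F s in at t. L2 (\<lambda>x. (v s x - v t x) / (s - t))"
  using ev_pos[OF assms]
proof eventually_elim
  case (elim s)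
  show ?case using L2_cmult[OF L2_diff[OF v_L2[OF elim] v_L2[OF assms]], of "1 / (s - t)"] by simp
qed

lemma const_cont: "((\<lambda>s. sq (\<lambda>x. g x - g x)) \<longlongrightarrow> 0) A"
  by (simp add: sq_def)

lemma pair_quotient:
  assumes "0 < t" "((\<lambda>s. sq (\<lambda>x. g s x - g0 x)) \<longlongrightarrow> 0) (at t)" "L2 g0" "\<forall>\<^sub>F s in at t. L2 (g s)"
  shows "((\<lambda>s. (LINT x|lborel. (v s x - v t x) * g s x) / (s - t)) \<longlongrightarrow> (LINT x|lborel. vt t x * g0 x)) (at t)"
proof -
  have "((\<lambda>s. LINT x|lborel. ((v s x - v t x) / (s - t)) * g s x) \<longlongrightarrow> (LINT x|lborel. vt t x * g0 x)) (at t)"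
    by (rule tendsto_integral_mult[OF v_deriv vt_L2 quotient_L2 assms(2-4)]) fact+
  then show ?thesis by simp
qed

text \<open>The difference quotient converges in L2 while the increment itself tends to 0, so
  squared increments are of higher than first order in time.\<close>

lemma sq_diff_quotient: "0 < t \<Longrightarrow> ((\<lambda>s. sq (\<lambda>x. v s x - v t x) / (s - t)) \<longlongrightarrow> 0) (at t)"
proof -
  assume t: "0 < t"
  have "((\<lambda>s. (LINT x|lborel. (v s x - v t x) * (v s x - v t x)) / (s - t)) \<longlongrightarrow> (LINT x|lborel. vt t x * 0)) (at t)"
    using t v_cont[OF t] ev_pos[OF t]
    by (intro pair_quotient) (auto simp: L2_def[of "\<lambda>x. 0"] intro: L2_diff v_L2 elim!: eventually_mono)
  then show ?thesis by (simp add: sq_def power2_eq_square)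
qed

lemma v_cube_L2: assumes "0 < t" shows "L2 (\<lambda>x. v t x ^ 3)"
proof -
  obtain c where c: "0 \<le> c" "\<And>x. \<bar>v t x\<bar> \<le> c" using v_bounded[OF assms] by blast
  have "L2 (\<lambda>x. (v t x)\<^sup>2 * v t x)"
  proof (rule L2_mult_bounded[OF v_L2[OF assms]])
    fix x show "\<bar>(v t x)\<^sup>2\<bar> \<le> c\<^sup>2" using power_mono[OF c(2)[of x], of 2] by simp
  qed (use assms in measurable)
  then show ?thesis by (simp add: power2_eq_square power3_eq_cube)
qed

lemma flux_L2: assumes "0 < t" shows "L2 (\<lambda>x. (1 + b x) * vx t x + d * v t x ^ 3)"
  using assms by (intro L2_add L2_cmult v_cube_L2 L2_mult_bounded[where c = 2] vx_L2 a_bounds) auto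

text \<open>The equation is tested with psi'(v). The cubic flux contributes psi''(v) v^3 v_x, the
  x-derivative of \<Theta>(v), which integrates to 0; only the diffusion survives. In time, psi(v)
  is expanded to first order: the linear term converges as an L2 pairing, and the quadratic
  remainder is at most \<open>A\<close> times the squared increment.\<close>

lemma entropy_derivative:
  assumes t: "0 < t"
    and \<psi>: "\<And>z. (\<psi> has_real_derivative \<psi>' z) (at z)" "\<And>z. (\<psi>' has_real_derivative \<psi>'' z) (at z)"
    and c\<psi>: "continuous_on UNIV \<psi>''" and A: "\<And>z. \<bar>\<psi>'' z\<bar> \<le> A"
    and z: "\<psi> 0 = 0" "\<psi>' 0 = 0"
    and \<Theta>: "\<And>z. (\<Theta> has_real_derivative \<psi>'' z * z ^ 3) (at z)" "integrable lborel (\<lambda>x. \<Theta> (v t x))"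
  shows "((\<lambda>s. LINT x|lborel. \<psi> (v s x)) has_real_derivative - (LINT x|lborel. \<psi>'' (v t x) * ((1 + b x) * (vx t x)\<^sup>2))) (at t)"
proof -
  have A0: "0 \<le> A" using A[of 0] by linarith
  have lip: "\<bar>\<psi>' y - \<psi>' x\<bar> \<le> A * \<bar>y - x\<bar>" for x y
  proof -
    have "norm (\<psi>' y - \<psi>' x) \<le> A * norm (y - x)"
      by (rule field_differentiable_bound[of UNIV \<psi>' \<psi>'']) (use \<psi> A in auto)
    then show ?thesis by simp
  qed
  have taylor: "\<bar>\<psi> y - \<psi> x - (y - x) * \<psi>' x\<bar> \<le> A * (y - x)\<^sup>2" for x y
  proof -
    have "norm ((\<psi> y - \<psi>' x * y) - (\<psi> x - \<psi>' x * x)) \<le> (A * \<bar>y - x\<bar>) * norm (y - x)"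
    proof (rule field_differentiable_bound[of "closed_segment x y" _ "\<lambda>w. \<psi>' w - \<psi>' x"])
      fix w assume w: "w \<in> closed_segment x y"
      show "((\<lambda>w. \<psi> w - \<psi>' x * w) has_field_derivative \<psi>' w - \<psi>' x) (at w within closed_segment x y)"
      proof (rule has_field_derivative_at_within)
        have "((\<lambda>w. \<psi> w - \<psi>' x * w) has_field_derivative \<psi>' w - \<psi>' x * 1) (at w)"
          by (intro DERIV_diff DERIV_cmult DERIV_ident \<psi>)
        then show "((\<lambda>w. \<psi> w - \<psi>' x * w) has_field_derivative \<psi>' w - \<psi>' x) (at w)" by simp
      qed
      have "\<bar>w - x\<bar> \<le> \<bar>y - x\<bar>" using segment_bound1[OF w] by simp
      then show "norm (\<psi>' w - \<psi>' x) \<le> A * \<bar>y - x\<bar>"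
        using lip[of w x] mult_left_mono[of "\<bar>w - x\<bar>" "\<bar>y - x\<bar>" A] A0 by simp
    qed auto
    moreover have "(\<psi> y - \<psi>' x * y) - (\<psi> x - \<psi>' x * x) = \<psi> y - \<psi> x - (y - x) * \<psi>' x" by (simp add: algebra_simps)
    ultimately show ?thesis by (simp add: power2_eq_square mult.assoc)
  qed
  have c1: "continuous_on UNIV \<psi>'" "continuous_on UNIV \<psi>"
    using \<psi> by (meson DERIV_isCont continuous_at_imp_continuous_on)+
  note [measurable] = borel_measurable_continuous_onI[OF c1(1)] borel_measurable_continuous_onI[OF c1(2)]
    borel_measurable_continuous_onI[OF c\<psi>] v_meas[OF t] vx_meas[OF t]
  have i\<psi>: "integrable lborel (\<lambda>x. \<psi> (v s x))" if s: "0 < s" for s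
  proof (rule integrable_le)
    show "integrable lborel (\<lambda>x. A * (v s x)\<^sup>2)" using L2_integrable[OF v_L2[OF s]] by simp
    note [measurable] = v_meas[OF s]
    show "(\<lambda>x. \<psi> (v s x)) \<in> borel_measurable borel" by measurable
    show "\<bar>\<psi> (v s x)\<bar> \<le> A * (v s x)\<^sup>2" for x using taylor[of "v s x" 0] by (simp add: z)
  qed
  have L\<psi>': "L2 (\<lambda>x. \<psi>' (v t x))"
    by (rule L2_bound[OF v_L2[OF t], of _ A]) (use lip[of _ 0] in \<open>auto simp: z\<close>)
  have L\<psi>'': "L2 (\<lambda>x. \<psi>'' (v t x) * vx t x)"
    by (rule L2_mult_bounded[OF vx_L2[OF t]]) (use A in auto)
  have p\<psi>: "prim (\<lambda>x. \<psi>' (v t x)) (\<lambda>x. \<psi>'' (v t x) * vx t x)"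
  proof (rule prim_C1)
    show "((\<lambda>x. \<psi>' (v t x)) has_real_derivative \<psi>'' (v t x) * vx t x) (at x)" for x
      by (rule DERIV_chain2[OF \<psi>(2) v_deriv_x[OF t]])
    show "continuous_on UNIV (\<lambda>x. \<psi>'' (v t x) * vx t x)"
      using continuous_on_compose2[OF c\<psi> v_cont_x[OF t]] vx_cont_x[OF t] by (intro continuous_on_mult) auto
  qed
  have p\<Theta>: "prim (\<lambda>x. \<Theta> (v t x)) (\<lambda>x. (\<psi>'' (v t x) * v t x ^ 3) * vx t x)"
  proof (rule prim_C1)
    show "((\<lambda>x. \<Theta> (v t x)) has_real_derivative (\<psi>'' (v t x) * v t x ^ 3) * vx t x) (at x)" for x
      by (rule DERIV_chain2[OF \<Theta>(1) v_deriv_x[OF t]])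
    show "continuous_on UNIV (\<lambda>x. (\<psi>'' (v t x) * v t x ^ 3) * vx t x)"
      using continuous_on_compose2[OF c\<psi> v_cont_x[OF t]] vx_cont_x[OF t] v_cont_x[OF t]
      by (intro continuous_on_mult continuous_on_power) auto
  qed
  have i3: "integrable lborel (\<lambda>x. (\<psi>'' (v t x) * v t x ^ 3) * vx t x)"
    using L2_mult_integrable[OF L\<psi>'' v_cube_L2[OF t]] by (simp add: mult_ac)
  have z3: "(LINT x|lborel. (\<psi>'' (v t x) * v t x ^ 3) * vx t x) = 0"
    by (rule prim_integral_0[OF p\<Theta> \<Theta>(2) i3])
  have i4: "integrable lborel (\<lambda>x. \<psi>'' (v t x) * ((1 + b x) * (vx t x)\<^sup>2))"
  proof -
    have "L2 (\<lambda>x. (1 + b x) * vx t x)" by (rule L2_mult_bounded[OF vx_L2[OF t] _ a_bounds(4)]) auto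
    from L2_mult_integrable[OF L\<psi>'' this] show ?thesis by (simp add: power2_eq_square mult_ac)
  qed
  have "(LINT x|lborel. \<psi>' (v t x) * vt t x) = - (LINT x|lborel. (\<psi>'' (v t x) * vx t x) * ((1 + b x) * vx t x + d * v t x ^ 3))"
    by (rule prim_integral_by_parts[OF p\<psi> v_eq[OF t] L\<psi>' L\<psi>'' flux_L2[OF t] vt_L2[OF t]])
  also have "(LINT x|lborel. (\<psi>'' (v t x) * vx t x) * ((1 + b x) * vx t x + d * v t x ^ 3))
     = (LINT x|lborel. \<psi>'' (v t x) * ((1 + b x) * (vx t x)\<^sup>2) + d * ((\<psi>'' (v t x) * v t x ^ 3) * vx t x))"
    by (intro Bochner_Integration.integral_cong) (auto simp: algebra_simps power2_eq_square)
  also have "\<dots> = (LINT x|lborel. \<psi>'' (v t x) * ((1 + b x) * (vx t x)\<^sup>2))"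
    using i3 i4 z3 by (subst Bochner_Integration.integral_add) auto
  finally have val: "(LINT x|lborel. \<psi>' (v t x) * vt t x) = - (LINT x|lborel. \<psi>'' (v t x) * ((1 + b x) * (vx t x)\<^sup>2))" .
  have "((\<lambda>s. (LINT x|lborel. (v s x - v t x) * \<psi>' (v t x)) / (s - t)) \<longlongrightarrow> (LINT x|lborel. vt t x * \<psi>' (v t x))) (at t)"
    by (rule pair_quotient[OF t const_cont L\<psi>']) (use L\<psi>' in simp)
  then have lim1: "((\<lambda>s. (LINT x|lborel. (v s x - v t x) * \<psi>' (v t x)) / (s - t)) \<longlongrightarrow>
     - (LINT x|lborel. \<psi>'' (v t x) * ((1 + b x) * (vx t x)\<^sup>2))) (at t)"
    using val by (simp add: mult.commute)
  have lim2: "((\<lambda>s. ((LINT x|lborel. \<psi> (v s x)) - (LINT x|lborel. \<psi> (v t x)) - (LINT x|lborel. (v s x - v t x) * \<psi>' (v t x))) / (s - t)) \<longlongrightarrow> 0) (at t)"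
  proof (rule Lim_null_comparison)
    have "((\<lambda>s. A * \<bar>sq (\<lambda>x. v s x - v t x) / (s - t)\<bar>) \<longlongrightarrow> A * \<bar>0\<bar>) (at t)"
      by (intro tendsto_intros sq_diff_quotient t)
    then show "((\<lambda>s. A * \<bar>sq (\<lambda>x. v s x - v t x) / (s - t)\<bar>) \<longlongrightarrow> 0) (at t)" by simp
    show "\<forall>\<^sub>F s in at t. norm (((LINT x|lborel. \<psi> (v s x)) - (LINT x|lborel. \<psi> (v t x)) - (LINT x|lborel. (v s x - v t x) * \<psi>' (v t x))) / (s - t))
        \<le> A * \<bar>sq (\<lambda>x. v s x - v t x) / (s - t)\<bar>"
      using ev_pos[OF t]
    proof eventually_elim
      case (elim s)
      have dL: "L2 (\<lambda>x. v s x - v t x)" using L2_diff[OF v_L2[OF elim] v_L2[OF t]] .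
      have i: "integrable lborel (\<lambda>x. \<psi> (v s x) - \<psi> (v t x) - (v s x - v t x) * \<psi>' (v t x))"
        using i\<psi>[OF elim] i\<psi>[OF t] L2_mult_integrable[OF dL L\<psi>'] by simp
      have eq: "(LINT x|lborel. \<psi> (v s x)) - (LINT x|lborel. \<psi> (v t x)) - (LINT x|lborel. (v s x - v t x) * \<psi>' (v t x))
         = (LINT x|lborel. \<psi> (v s x) - \<psi> (v t x) - (v s x - v t x) * \<psi>' (v t x))"
        using i\<psi>[OF elim] i\<psi>[OF t] L2_mult_integrable[OF dL L\<psi>'] by simp
      have "\<bar>LINT x|lborel. \<psi> (v s x) - \<psi> (v t x) - (v s x - v t x) * \<psi>' (v t x)\<bar> \<le> (LINT x|lborel. \<bar>\<psi> (v s x) - \<psi> (v t x) - (v s x - v t x) * \<psi>' (v t x)\<bar>)"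
        by (rule integral_abs_bound)
      also have "\<dots> \<le> (LINT x|lborel. A * (v s x - v t x)\<^sup>2)"
      proof (rule integral_mono)
        show "\<bar>\<psi> (v s x) - \<psi> (v t x) - (v s x - v t x) * \<psi>' (v t x)\<bar> \<le> A * (v s x - v t x)\<^sup>2" for x
          by (rule taylor)
        show "integrable lborel (\<lambda>x. \<bar>\<psi> (v s x) - \<psi> (v t x) - (v s x - v t x) * \<psi>' (v t x)\<bar>)"
          using i by (rule integrable_abs)
        show "integrable lborel (\<lambda>x. A * (v s x - v t x)\<^sup>2)" using L2_integrable[OF dL] by simp
      qed
      also have "\<dots> = A * sq (\<lambda>x. v s x - v t x)" by (simp add: sq_def)
      finally show ?case unfolding eq by (simp add: abs_divide divide_right_mono)
    qed
  qed
  have "((\<lambda>s. ((LINT x|lborel. \<psi> (v s x)) - (LINT x|lborel. \<psi> (v t x))) / (s - t)) \<longlongrightarrow>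
     - (LINT x|lborel. \<psi>'' (v t x) * ((1 + b x) * (vx t x)\<^sup>2))) (at t)"
    using tendsto_add[OF lim1 lim2] by (simp add: diff_divide_distrib)
  then show ?thesis by (simp add: has_field_derivative_iff)
qed

section \<open>Bounds in L1 and L2 by the initial data\<close>

text \<open>One family for two bounds: it tends to the modulus as e tends to 0, and 2 e times it
  tends to z^2 as e tends to infinity. It is Lipschitz with constant 1, so its integral passes to
  the initial time under mere L1 convergence.\<close>

definition smooth_abs :: "real \<Rightarrow> real \<Rightarrow> real" where "smooth_abs e z = sqrt (e\<^sup>2 + z\<^sup>2) - e"

lemma smooth_abs_facts:
  assumes "0 < e"
  shows "0 \<le> smooth_abs e z" "smooth_abs e z \<le> \<bar>z\<bar>" "2 * e * smooth_abs e z \<le> z\<^sup>2" "\<bar>smooth_abs e y - smooth_abs e z\<bar> \<le> \<bar>y - z\<bar>"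
proof -
  have r: "e \<le> sqrt (e\<^sup>2 + z\<^sup>2)" using assms by (intro real_le_rsqrt) auto
  then show "0 \<le> smooth_abs e z" by (simp add: smooth_abs_def)
  have "sqrt (e\<^sup>2 + z\<^sup>2) \<le> sqrt (e\<^sup>2) + sqrt (z\<^sup>2)" by (rule sqrt_add_le_add_sqrt) auto
  then show "smooth_abs e z \<le> \<bar>z\<bar>" using assms by (simp add: smooth_abs_def)
  have "2 * e * sqrt (e\<^sup>2 + z\<^sup>2) \<le> e\<^sup>2 + (sqrt (e\<^sup>2 + z\<^sup>2))\<^sup>2" by (rule sum_squares_bound)
  also have "(sqrt (e\<^sup>2 + z\<^sup>2))\<^sup>2 = e\<^sup>2 + z\<^sup>2" by simp
  finally show "2 * e * smooth_abs e z \<le> z\<^sup>2" by (simp add: smooth_abs_def algebra_simps power2_eq_square)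
  have "norm (smooth_abs e y - smooth_abs e z) \<le> 1 * norm (y - z)"
  proof (rule field_differentiable_bound[of UNIV _ "\<lambda>z. z / sqrt (e\<^sup>2 + z\<^sup>2)"])
    fix z :: real
    show "(smooth_abs e has_field_derivative z / sqrt (e\<^sup>2 + z\<^sup>2)) (at z within UNIV)"
      unfolding smooth_abs_def using DERIV_diff[OF pseudo_abs_deriv(1)[OF assms, of z] DERIV_const[of e]] by simp
    have "\<bar>z\<bar> \<le> sqrt (e\<^sup>2 + z\<^sup>2)" by (intro real_le_rsqrt) auto
    then show "norm (z / sqrt (e\<^sup>2 + z\<^sup>2)) \<le> 1" using assms by (simp add: divide_le_eq_1 add_pos_nonneg)
  qed auto
  then show "\<bar>smooth_abs e y - smooth_abs e z\<bar> \<le> \<bar>y - z\<bar>" by simp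
qed

lemma smooth_abs_cont: "continuous_on UNIV (smooth_abs e)"
  unfolding smooth_abs_def by (intro continuous_intros)

lemma smooth_abs_meas [measurable]: "smooth_abs e \<in> borel_measurable borel"
  by (rule borel_measurable_continuous_onI[OF smooth_abs_cont])

lemma smooth_abs_integrable:
  fixes f :: "real \<Rightarrow> real"
  assumes "0 < e" "integrable lborel f" shows "integrable lborel (\<lambda>x. smooth_abs e (f x))"
proof (rule integrable_le)
  show "integrable lborel (\<lambda>x. \<bar>f x\<bar>)" using assms by simp
  have [measurable]: "f \<in> borel_measurable borel" using assms by auto
  show "(\<lambda>x. smooth_abs e (f x)) \<in> borel_measurable borel" by measurable
  show "\<bar>smooth_abs e (f x)\<bar> \<le> \<bar>f x\<bar>" for x using smooth_abs_facts[OF assms(1)] by (metis abs_of_nonneg)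
qed

text \<open>\<open>smooth_abs e\<close> is convex, so the dissipation in
  \<open>entropy_derivative\<close> has a sign. Its second derivative e^2 / R^3 is at most 1/e
  because R \<ge> e.\<close>

lemma smooth_abs_decreasing:
  assumes e: "0 < e" and "0 < s" "s \<le> t"
  shows "(LINT x|lborel. smooth_abs e (v t x)) \<le> (LINT x|lborel. smooth_abs e (v s x))"
proof (rule DERIV_nonpos_imp_nonincreasing[OF assms(3)])
  fix r assume r: "s \<le> r" "r \<le> t"
  then have r0: "0 < r" using assms by linarith
  define R where "R = (\<lambda>z. sqrt (e\<^sup>2 + z\<^sup>2))"
  have Re: "e \<le> R z" for z unfolding R_def using e by (intro real_le_rsqrt) auto
  have R0: "0 < R z" for z using Re[of z] e by linarith
  have D: "(R has_real_derivative z / R z) (at z)" "((\<lambda>z. z / R z) has_real_derivative e\<^sup>2 / R z ^ 3) (at z)"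
    "((\<lambda>z. e\<^sup>2 * (R z - 2 * e + e\<^sup>2 / R z)) has_real_derivative e\<^sup>2 / R z ^ 3 * z ^ 3) (at z)" for z
    unfolding R_def by (rule pseudo_abs_deriv[OF e])+
  have "((\<lambda>s. LINT x|lborel. smooth_abs e (v s x)) has_real_derivative
     - (LINT x|lborel. e\<^sup>2 / R (v r x) ^ 3 * ((1 + b x) * (vx r x)\<^sup>2))) (at r)"
  proof (rule entropy_derivative[OF r0, where \<psi>' = "\<lambda>z. z / R z" and A = "1 / e" and \<Theta> = "\<lambda>z. e\<^sup>2 * (R z - 2 * e + e\<^sup>2 / R z)"])
    show "(smooth_abs e has_real_derivative z / R z) (at z)" for z
      unfolding smooth_abs_def using DERIV_diff[OF D(1)[of z] DERIV_const[of e]] by (simp add: R_def)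
    show "continuous_on UNIV (\<lambda>z. e\<^sup>2 / R z ^ 3)"
      unfolding R_def using R0 by (intro continuous_intros) (auto simp: R_def)
    show "\<bar>e\<^sup>2 / R z ^ 3\<bar> \<le> 1 / e" for z
    proof -
      have "e ^ 3 \<le> R z ^ 3" using Re e by (intro power_mono) auto
      then have "e\<^sup>2 / R z ^ 3 \<le> e\<^sup>2 / e ^ 3" using e R0[of z] by (intro divide_left_mono) auto
      also have "\<dots> = 1 / e" using e by (simp add: power2_eq_square power3_eq_cube)
      finally show ?thesis using R0[of z] by simp
    qed
    \<comment> \<open>The bracket equals (R - e)^2 / R, which lies between 0 and |v|, so
      integrability is inherited from the solution.\<close>
    show "integrable lborel (\<lambda>x. e\<^sup>2 * (R (v r x) - 2 * e + e\<^sup>2 / R (v r x)))"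
    proof (rule integrable_le)
      show "integrable lborel (\<lambda>x. e\<^sup>2 * \<bar>v r x\<bar>)" using v_int[OF r0] by simp
      note [measurable] = v_meas[OF r0]
      show "(\<lambda>x. e\<^sup>2 * (R (v r x) - 2 * e + e\<^sup>2 / R (v r x))) \<in> borel_measurable borel"
        unfolding R_def by measurable
      fix x
      have "e\<^sup>2 / R (v r x) \<le> e" using Re[of "v r x"] R0[of "v r x"] e by (simp add: divide_le_eq power2_eq_square)
      then have le: "R (v r x) - 2 * e + e\<^sup>2 / R (v r x) \<le> \<bar>v r x\<bar>"
        using smooth_abs_facts(2)[OF e, of "v r x"] by (simp add: smooth_abs_def R_def)
      have "R (v r x) - 2 * e + e\<^sup>2 / R (v r x) = (R (v r x) - e)\<^sup>2 / R (v r x)"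
        using R0[of "v r x"] by (simp add: field_simps power2_eq_square)
      then have ge: "0 \<le> R (v r x) - 2 * e + e\<^sup>2 / R (v r x)" using R0[of "v r x"] by simp
      show "\<bar>e\<^sup>2 * (R (v r x) - 2 * e + e\<^sup>2 / R (v r x))\<bar> \<le> e\<^sup>2 * \<bar>v r x\<bar>"
        using le ge by (simp add: abs_mult mult_left_mono)
    qed
    show "smooth_abs e 0 = 0" using e by (simp add: smooth_abs_def)
  qed (fact D | simp)+
  moreover have "0 \<le> (LINT x|lborel. e\<^sup>2 / R (v r x) ^ 3 * ((1 + b x) * (vx r x)\<^sup>2))"
    by (intro integral_nonneg_AE AE_I2 mult_nonneg_nonneg divide_nonneg_nonneg)
       (use R0 a_bounds(3) in \<open>auto simp: less_imp_le\<close>)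
  ultimately show "\<exists>y. ((\<lambda>s. LINT x|lborel. smooth_abs e (v s x)) has_real_derivative y) (at r) \<and> y \<le> 0" by auto
qed

lemma smooth_abs_initial:
  assumes e: "0 < e" and t: "0 < t"
  shows "(LINT x|lborel. smooth_abs e (v t x)) \<le> (LINT x|lborel. smooth_abs e (u0 x))"
proof (rule tendsto_le[OF _ _ tendsto_const])
  show "((\<lambda>s. (LINT x|lborel. smooth_abs e (u0 x)) + (LINT x|lborel. \<bar>v s x - u0 x\<bar>)) \<longlongrightarrow> (LINT x|lborel. smooth_abs e (u0 x))) (at_right 0)"
    using tendsto_add[OF tendsto_const v_initial] by simp
  have "\<forall>\<^sub>F s in at_right 0. s < t \<and> 0 < s"
    using t by (auto simp: eventually_at_right intro!: exI[of _ t])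
  then show "\<forall>\<^sub>F s in at_right 0. (LINT x|lborel. smooth_abs e (v t x)) \<le> (LINT x|lborel. smooth_abs e (u0 x)) + (LINT x|lborel. \<bar>v s x - u0 x\<bar>)"
  proof eventually_elim
    case (elim s)
    have "(LINT x|lborel. smooth_abs e (v t x)) \<le> (LINT x|lborel. smooth_abs e (v s x))"
      using smooth_abs_decreasing[OF e, of s t] elim by simp
    also have "\<dots> \<le> (LINT x|lborel. smooth_abs e (u0 x) + \<bar>v s x - u0 x\<bar>)"
    proof (rule integral_mono)
      show "smooth_abs e (v s x) \<le> smooth_abs e (u0 x) + \<bar>v s x - u0 x\<bar>" for x
        using smooth_abs_facts(4)[OF e, of "v s x" "u0 x"] by linarith
    qed (use smooth_abs_integrable[OF e] v_int[of s] u0_int elim in auto)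
    also have "\<dots> = (LINT x|lborel. smooth_abs e (u0 x)) + (LINT x|lborel. \<bar>v s x - u0 x\<bar>)"
      using smooth_abs_integrable[OF e u0_int] v_int[of s] u0_int elim by (subst Bochner_Integration.integral_add) auto
    finally show ?case .
  qed
qed simp

lemma v_L1_bound:
  assumes t: "0 < t"
  shows "(LINT x|lborel. \<bar>v t x\<bar>) \<le> (LINT x|lborel. \<bar>u0 x\<bar>)"
proof (rule LIMSEQ_le_const2)
  note [measurable] = v_meas[OF t]
  show "(\<lambda>n. LINT x|lborel. smooth_abs (inverse (real (Suc n))) (v t x)) \<longlonglongrightarrow> (LINT x|lborel. \<bar>v t x\<bar>)"
  proof (rule integral_dominated_convergence[where w = "\<lambda>x. \<bar>v t x\<bar>"])
    show "AE x in lborel. (\<lambda>n. smooth_abs (inverse (real (Suc n))) (v t x)) \<longlonglongrightarrow> \<bar>v t x\<bar>"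
    proof (rule AE_I2)
      fix x
      have "(\<lambda>n. sqrt ((inverse (real (Suc n)))\<^sup>2 + (v t x)\<^sup>2) - inverse (real (Suc n))) \<longlonglongrightarrow> sqrt (0\<^sup>2 + (v t x)\<^sup>2) - 0"
        by (intro tendsto_intros LIMSEQ_inverse_real_of_nat)
      then show "(\<lambda>n. smooth_abs (inverse (real (Suc n))) (v t x)) \<longlonglongrightarrow> \<bar>v t x\<bar>" by (simp add: smooth_abs_def)
    qed
    show "AE x in lborel. norm (smooth_abs (inverse (real (Suc n))) (v t x)) \<le> \<bar>v t x\<bar>" for n
      using smooth_abs_facts(1,2)[of "inverse (real (Suc n))"] by (simp del: of_nat_Suc)
  qed (use v_int[OF t] in auto)
  show "\<exists>N. \<forall>n\<ge>N. (LINT x|lborel. smooth_abs (inverse (real (Suc n))) (v t x)) \<le> (LINT x|lborel. \<bar>u0 x\<bar>)"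
  proof (intro exI[of _ 0] allI impI)
    fix n
    have e: "0 < inverse (real (Suc n))" by simp
    have "(LINT x|lborel. smooth_abs (inverse (real (Suc n))) (v t x)) \<le> (LINT x|lborel. smooth_abs (inverse (real (Suc n))) (u0 x))"
      by (rule smooth_abs_initial[OF e t])
    also have "\<dots> \<le> (LINT x|lborel. \<bar>u0 x\<bar>)"
      by (rule integral_mono) (use smooth_abs_integrable[OF e u0_int] u0_int smooth_abs_facts(2)[OF e] in auto)
    finally show "(LINT x|lborel. smooth_abs (inverse (real (Suc n))) (v t x)) \<le> (LINT x|lborel. \<bar>u0 x\<bar>)" .
  qed
qed

text \<open>The initial value is attained in L1 only, so this bound is not a matter of continuity at
  time 0. It comes from the functionals 2 e \<open>smooth_abs e\<close>, which are continuous in L1,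
  with e = n + 1 tending to infinity.\<close>

lemma v_sq_bound:
  assumes t: "0 < t"
  shows "sq (v t) \<le> sq u0"
proof (rule LIMSEQ_le_const2)
  note [measurable] = v_meas[OF t]
  show "(\<lambda>n. LINT x|lborel. 2 * real (Suc n) * smooth_abs (real (Suc n)) (v t x)) \<longlonglongrightarrow> sq (v t)"
    unfolding sq_def
  proof (rule integral_dominated_convergence[where w = "\<lambda>x. (v t x)\<^sup>2"])
    show "AE x in lborel. (\<lambda>n. 2 * real (Suc n) * smooth_abs (real (Suc n)) (v t x)) \<longlonglongrightarrow> (v t x)\<^sup>2"
    proof (rule AE_I2)
      fix x
      \<comment> \<open>Rationalising sqrt(k^2 + z^2) - k removes the difference of two large
        numbers; the left side has an evident limit.\<close>
      have eq: "2 * (v t x)\<^sup>2 / (sqrt (1 + (inverse (real (Suc n)) * v t x)\<^sup>2) + 1) = 2 * real (Suc n) * smooth_abs (real (Suc n)) (v t x)" for n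
      proof -
        define k where "k = real (Suc n)"
        have k: "0 < k" by (simp add: k_def)
        define r where "r = sqrt (k\<^sup>2 + (v t x)\<^sup>2)"
        have r0: "0 \<le> r" by (simp add: r_def)
        have rr: "r * r = k\<^sup>2 + (v t x)\<^sup>2" by (simp add: r_def)
        have "sqrt (1 + (inverse k * v t x)\<^sup>2) = sqrt ((k\<^sup>2 + (v t x)\<^sup>2) / k\<^sup>2)"
          using k by (intro arg_cong[where f = sqrt]) (simp add: field_simps power2_eq_square)
        also have "\<dots> = r / k" using k by (simp add: real_sqrt_divide r_def)
        finally have "2 * (v t x)\<^sup>2 / (sqrt (1 + (inverse k * v t x)\<^sup>2) + 1) = 2 * (v t x)\<^sup>2 / (r / k + 1)" by simp
        also have "\<dots> = 2 * k * ((r * r - k\<^sup>2) / (r + k))" using k r0 rr by (simp add: field_simps)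
        also have "(r * r - k\<^sup>2) / (r + k) = r - k"
          using k r0 by (simp add: field_simps power2_eq_square)
        finally show ?thesis by (simp add: smooth_abs_def r_def k_def)
      qed
      have "(\<lambda>n. 2 * (v t x)\<^sup>2 / (sqrt (1 + (inverse (real (Suc n)) * v t x)\<^sup>2) + 1)) \<longlonglongrightarrow> 2 * (v t x)\<^sup>2 / (sqrt (1 + (0 * v t x)\<^sup>2) + 1)"
        by (intro tendsto_intros LIMSEQ_inverse_real_of_nat) auto
      then show "(\<lambda>n. 2 * real (Suc n) * smooth_abs (real (Suc n)) (v t x)) \<longlonglongrightarrow> (v t x)\<^sup>2"
        unfolding eq by simp
    qed
    show "AE x in lborel. norm (2 * real (Suc n) * smooth_abs (real (Suc n)) (v t x)) \<le> (v t x)\<^sup>2" for n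
      using smooth_abs_facts(1,3)[of "real (Suc n)"] by (simp add: abs_mult del: of_nat_Suc)
  qed (use L2_integrable[OF v_L2[OF t]] in auto)
  show "\<exists>N. \<forall>n\<ge>N. (LINT x|lborel. 2 * real (Suc n) * smooth_abs (real (Suc n)) (v t x)) \<le> sq u0"
  proof (intro exI[of _ 0] allI impI)
    fix n
    have e: "0 < real (Suc n)" by simp
    have "(LINT x|lborel. 2 * real (Suc n) * smooth_abs (real (Suc n)) (v t x)) \<le> (LINT x|lborel. 2 * real (Suc n) * smooth_abs (real (Suc n)) (u0 x))"
      using smooth_abs_initial[OF e t] e by (simp add: mult_left_mono del: of_nat_Suc)
    also have "\<dots> \<le> sq u0"
      unfolding sq_def
      by (rule integral_mono) (use smooth_abs_integrable[OF e u0_int] L2_integrable[OF u0_L2] smooth_abs_facts(3)[OF e] in auto)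
    finally show "(LINT x|lborel. 2 * real (Suc n) * smooth_abs (real (Suc n)) (v t x)) \<le> sq u0" .
  qed
qed


section \<open>Energy decay and Nash's inequality\<close>

text \<open>The added 1 keeps the constant positive also for zero data, so that it can be divided
  by.\<close>

definition L1_cap :: real where "L1_cap = (LINT x|lborel. \<bar>u0 x\<bar>) + 1"

definition energy :: "real \<Rightarrow> real" where "energy t = (LINT x|lborel. (1 + b x) * (vx t x)\<^sup>2)"

lemma L1_cap_pos: "0 < L1_cap"
  unfolding L1_cap_def by (rule add_nonneg_pos) auto

lemma v_L1_le_L1_cap: "0 < t \<Longrightarrow> (LINT x|lborel. \<bar>v t x\<bar>) \<le> L1_cap"
  using v_L1_bound[of t] by (simp add: L1_cap_def)

lemma a_vx_L2: "0 < t \<Longrightarrow> L2 (\<lambda>x. (1 + b x) * vx t x)"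
  by (intro L2_mult_bounded[where c = 2] vx_L2 a_bounds) auto

lemma energy_bounds:
  assumes t: "0 < t"
  shows "(1 - \<beta>) * sq (vx t) \<le> energy t" "energy t \<le> 2 * sq (vx t)" "0 \<le> energy t"
proof -
  have i: "integrable lborel (\<lambda>x. (1 + b x) * (vx t x)\<^sup>2)"
    using L2_mult_integrable[OF a_vx_L2[OF t] vx_L2[OF t]] by (simp add: power2_eq_square mult.assoc)
  have i2: "integrable lborel (\<lambda>x. (vx t x)\<^sup>2)" using L2_integrable[OF vx_L2[OF t]] .
  have "(LINT x|lborel. (1 - \<beta>) * (vx t x)\<^sup>2) \<le> energy t"
    unfolding energy_def by (rule integral_mono) (use i i2 a_bounds in \<open>auto intro!: mult_right_mono\<close>)
  then show 1: "(1 - \<beta>) * sq (vx t) \<le> energy t" by (simp add: sq_def)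
  have "energy t \<le> (LINT x|lborel. 2 * (vx t x)\<^sup>2)"
    unfolding energy_def
  proof (rule integral_mono)
    show "(1 + b x) * (vx t x)\<^sup>2 \<le> 2 * (vx t x)\<^sup>2" for x
      using a_bounds(4)[of x] by (intro mult_right_mono) auto
  qed (use i i2 in auto)
  then show "energy t \<le> 2 * sq (vx t)" by (simp add: sq_def)
  have "0 \<le> (1 - \<beta>) * sq (vx t)" using \<beta>_less by (intro mult_nonneg_nonneg) auto
  with 1 show "0 \<le> energy t" by linarith
qed

lemma sq_v_deriv:
  assumes t: "0 < t"
  shows "((\<lambda>s. sq (v s)) has_real_derivative - 2 * energy t) (at t)"
proof -
  obtain c where c: "0 \<le> c" "\<And>x. \<bar>v t x\<bar> \<le> c" using v_bounded[OF t] by blast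
  have "L2 (\<lambda>x. v t x * v t x)"
    using v_meas[OF t] c by (intro L2_mult_bounded[OF v_L2[OF t]]) auto
  then have i: "integrable lborel (\<lambda>x. (v t x) ^ 4 / 2)"
    using L2_integrable[of "\<lambda>x. v t x * v t x"] by (simp add: power2_eq_square power4_eq_xxxx mult.assoc)
  have "((\<lambda>s. LINT x|lborel. (v s x)\<^sup>2) has_real_derivative - (LINT x|lborel. 2 * ((1 + b x) * (vx t x)\<^sup>2))) (at t)"
  proof (rule entropy_derivative[OF t, where \<psi>' = "\<lambda>z. 2 * z" and A = 2 and \<Theta> = "\<lambda>z. z ^ 4 / 2"])
    show "((\<lambda>a. a\<^sup>2) has_real_derivative 2 * z) (at z)" for z :: real
      by (auto intro!: derivative_eq_intros)
    show "((*) 2 has_real_derivative 2) (at z)" for z :: real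
      by (auto intro!: derivative_eq_intros)
    show "((\<lambda>z. z ^ 4 / 2) has_real_derivative 2 * z ^ 3) (at z)" for z :: real
      by (auto intro!: derivative_eq_intros)
  qed (use i in auto)
  then show ?thesis by (simp add: sq_def[abs_def] energy_def)
qed

text \<open>The space derivative of the diffusive part (1 + b) v_x of the flux.\<close>

definition q :: "real \<Rightarrow> real \<Rightarrow> real" where "q t x = b' x * vx t x + (1 + b x) * vxx t x"

lemma q_prim: "0 < t \<Longrightarrow> prim (\<lambda>x. (1 + b x) * vx t x) (q t)"
proof -
  assume t: "0 < t"
  have "prim (\<lambda>x. 1 + b x) b'"
    by (rule prim_C1) (use b_deriv b'_cont in \<open>auto intro!: derivative_eq_intros\<close>)
  from prim_mult[OF this vx_prim[OF t]] show ?thesis by (simp add: q_def[abs_def])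
qed

lemma q_L2: "0 < t \<Longrightarrow> L2 (q t)"
  unfolding q_def[abs_def]
  by (intro L2_add L2_mult_bounded[where c = B] L2_mult_bounded[where c = 2] vx_L2 vxx_L2 b'_bound a_bounds) auto

lemma q_cont: "0 < t \<Longrightarrow> ((\<lambda>s. sq (\<lambda>x. q s x - q t x)) \<longlongrightarrow> 0) (at t)"
proof -
  assume t: "0 < t"
  show ?thesis
  proof (rule Lim_null_comparison)
    have "((\<lambda>s. 2 * (B\<^sup>2 * sq (\<lambda>x. vx s x - vx t x)) + 2 * (2\<^sup>2 * sq (\<lambda>x. vxx s x - vxx t x))) \<longlongrightarrow> 2 * (B\<^sup>2 * 0) + 2 * (2\<^sup>2 * 0)) (at t)"
      by (intro tendsto_intros vx_cont vxx_cont t)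
    then show "((\<lambda>s. 2 * (B\<^sup>2 * sq (\<lambda>x. vx s x - vx t x)) + 2 * (2\<^sup>2 * sq (\<lambda>x. vxx s x - vxx t x))) \<longlongrightarrow> 0) (at t)" by simp
    have le: "sq (\<lambda>x. f x * g x) \<le> c\<^sup>2 * sq g" if g: "L2 g" and [measurable]: "f \<in> borel_measurable borel" and f: "\<And>x. \<bar>f x\<bar> \<le> c" for f g c
    proof -
      have "sq (\<lambda>x. f x * g x) \<le> (LINT x|lborel. c\<^sup>2 * (g x)\<^sup>2)"
        unfolding sq_def
      proof (rule integral_mono)
        show "integrable lborel (\<lambda>x. (f x * g x)\<^sup>2)"
          using L2_integrable[OF L2_mult_bounded[OF g _ f]] by simp
        show "integrable lborel (\<lambda>x. c\<^sup>2 * (g x)\<^sup>2)" using L2_integrable[OF g] by simp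
        fix x
        have "(f x)\<^sup>2 \<le> c\<^sup>2" using power_mono[OF f[of x], of 2] by simp
        then show "(f x * g x)\<^sup>2 \<le> c\<^sup>2 * (g x)\<^sup>2" by (simp add: power_mult_distrib mult_right_mono)
      qed
      then show ?thesis by (simp add: sq_def)
    qed
    show "\<forall>\<^sub>F s in at t. norm (sq (\<lambda>x. q s x - q t x)) \<le> 2 * (B\<^sup>2 * sq (\<lambda>x. vx s x - vx t x)) + 2 * (2\<^sup>2 * sq (\<lambda>x. vxx s x - vxx t x))"
      using ev_pos[OF t]
    proof eventually_elim
      case (elim s)
      have L: "L2 (\<lambda>x. vx s x - vx t x)" "L2 (\<lambda>x. vxx s x - vxx t x)"
        using L2_diff vx_L2 vxx_L2 elim t by auto
      have "sq (\<lambda>x. q s x - q t x) = sq (\<lambda>x. b' x * (vx s x - vx t x) + (1 + b x) * (vxx s x - vxx t x))"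
        by (rule arg_cong[where f = sq]) (auto simp: q_def algebra_simps)
      also have "\<dots> \<le> 2 * sq (\<lambda>x. b' x * (vx s x - vx t x)) + 2 * sq (\<lambda>x. (1 + b x) * (vxx s x - vxx t x))"
        by (intro sq_add_le L2_mult_bounded[where c = B] L2_mult_bounded[where c = 2] L b'_bound a_bounds) auto
      also have "\<dots> \<le> 2 * (B\<^sup>2 * sq (\<lambda>x. vx s x - vx t x)) + 2 * (2\<^sup>2 * sq (\<lambda>x. vxx s x - vxx t x))"
        using le[OF L(1) b'_meas b'_bound] le[OF L(2) _ a_bounds(4)] by (intro add_mono) auto
      finally show ?case by simp
    qed
  qed
qed

text \<open>No time derivative of v_x is available. The increment of the energy is factored as (1 +
  b)(v_x(s) + v_x(t)) times v_x(s) - v_x(t) and integrated by parts, so that only v is differenced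
  in time and the other factor becomes \<open>q s + q t\<close>, which converges in L2.\<close>

lemma energy_deriv:
  assumes t: "0 < t"
  shows "(energy has_real_derivative - 2 * (LINT x|lborel. vt t x * q t x)) (at t)"
proof -
  have "((\<lambda>s. (LINT x|lborel. (v s x - v t x) * (q s x + q t x)) / (s - t)) \<longlongrightarrow> (LINT x|lborel. vt t x * (q t x + q t x))) (at t)"
    using ev_pos[OF t] q_L2 t q_cont[OF t]
    by (intro pair_quotient) (auto intro!: L2_add L2_cmult elim!: eventually_mono)
  then have "((\<lambda>s. - ((LINT x|lborel. (v s x - v t x) * (q s x + q t x)) / (s - t))) \<longlongrightarrow> - (LINT x|lborel. vt t x * (q t x + q t x))) (at t)"
    by (rule tendsto_minus)
  then have "((\<lambda>s. (energy s - energy t) / (s - t)) \<longlongrightarrow> - (LINT x|lborel. vt t x * (q t x + q t x))) (at t)"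
  proof (rule Lim_transform_eventually)
    show "\<forall>\<^sub>F s in at t. - ((LINT x|lborel. (v s x - v t x) * (q s x + q t x)) / (s - t)) = (energy s - energy t) / (s - t)"
      using ev_pos[OF t]
    proof eventually_elim
      case (elim s)
      have P: "prim (\<lambda>x. (1 + b x) * vx s x + (1 + b x) * vx t x) (\<lambda>x. q s x + q t x)"
        by (intro prim_add q_prim elim t)
      have Q: "prim (\<lambda>x. v s x - v t x) (\<lambda>x. vx s x - vx t x)"
        by (intro prim_diff v_prim elim t)
      have i: "integrable lborel (\<lambda>x. (1 + b x) * (vx s x)\<^sup>2)" if "0 < s" for s
        using L2_mult_integrable[OF a_vx_L2[OF that] vx_L2[OF that]] by (simp add: power2_eq_square mult.assoc)
      have "energy s - energy t = (LINT x|lborel. (1 + b x) * (vx s x)\<^sup>2 - (1 + b x) * (vx t x)\<^sup>2)"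
        using i[OF elim] i[OF t] by (simp add: energy_def)
      also have "\<dots> = (LINT x|lborel. ((1 + b x) * vx s x + (1 + b x) * vx t x) * (vx s x - vx t x))"
        by (intro Bochner_Integration.integral_cong) (auto simp: algebra_simps power2_eq_square)
      also have "\<dots> = - (LINT x|lborel. (q s x + q t x) * (v s x - v t x))"
        by (rule prim_integral_by_parts[OF P Q])
           (intro L2_add L2_diff a_vx_L2 q_L2 v_L2 vx_L2 elim t)+
      finally show ?case by (simp add: mult.commute)
    qed
  qed
  moreover have "(LINT x|lborel. vt t x * (q t x + q t x)) = 2 * (LINT x|lborel. vt t x * q t x)"
    by (subst integral_mult_right_zero[symmetric], intro Bochner_Integration.integral_cong) auto
  ultimately show ?thesis by (simp add: has_field_derivative_iff)
qed

definition \<kappa> :: real where "\<kappa> = 18 * d\<^sup>2 / (1 - \<beta>)\<^sup>2"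

text \<open>The time derivative is q + g with g = 3 d v^2 v_x, and -2 (q + g) q \<le> g^2 / 2 by
  completing the square. Agmon's inequality bounds v^4 by 4 \<open>sq (v t) * sq (vx t)\<close>,
  which gives 9/2 * 4 = 18 in \<kappa>; the two factors \<open>sq (vx t)\<close> are turned into
  energies at the cost of (1 - \<beta>)^2.\<close>

lemma energy_deriv_le:
  assumes t: "0 < t"
  shows "- 2 * (LINT x|lborel. vt t x * q t x) \<le> \<kappa> * sq (v t) * (energy t)\<^sup>2"
proof -
  obtain c where c: "0 \<le> c" "\<And>x. \<bar>v t x\<bar> \<le> c" using v_bounded[OF t] by blast
  define g where "g = (\<lambda>x. 3 * d * ((v t x)\<^sup>2 * vx t x))"
  have c2: "\<bar>(v t x)\<^sup>2\<bar> \<le> c\<^sup>2" for x using power_mono[OF c(2)[of x], of 2] by simp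
  have gL: "L2 g" unfolding g_def
    using v_meas[OF t] c2 by (intro L2_cmult L2_mult_bounded[where c = "c\<^sup>2"] vx_L2[OF t]) auto
  have "prim (\<lambda>x. v t x ^ 3) (\<lambda>x. 3 * ((v t x)\<^sup>2 * vx t x))"
    using prim_mult[OF prim_mult[OF v_prim[OF t] v_prim[OF t]] v_prim[OF t]]
    by (simp add: power3_eq_cube power2_eq_square algebra_simps)
  from prim_add[OF q_prim[OF t] prim_cmult[OF this, of d]]
  have "prim (\<lambda>x. (1 + b x) * vx t x + d * v t x ^ 3) (\<lambda>x. q t x + g x)"
    by (simp add: g_def mult_ac)
  from prim_density_unique[OF v_eq[OF t] this]
  have ae: "AE x in lborel. vt t x = q t x + g x" .
  have [measurable]: "q t \<in> borel_measurable borel" "g \<in> borel_measurable borel" "vt t \<in> borel_measurable borel"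
    using L2_measurable q_L2[OF t] gL vt_L2[OF t] by auto
  have "- 2 * (LINT x|lborel. vt t x * q t x) = (LINT x|lborel. - 2 * ((q t x + g x) * q t x))"
    using ae by (subst integral_mult_right_zero[symmetric], intro integral_cong_AE) auto
  also have "\<dots> \<le> (LINT x|lborel. (g x)\<^sup>2 / 2)"
  proof (rule integral_mono)
    show "integrable lborel (\<lambda>x. - 2 * ((q t x + g x) * q t x))"
      using L2_mult_integrable[OF L2_add[OF q_L2[OF t] gL] q_L2[OF t]] by simp
    show "integrable lborel (\<lambda>x. (g x)\<^sup>2 / 2)" using L2_integrable[OF gL] by simp
    fix x
    have "0 \<le> (2 * q t x + g x)\<^sup>2" by simp
    then show "- 2 * ((q t x + g x) * q t x) \<le> (g x)\<^sup>2 / 2" by (simp add: power2_eq_square algebra_simps)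
  qed
  also have "\<dots> \<le> (LINT x|lborel. (9 * d\<^sup>2 / 2 * (4 * (sq (v t) * sq (vx t)))) * (vx t x)\<^sup>2)"
  proof (rule integral_mono)
    show "integrable lborel (\<lambda>x. (g x)\<^sup>2 / 2)" using L2_integrable[OF gL] by simp
    show "integrable lborel (\<lambda>x. (9 * d\<^sup>2 / 2 * (4 * (sq (v t) * sq (vx t)))) * (vx t x)\<^sup>2)"
      using L2_integrable[OF vx_L2[OF t]] by simp
    fix x
    have "((v t x)\<^sup>2)\<^sup>2 \<le> (2 * sqrt (sq (v t) * sq (vx t)))\<^sup>2"
      by (rule power_mono[OF prim_sup_L2[OF v_prim v_L2 vx_L2]]) (use t in auto)
    also have "\<dots> = 4 * (sq (v t) * sq (vx t))" by (simp add: power_mult_distrib)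
    finally have "9 * d\<^sup>2 / 2 * ((v t x)\<^sup>2)\<^sup>2 * (vx t x)\<^sup>2 \<le> 9 * d\<^sup>2 / 2 * (4 * (sq (v t) * sq (vx t))) * (vx t x)\<^sup>2"
      by (intro mult_right_mono mult_left_mono) auto
    then show "(g x)\<^sup>2 / 2 \<le> (9 * d\<^sup>2 / 2 * (4 * (sq (v t) * sq (vx t)))) * (vx t x)\<^sup>2"
      by (simp add: g_def power_mult_distrib)
  qed
  also have "\<dots> = 18 * d\<^sup>2 * sq (v t) * (sq (vx t))\<^sup>2"
    by (simp add: sq_def[of "vx t"] power2_eq_square)
  also have "\<dots> \<le> 18 * d\<^sup>2 * sq (v t) * (energy t / (1 - \<beta>))\<^sup>2"
    using energy_bounds(1)[OF t] \<beta>_less by (intro mult_left_mono power_mono) (auto simp: field_simps)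
  also have "\<dots> = \<kappa> * sq (v t) * (energy t)\<^sup>2" by (simp add: \<kappa>_def power_divide)
  finally show ?thesis .
qed

definition C2 :: real where "C2 = exp (\<kappa> * (sq u0)\<^sup>2 / 4)"

text \<open>
  Since \<open>(sq (v t))' = - 2 * energy t\<close>, the inequality \<open>(energy t)' \<le> \<kappa> * sq (v t) * (energy t)\<^sup>2\<close> says that
  \<open>energy t * exp (\<kappa> * (sq (v t))\<^sup>2 / 4)\<close> is nonincreasing.
\<close>

lemma energy_almost_decreasing:
  assumes "0 < s" "s \<le> t"
  shows "energy t \<le> C2 * energy s"
proof -
  have \<kappa>0: "0 \<le> \<kappa>" by (simp add: \<kappa>_def)
  have "energy t * exp (\<kappa> / 4 * (sq (v t))\<^sup>2) \<le> energy s * exp (\<kappa> / 4 * (sq (v s))\<^sup>2)"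
  proof (rule DERIV_nonpos_imp_nonincreasing[OF assms(2)])
    fix r assume "s \<le> r" "r \<le> t"
    then have r: "0 < r" using assms by linarith
    define e' where "e' = - 2 * (LINT x|lborel. vt r x * q r x)"
    define X where "X = exp (\<kappa> / 4 * (sq (v r))\<^sup>2)"
    have "((\<lambda>r. energy r * exp (\<kappa> / 4 * (sq (v r))\<^sup>2)) has_real_derivative
        e' * X + X * (\<kappa> / 4 * (2 * sq (v r) * (- 2 * energy r))) * energy r) (at r)"
      unfolding e'_def X_def
      by (rule derivative_eq_intros energy_deriv[OF r] sq_v_deriv[OF r] refl | simp)+
    moreover have "e' * X + X * (\<kappa> / 4 * (2 * sq (v r) * (- 2 * energy r))) * energy r = X * (e' - \<kappa> * sq (v r) * (energy r)\<^sup>2)"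
      by (simp add: algebra_simps power2_eq_square)
    moreover have "X * (e' - \<kappa> * sq (v r) * (energy r)\<^sup>2) \<le> 0"
      using energy_deriv_le[OF r] by (intro mult_nonneg_nonpos) (auto simp: X_def e'_def)
    ultimately show "\<exists>y. ((\<lambda>r. energy r * exp (\<kappa> / 4 * (sq (v r))\<^sup>2)) has_real_derivative y) (at r) \<and> y \<le> 0" by auto
  qed
  moreover have "energy t \<le> energy t * exp (\<kappa> / 4 * (sq (v t))\<^sup>2)"
    using energy_bounds(3)[of t] assms \<kappa>0 by (simp add: mult_le_cancel_left1)
  moreover have "energy s * exp (\<kappa> / 4 * (sq (v s))\<^sup>2) \<le> C2 * energy s"
  proof -
    have "(sq (v s))\<^sup>2 \<le> (sq u0)\<^sup>2" using v_sq_bound[OF assms(1)] by (intro power_mono) auto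
    then have "\<kappa> / 4 * (sq (v s))\<^sup>2 \<le> \<kappa> * (sq u0)\<^sup>2 / 4" using \<kappa>0 by (simp add: mult_left_mono)
    then have "exp (\<kappa> / 4 * (sq (v s))\<^sup>2) \<le> C2" by (simp add: C2_def)
    from mult_right_mono[OF this energy_bounds(3)[OF assms(1)]] show ?thesis by (simp only: mult.commute)
  qed
  ultimately show ?thesis by linarith
qed

text \<open>Over [t/2, t] the dissipated amount is at most \<open>sq (v (t / 2))\<close>, so by the
  mean value theorem the energy is at most \<open>sq (v (t / 2)) / t\<close> at some time there. The
  near-monotonicity carries this bound to the final time.\<close>

lemma energy_decay:
  assumes t: "0 < t"
  shows "energy t \<le> C2 * (sq (v (t / 2)) / t)"
proof -
  have "((\<lambda>s. sq (v s)) has_real_derivative - 2 * energy x) (at x)" if "t / 2 \<le> x" for x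
    by (rule sq_v_deriv) (use that t in linarith)
  from MVT2[of "t / 2" t "\<lambda>s. sq (v s)" "\<lambda>s. - 2 * energy s", OF _ this] t
  obtain z where z: "t / 2 < z" "z < t" "sq (v t) - sq (v (t / 2)) = (t - t / 2) * (- 2 * energy z)" by auto
  have "t * energy z = sq (v (t / 2)) - sq (v t)" using z(3) by (simp add: field_simps)
  also have "\<dots> \<le> sq (v (t / 2))" by simp
  finally have "energy z \<le> sq (v (t / 2)) / t" using t by (simp add: field_simps)
  moreover have "0 < C2" by (simp add: C2_def)
  ultimately have "C2 * energy z \<le> C2 * (sq (v (t / 2)) / t)" by (intro mult_left_mono) auto
  then show ?thesis using energy_almost_decreasing[of z t] z t by linarith
qed

lemma v_sup_cube:
  assumes t: "0 < t"
  shows "\<bar>v t x\<bar> ^ 3 \<le> 4 * L1_cap * sq (vx t)"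
proof -
  have "\<bar>v t x\<bar> ^ 3 \<le> 4 * (LINT x|lborel. \<bar>v t x\<bar>) * sq (vx t)"
    by (rule prim_sup_L1_L2[OF v_prim v_L2 vx_L2 v_int]) (use t in auto)
  also have "\<dots> \<le> 4 * L1_cap * sq (vx t)" using v_L1_le_L1_cap[OF t] by (intro mult_right_mono) auto
  finally show ?thesis .
qed

text \<open>The supremum bound in terms of the L1 norm and v_x is fed back into
  \<open>sq (v t)\<close> \<le> supremum * L1 norm; the cube clears the cube root N.\<close>

lemma nash:
  assumes t: "0 < t"
  shows "(sq (v t)) ^ 3 \<le> 4 * L1_cap ^ 4 / (1 - \<beta>) * energy t"
proof -
  define N where "N = root 3 (4 * L1_cap * sq (vx t))"
  have N: "N ^ 3 = 4 * L1_cap * sq (vx t)" "0 \<le> N" using L1_cap_pos by (auto simp: N_def intro!: real_root_pow_pos2 mult_nonneg_nonneg)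
  have "\<bar>v t x\<bar> \<le> N" for x
  proof (rule power_le_imp_le_base[where n = 2])
    show "\<bar>v t x\<bar> ^ Suc 2 \<le> N ^ Suc 2" using v_sup_cube[OF t, of x] N(1) by (simp add: eval_nat_numeral)
  qed (rule N)
  from L2_bounded_integrable(2)[OF v_int[OF t] this]
  have "sq (v t) \<le> N * (LINT x|lborel. \<bar>v t x\<bar>)" .
  also have "\<dots> \<le> N * L1_cap" using v_L1_le_L1_cap[OF t] N by (intro mult_left_mono)
  finally have "(sq (v t)) ^ 3 \<le> (N * L1_cap) ^ 3" by (intro power_mono) auto
  also have "\<dots> = (4 * L1_cap * sq (vx t)) * L1_cap ^ 3" by (simp only: power_mult_distrib N(1))
  also have "\<dots> = 4 * L1_cap ^ 4 * sq (vx t)" by (simp add: power3_eq_cube power4_eq_xxxx)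
  also have "\<dots> \<le> 4 * L1_cap ^ 4 * (energy t / (1 - \<beta>))"
    using energy_bounds(1)[OF t] \<beta>_less by (intro mult_left_mono) (auto simp: field_simps)
  finally show ?thesis by simp
qed

lemma sq_v_decreasing:
  assumes "0 < s" "s \<le> t"
  shows "sq (v t) \<le> sq (v s)"
proof (rule DERIV_nonpos_imp_nonincreasing[OF assms(2)])
  fix r assume "s \<le> r" "r \<le> t"
  then have r: "0 < r" using assms by linarith
  show "\<exists>y. ((\<lambda>s. sq (v s)) has_real_derivative y) (at r) \<and> y \<le> 0"
    using sq_v_deriv[OF r] energy_bounds(3)[OF r] by (intro exI[of _ "- 2 * energy r"]) simp
qed

text \<open>For y = \<open>sq (v r)\<close>, the identity y' = -2 energy and Nash's inequality give
  (1/y^2)' = 4 energy / y^3 \<ge> k, so 1/y^2 grows at least linearly. Starting at t/2 instead of 0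
  avoids the behaviour at time 0 and costs a factor 2. If y is positive at \<open>t\<close>,
  monotonicity keeps it positive before.\<close>

lemma sq_v_decay:
  assumes t: "0 < t"
  shows "(sq (v t))\<^sup>2 * t \<le> 2 * L1_cap ^ 4 / (1 - \<beta>)"
proof (cases "sq (v t) = 0")
  case True
  then show ?thesis using L1_cap_pos \<beta>_less by simp
next
  case False
  then have y0: "0 < sq (v t)" using sq_nonneg[of "v t"] by linarith
  define k where "k = (1 - \<beta>) / L1_cap ^ 4"
  have k: "0 < k" using \<beta>_less L1_cap_pos by (simp add: k_def)
  have pos: "0 < sq (v r)" if "0 < r" "r \<le> t" for r
  proof -
    have "sq (v t) \<le> sq (v r)"
      by (rule sq_v_decreasing[OF that])
    then show ?thesis using y0 by linarith
  qed
  have "inverse ((sq (v (t / 2)))\<^sup>2) - k * (t / 2) \<le> inverse ((sq (v t))\<^sup>2) - k * t"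
  proof (rule DERIV_nonneg_imp_nondecreasing[of "t / 2" t "\<lambda>r. inverse ((sq (v r))\<^sup>2) - k * r"])
    fix r assume "t / 2 \<le> r" "r \<le> t"
    then have r: "0 < r" "r \<le> t" using t by auto
    define y where "y = sq (v r)"
    have y: "0 < y" using pos[OF r] by (simp add: y_def)
    have "((\<lambda>r. (sq (v r))\<^sup>2) has_real_derivative 2 * y * (- 2 * energy r)) (at r)"
      unfolding y_def by (rule derivative_eq_intros sq_v_deriv[OF r(1)] refl | simp)+
    from DERIV_inverse'[OF this]
    have "((\<lambda>r. inverse ((sq (v r))\<^sup>2) - k * r) has_real_derivative
       - (inverse (y\<^sup>2) * (2 * y * (- 2 * energy r)) * inverse (y\<^sup>2)) - k * 1) (at r)"
      using y by (intro DERIV_diff DERIV_cmult DERIV_ident) (simp add: y_def)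
    moreover have "- (inverse (y\<^sup>2) * (2 * y * (- 2 * energy r)) * inverse (y\<^sup>2)) - k * 1 = 4 * energy r / y ^ 3 - k"
      using y by (simp add: field_simps power2_eq_square power3_eq_cube)
    moreover have "0 \<le> 4 * energy r / y ^ 3 - k"
    proof -
      have "k * y ^ 3 \<le> k * (4 * L1_cap ^ 4 / (1 - \<beta>) * energy r)"
        using nash[OF r(1)] k by (intro mult_left_mono) (auto simp: y_def)
      also have "\<dots> = 4 * energy r" using \<beta>_less L1_cap_pos by (simp add: k_def)
      finally show ?thesis using y by (simp add: field_simps)
    qed
    ultimately show "\<exists>z. ((\<lambda>r. inverse ((sq (v r))\<^sup>2) - k * r) has_real_derivative z) (at r) \<and> 0 \<le> z" by auto
  qed (use t in simp)
  moreover have "0 \<le> inverse ((sq (v (t / 2)))\<^sup>2)" by simp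
  moreover have "k * t - k * (t / 2) = k * t / 2" by simp
  ultimately have "k * t / 2 \<le> inverse ((sq (v t))\<^sup>2)" by linarith
  then have "(sq (v t))\<^sup>2 * (k * t / 2) \<le> 1" using y0 by (simp add: field_simps)
  then have "(sq (v t))\<^sup>2 * t \<le> 2 / k" using k by (simp add: field_simps)
  then show ?thesis by (simp add: k_def)
qed

text \<open>Two bounds on \<open>sq (vx t)\<close> enter, of order 1/t from the bound by
  \<open>sq u0\<close> and of order t^(-3/2) from the decay of \<open>sq (v t)\<close>; through
  \<open>v_sup_cube\<close> the cube root of each bounds the supremum. The rate t^(-1/3) is meant
  for small times, where t^(-1/2) would bound the L1 norm of v^3 only by a multiple of 1/t.\<close>

lemma decay:
  "\<exists>D\<ge>1. \<forall>t>0. (\<forall>x. \<bar>v t x\<bar> \<le> D * t powr (-1/2)) \<and> (\<forall>x. \<bar>v t x\<bar> \<le> D * t powr (-1/3))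
     \<and> sq (vx t) \<le> D * t powr (-3/2)"
proof -
  define E1 where "E1 = C2 * sq u0 / (1 - \<beta>)"
  define E2 where "E2 = C2 * sqrt (4 * L1_cap ^ 4 / (1 - \<beta>)) / (1 - \<beta>)"
  have C2: "0 < C2" by (simp add: C2_def)
  have E: "0 \<le> E1" "0 \<le> E2" using C2 \<beta>_less L1_cap_pos by (auto simp: E1_def E2_def)
  have vx: "sq (vx t) \<le> C2 / (1 - \<beta>) * (sq (v (t / 2)) / t)" if t: "0 < t" for t
  proof -
    have "sq (vx t) \<le> energy t / (1 - \<beta>)" using energy_bounds(1)[OF t] \<beta>_less by (simp add: field_simps)
    also have "\<dots> \<le> C2 * (sq (v (t / 2)) / t) / (1 - \<beta>)"
      using energy_decay[OF t] \<beta>_less by (intro divide_right_mono) auto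
    finally show ?thesis by (simp add: mult.commute)
  qed
  have b1: "sq (vx t) \<le> E1 * t powr (-1)" if t: "0 < t" for t
  proof -
    have "sq (v (t / 2)) / t \<le> sq u0 / t" using v_sq_bound[of "t / 2"] t by (intro divide_right_mono) auto
    then have "C2 / (1 - \<beta>) * (sq (v (t / 2)) / t) \<le> C2 / (1 - \<beta>) * (sq u0 / t)"
      using C2 \<beta>_less by (intro mult_left_mono) auto
    also have "\<dots> = E1 * t powr (-1)" using t by (simp add: E1_def powr_minus_divide)
    finally show ?thesis using vx[OF t] by linarith
  qed
  have b2: "sq (vx t) \<le> E2 * t powr (-3/2)" if t: "0 < t" for t
  proof -
    have "(sq (v (t / 2)))\<^sup>2 \<le> 4 * L1_cap ^ 4 / (1 - \<beta>) / t"
      using sq_v_decay[of "t / 2"] t by (subst pos_le_divide_eq) (auto simp: field_simps)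
    then have "sq (v (t / 2)) \<le> sqrt (4 * L1_cap ^ 4 / (1 - \<beta>) / t)" by (rule real_le_rsqrt)
    also have "\<dots> = sqrt (4 * L1_cap ^ 4 / (1 - \<beta>)) * t powr (-1/2)"
      using t by (simp add: real_sqrt_divide real_sqrt_mult powr_minus_divide powr_half_sqrt)
    finally have "sq (v (t / 2)) / t \<le> sqrt (4 * L1_cap ^ 4 / (1 - \<beta>)) * t powr (-1/2) / t"
      using t by (intro divide_right_mono) auto
    also have "t powr (-1/2) = t powr (-3/2) * t"
      using t powr_add[of t "-3/2" 1] by simp
    finally have "sq (v (t / 2)) / t \<le> sqrt (4 * L1_cap ^ 4 / (1 - \<beta>)) * t powr (-3/2)"
      using t by simp
    then have "C2 / (1 - \<beta>) * (sq (v (t / 2)) / t) \<le> C2 / (1 - \<beta>) * (sqrt (4 * L1_cap ^ 4 / (1 - \<beta>)) * t powr (-3/2))"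
      using C2 \<beta>_less by (intro mult_left_mono) auto
    also have "\<dots> = E2 * t powr (-3/2)" by (simp add: E2_def)
    finally show ?thesis using vx[OF t] by linarith
  qed
  have cube: "\<bar>v t x\<bar> \<le> root 3 (4 * L1_cap * e) * t powr r"
    if t: "0 < t" and e: "0 \<le> e" and le: "sq (vx t) \<le> e * t powr (3 * r)" for t x e r
  proof (rule power_le_imp_le_base[where n = 2])
    have p: "0 \<le> 4 * L1_cap * e" using e L1_cap_pos by simp
    have "\<bar>v t x\<bar> ^ 3 \<le> 4 * L1_cap * sq (vx t)" by (rule v_sup_cube[OF t])
    also have "\<dots> \<le> 4 * L1_cap * (e * t powr (3 * r))" using le L1_cap_pos by (intro mult_left_mono) auto
    also have "\<dots> = (root 3 (4 * L1_cap * e)) ^ 3 * (t powr r) ^ 3"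
    proof -
      have "(t powr r) ^ 3 = t powr (3 * r)" using t by (simp add: powr_power mult.commute)
      then show ?thesis using p by (simp add: mult.assoc)
    qed
    finally have "\<bar>v t x\<bar> ^ 3 \<le> (root 3 (4 * L1_cap * e) * t powr r) ^ 3"
      by (simp only: power_mult_distrib)
    then show "\<bar>v t x\<bar> ^ Suc 2 \<le> (root 3 (4 * L1_cap * e) * t powr r) ^ Suc 2"
      by (simp only: numeral_3_eq_3 numeral_2_eq_2)
    show "0 \<le> root 3 (4 * L1_cap * e) * t powr r" using p by simp
  qed
  define D where "D = 1 + E2 + root 3 (4 * L1_cap * E1) + root 3 (4 * L1_cap * E2)"
  have r: "0 \<le> root 3 (4 * L1_cap * E1)" "0 \<le> root 3 (4 * L1_cap * E2)" using E L1_cap_pos by auto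
  have D: "1 \<le> D" "E2 \<le> D" "root 3 (4 * L1_cap * E1) \<le> D" "root 3 (4 * L1_cap * E2) \<le> D" using E r by (auto simp: D_def)
  have up: "y \<le> D * t powr s" if "y \<le> e * t powr s" "e \<le> D" for y e t s
    using that mult_right_mono[OF that(2), of "t powr s"] by simp
  show ?thesis
  proof (intro exI[of _ D] conjI allI impI D(1))
    fix t :: real assume t: "0 < t"
    show "sq (vx t) \<le> D * t powr (-3/2)" by (rule up[OF b2[OF t] D(2)])
    fix x
    show "\<bar>v t x\<bar> \<le> D * t powr (-1/2)"
      using cube[OF t E(2), of "-1/2"] b2[OF t] by (intro up[OF _ D(4)]) simp
    show "\<bar>v t x\<bar> \<le> D * t powr (-1/3)"
      using cube[OF t E(1), of "-1/3"] b1[OF t] by (intro up[OF _ D(3)]) simp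
  qed
qed

end

subsection \<open>The heat kernel\<close>

definition Gx :: "real \<Rightarrow> real \<Rightarrow> real" where "Gx t x = - (x / (2 * t)) * G t x"
definition Gxx :: "real \<Rightarrow> real \<Rightarrow> real" where "Gxx t x = (x\<^sup>2 / (4 * t\<^sup>2) - 1 / (2 * t)) * G t x"
text \<open>By the heat equation this kernel and the next are the time derivatives of
  \<open>Gx\<close> and \<open>Gxx\<close>, and they occur in this role.\<close>

definition Gxxx :: "real \<Rightarrow> real \<Rightarrow> real" where "Gxxx t x = (3 * x / (4 * t\<^sup>2) - x ^ 3 / (8 * t ^ 3)) * G t x"
definition Gxxxx :: "real \<Rightarrow> real \<Rightarrow> real" where
  "Gxxxx t x = (3 / (4 * t\<^sup>2) - 3 * x\<^sup>2 / (4 * t ^ 3) + x ^ 4 / (16 * t ^ 4)) * G t x"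

lemma G_eq: "0 < t \<Longrightarrow> G t x = exp (- x\<^sup>2 / (4 * t)) / sqrt (4 * pi * t)"
  by (simp add: G_def powr_minus_divide powr_half_sqrt)

lemma G_nonneg [simp]: "0 \<le> G t x"
  by (simp add: G_def)

lemma G_minus: "G t (- x) = G t x"
  by (simp add: G_def)

lemma G_normal_density: "0 < t \<Longrightarrow> G t = normal_density 0 (sqrt (2 * t))"
  by (rule ext) (simp add: G_eq normal_density_def mult_ac)

lemma G_integrable: "0 < t \<Longrightarrow> integrable lborel (G t)"
  by (simp add: G_normal_density)

lemma G_integral: "0 < t \<Longrightarrow> (LINT x|lborel. G t x) = 1"
  by (simp add: G_normal_density)

lemma G_measurable2 [measurable]: "(\<lambda>(t, x). G t x) \<in> borel_measurable (borel \<Otimes>\<^sub>M borel)"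
  unfolding G_def by measurable

lemma Gx_measurable [measurable (raw)]:
  assumes "f \<in> borel_measurable M" "g \<in> borel_measurable M"
  shows "(\<lambda>w. Gx (f w) (g w)) \<in> borel_measurable M"
  using assms unfolding Gx_def by measurable

lemma Gxx_measurable [measurable (raw)]:
  assumes "f \<in> borel_measurable M" "g \<in> borel_measurable M"
  shows "(\<lambda>w. Gxx (f w) (g w)) \<in> borel_measurable M"
  using assms unfolding Gxx_def by measurable

lemma G_deriv_x: "0 < t \<Longrightarrow> (G t has_real_derivative Gx t x) (at x)"
proof -
  assume t: "0 < t"
  have "((\<lambda>x. exp (- x\<^sup>2 / (4 * t)) / sqrt (4 * pi * t)) has_real_derivative
    (exp (- x\<^sup>2 / (4 * t)) * (- (2 * x) / (4 * t))) / sqrt (4 * pi * t)) (at x)"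
    by (rule DERIV_cdivide) (rule derivative_eq_intros refl | use t in simp)+
  moreover have "G t = (\<lambda>x. exp (- x\<^sup>2 / (4 * t)) / sqrt (4 * pi * t))" using G_eq[OF t] by auto
  ultimately show ?thesis using t by (simp add: Gx_def field_simps)
qed

lemma G_deriv_t: "0 < t \<Longrightarrow> ((\<lambda>t. G t x) has_real_derivative Gxx t x) (at t)"
proof -
  assume t: "0 < t"
  define c where "c = sqrt (4 * pi)"
  have c: "0 < c" by (simp add: c_def)
  have "((\<lambda>t. exp (- x\<^sup>2 / (4 * t)) / (c * sqrt t)) has_real_derivative
    ((exp (- x\<^sup>2 / (4 * t)) * (x\<^sup>2 / (4 * t\<^sup>2))) * (c * sqrt t) - exp (- x\<^sup>2 / (4 * t)) * (c * (inverse (sqrt t) / 2))) / ((c * sqrt t) * (c * sqrt t))) (at t)"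
  proof (rule DERIV_divide)
    show "((\<lambda>t. exp (- x\<^sup>2 / (4 * t))) has_real_derivative exp (- x\<^sup>2 / (4 * t)) * (x\<^sup>2 / (4 * t\<^sup>2))) (at t)"
      using t by (auto intro!: derivative_eq_intros simp: field_simps power2_eq_square)
    show "((\<lambda>t. c * sqrt t) has_real_derivative c * (inverse (sqrt t) / 2)) (at t)"
      using t by (intro DERIV_cmult DERIV_real_sqrt)
  qed (use t c in simp)
  moreover have "((exp (- x\<^sup>2 / (4 * t)) * (x\<^sup>2 / (4 * t\<^sup>2))) * (c * sqrt t) - exp (- x\<^sup>2 / (4 * t)) * (c * (inverse (sqrt t) / 2))) / ((c * sqrt t) * (c * sqrt t))
     = Gxx t x"
  proof -
    define r where "r = sqrt t"
    have r: "0 < r" "t = r * r" using t by (auto simp: r_def)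
    define E where "E = exp (- x\<^sup>2 / (4 * t))"
    have "Gxx t x = (x\<^sup>2 / (4 * t\<^sup>2) - 1 / (2 * t)) * (E / (c * r))"
      using t by (simp add: Gxx_def G_eq E_def c_def r_def real_sqrt_mult)
    moreover have "((E * (x\<^sup>2 / (4 * t\<^sup>2))) * (c * r) - E * (c * (inverse r / 2))) / ((c * r) * (c * r))
      = (x\<^sup>2 / (4 * t\<^sup>2) - 1 / (2 * t)) * (E / (c * r))"
      using r c by (simp add: field_simps power2_eq_square)
    ultimately show ?thesis by (simp only: E_def r_def)
  qed
  ultimately have "((\<lambda>t. exp (- x\<^sup>2 / (4 * t)) / (c * sqrt t)) has_real_derivative Gxx t x) (at t)" by simp
  then show ?thesis
  proof (rule has_field_derivative_transform_within_open[where S = "{0<..}"])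
    fix s :: real assume "s \<in> {0<..}"
    then show "exp (- x\<^sup>2 / (4 * s)) / (c * sqrt s) = G s x" by (simp add: G_eq c_def real_sqrt_mult)
  qed (use t in auto)
qed

lemma Gx_deriv_x: "0 < t \<Longrightarrow> (Gx t has_real_derivative Gxx t x) (at x)"
proof -
  assume t: "0 < t"
  have "((\<lambda>x. - (x / (2 * t)) * G t x) has_real_derivative (- (1 / (2 * t)) * G t x + Gx t x * (- (x / (2 * t))))) (at x)"
    by (intro DERIV_mult[OF _ G_deriv_x[OF t]] DERIV_minus DERIV_cdivide DERIV_ident)
  moreover have "(- (1 / (2 * t)) * G t x + Gx t x * (- (x / (2 * t)))) = Gxx t x"
    using t by (simp add: Gx_def Gxx_def field_simps power2_eq_square)
  ultimately show ?thesis by (simp add: Gx_def[abs_def])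
qed

lemma Gx_deriv_t: "0 < t \<Longrightarrow> ((\<lambda>t. Gx t x) has_real_derivative Gxxx t x) (at t)"
proof -
  assume t: "0 < t"
  have d: "((\<lambda>t. - (x / (2 * t))) has_real_derivative x / (2 * t\<^sup>2)) (at t)"
    using t by (auto intro!: derivative_eq_intros simp: field_simps power2_eq_square)
  have "((\<lambda>t. - (x / (2 * t)) * G t x) has_real_derivative (x / (2 * t\<^sup>2) * G t x + Gxx t x * (- (x / (2 * t))))) (at t)"
    by (rule DERIV_mult[OF d G_deriv_t[OF t]])
  moreover have "(x / (2 * t\<^sup>2) * G t x + Gxx t x * (- (x / (2 * t)))) = Gxxx t x"
    using t by (simp add: Gxx_def Gxxx_def field_simps power2_eq_square power3_eq_cube)
  ultimately show ?thesis by (simp add: Gx_def[abs_def])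
qed

lemma Gxx_deriv_t: "0 < t \<Longrightarrow> ((\<lambda>t. Gxx t x) has_real_derivative Gxxxx t x) (at t)"
proof -
  assume t: "0 < t"
  have d: "((\<lambda>t. x\<^sup>2 / (4 * t\<^sup>2) - 1 / (2 * t)) has_real_derivative - x\<^sup>2 / (2 * t ^ 3) + 1 / (2 * t\<^sup>2)) (at t)"
    using t by (auto intro!: derivative_eq_intros simp: field_simps power2_eq_square power3_eq_cube)
  have "((\<lambda>t. (x\<^sup>2 / (4 * t\<^sup>2) - 1 / (2 * t)) * G t x) has_real_derivative
     ((- x\<^sup>2 / (2 * t ^ 3) + 1 / (2 * t\<^sup>2)) * G t x + Gxx t x * (x\<^sup>2 / (4 * t\<^sup>2) - 1 / (2 * t)))) (at t)"
    by (rule DERIV_mult[OF d G_deriv_t[OF t]])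
  moreover have "((- x\<^sup>2 / (2 * t ^ 3) + 1 / (2 * t\<^sup>2)) * G t x + Gxx t x * (x\<^sup>2 / (4 * t\<^sup>2) - 1 / (2 * t))) = Gxxxx t x"
  proof -
    have "(- x\<^sup>2 / (2 * t ^ 3) + 1 / (2 * t\<^sup>2)) + (x\<^sup>2 / (4 * t\<^sup>2) - 1 / (2 * t)) * (x\<^sup>2 / (4 * t\<^sup>2) - 1 / (2 * t))
      = 3 / (4 * t\<^sup>2) - 3 * x\<^sup>2 / (4 * t ^ 3) + x ^ 4 / (16 * t ^ 4)"
      using t by (simp add: field_simps power2_eq_square power3_eq_cube power4_eq_xxxx)
    then have "((- x\<^sup>2 / (2 * t ^ 3) + 1 / (2 * t\<^sup>2)) + (x\<^sup>2 / (4 * t\<^sup>2) - 1 / (2 * t)) * (x\<^sup>2 / (4 * t\<^sup>2) - 1 / (2 * t))) * G t x = Gxxxx t x"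
      by (simp add: Gxxxx_def)
    then show ?thesis by (simp add: Gxx_def algebra_simps)
  qed
  ultimately show ?thesis by (simp add: Gxx_def[abs_def])
qed

lemma G_le: "0 < t \<Longrightarrow> G t x \<le> t powr (-1/2)"
proof -
  assume t: "0 < t"
  have "1 \<le> 4 * pi" using pi_ge_two by linarith
  then have "t powr (1/2) \<le> (4 * pi * t) powr (1/2)" using t by (intro powr_mono2) auto
  then have "(4 * pi * t) powr (-1/2) \<le> t powr (-1/2)"
    using t by (simp add: powr_minus_divide frac_le)
  moreover have "exp (- x\<^sup>2 / (4 * t)) \<le> 1" using t by simp
  ultimately have "(4 * pi * t) powr (-1/2) * exp (- x\<^sup>2 / (4 * t)) \<le> t powr (-1/2) * 1"
    by (intro mult_mono) auto
  then show ?thesis by (simp add: G_def)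
qed

text \<open>Doubling the time leaves a spare factor exp(-r^2/8), r = |x| / sqrt t, which absorbs
  polynomials up to degree 4; its reciprocal \<open>e\<close> is bounded below by a Taylor
  polynomial. The constant 800 is 400 for the polynomial times 2 for sqrt 2.\<close>

lemma poly_gauss_bound:
  assumes t: "0 < t"
  shows "(1 + (\<bar>x\<bar> / sqrt t) + (\<bar>x\<bar> / sqrt t)\<^sup>2 + (\<bar>x\<bar> / sqrt t) ^ 3 + (\<bar>x\<bar> / sqrt t) ^ 4) * G t x \<le> 800 * G (2 * t) x"
proof -
  define r where "r = \<bar>x\<bar> / sqrt t"
  have r0: "0 \<le> r" using t by (simp add: r_def)
  have rx: "x\<^sup>2 = r\<^sup>2 * t" using t by (simp add: r_def power_divide)
  define e where "e = exp (r\<^sup>2 / 8)"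
  have e: "1 + r\<^sup>2 / 8 + (r\<^sup>2 / 8)\<^sup>2 / 2 \<le> e"
    unfolding e_def by (rule exp_lower_Taylor_quadratic) simp
  then have "1 + r\<^sup>2 / 8 + r ^ 4 / 128 \<le> e" by (simp add: power_divide power4_eq_xxxx power2_eq_square)
  moreover have "2 * r \<le> 1 + r\<^sup>2" using sum_squares_bound[of r 1] by (simp add: power2_eq_square)
  moreover have "2 * r ^ 3 \<le> r\<^sup>2 + r ^ 4" using sum_squares_bound[of r "r\<^sup>2"] by (simp add: power2_eq_square power3_eq_cube power4_eq_xxxx)
  moreover have "0 \<le> r\<^sup>2" "0 \<le> r ^ 4" by auto
  ultimately have p: "1 + r + r\<^sup>2 + r ^ 3 + r ^ 4 \<le> 400 * e" by linarith
  have "exp (- x\<^sup>2 / (4 * t)) * e = exp (- x\<^sup>2 / (4 * (2 * t)))"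
    unfolding e_def rx using t by (simp flip: exp_add add: field_simps)
  moreover have "sqrt 8 = 2 * sqrt 2" using real_sqrt_mult[of 4 2] by simp
  ultimately have ge: "G t x * e = sqrt 2 * G (2 * t) x"
    using t by (simp add: G_eq real_sqrt_mult field_simps)
  have "(1 + r + r\<^sup>2 + r ^ 3 + r ^ 4) * G t x \<le> (400 * e) * G t x"
    by (rule mult_right_mono[OF p]) simp
  also have "\<dots> = 400 * sqrt 2 * G (2 * t) x" using ge by (simp add: mult_ac)
  also have "\<dots> \<le> 800 * G (2 * t) x"
    using real_sqrt_le_mono[of 2 4] by (intro mult_right_mono) auto
  finally show ?thesis by (simp add: r_def)
qed

text \<open>In the variable r each kernel is G times a polynomial of degree at most 4 and the factor
  s^(-k), where s = sqrt t and k is the number of space derivatives. One bound for the sum of the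
  powers of r therefore serves all cases.\<close>

lemma kernel_bounds:
  assumes t: "0 < t"
  shows "\<bar>G t x\<bar> \<le> 800 * G (2 * t) x"
    and "\<bar>Gx t x\<bar> \<le> 800 * t powr (-1/2) * G (2 * t) x"
    and "\<bar>Gxx t x\<bar> \<le> 800 * t powr (-1) * G (2 * t) x"
    and "\<bar>Gxxx t x\<bar> \<le> 800 * t powr (-3/2) * G (2 * t) x"
    and "\<bar>Gxxxx t x\<bar> \<le> 800 * t powr (-2) * G (2 * t) x"
proof -
  define s where "s = sqrt t"
  have s: "0 < s" "t = s * s" using t by (auto simp: s_def)
  define r where "r = \<bar>x\<bar> / s"
  have r0: "0 \<le> r" and rx: "\<bar>x\<bar> = r * s" using s by (auto simp: r_def)
  have p: "t powr (-1/2) = 1 / s ^ 1" "t powr (-1) = 1 / s\<^sup>2" "t powr (-3/2) = 1 / s ^ 3" "t powr (-2) = 1 / s ^ 4"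
  proof -
    have "t powr a = s powr (2 * a)" for a using s by (simp add: powr_mult flip: powr_add)
    then show "t powr (-1/2) = 1 / s ^ 1" "t powr (-1) = 1 / s\<^sup>2" "t powr (-3/2) = 1 / s ^ 3" "t powr (-2) = 1 / s ^ 4"
      using s by (auto simp: powr_minus_divide powr_numeral power2_eq_square)
  qed
  have B: "(1 + r + r\<^sup>2 + r ^ 3 + r ^ 4) * G t x \<le> 800 * G (2 * t) x"
    using poly_gauss_bound[OF t, of x] by (simp add: r_def s_def)
  have main: "\<bar>c * G t x\<bar> \<le> 800 * (1 / s ^ k) * G (2 * t) x"
    if "\<bar>c\<bar> \<le> (1 + r + r\<^sup>2 + r ^ 3 + r ^ 4) * (1 / s ^ k)" for c k
  proof -
    have "\<bar>c * G t x\<bar> = \<bar>c\<bar> * G t x" by (simp add: abs_mult)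
    also have "\<dots> \<le> ((1 + r + r\<^sup>2 + r ^ 3 + r ^ 4) * (1 / s ^ k)) * G t x"
      using that by (rule mult_right_mono) simp
    also have "\<dots> = (1 / s ^ k) * ((1 + r + r\<^sup>2 + r ^ 3 + r ^ 4) * G t x)" by simp
    also have "\<dots> \<le> (1 / s ^ k) * (800 * G (2 * t) x)" using B s by (intro mult_left_mono) auto
    finally show ?thesis by (simp add: mult_ac)
  qed
  have nn: "0 \<le> r\<^sup>2" "0 \<le> r ^ 3" "0 \<le> r ^ 4" using r0 by auto
  show "\<bar>G t x\<bar> \<le> 800 * G (2 * t) x"
    using main[of 1 0] nn r0 by simp
  have "\<bar>- (x / (2 * t))\<bar> = (r / 2) * (1 / s ^ 1)"
    using s rx by (simp add: abs_mult abs_divide)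
  also have "\<dots> \<le> (1 + r + r\<^sup>2 + r ^ 3 + r ^ 4) * (1 / s ^ 1)"
    using s nn r0 by (intro mult_right_mono) auto
  finally show "\<bar>Gx t x\<bar> \<le> 800 * t powr (-1/2) * G (2 * t) x"
    unfolding p Gx_def by (rule main)
  have x2: "x\<^sup>2 = r\<^sup>2 * s\<^sup>2" using rx power2_abs[of x] by (metis power_mult_distrib)
  have "\<bar>x\<^sup>2 / (4 * t\<^sup>2) - 1 / (2 * t)\<bar> = \<bar>r\<^sup>2 / 4 - 1 / 2\<bar> * (1 / s\<^sup>2)"
  proof -
    have "x\<^sup>2 / (4 * t\<^sup>2) - 1 / (2 * t) = (r\<^sup>2 / 4 - 1 / 2) * (1 / s\<^sup>2)"
      unfolding x2 using s by (simp add: field_simps power2_eq_square)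
    then show ?thesis by (simp add: abs_mult)
  qed
  also have "\<dots> \<le> (1 + r + r\<^sup>2 + r ^ 3 + r ^ 4) * (1 / s\<^sup>2)"
  proof (rule mult_right_mono)
    show "\<bar>r\<^sup>2 / 4 - 1 / 2\<bar> \<le> 1 + r + r\<^sup>2 + r ^ 3 + r ^ 4" using nn r0 by (intro abs_leI) linarith+
  qed simp
  finally show "\<bar>Gxx t x\<bar> \<le> 800 * t powr (-1) * G (2 * t) x"
    unfolding p Gxx_def by (rule main)
  have "\<bar>3 * x / (4 * t\<^sup>2) - x ^ 3 / (8 * t ^ 3)\<bar> = \<bar>x\<bar> * \<bar>3 / (4 * t\<^sup>2) - x\<^sup>2 / (8 * t ^ 3)\<bar>"
    by (subst abs_mult[symmetric]) (simp add: right_diff_distrib power2_eq_square power3_eq_cube)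
  also have "\<dots> = (r * s) * (\<bar>3 / 4 - r\<^sup>2 / 8\<bar> * (1 / s ^ 4))"
  proof -
    have "3 / (4 * t\<^sup>2) - x\<^sup>2 / (8 * t ^ 3) = (3 / 4 - r\<^sup>2 / 8) * (1 / s ^ 4)"
      unfolding x2 using s by (simp add: field_simps power2_eq_square power3_eq_cube power4_eq_xxxx)
    then show ?thesis using rx s by (simp add: abs_mult)
  qed
  also have "\<dots> = (r * \<bar>3 / 4 - r\<^sup>2 / 8\<bar>) * (1 / s ^ 3)"
    using s by (simp add: power4_eq_xxxx power3_eq_cube)
  also have "\<dots> \<le> (1 + r + r\<^sup>2 + r ^ 3 + r ^ 4) * (1 / s ^ 3)"
  proof (rule mult_right_mono)
    have "\<bar>3 / 4 - r\<^sup>2 / 8\<bar> \<le> 3 / 4 + r\<^sup>2 / 8" using nn by (intro abs_leI) linarith+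
    then have "r * \<bar>3 / 4 - r\<^sup>2 / 8\<bar> \<le> r * (3 / 4 + r\<^sup>2 / 8)" using r0 by (intro mult_left_mono)
    also have "\<dots> = 3 / 4 * r + r ^ 3 / 8" by (simp add: algebra_simps power2_eq_square power3_eq_cube)
    finally show "r * \<bar>3 / 4 - r\<^sup>2 / 8\<bar> \<le> 1 + r + r\<^sup>2 + r ^ 3 + r ^ 4" using nn r0 by linarith
  qed (use s in simp)
  finally show "\<bar>Gxxx t x\<bar> \<le> 800 * t powr (-3/2) * G (2 * t) x"
    unfolding p Gxxx_def by (rule main)
  have x4: "x ^ 4 = r ^ 4 * s ^ 4" using x2 by (simp add: power4_eq_xxxx power2_eq_square)
  have "\<bar>3 / (4 * t\<^sup>2) - 3 * x\<^sup>2 / (4 * t ^ 3) + x ^ 4 / (16 * t ^ 4)\<bar> = \<bar>3 / 4 - 3 * r\<^sup>2 / 4 + r ^ 4 / 16\<bar> * (1 / s ^ 4)"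
  proof -
    have "3 / (4 * t\<^sup>2) - 3 * x\<^sup>2 / (4 * t ^ 3) + x ^ 4 / (16 * t ^ 4) = (3 / 4 - 3 * r\<^sup>2 / 4 + r ^ 4 / 16) * (1 / s ^ 4)"
      unfolding x2 x4 using s by (simp add: field_simps power2_eq_square power3_eq_cube power4_eq_xxxx)
    then show ?thesis by (simp add: abs_mult)
  qed
  also have "\<dots> \<le> (1 + r + r\<^sup>2 + r ^ 3 + r ^ 4) * (1 / s ^ 4)"
  proof (rule mult_right_mono)
    show "\<bar>3 / 4 - 3 * r\<^sup>2 / 4 + r ^ 4 / 16\<bar> \<le> 1 + r + r\<^sup>2 + r ^ 3 + r ^ 4" using nn r0 by (intro abs_leI) linarith+
  qed simp
  finally show "\<bar>Gxxxx t x\<bar> \<le> 800 * t powr (-2) * G (2 * t) x"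
    unfolding p Gxxxx_def by (rule main)
qed

text \<open>Enlarging the time increases the exponential, and the normalising factor loses at most
  sqrt 4 = 2.\<close>

lemma G_le_double:
  assumes "0 < t" "t \<le> s" "s \<le> 4 * t"
  shows "G t z \<le> 2 * G s z"
proof -
  have "exp (- z\<^sup>2 / (4 * t)) \<le> exp (- z\<^sup>2 / (4 * s))"
    using assms by (auto simp: frac_le)
  moreover have "1 / sqrt (4 * pi * t) \<le> 2 / sqrt (4 * pi * s)"
  proof -
    have "sqrt (4 * pi * s) \<le> sqrt (4 * (4 * pi * t))" using assms by (intro real_sqrt_le_mono) auto
    also have "\<dots> = 2 * sqrt (4 * pi * t)" by (simp only: real_sqrt_mult) simp
    finally show ?thesis using assms by (simp add: field_simps)
  qed
  ultimately have "exp (- z\<^sup>2 / (4 * t)) * (1 / sqrt (4 * pi * t)) \<le> exp (- z\<^sup>2 / (4 * s)) * (2 / sqrt (4 * pi * s))"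
    using assms by (intro mult_mono) auto
  then show ?thesis using assms by (simp add: G_eq mult.commute)
qed

text \<open>A shift by at most sqrt t is absorbed by doubling the time once more, through x^2 \<le>
  2 (x - y)^2 + 2 y^2. The remaining bounded exponential costs at most 3, the normalisation at most
  2.\<close>

lemma G_shift:
  assumes "0 < t" "\<bar>y\<bar> \<le> sqrt t"
  shows "G (2 * t) (x - y) \<le> 8 * G (4 * t) x"
proof -
  have y: "y\<^sup>2 \<le> t" using assms real_sqrt_le_iff[of "y\<^sup>2" t] by simp
  have "x\<^sup>2 \<le> 2 * (x - y)\<^sup>2 + 2 * y\<^sup>2"
    using zero_le_power2[of "x - 2 * y"] by (simp add: power2_eq_square algebra_simps)
  then have "x\<^sup>2 \<le> 2 * (x - y)\<^sup>2 + 2 * t" using y by linarith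
  then have "- (x - y)\<^sup>2 / (8 * t) \<le> 1 + (- x\<^sup>2 / (16 * t))"
    using assms(1) by (simp add: field_simps)
  then have "exp (- (x - y)\<^sup>2 / (8 * t)) \<le> exp 1 * exp (- x\<^sup>2 / (16 * t))"
    by (simp flip: exp_add)
  also have "\<dots> \<le> 3 * exp (- x\<^sup>2 / (16 * t))" using exp_le by (intro mult_right_mono) auto
  finally have e: "exp (- (x - y)\<^sup>2 / (8 * t)) \<le> 3 * exp (- x\<^sup>2 / (16 * t))" .
  have "sqrt (4 * pi * (4 * t)) \<le> sqrt (4 * (4 * pi * (2 * t)))" using assms by (intro real_sqrt_le_mono) auto
  also have "\<dots> = 2 * sqrt (4 * pi * (2 * t))" by (simp only: real_sqrt_mult) simp
  finally have "1 / sqrt (4 * pi * (2 * t)) \<le> 2 / sqrt (4 * pi * (4 * t))"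
    using assms by (simp add: field_simps)
  with e have "exp (- (x - y)\<^sup>2 / (8 * t)) * (1 / sqrt (4 * pi * (2 * t))) \<le> (3 * exp (- x\<^sup>2 / (16 * t))) * (2 / sqrt (4 * pi * (4 * t)))"
    using assms by (intro mult_mono) auto
  also have "\<dots> \<le> 8 * (exp (- x\<^sup>2 / (16 * t)) / sqrt (4 * pi * (4 * t)))"
    using assms by (simp add: field_simps)
  finally show ?thesis using assms by (simp add: G_eq)
qed

section \<open>Increments of the heat kernel in space and time\<close>

text \<open>Relative size of a kernel increment: linear in the shift up to the diffusive length sqrt
  t, bounded beyond it. For fixed \<open>y\<close> it tends to 0 as \<open>t\<close> grows, which is
  the smallness that dominated convergence exploits.\<close>

definition cutoff :: "real \<Rightarrow> real \<Rightarrow> real" where "cutoff t y = min 1 (\<bar>y\<bar> / sqrt t)"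
text \<open>Common majorant of the kernel increments. Its space integral 2 and its supremum bound 2
  t^(-1/2) are independent of \<open>y\<close>.\<close>

definition heat_pair :: "real \<Rightarrow> real \<Rightarrow> real \<Rightarrow> real" where "heat_pair t y x = G (4 * t) (x - y) + G (4 * t) x"

lemma cutoff_bounds: "0 < t \<Longrightarrow> 0 \<le> cutoff t y" "cutoff t y \<le> 1" "cutoff t y \<le> \<bar>y\<bar> / sqrt t"
  by (auto simp: cutoff_def)

lemma heat_pair_nonneg [simp]: "0 \<le> heat_pair t y x"
  by (simp add: heat_pair_def)

text \<open>The segment from x to x - y stays within distance sqrt t of x, so \<open>G_shift\<close>
  bounds the derivative on all of it by a single Gaussian at x.\<close>

lemma kernel_diff_small:
  assumes t: "0 < t" and f: "\<And>w. (f has_real_derivative f' w) (at w)"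
    and f': "\<And>w. \<bar>f' w\<bar> \<le> c * t powr (-1/2) * G (2 * t) w" and c: "0 \<le> c" and y: "\<bar>y\<bar> \<le> sqrt t"
  shows "\<bar>f (x - y) - f x\<bar> \<le> 8 * c * (\<bar>y\<bar> / sqrt t) * G (4 * t) x"
proof -
  have "norm (f (x - y) - f x) \<le> (c * t powr (-1/2) * (8 * G (4 * t) x)) * norm ((x - y) - x)"
  proof (rule field_differentiable_bound[of "closed_segment x (x - y)" f f'])
    fix w assume w: "w \<in> closed_segment x (x - y)"
    show "(f has_field_derivative f' w) (at w within closed_segment x (x - y))"
      using f by (rule has_field_derivative_at_within)
    have "\<bar>x - w\<bar> \<le> sqrt t" using segment_bound1[OF w] y by simp
    from G_shift[OF t this, of x] have "G (2 * t) w \<le> 8 * G (4 * t) x" by simp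
    then have "c * t powr (-1/2) * G (2 * t) w \<le> c * t powr (-1/2) * (8 * G (4 * t) x)"
      using c by (intro mult_left_mono) auto
    then show "norm (f' w) \<le> c * t powr (-1/2) * (8 * G (4 * t) x)" using f'[of w] by simp
  qed auto
  moreover have "t powr (-1/2) = 1 / sqrt t" using t by (simp add: powr_minus_divide powr_half_sqrt)
  ultimately show ?thesis by (simp add: mult_ac)
qed

lemma G2_le_heat_pair:
  assumes "0 < t"
  shows "G (2 * t) x \<le> 2 * heat_pair t y x" "G (2 * t) (x - y) \<le> 2 * heat_pair t y x" "G (2 * t) (x - y) + G (2 * t) x \<le> 2 * heat_pair t y x"
proof -
  have "G (2 * t) z \<le> 2 * G (4 * t) z" for z by (rule G_le_double) (use assms in auto)
  note g = this
  have h: "2 * G (4 * t) x + 2 * G (4 * t) (x - y) = 2 * heat_pair t y x" by (simp add: heat_pair_def)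
  have n: "0 \<le> 2 * G (4 * t) z" for z by simp
  show "G (2 * t) x \<le> 2 * heat_pair t y x" unfolding h[symmetric] by (rule add_increasing2[OF n g])
  show "G (2 * t) (x - y) \<le> 2 * heat_pair t y x" unfolding h[symmetric] by (rule add_increasing[OF n g])
  show "G (2 * t) (x - y) + G (2 * t) x \<le> 2 * heat_pair t y x"
    unfolding h[symmetric] using add_mono[OF g g, of x "x - y"] by (simp only: add.commute)
qed

lemma kernel_diff:
  assumes t: "0 < t" and f: "\<And>w. (f has_real_derivative f' w) (at w)"
    and f': "\<And>w. \<bar>f' w\<bar> \<le> c * t powr (-1/2) * G (2 * t) w" and f0: "\<And>w. \<bar>f w\<bar> \<le> c * G (2 * t) w" and c: "0 \<le> c"
  shows "\<bar>f (x - y) - f x\<bar> \<le> 8 * c * cutoff t y * heat_pair t y x"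
proof (cases "\<bar>y\<bar> \<le> sqrt t")
  case True
  then have cutoff: "cutoff t y = \<bar>y\<bar> / sqrt t" using t by (simp add: cutoff_def)
  have "\<bar>f (x - y) - f x\<bar> \<le> 8 * c * (\<bar>y\<bar> / sqrt t) * G (4 * t) x"
    by (rule kernel_diff_small[OF t f f' c True])
  also have "\<dots> \<le> 8 * c * (\<bar>y\<bar> / sqrt t) * heat_pair t y x"
    using c t by (intro mult_left_mono) (auto simp: heat_pair_def)
  finally show ?thesis by (simp add: cutoff)
next
  case False
  then have cutoff: "cutoff t y = 1" using t by (simp add: cutoff_def)
  have "\<bar>f (x - y) - f x\<bar> \<le> c * (G (2 * t) (x - y) + G (2 * t) x)"
    using f0[of x] f0[of "x - y"] by (simp add: distrib_left)
  also have "\<dots> \<le> c * (8 * heat_pair t y x)"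
    using G2_le_heat_pair(3)[OF t, of x y] c by (intro mult_left_mono) (auto intro: order_trans)
  finally show ?thesis by (simp add: cutoff)
qed

lemma G_diff:
  assumes t: "0 < t" shows "\<bar>G t (x - y) - G t x\<bar> \<le> 6400 * cutoff t y * heat_pair t y x"
proof -
  have "\<bar>G t (x - y) - G t x\<bar> \<le> 8 * 800 * cutoff t y * heat_pair t y x"
    by (rule kernel_diff[OF t G_deriv_x[OF t] kernel_bounds(2)[OF t]])
       (use kernel_bounds(1)[OF t] in auto)
  then show ?thesis by simp
qed

lemma Gxx_bound:
  fixes t :: real
  assumes t: "0 < t" shows "\<bar>Gxx t w\<bar> \<le> 800 * t powr (-1/2) * t powr (-1/2) * G (2 * t) w"
proof -
  have "t powr (-1/2) * t powr (-1/2) = t powr (-1)" by (simp flip: powr_add)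
  then have "800 * t powr (-1/2) * t powr (-1/2) * G (2 * t) w = 800 * t powr (-1) * G (2 * t) w"
    by (simp only: mult.assoc)
  then show ?thesis using kernel_bounds(3)[OF t, of w] by linarith
qed

lemma Gx_diff:
  assumes t: "0 < t" shows "\<bar>Gx t (x - y) - Gx t x\<bar> \<le> 6400 * t powr (-1/2) * cutoff t y * heat_pair t y x"
proof -
  have "\<bar>Gx t (x - y) - Gx t x\<bar> \<le> 8 * (800 * t powr (-1/2)) * cutoff t y * heat_pair t y x"
    by (rule kernel_diff[OF t Gx_deriv_x[OF t] Gxx_bound[OF t] kernel_bounds(2)[OF t]]) simp
  then show ?thesis by simp
qed

text \<open>The Taylor remainder is quadratic in y for |y| \<le> sqrt t. Beyond that 1 \<le> |y|
  t^(-1/2), and the three terms are bounded separately. The form |y| * \<open>cutoff t y\<close> is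
  at most |y|, so a first moment of the initial value dominates it.\<close>

lemma G_diff2:
  assumes t: "0 < t"
  shows "\<bar>G t (x - y) - G t x + y * Gx t x\<bar> \<le> 6400 * t powr (-1/2) * \<bar>y\<bar> * cutoff t y * heat_pair t y x"
proof (cases "\<bar>y\<bar> \<le> sqrt t")
  case True
  then have cutoff: "cutoff t y = \<bar>y\<bar> / sqrt t" using t by (simp add: cutoff_def)
  define L where "L = 6400 * t powr (-1/2) * (\<bar>y\<bar> / sqrt t) * G (4 * t) x"
  have "norm ((G t (x - y) + y * Gx t x) - (G t (x - 0) + 0 * Gx t x)) \<le> L * norm (y - 0)"
  proof (rule field_differentiable_bound[of "closed_segment 0 y" "\<lambda>w. G t (x - w) + w * Gx t x" "\<lambda>w. - Gx t (x - w) + Gx t x"])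
    fix w assume w: "w \<in> closed_segment 0 y"
    have "((\<lambda>w. G t (x - w)) has_real_derivative Gx t (x - w) * (-1)) (at w)"
      by (rule DERIV_chain2[OF G_deriv_x[OF t]]) (auto intro!: derivative_eq_intros)
    then have "((\<lambda>w. G t (x - w) + w * Gx t x) has_field_derivative Gx t (x - w) * (-1) + 1 * Gx t x) (at w)"
      by (intro DERIV_add DERIV_cmult_right DERIV_ident)
    then have "((\<lambda>w. G t (x - w) + w * Gx t x) has_field_derivative - Gx t (x - w) + Gx t x) (at w)"
      by simp
    then show "((\<lambda>w. G t (x - w) + w * Gx t x) has_field_derivative - Gx t (x - w) + Gx t x) (at w within closed_segment 0 y)"
      by (rule has_field_derivative_at_within)
    have wy: "\<bar>w\<bar> \<le> \<bar>y\<bar>" using segment_bound1[OF w] by simp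
    have "\<bar>Gx t (x - w) - Gx t x\<bar> \<le> 8 * (800 * t powr (-1/2)) * (\<bar>w\<bar> / sqrt t) * G (4 * t) x"
      by (rule kernel_diff_small[OF t Gx_deriv_x[OF t] Gxx_bound[OF t]]) (use True wy in auto)
    also have "\<dots> \<le> L" unfolding L_def using wy t
      by (simp add: divide_right_mono mult_right_mono mult_left_mono)
    finally show "norm (- Gx t (x - w) + Gx t x) \<le> L" by (simp add: abs_minus_commute)
  qed auto
  also have "L * norm (y - 0) \<le> 6400 * t powr (-1/2) * \<bar>y\<bar> * cutoff t y * heat_pair t y x"
  proof -
    have "L * norm (y - 0) = 6400 * t powr (-1/2) * \<bar>y\<bar> * cutoff t y * G (4 * t) x" by (simp add: L_def cutoff)
    also have "\<dots> \<le> 6400 * t powr (-1/2) * \<bar>y\<bar> * cutoff t y * heat_pair t y x"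
      using cutoff_bounds(1)[OF t] by (intro mult_left_mono) (auto simp: heat_pair_def)
    finally show ?thesis .
  qed
  finally show ?thesis by (simp add: algebra_simps)
next
  case False
  then have cutoff: "cutoff t y = 1" using t by (simp add: cutoff_def)
  have sp: "t powr (-1/2) = 1 / sqrt t" using t by (simp add: powr_minus_divide powr_half_sqrt)
  have y1: "1 \<le> t powr (-1/2) * \<bar>y\<bar>" using False t unfolding sp by (simp add: field_simps)
  have "\<bar>G t (x - y)\<bar> + \<bar>G t x\<bar> \<le> 800 * (G (2 * t) (x - y) + G (2 * t) x)"
    using kernel_bounds(1)[OF t, of x] kernel_bounds(1)[OF t, of "x - y"] by (simp add: distrib_left)
  also have "\<dots> \<le> 800 * (2 * heat_pair t y x)" using G2_le_heat_pair(3)[OF t, of x y] by simp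
  also have "\<dots> \<le> (t powr (-1/2) * \<bar>y\<bar>) * (1600 * heat_pair t y x)"
    using mult_right_mono[OF y1, of "1600 * heat_pair t y x"] by simp
  finally have 1: "\<bar>G t (x - y)\<bar> + \<bar>G t x\<bar> \<le> (t powr (-1/2) * \<bar>y\<bar>) * (1600 * heat_pair t y x)" .
  have "\<bar>y * Gx t x\<bar> \<le> \<bar>y\<bar> * (800 * t powr (-1/2) * (2 * heat_pair t y x))"
  proof -
    have "800 * t powr (-1/2) * G (2 * t) x \<le> 800 * t powr (-1/2) * (2 * heat_pair t y x)"
      using G2_le_heat_pair(1)[OF t, of x y] by (intro mult_left_mono) auto
    then have "\<bar>Gx t x\<bar> \<le> 800 * t powr (-1/2) * (2 * heat_pair t y x)"
      using kernel_bounds(2)[OF t, of x] by linarith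
    then show ?thesis unfolding abs_mult by (intro mult_left_mono) auto
  qed
  then have 2: "\<bar>y * Gx t x\<bar> \<le> (t powr (-1/2) * \<bar>y\<bar>) * (1600 * heat_pair t y x)" by (simp add: mult_ac)
  have "\<bar>G t (x - y) - G t x + y * Gx t x\<bar> \<le> (t powr (-1/2) * \<bar>y\<bar>) * (1600 * heat_pair t y x) + (t powr (-1/2) * \<bar>y\<bar>) * (1600 * heat_pair t y x)"
    using 1 2 by linarith
  also have "\<dots> = 3200 * ((t powr (-1/2) * \<bar>y\<bar>) * heat_pair t y x)" by simp
  also have "\<dots> \<le> 6400 * ((t powr (-1/2) * \<bar>y\<bar>) * heat_pair t y x)" by (intro mult_right_mono) auto
  finally show ?thesis by (simp add: cutoff mult_ac)
qed

text \<open>For s \<le> t/2 the mean value theorem in time stays within [t/2, t], where powers of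
  the time and Gaussians are comparable with those at \<open>t\<close>.\<close>

lemma Gx_time_diff:
  assumes t: "0 < t" and s: "0 \<le> s" "s \<le> t / 2"
  shows "\<bar>Gx (t - s) z - Gx t z\<bar> \<le> 12800 * t powr (-1/2) * (s / t) * G (4 * t) z"
proof -
  define L where "L = 12800 * t powr (-3/2) * G (4 * t) z"
  have "norm (Gx (t - s) z - Gx t z) \<le> L * norm ((t - s) - t)"
  proof (rule field_differentiable_bound[of "closed_segment t (t - s)" "\<lambda>t. Gx t z" "\<lambda>t. Gxxx t z"])
    fix r assume "r \<in> closed_segment t (t - s)"
    then have r: "t / 2 \<le> r" "r \<le> t" using s by (auto simp: closed_segment_eq_real_ivl split: if_splits)
    then have r0: "0 < r" using t by linarith
    show "((\<lambda>t. Gx t z) has_field_derivative Gxxx r z) (at r within closed_segment t (t - s))"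
      using Gx_deriv_t[OF r0] by (rule has_field_derivative_at_within)
    have g: "G (2 * r) z \<le> 2 * G (4 * t) z" by (rule G_le_double) (use r t in auto)
    have "r powr (-3/2) \<le> (t / 2) powr (-3/2)" using r t by (intro powr_mono2') auto
    also have "\<dots> = t powr (-3/2) * 2 powr (3/2)" using t by (simp add: powr_divide powr_minus_divide)
    also have "\<dots> \<le> t powr (-3/2) * 2 powr 2" by (intro mult_left_mono powr_mono) auto
    finally have p: "r powr (-3/2) \<le> 4 * t powr (-3/2)" by (simp add: powr_numeral)
    have "800 * r powr (-3/2) * G (2 * r) z \<le> (800 * (4 * t powr (-3/2))) * (2 * G (4 * t) z)"
      using p g by (intro mult_mono) auto
    also have "\<dots> \<le> L" unfolding L_def by (simp add: mult_right_mono)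
    finally show "norm (Gxxx r z) \<le> L" using kernel_bounds(4)[OF r0, of z] by simp
  qed auto
  also have "L * norm ((t - s) - t) = 12800 * t powr (-1/2) * (s / t) * G (4 * t) z"
  proof -
    have "t powr (-1/2) = t powr (-3/2) * t" using t powr_add[of t "-3/2" 1] by simp
    then show ?thesis using t s by (simp add: L_def)
  qed
  finally show ?thesis by simp
qed

lemma Gx_space_time_diff:
  assumes t: "0 < t" and s: "0 \<le> s" "s \<le> t / 2"
  shows "\<bar>Gx (t - s) (x - y) - Gx t x\<bar> \<le> 12800 * t powr (-1/2) * (s / t + cutoff t y) * heat_pair t y x"
proof -
  have "\<bar>Gx (t - s) (x - y) - Gx t (x - y)\<bar> \<le> 12800 * t powr (-1/2) * (s / t) * G (4 * t) (x - y)"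
    by (rule Gx_time_diff[OF t s])
  also have "\<dots> \<le> 12800 * t powr (-1/2) * (s / t) * heat_pair t y x"
    using t s by (intro mult_left_mono) (auto simp: heat_pair_def)
  finally have 1: "\<bar>Gx (t - s) (x - y) - Gx t (x - y)\<bar> \<le> 12800 * t powr (-1/2) * (s / t) * heat_pair t y x" .
  have "6400 * (t powr (-1/2) * cutoff t y * heat_pair t y x) \<le> 12800 * (t powr (-1/2) * cutoff t y * heat_pair t y x)"
    using cutoff_bounds(1)[OF t] by (intro mult_right_mono) auto
  then have 2: "\<bar>Gx t (x - y) - Gx t x\<bar> \<le> 12800 * t powr (-1/2) * cutoff t y * heat_pair t y x"
    using Gx_diff[OF t, of x y] by (simp add: mult_ac)
  show ?thesis using 1 2 by (simp add: distrib_left distrib_right)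
qed

lemma Gx_sup: "0 < t \<Longrightarrow> \<bar>Gx t x\<bar> \<le> 800 * t powr (-1)"
proof -
  assume t: "0 < t"
  have "G (2 * t) x \<le> (2 * t) powr (-1/2)" using t by (intro G_le) auto
  also have "\<dots> \<le> t powr (-1/2)" using t by (intro powr_mono2') auto
  finally have "800 * t powr (-1/2) * G (2 * t) x \<le> 800 * t powr (-1/2) * t powr (-1/2)"
    by (intro mult_left_mono) auto
  moreover have "t powr (-1/2) * t powr (-1/2) = t powr (-1)" by (simp flip: powr_add)
  ultimately show ?thesis using kernel_bounds(2)[OF t, of x] by (simp only: mult.assoc)
qed

lemma Gx_integrable: "0 < t \<Longrightarrow> integrable lborel (Gx t)"
  by (rule integrable_le[of "\<lambda>x. 800 * t powr (-1/2) * G (2 * t) x"])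
     (use kernel_bounds(2)[of t] G_integrable[of "2 * t"] in auto)

lemma Gx_L1: "0 < t \<Longrightarrow> (LINT x|lborel. \<bar>Gx t x\<bar>) \<le> 800 * t powr (-1/2)"
proof -
  assume t: "0 < t"
  have "(LINT x|lborel. \<bar>Gx t x\<bar>) \<le> (LINT x|lborel. 800 * t powr (-1/2) * G (2 * t) x)"
    by (rule integral_mono) (use t kernel_bounds(2)[OF t] G_integrable[of "2 * t"] Gx_integrable in auto)
  also have "\<dots> = 800 * t powr (-1/2)" using t G_integral[of "2 * t"] by simp
  finally show ?thesis .
qed

lemma G_L2: "0 < t \<Longrightarrow> L2 (G t)"
  using L2_bounded_integrable(1)[OF G_integrable, of t "t powr (-1/2)"] G_le[of t] by simp

lemma integrable_reflect:
  fixes f :: "real \<Rightarrow> real"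
  assumes "integrable lborel f" shows "integrable lborel (\<lambda>y. f (x - y))"
  using lborel_integrable_real_affine[OF assms, of "-1" x] by simp

lemma integral_reflect:
  fixes f :: "real \<Rightarrow> real"
  shows "(LINT y|lborel. f (x - y)) = (LINT y|lborel. f y)"
  using lborel_integral_real_affine[of "-1" f x] by simp

lemma L2_reflect: "L2 f \<Longrightarrow> L2 (\<lambda>y. f (x - y))"
  unfolding L2_def using integrable_reflect[of "\<lambda>y. (f y)\<^sup>2" x] by auto

lemma G_convolution:
  assumes "0 < s" "0 < t"
  shows "Defs.convolution (G s) (G t) x = G (s + t) x"
proof -
  have sq: "sqrt ((sqrt (2 * s))\<^sup>2 + (sqrt (2 * t))\<^sup>2) = sqrt (2 * (s + t))" using assms by simp
  have "(\<integral>\<^sup>+y. ennreal (G s (x - y) * G t y) \<partial>lborel) = ennreal (G (s + t) x)"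
    using fun_cong[OF conv_normal_density_zero_mean[of "sqrt (2 * s)" "sqrt (2 * t)"], of x] assms
    by (simp add: G_normal_density sq)
  moreover have "Defs.convolution (G s) (G t) x = enn2real (\<integral>\<^sup>+y. ennreal (G s (x - y) * G t y) \<partial>lborel)"
    unfolding Defs.convolution_def by (rule integral_eq_nn_integral) auto
  ultimately show ?thesis by simp
qed

lemma G_cube: "0 < s \<Longrightarrow> (G s y) ^ 3 = \<alpha>\<^sub>1 / s * G (s / 3) y"
proof -
  assume s: "0 < s"
  define X where "X = sqrt (4 * pi * (s / 3))"
  define E where "E = exp (- y\<^sup>2 / (4 * (s / 3)))"
  have X: "0 < X" using s by (simp add: X_def)
  have "(exp (- y\<^sup>2 / (4 * s))) ^ 3 = E"
    unfolding E_def by (simp flip: exp_of_nat_mult)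
  moreover have "(sqrt (4 * pi * s)) ^ 3 = 4 * pi * s * sqrt (4 * pi * s)"
    using s by (simp add: power3_eq_cube)
  moreover have "sqrt (4 * pi * s) = sqrt 3 * X" unfolding X_def by (simp flip: real_sqrt_mult)
  ultimately have 1: "(G s y) ^ 3 = E / (4 * pi * s * (sqrt 3 * X))"
    using s by (simp only: G_eq power_divide)
  have 2: "\<alpha>\<^sub>1 = 1 / (4 * pi * sqrt 3)"
    by (simp add: \<alpha>\<^sub>1_def powr_minus_divide powr_half_sqrt)
  have 3: "G (s / 3) y = E / X" using s by (simp add: G_eq E_def X_def)
  show ?thesis unfolding 1 2 3 by simp
qed

text \<open>Both errors are controlled by one fixed Gaussian, so the kernel is a differentiable
  curve in L2; this is what differentiating its pairing with the solution requires.\<close>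

lemma G_time_expansion:
  assumes t: "0 < t" and s: "\<bar>s - t\<bar> \<le> t / 2"
  shows "\<bar>G s z - G t z - (s - t) * Gxx t z\<bar> \<le> 6400 * t powr (-2) * (s - t)\<^sup>2 * G (4 * t) z"
    and "\<bar>G s z - G t z\<bar> \<le> 3200 * t powr (-1) * \<bar>s - t\<bar> * G (4 * t) z"
proof -
  have rng: "t / 2 \<le> r \<and> r \<le> 3 * t / 2 \<and> \<bar>r - t\<bar> \<le> \<bar>s - t\<bar>" if "r \<in> closed_segment t s" for r
    using that s by (auto simp: closed_segment_eq_real_ivl split: if_splits)
  have g: "G (2 * r) z \<le> 2 * G (4 * t) z" if "r \<in> closed_segment t s" for r
    by (rule G_le_double) (use rng[OF that] t in auto)
  have p: "r powr (- real k) \<le> 2 ^ k * t powr (- real k)" if "r \<in> closed_segment t s" for r k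
  proof -
    have "r powr (- real k) \<le> (t / 2) powr (- real k)" using rng[OF that] t by (intro powr_mono2') auto
    also have "\<dots> = 2 ^ k * t powr (- real k)" using t by (simp add: powr_divide powr_minus_divide powr_realpow)
    finally show ?thesis .
  qed
  show 1: "\<bar>G s z - G t z\<bar> \<le> 3200 * t powr (-1) * \<bar>s - t\<bar> * G (4 * t) z"
  proof -
    have "norm (G s z - G t z) \<le> (3200 * t powr (-1) * G (4 * t) z) * norm (s - t)"
    proof (rule field_differentiable_bound[of "closed_segment t s" "\<lambda>t. G t z" "\<lambda>t. Gxx t z"])
      fix r assume r: "r \<in> closed_segment t s"
      have r0: "0 < r" using rng[OF r] t by linarith
      show "((\<lambda>t. G t z) has_field_derivative Gxx r z) (at r within closed_segment t s)"
        using G_deriv_t[OF r0] by (rule has_field_derivative_at_within)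
      have "800 * r powr (-1) * G (2 * r) z \<le> (800 * (2 * t powr (-1))) * (2 * G (4 * t) z)"
        using p[OF r, of 1] g[OF r] by (intro mult_mono) auto
      then show "norm (Gxx r z) \<le> 3200 * t powr (-1) * G (4 * t) z"
        using kernel_bounds(3)[OF r0, of z] by simp
    qed auto
    then show ?thesis by (simp add: mult_ac)
  qed
  have xx: "\<bar>Gxx r z - Gxx t z\<bar> \<le> 6400 * t powr (-2) * \<bar>s - t\<bar> * G (4 * t) z" if rr: "r \<in> closed_segment t s" for r
  proof -
    have sub: "closed_segment t r \<subseteq> closed_segment t s" using rr by (simp add: subset_closed_segment)
    have "norm (Gxx r z - Gxx t z) \<le> (6400 * t powr (-2) * G (4 * t) z) * norm (r - t)"
    proof (rule field_differentiable_bound[of "closed_segment t r" "\<lambda>t. Gxx t z" "\<lambda>t. Gxxxx t z"])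
      fix w assume "w \<in> closed_segment t r"
      then have w: "w \<in> closed_segment t s" using sub by blast
      have w0: "0 < w" using rng[OF w] t by linarith
      show "((\<lambda>t. Gxx t z) has_field_derivative Gxxxx w z) (at w within closed_segment t r)"
        using Gxx_deriv_t[OF w0] by (rule has_field_derivative_at_within)
      have "800 * w powr (-2) * G (2 * w) z \<le> (800 * (4 * t powr (-2))) * (2 * G (4 * t) z)"
        using p[OF w, of 2] g[OF w] by (intro mult_mono) auto
      then show "norm (Gxxxx w z) \<le> 6400 * t powr (-2) * G (4 * t) z"
        using kernel_bounds(5)[OF w0, of z] by simp
    qed auto
    also have "\<dots> \<le> (6400 * t powr (-2) * G (4 * t) z) * norm (s - t)"
      using rng[OF rr] by (intro mult_left_mono) auto
    finally show ?thesis by (simp add: mult_ac)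
  qed
  have "norm ((G s z - s * Gxx t z) - (G t z - t * Gxx t z)) \<le> (6400 * t powr (-2) * \<bar>s - t\<bar> * G (4 * t) z) * norm (s - t)"
  proof (rule field_differentiable_bound[of "closed_segment t s" "\<lambda>r. G r z - r * Gxx t z" "\<lambda>r. Gxx r z - Gxx t z"])
    fix r assume r: "r \<in> closed_segment t s"
    have r0: "0 < r" using rng[OF r] t by linarith
    have "((\<lambda>r. G r z - r * Gxx t z) has_field_derivative Gxx r z - 1 * Gxx t z) (at r)"
      by (intro DERIV_diff DERIV_cmult_right DERIV_ident G_deriv_t r0)
    then have "((\<lambda>r. G r z - r * Gxx t z) has_field_derivative Gxx r z - Gxx t z) (at r)" by simp
    then show "((\<lambda>r. G r z - r * Gxx t z) has_field_derivative Gxx r z - Gxx t z) (at r within closed_segment t s)"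
      by (rule has_field_derivative_at_within)
    show "norm (Gxx r z - Gxx t z) \<le> 6400 * t powr (-2) * \<bar>s - t\<bar> * G (4 * t) z" using xx[OF r] by simp
  qed auto
  moreover have "(G s z - s * Gxx t z) - (G t z - t * Gxx t z) = G s z - G t z - (s - t) * Gxx t z" by (simp add: algebra_simps)
  moreover have "(6400 * t powr (-2) * \<bar>s - t\<bar> * G (4 * t) z) * norm (s - t) = 6400 * t powr (-2) * (\<bar>s - t\<bar> * \<bar>s - t\<bar>) * G (4 * t) z"
    by (simp only: real_norm_def mult_ac)
  moreover have "\<bar>s - t\<bar> * \<bar>s - t\<bar> = (s - t)\<^sup>2" by (simp add: power2_eq_square)
  ultimately show "\<bar>G s z - G t z - (s - t) * Gxx t z\<bar> \<le> 6400 * t powr (-2) * (s - t)\<^sup>2 * G (4 * t) z"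
    by (simp only: real_norm_def)
qed

subsection \<open>Heat potentials\<close>

lemma powr_has_integral:
  assumes "- 1 < a" "0 < (t::real)"
  shows "set_integrable lborel {0<..<t} (\<lambda>s. s powr a)" "(LINT s:{0<..<t}|lborel. s powr a) = t powr (a + 1) / (a + 1)"
proof -
  have h: "((\<lambda>x. x powr a) has_integral (t powr (a + 1) / (a + 1))) {0..t}"
    using has_integral_powr_from_0[OF assms(1), of t] assms(2) by simp
  then have h': "((\<lambda>x. x powr a) has_integral (t powr (a + 1) / (a + 1))) {0<..<t}"
    by (subst has_integral_Icc_iff_Ioo[symmetric])
  then have "(\<lambda>x. x powr a) absolutely_integrable_on {0<..<t}"
    by (intro nonnegative_absolutely_integrable_1) (auto simp: integrable_on_def)
  then have si: "set_integrable lebesgue {0<..<t} (\<lambda>x. x powr a)" .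
  then show i: "set_integrable lborel {0<..<t} (\<lambda>s. s powr a)"
    unfolding set_integrable_def by (subst (asm) integrable_completion) auto
  show "(LINT s:{0<..<t}|lborel. s powr a) = t powr (a + 1) / (a + 1)"
    using set_borel_integral_eq_integral(2)[OF i] h' by (simp add: integral_unique)
qed

lemma powr_reflect_integrable:
  assumes "- 1 < a" "0 < (t::real)"
  shows "set_integrable lborel {0<..<t} (\<lambda>s. (t - s) powr a)"
proof -
  have "integrable lborel (\<lambda>s. indicator {0<..<t} s *\<^sub>R s powr a)"
    using powr_has_integral(1)[OF assms] by (simp add: set_integrable_def)
  from integrable_reflect[OF this, of t]
  have "integrable lborel (\<lambda>s. indicator {0<..<t} (t - s) *\<^sub>R (t - s) powr a)" .
  moreover have "indicator {0<..<t} (t - s) = (indicator {0<..<t} s :: real)" for s by (auto simp: indicator_def)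
  ultimately show ?thesis by (simp add: set_integrable_def)
qed

text \<open>Here the source is integrable and the kernel bounded; in \<open>conv_bounds_sup\<close>
  it is the reverse. Potentials use the first at times far from the final time and the second close
  to it, where the supremum of \<open>Gx\<close> is not integrable in time but its L1 norm
  is.\<close>

lemma conv_bounds:
  fixes f k :: "real \<Rightarrow> real"
  assumes f: "integrable lborel f" and k: "k \<in> borel_measurable borel" "\<And>z. \<bar>k z\<bar> \<le> c"
  shows "integrable lborel (\<lambda>y. k (x - y) * f y)" "\<bar>LINT y|lborel. k (x - y) * f y\<bar> \<le> c * (LINT y|lborel. \<bar>f y\<bar>)"
proof -
  have [measurable]: "f \<in> borel_measurable borel" "k \<in> borel_measurable borel" using f k by auto
  have b: "\<bar>k (x - y) * f y\<bar> \<le> c * \<bar>f y\<bar>" for y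
    unfolding abs_mult by (rule mult_right_mono[OF k(2)]) simp
  show i: "integrable lborel (\<lambda>y. k (x - y) * f y)"
    by (rule integrable_le[of "\<lambda>y. c * \<bar>f y\<bar>"]) (use f b in auto)
  have "\<bar>LINT y|lborel. k (x - y) * f y\<bar> \<le> (LINT y|lborel. \<bar>k (x - y) * f y\<bar>)" by (rule integral_abs_bound)
  also have "\<dots> \<le> (LINT y|lborel. c * \<bar>f y\<bar>)" by (rule integral_mono) (use i f b in auto)
  finally show "\<bar>LINT y|lborel. k (x - y) * f y\<bar> \<le> c * (LINT y|lborel. \<bar>f y\<bar>)" by simp
qed

lemma conv_bounds_sup:
  fixes f k :: "real \<Rightarrow> real"
  assumes k: "integrable lborel k" and f: "f \<in> borel_measurable borel" "\<And>z. \<bar>f z\<bar> \<le> c"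
  shows "integrable lborel (\<lambda>y. k (x - y) * f y)" "\<bar>LINT y|lborel. k (x - y) * f y\<bar> \<le> c * (LINT y|lborel. \<bar>k y\<bar>)"
proof -
  have [measurable]: "f \<in> borel_measurable borel" "k \<in> borel_measurable borel" using f k by auto
  have b: "\<bar>k (x - y) * f y\<bar> \<le> c * \<bar>k (x - y)\<bar>" for y
    unfolding abs_mult using mult_left_mono[OF f(2)[of y], of "\<bar>k (x - y)\<bar>"] by (simp add: mult.commute)
  have ik: "integrable lborel (\<lambda>y. c * \<bar>k (x - y)\<bar>)" using integrable_reflect[OF k, of x] by simp
  show i: "integrable lborel (\<lambda>y. k (x - y) * f y)"
    by (rule integrable_le[OF ik _ b]) auto
  have "\<bar>LINT y|lborel. k (x - y) * f y\<bar> \<le> (LINT y|lborel. \<bar>k (x - y) * f y\<bar>)" by (rule integral_abs_bound)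
  also have "\<dots> \<le> (LINT y|lborel. c * \<bar>k (x - y)\<bar>)" by (rule integral_mono) (use i ik b in auto)
  also have "\<dots> = c * (LINT y|lborel. \<bar>k y\<bar>)" using integral_reflect[of "\<lambda>y. \<bar>k y\<bar>" x] by simp
  finally show "\<bar>LINT y|lborel. k (x - y) * f y\<bar> \<le> c * (LINT y|lborel. \<bar>k y\<bar>)" .
qed

lemma conv_G_deriv:
  assumes t: "0 < t" and f: "integrable lborel f"
  shows "((\<lambda>x. LINT y|lborel. G t (x - y) * f y) has_real_derivative (LINT y|lborel. Gx t (x - y) * f y)) (at x)"
proof -
  define c where "c = 800 * t powr (-1) * (2 * t) powr (-1/2)"
  have cG: "\<bar>Gxx t w\<bar> \<le> c" for w
  proof -
    have "800 * t powr (-1) * G (2 * t) w \<le> c" unfolding c_def using t by (intro mult_left_mono G_le) auto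
    then show ?thesis using kernel_bounds(3)[OF t, of w] by linarith
  qed
  have quad: "\<bar>(G t (w + h) - G t w) / h - Gx t w\<bar> \<le> c * \<bar>h\<bar>" if "h \<noteq> 0" for w h
  proof -
    have lip: "\<bar>Gx t z - Gx t w\<bar> \<le> c * \<bar>z - w\<bar>" for z
      using field_differentiable_bound[of UNIV "Gx t" "Gxx t" c z w] Gx_deriv_x[OF t] cG by simp
    have "norm ((G t (w + h) - (w + h) * Gx t w) - (G t w - w * Gx t w)) \<le> (c * \<bar>h\<bar>) * norm ((w + h) - w)"
    proof (rule field_differentiable_bound[of "closed_segment w (w + h)" "\<lambda>z. G t z - z * Gx t w" "\<lambda>z. Gx t z - Gx t w"])
      fix z assume z: "z \<in> closed_segment w (w + h)"
      have "((\<lambda>z. G t z - z * Gx t w) has_real_derivative Gx t z - 1 * Gx t w) (at z)"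
        by (intro DERIV_diff G_deriv_x t DERIV_cmult_right DERIV_ident)
      then have "((\<lambda>z. G t z - z * Gx t w) has_real_derivative Gx t z - Gx t w) (at z)" by simp
      then show "((\<lambda>z. G t z - z * Gx t w) has_field_derivative Gx t z - Gx t w) (at z within closed_segment w (w + h))"
        by (rule has_field_derivative_at_within)
      have c0: "0 \<le> c" by (simp add: c_def)
      have "\<bar>z - w\<bar> \<le> \<bar>h\<bar>" using segment_bound1[OF z] by simp
      then show "norm (Gx t z - Gx t w) \<le> c * \<bar>h\<bar>" using lip[of z] mult_left_mono[OF _ c0, of "\<bar>z - w\<bar>" "\<bar>h\<bar>"] by simp
    qed auto
    moreover have "(G t (w + h) - (w + h) * Gx t w) - (G t w - w * Gx t w) = h * ((G t (w + h) - G t w) / h - Gx t w)"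
      using that by (simp add: field_simps)
    ultimately have "\<bar>h\<bar> * \<bar>(G t (w + h) - G t w) / h - Gx t w\<bar> \<le> \<bar>h\<bar> * (c * \<bar>h\<bar>)"
      by (simp add: abs_mult mult_ac)
    then show ?thesis using that by simp
  qed
  have mG [measurable]: "G t \<in> borel_measurable borel" "Gx t \<in> borel_measurable borel" by auto
  have iG: "integrable lborel (\<lambda>y. G t (x - y) * f y)" for x
    by (rule conv_bounds(1)[OF f, where c = "t powr (-1/2)"]) (use G_le[OF t] in auto)
  have iGx: "integrable lborel (\<lambda>y. Gx t (x - y) * f y)" for x
    by (rule conv_bounds(1)[OF f, where c = "800 * t powr (-1)"]) (use Gx_sup[OF t] in auto)
  have "((\<lambda>h. ((LINT y|lborel. G t (x + h - y) * f y) - (LINT y|lborel. G t (x - y) * f y)) / h - (LINT y|lborel. Gx t (x - y) * f y)) \<longlongrightarrow> 0) (at 0)"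
  proof (rule Lim_null_comparison)
    have "((\<lambda>h. c * \<bar>h\<bar> * (LINT y|lborel. \<bar>f y\<bar>)) \<longlongrightarrow> c * \<bar>0\<bar> * (LINT y|lborel. \<bar>f y\<bar>)) (at 0)"
      by (intro tendsto_intros)
    then show "((\<lambda>h. c * \<bar>h\<bar> * (LINT y|lborel. \<bar>f y\<bar>)) \<longlongrightarrow> 0) (at 0)" by simp
    show "\<forall>\<^sub>F h in at 0. norm (((LINT y|lborel. G t (x + h - y) * f y) - (LINT y|lborel. G t (x - y) * f y)) / h - (LINT y|lborel. Gx t (x - y) * f y))
        \<le> c * \<bar>h\<bar> * (LINT y|lborel. \<bar>f y\<bar>)"
      unfolding eventually_at_filter
    proof (intro always_eventually allI impI)
      fix h :: real assume h: "h \<noteq> 0"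
      define k where "k = (\<lambda>w. (G t (w + h) - G t w) / h - Gx t w)"
      have [measurable]: "k \<in> borel_measurable borel" unfolding k_def by measurable
      have "((LINT y|lborel. G t (x + h - y) * f y) - (LINT y|lborel. G t (x - y) * f y)) / h - (LINT y|lborel. Gx t (x - y) * f y)
         = (LINT y|lborel. (G t (x + h - y) * f y - G t (x - y) * f y) / h - Gx t (x - y) * f y)"
        using iG[of "x + h"] iG[of x] iGx[of x] by simp
      also have "\<dots> = (LINT y|lborel. k (x - y) * f y)"
        by (intro Bochner_Integration.integral_cong) (auto simp: k_def field_simps h add_diff_eq diff_add_eq)
      finally have eq: "((LINT y|lborel. G t (x + h - y) * f y) - (LINT y|lborel. G t (x - y) * f y)) / h - (LINT y|lborel. Gx t (x - y) * f y) = (LINT y|lborel. k (x - y) * f y)" .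
      show "norm (((LINT y|lborel. G t (x + h - y) * f y) - (LINT y|lborel. G t (x - y) * f y)) / h - (LINT y|lborel. Gx t (x - y) * f y)) \<le> c * \<bar>h\<bar> * (LINT y|lborel. \<bar>f y\<bar>)"
        unfolding eq real_norm_def by (rule conv_bounds(2)[OF f]) (use quad[OF h] in \<open>auto simp: k_def\<close>)
    qed
  qed
  then show ?thesis unfolding DERIV_def by (rule LIM_zero_cancel)
qed

text \<open>The semigroup law for \<open>G\<close> is differentiated in x.\<close>

lemma Gx_convolution:
  assumes "0 < s" "0 < t"
  shows "(LINT y|lborel. Gx s (x - y) * G t y) = Gx (s + t) x"
proof -
  have "(\<lambda>x. LINT y|lborel. G s (x - y) * G t y) = G (s + t)"
    using G_convolution[OF assms] by (auto simp: Defs.convolution_def)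
  then have "(G (s + t) has_real_derivative (LINT y|lborel. Gx s (x - y) * G t y)) (at x)"
    using conv_G_deriv[OF assms(1) G_integrable[OF assms(2)], of x] by simp
  then show ?thesis using G_deriv_x[of "s + t" x] assms by (meson DERIV_unique add_pos_pos)
qed

text \<open>By the mean value theorem the majorant of the derivative also bounds the difference
  quotients, so dominated convergence applies along every sequence tending to x.\<close>

lemma set_integral_has_real_derivative:
  fixes J J' :: "real \<Rightarrow> real \<Rightarrow> real"
  assumes S: "S \<in> sets borel"
    and dJ: "\<And>s x. s \<in> S \<Longrightarrow> (J s has_real_derivative J' s x) (at x)"
    and kernel_majorant: "\<And>s x. s \<in> S \<Longrightarrow> \<bar>J' s x\<bar> \<le> w s" "set_integrable lborel S w"
    and iJ: "\<And>x. set_integrable lborel S (\<lambda>s. J s x)"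
    and mJ': "\<And>x. (\<lambda>s. J' s x) \<in> borel_measurable borel"
  shows "((\<lambda>x. LINT s:S|lborel. J s x) has_real_derivative (LINT s:S|lborel. J' s x)) (at x)"
proof -
  note [measurable] = S mJ'
  have lip: "\<bar>(J s y - J s x) / (y - x)\<bar> \<le> w s" if s: "s \<in> S" for s x y
  proof -
    have "norm (J s y - J s x) \<le> w s * norm (y - x)"
      by (rule field_differentiable_bound[of UNIV "J s" "J' s"]) (use dJ[OF s] kernel_majorant(1)[OF s] in auto)
    moreover have "0 \<le> w s" using kernel_majorant(1)[OF s, of 0] by (rule order_trans[OF abs_ge_zero])
    ultimately show ?thesis by (cases "y = x") (auto simp: abs_divide divide_le_eq)
  qed
  have iJ': "integrable lborel (\<lambda>s. indicator S s * J s x)" for x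
    using iJ[of x] by (simp add: set_integrable_def)
  have "((\<lambda>y. ((LINT s:S|lborel. J s y) - (LINT s:S|lborel. J s x)) / (y - x)) \<longlongrightarrow> (LINT s:S|lborel. J' s x)) (at x)"
    unfolding tendsto_at_iff_sequentially comp_def
  proof (intro allI impI)
    fix X :: "nat \<Rightarrow> real" assume X: "\<forall>i. X i \<in> UNIV - {x}" "X \<longlonglongrightarrow> x"
    have eq: "indicator S s * ((J s (X n) - J s x) / (X n - x)) = (indicator S s * J s (X n) - indicator S s * J s x) / (X n - x)" for s n
      by (auto simp: algebra_simps diff_divide_distrib)
    have "(\<lambda>n. LINT s|lborel. indicator S s * ((J s (X n) - J s x) / (X n - x))) \<longlonglongrightarrow> (LINT s|lborel. indicator S s * J' s x)"
    proof (rule integral_dominated_convergence[where w = "\<lambda>s. indicator S s * w s"])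
      show "integrable lborel (\<lambda>s. indicator S s * w s)" using kernel_majorant(2) by (simp add: set_integrable_def)
      show "AE s in lborel. (\<lambda>n. indicator S s * ((J s (X n) - J s x) / (X n - x))) \<longlonglongrightarrow> indicator S s * J' s x"
      proof (rule AE_I2)
        fix s
        show "(\<lambda>n. indicator S s * ((J s (X n) - J s x) / (X n - x))) \<longlonglongrightarrow> indicator S s * J' s x"
        proof (cases "s \<in> S")
          case True
          then have "((\<lambda>y. (J s y - J s x) / (y - x)) \<longlongrightarrow> J' s x) (at x)"
            using dJ[of s x] by (simp add: has_field_derivative_iff)
          then have "(\<lambda>n. (J s (X n) - J s x) / (X n - x)) \<longlonglongrightarrow> J' s x"
            using X unfolding tendsto_at_iff_sequentially comp_def by blast
          then show ?thesis using True by simp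
        qed simp
      qed
      show "AE s in lborel. norm (indicator S s * ((J s (X n) - J s x) / (X n - x))) \<le> indicator S s * w s" for n
        using lip by (intro AE_I2) (auto simp: indicator_def)
      show "(\<lambda>s. indicator S s * ((J s (X n) - J s x) / (X n - x))) \<in> borel_measurable lborel" for n
        unfolding eq by (intro borel_measurable_divide borel_measurable_diff borel_measurable_const borel_measurable_integrable iJ')
    qed measurable
    moreover have "(LINT s|lborel. indicator S s * ((J s (X n) - J s x) / (X n - x)))
        = ((LINT s:S|lborel. J s (X n)) - (LINT s:S|lborel. J s x)) / (X n - x)" for n
      unfolding eq using iJ' by (simp add: set_lebesgue_integral_def)
    moreover have "(LINT s|lborel. indicator S s * J' s x) = (LINT s:S|lborel. J' s x)" by (simp add: set_lebesgue_integral_def)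
    ultimately show "(\<lambda>n. ((LINT s:S|lborel. J s (X n)) - (LINT s:S|lborel. J s x)) / (X n - x)) \<longlonglongrightarrow> (LINT s:S|lborel. J' s x)"
      by (simp only:)
  qed
  then show ?thesis by (simp add: has_field_derivative_iff)
qed

section \<open>Potentials of admissible sources\<close>

text \<open>The two ends of the time interval are treated differently: near 0 the L1 norm may blow
  up at an integrable rate, and near \<open>t\<close> a supremum bound compensates the singular
  kernel. The constant \<open>c\<close> may depend on \<open>t\<close>; it serves integrability and
  differentiability, never a decay rate.\<close>

locale source =
  fixes h :: "real \<Rightarrow> real \<Rightarrow> real" and A t c :: real
  assumes h_meas: "(\<lambda>(s, y). h s y) \<in> borel_measurable (borel \<Otimes>\<^sub>M borel)"
    and t_pos: "0 < t"
    and h_int: "\<And>s. 0 < s \<Longrightarrow> s < t \<Longrightarrow> integrable lborel (h s)"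
    and h_L1: "\<And>s. 0 < s \<Longrightarrow> s < t \<Longrightarrow> (LINT y|lborel. \<bar>h s y\<bar>) \<le> A * s powr (-3/4)"
    and h_sup: "\<And>s y. t / 2 \<le> s \<Longrightarrow> s < t \<Longrightarrow> \<bar>h s y\<bar> \<le> c"

text \<open>\<open>potx\<close> is the Duhamel term of the source d/dx h with the derivative moved
  onto the kernel. Its antiderivative \<open>pot\<close> is needed because \<open>Phi_star\<close>
  differentiates after integrating.\<close>

definition pot :: "(real \<Rightarrow> real \<Rightarrow> real) \<Rightarrow> real \<Rightarrow> real \<Rightarrow> real" where
  "pot h t x = (LINT s:{0<..<t}|lborel. (LINT y|lborel. G (t - s) (x - y) * h s y))"

definition potx :: "(real \<Rightarrow> real \<Rightarrow> real) \<Rightarrow> real \<Rightarrow> real \<Rightarrow> real" where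
  "potx h t x = (LINT s:{0<..<t}|lborel. (LINT y|lborel. Gx (t - s) (x - y) * h s y))"

context source
begin

lemma h_measurable [measurable (raw)]:
  assumes "f \<in> borel_measurable M" "g \<in> borel_measurable M"
  shows "(\<lambda>w. h (f w) (g w)) \<in> borel_measurable M"
  using measurable_compose[OF measurable_Pair[OF assms] h_meas] by simp

lemma A_nonneg: "0 \<le> A"
proof -
  have "0 \<le> (LINT y|lborel. \<bar>h (t / 2) y\<bar>)" by simp
  also have "\<dots> \<le> A * (t / 2) powr (-3/4)" by (rule h_L1) (use t_pos in auto)
  finally show ?thesis using t_pos by (simp add: zero_le_mult_iff)
qed

lemma c_nonneg: "0 \<le> c" using h_sup[of "t / 2" 0] t_pos by (auto intro: order_trans[OF abs_ge_zero])

text \<open>Sum of the bounds for the kernels \<open>G\<close> and \<open>Gx\<close> on both halves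
  of the time interval, so that one integrable function dominates all four cases.\<close>

definition kernel_majorant :: "real \<Rightarrow> real" where
  "kernel_majorant s = (1600 / t * A + 2 * A / sqrt t) * s powr (-3/4) + (800 * c + c * 2 / sqrt t) * (t - s) powr (-1/2) + c"

lemma kernel_majorant_integrable: "set_integrable lborel {0<..<t} kernel_majorant"
  unfolding kernel_majorant_def
  using powr_has_integral(1)[of "-3/4" t] powr_reflect_integrable[of "-1/2" t] t_pos
  by (intro set_integral_add set_integrable_mult_right) (auto simp: set_integrable_def integrable_indicator_iff)

lemma kernels_le_kernel_majorant:
  assumes s: "0 < s" "s < t"
  shows "\<bar>LINT y|lborel. Gx (t - s) (x - y) * h s y\<bar> \<le> kernel_majorant s" "\<bar>LINT y|lborel. G (t - s) (x - y) * h s y\<bar> \<le> kernel_majorant s"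
    "integrable lborel (\<lambda>y. Gx (t - s) (x - y) * h s y)" "integrable lborel (\<lambda>y. G (t - s) (x - y) * h s y)"
proof -
  have ts: "0 < t - s" using s by simp
  have [measurable]: "h s \<in> borel_measurable borel" by measurable
  show "integrable lborel (\<lambda>y. Gx (t - s) (x - y) * h s y)"
    by (rule conv_bounds(1)[OF h_int[OF s], where c = "800 * (t - s) powr (-1)"]) (use Gx_sup[OF ts] in auto)
  show "integrable lborel (\<lambda>y. G (t - s) (x - y) * h s y)"
    by (rule conv_bounds(1)[OF h_int[OF s], where c = "(t - s) powr (-1/2)"]) (use G_le[OF ts] in auto)
  have st: "0 < sqrt t" using t_pos by simp
  have nn: "0 \<le> (1600 / t * A) * s powr (-3/4)" "0 \<le> 2 * A / sqrt t * s powr (-3/4)" "0 \<le> 800 * c * (t - s) powr (-1/2)"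
    "0 \<le> c * 2 / sqrt t * (t - s) powr (-1/2)"
    using A_nonneg c_nonneg t_pos st by auto
  have kernel_majorant: "kernel_majorant s = 1600 / t * A * s powr (-3/4) + 2 * A / sqrt t * s powr (-3/4) + 800 * c * (t - s) powr (-1/2)
     + c * 2 / sqrt t * (t - s) powr (-1/2) + c"
    by (simp add: kernel_majorant_def algebra_simps)
  show "\<bar>LINT y|lborel. Gx (t - s) (x - y) * h s y\<bar> \<le> kernel_majorant s"
  proof (cases "s < t / 2")
    case True
    have "\<bar>LINT y|lborel. Gx (t - s) (x - y) * h s y\<bar> \<le> (800 * (t - s) powr (-1)) * (LINT y|lborel. \<bar>h s y\<bar>)"
      by (rule conv_bounds(2)[OF h_int[OF s]]) (use Gx_sup[OF ts] in auto)
    also have "\<dots> \<le> (800 * (2 / t)) * (A * s powr (-3/4))"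
    proof (intro mult_mono mult_left_mono h_L1 s)
      have "t \<le> 2 * (t - s)" using True by simp
      then show "(t - s) powr (-1) \<le> 2 / t" using ts t_pos by (simp add: powr_minus_divide field_simps)
    qed (use t_pos in auto)
    also have "\<dots> = 1600 / t * A * s powr (-3/4)" by simp
    finally show ?thesis unfolding kernel_majorant using nn c_nonneg by linarith
  next
    case False
    have "\<bar>LINT y|lborel. Gx (t - s) (x - y) * h s y\<bar> \<le> c * (LINT y|lborel. \<bar>Gx (t - s) y\<bar>)"
      by (rule conv_bounds_sup(2)[OF Gx_integrable[OF ts]]) (use h_sup False s in auto)
    also have "\<dots> \<le> c * (800 * (t - s) powr (-1/2))" by (rule mult_left_mono[OF Gx_L1[OF ts] c_nonneg])
    finally show ?thesis unfolding kernel_majorant using nn c_nonneg by linarith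
  qed
  show "\<bar>LINT y|lborel. G (t - s) (x - y) * h s y\<bar> \<le> kernel_majorant s"
  proof (cases "s < t / 2")
    case True
    have "\<bar>LINT y|lborel. G (t - s) (x - y) * h s y\<bar> \<le> ((t - s) powr (-1/2)) * (LINT y|lborel. \<bar>h s y\<bar>)"
      by (rule conv_bounds(2)[OF h_int[OF s]]) (use G_le[OF ts] in auto)
    also have "\<dots> \<le> (2 / sqrt t) * (A * s powr (-3/4))"
    proof (intro mult_mono h_L1 s)
      have "(t - s) powr (-1/2) \<le> (t / 4) powr (-1/2)" using True t_pos by (intro powr_mono2') auto
      also have "\<dots> = 2 / sqrt t" using t_pos by (simp add: powr_minus_divide powr_half_sqrt real_sqrt_divide)
      finally show "(t - s) powr (-1/2) \<le> 2 / sqrt t" .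
    qed (use t_pos in auto)
    also have "\<dots> = 2 * A / sqrt t * s powr (-3/4)" by simp
    finally show ?thesis unfolding kernel_majorant using nn c_nonneg by linarith
  next
    case False
    have "\<bar>LINT y|lborel. G (t - s) (x - y) * h s y\<bar> \<le> c * (LINT y|lborel. \<bar>G (t - s) y\<bar>)"
      by (rule conv_bounds_sup(2)[OF G_integrable[OF ts]]) (use h_sup False s in auto)
    also have "\<dots> = c" using G_integral[OF ts] by simp
    finally show ?thesis unfolding kernel_majorant using nn by linarith
  qed
qed

lemma potx_integrable: "set_integrable lborel {0<..<t} (\<lambda>s. LINT y|lborel. Gx (t - s) (x - y) * h s y)"
  unfolding set_integrable_def
proof (rule Bochner_Integration.integrable_bound[OF kernel_majorant_integrable[unfolded set_integrable_def]])
  show "(\<lambda>s. indicator {0<..<t} s *\<^sub>R (LINT y|lborel. Gx (t - s) (x - y) * h s y)) \<in> borel_measurable lborel"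
    by measurable
  show "AE s in lborel. norm (indicator {0<..<t} s *\<^sub>R (LINT y|lborel. Gx (t - s) (x - y) * h s y)) \<le> norm (indicator {0<..<t} s *\<^sub>R kernel_majorant s)"
    by (intro AE_I2) (auto simp: indicator_def intro!: order_trans[OF kernels_le_kernel_majorant(1) abs_ge_self])
qed

lemma pot_integrable: "set_integrable lborel {0<..<t} (\<lambda>s. LINT y|lborel. G (t - s) (x - y) * h s y)"
  unfolding set_integrable_def
proof (rule Bochner_Integration.integrable_bound[OF kernel_majorant_integrable[unfolded set_integrable_def]])
  show "(\<lambda>s. indicator {0<..<t} s *\<^sub>R (LINT y|lborel. G (t - s) (x - y) * h s y)) \<in> borel_measurable lborel"
    by measurable
  show "AE s in lborel. norm (indicator {0<..<t} s *\<^sub>R (LINT y|lborel. G (t - s) (x - y) * h s y)) \<le> norm (indicator {0<..<t} s *\<^sub>R kernel_majorant s)"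
    by (intro AE_I2) (auto simp: indicator_def intro!: order_trans[OF kernels_le_kernel_majorant(2) abs_ge_self])
qed

lemma potx_measurable: "potx h t \<in> borel_measurable borel"
  unfolding potx_def set_lebesgue_integral_def by measurable

lemma pot_deriv: "(pot h t has_real_derivative potx h t x) (at x)"
  unfolding pot_def[abs_def] potx_def
proof (rule set_integral_has_real_derivative[OF _ _ _ kernel_majorant_integrable pot_integrable])
  fix s x assume s: "s \<in> {0<..<t}"
  show "((\<lambda>x. LINT y|lborel. G (t - s) (x - y) * h s y) has_real_derivative (LINT y|lborel. Gx (t - s) (x - y) * h s y)) (at x)"
    by (rule conv_G_deriv) (use s h_int in auto)
  show "\<bar>LINT y|lborel. Gx (t - s) (x - y) * h s y\<bar> \<le> kernel_majorant s" by (rule kernels_le_kernel_majorant(1)) (use s in auto)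
qed measurable

end

subsection \<open>The integral equation\<close>

lemma sq_le_bound:
  assumes "L2 g" "h \<in> borel_measurable borel" "\<And>y. \<bar>h y\<bar> \<le> c * g y"
  shows "sq h \<le> c\<^sup>2 * sq g"
proof -
  have le: "(h y)\<^sup>2 \<le> c\<^sup>2 * (g y)\<^sup>2" for y
    using power_mono[OF assms(3)[of y], of 2] by (simp add: power_mult_distrib)
  have i: "integrable lborel (\<lambda>y. c\<^sup>2 * (g y)\<^sup>2)" using L2_integrable[OF assms(1)] by simp
  have "integrable lborel (\<lambda>y. (h y)\<^sup>2)"
    by (rule integrable_le[OF i]) (use assms(2) le in auto)
  then have "sq h \<le> (LINT y|lborel. c\<^sup>2 * (g y)\<^sup>2)" unfolding sq_def by (rule integral_mono) (use i le in auto)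
  then show ?thesis by (simp add: sq_def)
qed

text \<open>Agmon's inequality for the difference converts L2 convergence of the function and its
  derivative into uniform convergence, with the explicit modulus \<open>e\<close>.\<close>

lemma sup_diff_tendsto:
  fixes H h :: "real \<Rightarrow> real \<Rightarrow> real"
  assumes "((\<lambda>s. sq (\<lambda>x. H s x - H t x)) \<longlongrightarrow> 0) (at t)" "((\<lambda>s. sq (\<lambda>x. h s x - h t x)) \<longlongrightarrow> 0) (at t)"
    and "\<And>s. 0 < s \<Longrightarrow> prim (H s) (h s)" "\<And>s. 0 < s \<Longrightarrow> L2 (H s)" "\<And>s. 0 < s \<Longrightarrow> L2 (h s)" and t: "0 < t"
  defines "e \<equiv> \<lambda>s. sqrt (2 * sqrt (sq (\<lambda>x. H s x - H t x) * sq (\<lambda>x. h s x - h t x)))"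
  shows "isCont e t" "e t = 0" "\<And>s x. 0 < s \<Longrightarrow> \<bar>H s x - H t x\<bar> \<le> e s"
proof -
  show e0: "e t = 0" by (simp add: e_def sq_def)
  have "(e \<longlongrightarrow> sqrt (2 * sqrt (0 * 0))) (at t)" unfolding e_def by (intro tendsto_intros assms)
  then show "isCont e t" using e0 by (simp add: isCont_def)
  fix s x :: real assume s: "0 < s"
  have "(H s x - H t x)\<^sup>2 \<le> 2 * sqrt (sq (\<lambda>x. H s x - H t x) * sq (\<lambda>x. h s x - h t x))"
    by (rule prim_sup_L2) (use assms s t in \<open>auto intro: prim_diff L2_diff\<close>)
  then show "\<bar>H s x - H t x\<bar> \<le> e s" unfolding e_def by (intro real_le_rsqrt) simp
qed

text \<open>A curve of L2 functions carries no joint measurability in time and space, which Fubini's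
  theorem requires. Continuity on the open half-plane supplies it.\<close>

lemma joint_continuous:
  fixes H h :: "real \<Rightarrow> real \<Rightarrow> real"
  assumes "\<And>t. 0 < t \<Longrightarrow> ((\<lambda>s. sq (\<lambda>x. H s x - H t x)) \<longlongrightarrow> 0) (at t)" "\<And>t. 0 < t \<Longrightarrow> ((\<lambda>s. sq (\<lambda>x. h s x - h t x)) \<longlongrightarrow> 0) (at t)"
    and "\<And>s. 0 < s \<Longrightarrow> prim (H s) (h s)" "\<And>s. 0 < s \<Longrightarrow> L2 (H s)" "\<And>s. 0 < s \<Longrightarrow> L2 (h s)"
  shows "continuous_on ({0<..} \<times> UNIV) (\<lambda>p. H (fst p) (snd p))"
  unfolding continuous_on_def
proof
  fix p assume "p \<in> {0::real<..} \<times> (UNIV :: real set)"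
  then have t: "0 < fst p" by auto
  define t where "t = fst p"
  have t0: "0 < t" using t by (simp add: t_def)
  define e where "e = (\<lambda>s. sqrt (2 * sqrt (sq (\<lambda>x. H s x - H t x) * sq (\<lambda>x. h s x - h t x))))"
  have e: "isCont e t" "e t = 0" "\<And>s x. 0 < s \<Longrightarrow> \<bar>H s x - H t x\<bar> \<le> e s"
    unfolding e_def by (rule sup_diff_tendsto[where H = H and h = h]; use assms t0 in auto)+
  let ?A = "at p within {0<..} \<times> UNIV"
  have 1: "((\<lambda>p. e (fst p)) \<longlongrightarrow> 0) ?A"
    using isCont_tendsto_compose[OF e(1), of fst ?A] e(2) by (simp add: t_def tendsto_fst)
  have "isCont (H t) (snd p)"
    using prim_continuous[OF assms(3)[OF t0]] by (simp add: continuous_on_eq_continuous_at)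
  from isCont_tendsto_compose[OF this, of snd ?A]
  have 2: "((\<lambda>q. H t (snd q)) \<longlongrightarrow> H t (snd p)) ?A" by (simp add: tendsto_snd)
  have "((\<lambda>q. H (fst q) (snd q) - H t (snd q)) \<longlongrightarrow> 0) ?A"
  proof (rule Lim_null_comparison[OF _ 1])
    show "\<forall>\<^sub>F q in ?A. norm (H (fst q) (snd q) - H t (snd q)) \<le> e (fst q)"
      unfolding eventually_at_filter using e(3) by (intro always_eventually) auto
  qed
  from tendsto_add[OF this 2] show "((\<lambda>q. H (fst q) (snd q)) \<longlongrightarrow> H (fst p) (snd p)) ?A"
    by (simp add: t_def)
qed

lemma joint_measurable:
  fixes H :: "real \<Rightarrow> real \<Rightarrow> real"
  assumes "continuous_on ({0<..} \<times> UNIV) (\<lambda>p. H (fst p) (snd p))" "\<And>s x. s \<le> 0 \<Longrightarrow> H s x = 0"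
  shows "(\<lambda>p. H (fst p) (snd p)) \<in> borel_measurable (borel \<Otimes>\<^sub>M borel)"
proof -
  have "(\<lambda>p. indicator ({0<..} \<times> UNIV) p *\<^sub>R H (fst p) (snd p)) \<in> borel_measurable borel"
    by (rule borel_measurable_continuous_on_indicator[OF _ assms(1)]) (simp add: open_Times borel_open)
  moreover have "(\<lambda>p. indicator ({0<..} \<times> UNIV) p *\<^sub>R H (fst p) (snd p)) = (\<lambda>p. H (fst p) (snd p))"
  proof
    fix p :: "real \<times> real"
    show "indicator ({0<..} \<times> UNIV) p *\<^sub>R H (fst p) (snd p) = H (fst p) (snd p)"
      using assms(2)[of "fst p"] by (cases "0 < fst p") (auto simp: mem_Times_iff)
  qed
  ultimately show ?thesis by (simp add: borel_prod)
qed

context flow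
begin

lemma v_joint: "(\<lambda>p. v (fst p) (snd p)) \<in> borel_measurable (borel \<Otimes>\<^sub>M borel)"
  by (intro joint_measurable joint_continuous[of v vx] v_cont vx_cont v_prim v_L2 vx_L2 v_nonpos)

lemma vx_joint: "(\<lambda>p. vx (fst p) (snd p)) \<in> borel_measurable (borel \<Otimes>\<^sub>M borel)"
  by (intro joint_measurable joint_continuous[of vx vxx] vx_cont vxx_cont vx_prim vx_L2 vxx_L2 vx_nonpos)

lemma v_joint_measurable [measurable (raw)]:
  assumes "f \<in> borel_measurable M" "g \<in> borel_measurable M"
  shows "(\<lambda>w. v (f w) (g w)) \<in> borel_measurable M"
  using measurable_compose[OF measurable_Pair[OF assms] v_joint] by simp

lemma vx_joint_measurable [measurable (raw)]:
  assumes "f \<in> borel_measurable M" "g \<in> borel_measurable M"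
  shows "(\<lambda>w. vx (f w) (g w)) \<in> borel_measurable M"
  using measurable_compose[OF measurable_Pair[OF assms] vx_joint] by simp

definition flux :: "real \<Rightarrow> real \<Rightarrow> real" where "flux s y = b y * vx s y + d * v s y ^ 3"

lemma flux_measurable [measurable (raw)]:
  assumes "f \<in> borel_measurable M" "g \<in> borel_measurable M"
  shows "(\<lambda>w. flux (f w) (g w)) \<in> borel_measurable M"
  using assms unfolding flux_def by measurable

lemma b_L2: "L2 b"
  by (rule L2_bounded_integrable(1)[OF b_int b_bound])

text \<open>After integration by parts the term v_x of the full flux cancels the time derivative of
  the kernel, so that only the perturbation \<open>flux\<close> remains, paired with
  \<open>Gx\<close>.\<close>

lemma duhamel_deriv:
  assumes s: "0 < s" "s < t"
  shows "((\<lambda>s. LINT y|lborel. G (t - s) (x - y) * v s y) has_real_derivative (LINT y|lborel. Gx (t - s) (x - y) * flux s y)) (at s)"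
proof -
  define \<tau> where "\<tau> = t - s"
  have \<tau>: "0 < \<tau>" using s by (simp add: \<tau>_def)
  have near: "\<forall>\<^sub>F r in at s. 0 < r \<and> r < t \<and> \<bar>r - s\<bar> \<le> \<tau> / 2"
  proof -
    have "\<forall>\<^sub>F r in at s. dist r s < min s (\<tau> / 2)"
      unfolding eventually_at using s \<tau> by (intro exI[of _ "min s (\<tau> / 2)"]) auto
    then show ?thesis
    proof eventually_elim
      case (elim r)
      then have "\<bar>r - s\<bar> < s" "\<bar>r - s\<bar> < \<tau> / 2" by (auto simp: dist_real_def)
      then have "r - s < \<tau> / 2" "s - r < s" "\<bar>r - s\<bar> \<le> \<tau> / 2" by linarith+
      then show ?case using \<tau> by (simp add: \<tau>_def)
    qed
  qed
  define k where "k = (\<lambda>r y. G (t - r) (x - y))"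
  have kL: "L2 (k r)" if "r < t" for r unfolding k_def using that by (intro L2_reflect G_L2) simp
  define g4 where "g4 = (\<lambda>y. G (4 * \<tau>) (x - y))"
  have g4: "L2 g4" unfolding g4_def using \<tau> by (intro L2_reflect G_L2) simp
  define c1 where "c1 = 3200 * \<tau> powr (-1)"
  define c2 where "c2 = 6400 * \<tau> powr (-2)"
  have kc: "((\<lambda>r. sq (\<lambda>y. k r y - k s y)) \<longlongrightarrow> 0) (at s)"
  proof (rule Lim_null_comparison)
    have "((\<lambda>r. (c1 * \<bar>r - s\<bar>)\<^sup>2 * sq g4) \<longlongrightarrow> (c1 * \<bar>s - s\<bar>)\<^sup>2 * sq g4) (at s)" by (intro tendsto_intros)
    then show "((\<lambda>r. (c1 * \<bar>r - s\<bar>)\<^sup>2 * sq g4) \<longlongrightarrow> 0) (at s)" by simp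
    show "\<forall>\<^sub>F r in at s. norm (sq (\<lambda>y. k r y - k s y)) \<le> (c1 * \<bar>r - s\<bar>)\<^sup>2 * sq g4"
      using near
    proof eventually_elim
      case (elim r)
      have "\<bar>k r y - k s y\<bar> \<le> (c1 * \<bar>r - s\<bar>) * g4 y" for y
        using G_time_expansion(2)[OF \<tau>, of "t - r" "x - y"] elim
        by (simp add: k_def c1_def g4_def \<tau>_def abs_minus_commute)
      then have "sq (\<lambda>y. k r y - k s y) \<le> (c1 * \<bar>r - s\<bar>)\<^sup>2 * sq g4"
        by (intro sq_le_bound[OF g4]) (auto simp: k_def)
      then show ?case by simp
    qed
  qed
  have gxx: "L2 (\<lambda>y. - Gxx \<tau> (x - y))"
  proof -
    have "L2 (\<lambda>y. G (2 * \<tau>) (x - y))" using \<tau> by (intro L2_reflect G_L2) simp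
    then show ?thesis
      by (rule L2_bound[where c = "800 * \<tau> powr (-1)"]) (use kernel_bounds(3)[OF \<tau>] in auto)
  qed
  have kd: "((\<lambda>r. sq (\<lambda>y. (k r y - k s y) / (r - s) - (- Gxx \<tau> (x - y)))) \<longlongrightarrow> 0) (at s)"
  proof (rule Lim_null_comparison)
    have "((\<lambda>r. (c2 * \<bar>r - s\<bar>)\<^sup>2 * sq g4) \<longlongrightarrow> (c2 * \<bar>s - s\<bar>)\<^sup>2 * sq g4) (at s)" by (intro tendsto_intros)
    then show "((\<lambda>r. (c2 * \<bar>r - s\<bar>)\<^sup>2 * sq g4) \<longlongrightarrow> 0) (at s)" by simp
    have ne: "\<forall>\<^sub>F r in at s. r \<noteq> s" by (simp add: eventually_at_filter)
    show "\<forall>\<^sub>F r in at s. norm (sq (\<lambda>y. (k r y - k s y) / (r - s) - (- Gxx \<tau> (x - y)))) \<le> (c2 * \<bar>r - s\<bar>)\<^sup>2 * sq g4"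
      using near ne
    proof eventually_elim
      case (elim r)
      have "\<bar>(k r y - k s y) / (r - s) - (- Gxx \<tau> (x - y))\<bar> \<le> (c2 * \<bar>r - s\<bar>) * g4 y" for y
      proof -
        define e where "e = k r y - k s y + (r - s) * Gxx \<tau> (x - y)"
        have "\<bar>e\<bar> \<le> c2 * (r - s)\<^sup>2 * g4 y"
          using G_time_expansion(1)[OF \<tau>, of "t - r" "x - y"] elim
          by (simp add: e_def k_def c2_def g4_def \<tau>_def abs_minus_commute power2_commute[of s r])
             (simp add: algebra_simps)
        moreover have "(k r y - k s y) / (r - s) - (- Gxx \<tau> (x - y)) = e / (r - s)"
          using elim by (simp add: e_def add_divide_distrib)
        moreover have "(r - s)\<^sup>2 = \<bar>r - s\<bar> * \<bar>r - s\<bar>" by (simp add: power2_eq_square)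
        ultimately show ?thesis using elim by (simp add: abs_divide divide_le_eq mult_ac)
      qed
      then have "sq (\<lambda>y. (k r y - k s y) / (r - s) - (- Gxx \<tau> (x - y))) \<le> (c2 * \<bar>r - s\<bar>)\<^sup>2 * sq g4"
        by (intro sq_le_bound[OF g4]) (auto simp: k_def)
      then show ?case by simp
    qed
  qed
  \<comment> \<open>The product rule is split asymmetrically: increments of the solution meet the
    moving kernel, increments of the kernel meet the solution at the fixed time \<open>s\<close>. No
    mixed term is left over.\<close>
  have lim1: "((\<lambda>r. (LINT y|lborel. (v r y - v s y) * k r y) / (r - s)) \<longlongrightarrow> (LINT y|lborel. vt s y * k s y)) (at s)"
    by (rule pair_quotient[OF s(1) kc]) (use kL s near in \<open>auto elim!: eventually_mono\<close>)
  have lim2: "((\<lambda>r. LINT y|lborel. ((k r y - k s y) / (r - s)) * v s y) \<longlongrightarrow> (LINT y|lborel. (- Gxx \<tau> (x - y)) * v s y)) (at s)"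
  proof (rule tendsto_integral_mult[OF kd gxx _ const_cont v_L2[OF s(1)]])
    show "\<forall>\<^sub>F r in at s. L2 (\<lambda>y. (k r y - k s y) / (r - s))"
      using near
    proof eventually_elim
      case (elim r)
      show ?case using L2_cmult[OF L2_diff[OF kL kL], of r s "1 / (r - s)"] elim s by simp
    qed
  qed (use v_L2[OF s(1)] in simp)
  have "((\<lambda>r. ((LINT y|lborel. k r y * v r y) - (LINT y|lborel. k s y * v s y)) / (r - s)) \<longlongrightarrow>
      (LINT y|lborel. vt s y * k s y) + (LINT y|lborel. (- Gxx \<tau> (x - y)) * v s y)) (at s)"
    using tendsto_add[OF lim1 lim2]
  proof (rule Lim_transform_eventually)
    show "\<forall>\<^sub>F r in at s. (LINT y|lborel. (v r y - v s y) * k r y) / (r - s) + (LINT y|lborel. ((k r y - k s y) / (r - s)) * v s y)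
       = ((LINT y|lborel. k r y * v r y) - (LINT y|lborel. k s y * v s y)) / (r - s)"
      using near
    proof eventually_elim
      case (elim r)
      have i: "integrable lborel (\<lambda>y. k p y * v w y)" if "p < t" "0 < w" for p w
        using that by (intro L2_mult_integrable kL v_L2)
      have "(LINT y|lborel. (v r y - v s y) * k r y) = (LINT y|lborel. k r y * v r y - k r y * v s y)"
        by (intro Bochner_Integration.integral_cong) (auto simp: algebra_simps)
      moreover have "(LINT y|lborel. ((k r y - k s y) / (r - s)) * v s y) = (LINT y|lborel. (k r y * v s y - k s y * v s y) / (r - s))"
        by (intro Bochner_Integration.integral_cong) (auto simp: algebra_simps)
      ultimately show ?case using i elim s by (cases "r = s") (simp_all flip: add_divide_distrib)
    qed
  qed
  moreover have "(LINT y|lborel. vt s y * k s y) + (LINT y|lborel. (- Gxx \<tau> (x - y)) * v s y) = (LINT y|lborel. Gx (t - s) (x - y) * flux s y)"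
  proof -
    have chain: "((\<lambda>y. w (x - y)) has_real_derivative - w' (x - y)) (at y)"
      if "\<And>z. (w has_real_derivative w' z) (at z)" for w w' y
    proof -
      have "((\<lambda>y. w (x - y)) has_real_derivative w' (x - y) * (-1)) (at y)"
        by (rule DERIV_chain2[OF that]) (auto intro!: derivative_eq_intros)
      then show ?thesis by simp
    qed
    have cG: "continuous_on UNIV (G \<tau>)" "continuous_on UNIV (Gx \<tau>)" "continuous_on UNIV (Gxx \<tau>)"
      using \<tau> unfolding G_def Gx_def Gxx_def by (auto intro!: continuous_intros)
    have p1: "prim (\<lambda>y. G \<tau> (x - y)) (\<lambda>y. - Gx \<tau> (x - y))"
      by (rule prim_C1[OF chain[OF G_deriv_x[OF \<tau>]]])
         (intro continuous_intros continuous_on_compose2[OF cG(2)], auto intro!: continuous_intros)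
    have p2: "prim (\<lambda>y. Gx \<tau> (x - y)) (\<lambda>y. - Gxx \<tau> (x - y))"
      by (rule prim_C1[OF chain[OF Gx_deriv_x[OF \<tau>]]])
         (intro continuous_intros continuous_on_compose2[OF cG(3)], auto intro!: continuous_intros)
    have LG: "L2 (\<lambda>y. G \<tau> (x - y))" using \<tau> by (intro L2_reflect G_L2)
    have LGx: "L2 (\<lambda>y. Gx \<tau> (x - y))"
    proof -
      have "L2 (\<lambda>y. G (2 * \<tau>) (x - y))" using \<tau> by (intro L2_reflect G_L2) simp
      then show ?thesis
        by (rule L2_bound[where c = "800 * \<tau> powr (-1/2)"]) (use kernel_bounds(2)[OF \<tau>] in auto)
    qed
    have LGx': "L2 (\<lambda>y. - Gx \<tau> (x - y))" using L2_cmult[OF LGx, of "-1"] by simp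
    have "(LINT y|lborel. G \<tau> (x - y) * vt s y) = - (LINT y|lborel. (- Gx \<tau> (x - y)) * ((1 + b y) * vx s y + d * v s y ^ 3))"
      by (rule prim_integral_by_parts[OF p1 v_eq[OF s(1)] LG LGx' flux_L2[OF s(1)] vt_L2[OF s(1)]])
    moreover have "(LINT y|lborel. Gx \<tau> (x - y) * vx s y) = - (LINT y|lborel. (- Gxx \<tau> (x - y)) * v s y)"
      by (rule prim_integral_by_parts[OF p2 v_prim[OF s(1)] LGx gxx v_L2[OF s(1)] vx_L2[OF s(1)]])
    moreover have "(LINT y|lborel. Gx \<tau> (x - y) * flux s y) =
       (LINT y|lborel. Gx \<tau> (x - y) * ((1 + b y) * vx s y + d * v s y ^ 3) - Gx \<tau> (x - y) * vx s y)"
      by (intro Bochner_Integration.integral_cong) (auto simp: flux_def algebra_simps)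
    moreover have "\<dots> = (LINT y|lborel. Gx \<tau> (x - y) * ((1 + b y) * vx s y + d * v s y ^ 3)) - (LINT y|lborel. Gx \<tau> (x - y) * vx s y)"
      using L2_mult_integrable[OF LGx flux_L2[OF s(1)]] L2_mult_integrable[OF LGx vx_L2[OF s(1)]] by simp
    ultimately show ?thesis by (simp add: k_def \<tau>_def mult.commute)
  qed
  ultimately show ?thesis by (simp add: has_field_derivative_iff k_def)
qed

text \<open>One constant fixed by choice from \<open>decay\<close>, so that the constants built from
  it can be definitions of the locale.\<close>

definition D0 :: real where "D0 = (SOME D. D \<ge> 1 \<and> (\<forall>t>0. (\<forall>x. \<bar>v t x\<bar> \<le> D * t powr (-1/2)) \<and> (\<forall>x. \<bar>v t x\<bar> \<le> D * t powr (-1/3))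
     \<and> sq (vx t) \<le> D * t powr (-3/2)))"

lemma D0: "D0 \<ge> 1" "0 < t \<Longrightarrow> \<bar>v t x\<bar> \<le> D0 * t powr (-1/2)" "0 < t \<Longrightarrow> \<bar>v t x\<bar> \<le> D0 * t powr (-1/3)"
    "0 < t \<Longrightarrow> sq (vx t) \<le> D0 * t powr (-3/2)"
  using someI_ex[OF decay] unfolding D0_def by blast+

text \<open>Cauchy-Schwarz with \<open>b\<close>, which is in L2 as a bounded integrable function;
  the rate is half that of \<open>sq (vx s)\<close>.\<close>

lemma bvx_bounds:
  assumes s: "0 < s"
  shows "integrable lborel (\<lambda>y. b y * vx s y)" "(LINT y|lborel. \<bar>b y * vx s y\<bar>) \<le> sqrt (sq b * D0) * s powr (-3/4)"
proof -
  show "integrable lborel (\<lambda>y. b y * vx s y)" by (rule L2_mult_integrable[OF b_L2 vx_L2[OF s]])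
  have "(LINT y|lborel. \<bar>b y * vx s y\<bar>) \<le> sqrt (sq b * sq (vx s))" by (rule Cauchy_Schwarz_L2[OF b_L2 vx_L2[OF s]])
  also have "\<dots> \<le> sqrt (sq b * (D0 * s powr (-3/2)))" using D0(4)[OF s] by (intro real_sqrt_le_mono mult_left_mono) auto
  also have "s powr (-3/2) = (s powr (-3/4))\<^sup>2" using s by (simp add: power2_eq_square flip: powr_add)
  finally show "(LINT y|lborel. \<bar>b y * vx s y\<bar>) \<le> sqrt (sq b * D0) * s powr (-3/4)"
    by (simp add: real_sqrt_mult)
qed

text \<open>One factor carries the L1 bound, the other two a supremum bound. The rates 1/s and
  s^(-2/3) are meant for large and small times; s^(-3/4) lies between them and therefore holds for
  all times, in the form that \<open>source\<close> asks for.\<close>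

lemma v3_bounds:
  assumes s: "0 < s"
  shows "integrable lborel (\<lambda>y. v s y ^ 3)" "(LINT y|lborel. \<bar>v s y ^ 3\<bar>) \<le> D0\<^sup>2 * L1_cap * s powr (-1)"
    "(LINT y|lborel. \<bar>v s y ^ 3\<bar>) \<le> D0\<^sup>2 * L1_cap * s powr (-2/3)" "(LINT y|lborel. \<bar>v s y ^ 3\<bar>) \<le> D0\<^sup>2 * L1_cap * s powr (-3/4)"
proof -
  note [measurable] = v_meas[OF s]
  have b: "\<bar>v s y ^ 3\<bar> \<le> c\<^sup>2 * \<bar>v s y\<bar>" if "\<And>y. \<bar>v s y\<bar> \<le> c" for c y
  proof -
    have "\<bar>v s y\<bar>\<^sup>2 * \<bar>v s y\<bar> \<le> c\<^sup>2 * \<bar>v s y\<bar>" by (intro mult_right_mono power_mono that) auto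
    then show ?thesis by (simp add: power_abs power3_eq_cube power2_eq_square abs_mult)
  qed
  show i: "integrable lborel (\<lambda>y. v s y ^ 3)"
    by (rule integrable_le[OF _ _ b[OF D0(2)[OF s]]]) (use v_int[OF s] in auto)
  have B: "(LINT y|lborel. \<bar>v s y ^ 3\<bar>) \<le> c\<^sup>2 * L1_cap" if c: "\<And>y. \<bar>v s y\<bar> \<le> c" for c
  proof -
    have "(LINT y|lborel. \<bar>v s y ^ 3\<bar>) \<le> (LINT y|lborel. c\<^sup>2 * \<bar>v s y\<bar>)"
      by (rule integral_mono) (use i v_int[OF s] b[OF c] in auto)
    also have "\<dots> \<le> c\<^sup>2 * L1_cap" using v_L1_le_L1_cap[OF s] by (simp add: mult_left_mono)
    finally show ?thesis .
  qed
  have p: "(D0 * s powr a)\<^sup>2 * L1_cap = D0\<^sup>2 * L1_cap * s powr (2 * a)" for a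
    using s by (simp add: power_mult_distrib power2_eq_square[of "s powr a"] flip: powr_add)
  show 1: "(LINT y|lborel. \<bar>v s y ^ 3\<bar>) \<le> D0\<^sup>2 * L1_cap * s powr (-1)"
    using B[OF D0(2)[OF s], unfolded p] by simp
  show 2: "(LINT y|lborel. \<bar>v s y ^ 3\<bar>) \<le> D0\<^sup>2 * L1_cap * s powr (-2/3)"
    using B[OF D0(3)[OF s], unfolded p] by simp
  have nn: "0 \<le> D0\<^sup>2 * L1_cap" using L1_cap_pos by simp
  show "(LINT y|lborel. \<bar>v s y ^ 3\<bar>) \<le> D0\<^sup>2 * L1_cap * s powr (-3/4)"
  proof (cases "1 \<le> s")
    case True
    then have "s powr (-1) \<le> s powr (-3/4)" by (intro powr_mono) auto
    then show ?thesis using 1 mult_left_mono[OF _ nn] by (meson order_trans)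
  next
    case False
    then have "s powr (-2/3) \<le> s powr (-3/4)" using s by (intro powr_mono') auto
    then show ?thesis using 2 mult_left_mono[OF _ nn] by (meson order_trans)
  qed
qed

definition A0 :: real where "A0 = sqrt (sq b * D0) + \<bar>d\<bar> * (D0\<^sup>2 * L1_cap)"

lemma flux_bounds:
  assumes s: "0 < s"
  shows "integrable lborel (flux s)" "(LINT y|lborel. \<bar>flux s y\<bar>) \<le> A0 * s powr (-3/4)"
proof -
  note i = bvx_bounds(1)[OF s] v3_bounds(1)[OF s]
  show i': "integrable lborel (flux s)" unfolding flux_def[abs_def] using i by simp
  have "(LINT y|lborel. \<bar>flux s y\<bar>) \<le> (LINT y|lborel. \<bar>b y * vx s y\<bar> + \<bar>d\<bar> * \<bar>v s y ^ 3\<bar>)"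
  proof (rule integral_mono)
    show "integrable lborel (\<lambda>y. \<bar>flux s y\<bar>)" using i' by simp
    show "integrable lborel (\<lambda>y. \<bar>b y * vx s y\<bar> + \<bar>d\<bar> * \<bar>v s y ^ 3\<bar>)"
      using i by (intro Bochner_Integration.integrable_add integrable_mult_right integrable_abs)
    show "\<bar>flux s y\<bar> \<le> \<bar>b y * vx s y\<bar> + \<bar>d\<bar> * \<bar>v s y ^ 3\<bar>" for y
      using abs_triangle_ineq[of "b y * vx s y" "d * v s y ^ 3"] by (simp add: flux_def abs_mult)
  qed
  also have "\<dots> = (LINT y|lborel. \<bar>b y * vx s y\<bar>) + \<bar>d\<bar> * (LINT y|lborel. \<bar>v s y ^ 3\<bar>)"
    using integrable_abs[OF i(1)] integrable_abs[OF i(2)] by (subst Bochner_Integration.integral_add) auto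
  also have "\<dots> \<le> sqrt (sq b * D0) * s powr (-3/4) + \<bar>d\<bar> * (D0\<^sup>2 * L1_cap * s powr (-3/4))"
    using bvx_bounds(2)[OF s] v3_bounds(4)[OF s] by (intro add_mono mult_left_mono) auto
  also have "\<dots> = A0 * s powr (-3/4)" by (simp add: A0_def algebra_simps)
  finally show "(LINT y|lborel. \<bar>flux s y\<bar>) \<le> A0 * s powr (-3/4)" .
qed

text \<open>A bound without rate: the L2 norm of \<open>vxx\<close> is continuous in time, hence
  bounded on the compact interval, and Agmon's inequality applies.\<close>

lemma vx_sup:
  assumes t: "0 < t"
  shows "\<exists>c\<ge>0. \<forall>s\<in>{t/2..t}. \<forall>y. \<bar>vx s y\<bar> \<le> c"
proof -
  have "((\<lambda>s. LINT y|lborel. vxx s y * vxx s y) \<longlongrightarrow> (LINT y|lborel. vxx s y * vxx s y)) (at s)" if s: "0 < s" for s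
    using vxx_cont[OF s] vxx_L2[OF s] ev_pos[OF s] vxx_L2
    by (intro tendsto_integral_mult) (auto elim!: eventually_mono)
  then have "continuous_on {t/2..t} (\<lambda>s. sq (vxx s))"
    using t by (intro continuous_at_imp_continuous_on) (auto simp: isCont_def sq_def power2_eq_square)
  then have "compact ((\<lambda>s. sq (vxx s)) ` {t/2..t})" by (rule compact_continuous_image) simp
  then obtain c1 where "\<forall>z\<in>(\<lambda>s. sq (vxx s)) ` {t/2..t}. norm z \<le> c1"
    using compact_imp_bounded bounded_iff by metis
  then have c1: "\<And>s. s \<in> {t/2..t} \<Longrightarrow> sq (vxx s) \<le> c1" by auto
  show ?thesis
  proof (intro exI[of _ "sqrt (2 * sqrt (D0 * (t/2) powr (-3/2) * c1))"] conjI ballI allI)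
    have "0 \<le> c1" using c1[of t] t sq_nonneg[of "vxx t"] by (auto intro: order_trans[OF sq_nonneg])
    then show "0 \<le> sqrt (2 * sqrt (D0 * (t/2) powr (-3/2) * c1))" using D0(1) by simp
    fix s y assume s: "s \<in> {t/2..t}"
    then have s0: "0 < s" using t by auto
    have "(vx s y)\<^sup>2 \<le> 2 * sqrt (sq (vx s) * sq (vxx s))"
      by (rule prim_sup_L2[OF vx_prim vx_L2 vxx_L2]) (use s0 in auto)
    also have "\<dots> \<le> 2 * sqrt (D0 * (t/2) powr (-3/2) * c1)"
    proof (intro mult_left_mono real_sqrt_le_mono mult_mono c1 s)
      have "s powr (-3/2) \<le> (t/2) powr (-3/2)" using s t by (intro powr_mono2') auto
      then have "D0 * s powr (-3/2) \<le> D0 * (t/2) powr (-3/2)" using D0(1) by (intro mult_left_mono) auto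
      then show "sq (vx s) \<le> D0 * (t/2) powr (-3/2)" using D0(4)[OF s0] by linarith
    qed (use D0(1) in auto)
    finally show "\<bar>vx s y\<bar> \<le> sqrt (2 * sqrt (D0 * (t/2) powr (-3/2) * c1))" by (intro real_le_rsqrt) simp
  qed
qed

lemma v_sup: assumes "0 < t" "t / 2 \<le> s" shows "\<bar>v s y\<bar> \<le> D0 * (t/2) powr (-1/2)"
proof -
  have "s powr (-1/2) \<le> (t/2) powr (-1/2)" using assms by (intro powr_mono2') auto
  then have "D0 * s powr (-1/2) \<le> D0 * (t/2) powr (-1/2)" using D0(1) by (intro mult_left_mono) auto
  then show ?thesis using D0(2)[of s y] assms by linarith
qed

lemma v_cube_sup: assumes "0 < t" "t / 2 \<le> s" shows "\<bar>v s y ^ 3\<bar> \<le> (D0 * (t/2) powr (-1/2)) ^ 3"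
  using power_mono[OF v_sup[OF assms, of y], of 3] by (simp add: power_abs)

lemma source_v3: "0 < t \<Longrightarrow> source (\<lambda>s y. v s y ^ 3) (D0\<^sup>2 * L1_cap) t ((D0 * (t/2) powr (-1/2)) ^ 3)"
  by unfold_locales (use v3_bounds(1,4) v_cube_sup in auto)

lemma source_bvx: "0 < t \<Longrightarrow> \<exists>c. source (\<lambda>s y. b y * vx s y) (sqrt (sq b * D0)) t c"
proof -
  assume t: "0 < t"
  obtain c where c: "0 \<le> c" "\<And>s y. s \<in> {t/2..t} \<Longrightarrow> \<bar>vx s y\<bar> \<le> c" using vx_sup[OF t] by blast
  have "source (\<lambda>s y. b y * vx s y) (sqrt (sq b * D0)) t (\<beta> * c)"
  proof
    fix s y assume "t / 2 \<le> s" "s < t"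
    then show "\<bar>b y * vx s y\<bar> \<le> \<beta> * c"
      unfolding abs_mult using c(1) \<beta>_nonneg by (intro mult_mono b_bound c(2)) auto
  qed (use t bvx_bounds in auto)
  then show ?thesis by blast
qed

end

section \<open>Estimates for averages of kernels\<close>

text \<open>Without integrability the left side is 0 by convention, so one can pass to nonnegative
  integrals unconditionally.\<close>

lemma ennreal_abs_integral_le:
  fixes f :: "'a \<Rightarrow> real"
  shows "ennreal \<bar>integral\<^sup>L M f\<bar> \<le> (\<integral>\<^sup>+x. ennreal \<bar>f x\<bar> \<partial>M)"
proof (cases "integrable M f")
  case True
  have "ennreal \<bar>integral\<^sup>L M f\<bar> \<le> ennreal (LINT x|M. \<bar>f x\<bar>)" by (intro ennreal_leI integral_abs_bound)
  also have "\<dots> = (\<integral>\<^sup>+x. ennreal \<bar>f x\<bar> \<partial>M)"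
    using True by (subst nn_integral_eq_integral) auto
  finally show ?thesis .
next
  case False
  then show ?thesis by (simp add: not_integrable_integral_eq)
qed

lemma nn_integral_kernel_le:
  fixes T :: "real \<Rightarrow> real" and k :: "'a \<Rightarrow> real \<Rightarrow> ennreal"
  assumes "sigma_finite_measure N" and k: "(\<lambda>(w, x). k w x) \<in> borel_measurable (N \<Otimes>\<^sub>M lborel)"
    and T: "\<And>x. ennreal \<bar>T x\<bar> \<le> (\<integral>\<^sup>+w. k w x \<partial>N)"
    and b: "\<And>w. w \<in> space N \<Longrightarrow> (\<integral>\<^sup>+x. k w x \<partial>lborel) \<le> c w"
  shows "(\<integral>\<^sup>+x. ennreal \<bar>T x\<bar> \<partial>lborel) \<le> (\<integral>\<^sup>+w. c w \<partial>N)"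
proof -
  interpret N: sigma_finite_measure N by fact
  interpret pair_sigma_finite N lborel by unfold_locales
  have "(\<integral>\<^sup>+x. ennreal \<bar>T x\<bar> \<partial>lborel) \<le> (\<integral>\<^sup>+x. (\<integral>\<^sup>+w. k w x \<partial>N) \<partial>lborel)"
    by (rule nn_integral_mono) (rule T)
  also have "\<dots> = (\<integral>\<^sup>+w. (\<integral>\<^sup>+x. k w x \<partial>lborel) \<partial>N)"
    using Fubini'[of k] k by simp
  also have "\<dots> \<le> (\<integral>\<^sup>+w. c w \<partial>N)"
    by (rule nn_integral_mono) (rule b)
  finally show ?thesis .
qed

lemma cutoff_measurable [measurable (raw)]:
  assumes "f \<in> borel_measurable M"
  shows "(\<lambda>w. cutoff t (f w)) \<in> borel_measurable M"
  using assms unfolding cutoff_def by measurable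

lemma heat_pair_measurable [measurable (raw)]:
  assumes "f \<in> borel_measurable M" "g \<in> borel_measurable M"
  shows "(\<lambda>w. heat_pair t (f w) (g w)) \<in> borel_measurable M"
  using assms unfolding heat_pair_def by measurable

lemma heat_pair_sup: assumes t: "0 < t" shows "heat_pair t y x \<le> 2 * t powr (-1/2)"
proof -
  have "G (4 * t) z \<le> t powr (-1/2)" for z
  proof -
    have "G (4 * t) z \<le> (4 * t) powr (-1/2)" using t by (intro G_le) auto
    also have "\<dots> \<le> t powr (-1/2)" using t by (intro powr_mono2') auto
    finally show ?thesis .
  qed
  from this[of x] this[of "x - y"] show ?thesis by (simp add: heat_pair_def)
qed

lemma G_nn_integral: "0 < t \<Longrightarrow> (\<integral>\<^sup>+x. ennreal (G t (x - y)) \<partial>lborel) = 1"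
proof -
  assume t: "0 < t"
  have eq: "G t (x - y) = G t (y - x)" for x using G_minus[of t "y - x"] by simp
  have "integrable lborel (\<lambda>x. G t (x - y))"
    unfolding eq by (rule integrable_reflect[OF G_integrable[OF t]])
  moreover have "(LINT x|lborel. G t (x - y)) = 1"
    unfolding eq using integral_reflect[of "G t" y] G_integral[OF t] by simp
  ultimately show ?thesis by (subst nn_integral_eq_integral) auto
qed

lemma heat_pair_nn_integral: "0 < t \<Longrightarrow> (\<integral>\<^sup>+x. ennreal (heat_pair t y x) \<partial>lborel) = 2"
  using G_nn_integral[of "4 * t" y] G_nn_integral[of "4 * t" 0]
  by (simp add: heat_pair_def ennreal_plus nn_integral_add)

text \<open>A function dominated by an average of \<open>heat_pair\<close> has its supremum and L1
  norms controlled by the total weight alone. Both rates demanded of a remainder thus reduce to the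
  decay of one scalar integral.\<close>

lemma heat_pair_average:
  fixes T :: "real \<Rightarrow> real" and w Y :: "'a \<Rightarrow> real"
  assumes N: "sigma_finite_measure N" and w: "integrable N w" "\<And>z. 0 \<le> w z" and Y: "Y \<in> borel_measurable N" and t: "0 < t"
    and T: "\<And>x. ennreal \<bar>T x\<bar> \<le> (\<integral>\<^sup>+z. ennreal (w z * heat_pair t (Y z) x) \<partial>N)"
  shows "\<bar>T x\<bar> \<le> 2 * t powr (-1/2) * integral\<^sup>L N w" "(\<integral>\<^sup>+x. ennreal \<bar>T x\<bar> \<partial>lborel) \<le> ennreal (2 * integral\<^sup>L N w)"
proof -
  interpret N: sigma_finite_measure N by fact
  have [measurable]: "w \<in> borel_measurable N" "Y \<in> borel_measurable N" using w Y by auto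
  have "ennreal \<bar>T x\<bar> \<le> (\<integral>\<^sup>+z. ennreal (2 * t powr (-1/2) * w z) \<partial>N)"
  proof (rule order_trans[OF T nn_integral_mono], rule ennreal_leI)
    fix z show "w z * heat_pair t (Y z) x \<le> 2 * t powr (-1/2) * w z"
      using mult_left_mono[OF heat_pair_sup[OF t, of "Y z" x] w(2)[of z]] by (simp add: mult_ac)
  qed
  also have "\<dots> = ennreal (2 * t powr (-1/2) * integral\<^sup>L N w)"
    using w by (subst nn_integral_eq_integral) auto
  finally show "\<bar>T x\<bar> \<le> 2 * t powr (-1/2) * integral\<^sup>L N w"
    using w by (subst (asm) ennreal_le_iff) (auto intro: integral_nonneg_AE)
  have "(\<integral>\<^sup>+x. ennreal \<bar>T x\<bar> \<partial>lborel) \<le> (\<integral>\<^sup>+z. ennreal (2 * w z) \<partial>N)"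
  proof (rule nn_integral_kernel_le[OF N _ T])
    show "(\<lambda>(z, x). ennreal (w z * heat_pair t (Y z) x)) \<in> borel_measurable (N \<Otimes>\<^sub>M lborel)" by measurable
    fix z
    have "(\<integral>\<^sup>+x. ennreal (w z * heat_pair t (Y z) x) \<partial>lborel) = ennreal (w z) * (\<integral>\<^sup>+x. ennreal (heat_pair t (Y z) x) \<partial>lborel)"
      using w(2) by (subst nn_integral_cmult[symmetric]) (auto simp: ennreal_mult)
    then show "(\<integral>\<^sup>+x. ennreal (w z * heat_pair t (Y z) x) \<partial>lborel) \<le> ennreal (2 * w z)"
      using w(2)[of z] by (simp add: heat_pair_nn_integral[OF t] ennreal_mult mult.commute)
  qed
  also have "\<dots> = ennreal (2 * integral\<^sup>L N w)"
    using w by (subst nn_integral_eq_integral) auto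
  finally show "(\<integral>\<^sup>+x. ennreal \<bar>T x\<bar> \<partial>lborel) \<le> ennreal (2 * integral\<^sup>L N w)" .
qed

lemma Gx_nn_integral: "0 < t \<Longrightarrow> (\<integral>\<^sup>+x. ennreal \<bar>Gx t (x - y)\<bar> \<partial>lborel) \<le> ennreal (800 * t powr (-1/2))"
proof -
  assume t: "0 < t"
  have "(\<integral>\<^sup>+x. ennreal \<bar>Gx t (x - y)\<bar> \<partial>lborel) \<le> (\<integral>\<^sup>+x. ennreal (800 * t powr (-1/2)) * ennreal (G (2 * t) (x - y)) \<partial>lborel)"
    using kernel_bounds(2)[OF t] by (intro nn_integral_mono) (simp add: ennreal_leI flip: ennreal_mult)
  also have "\<dots> = ennreal (800 * t powr (-1/2))"
    using t G_nn_integral[of "2 * t" y] by (subst nn_integral_cmult) auto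
  finally show ?thesis .
qed

text \<open>Tonelli's theorem lets the x-integral act on the kernel first, which leaves (t -
  s)^(-1/2) times the L1 norm of the source.\<close>

lemma potential_L1:
  fixes h :: "real \<Rightarrow> real \<Rightarrow> real"
  assumes hm: "(\<lambda>(s, y). h s y) \<in> borel_measurable (borel \<Otimes>\<^sub>M borel)" and S: "S \<in> sets borel" "S \<subseteq> {0<..<t}"
    and c: "\<And>s. s \<in> S \<Longrightarrow> integrable lborel (h s)" "\<And>s. s \<in> S \<Longrightarrow> (LINT y|lborel. \<bar>h s y\<bar>) \<le> c s"
      "\<And>s. s \<in> S \<Longrightarrow> 0 \<le> c s"
    and i: "set_integrable lborel S (\<lambda>s. 800 * (t - s) powr (-1/2) * c s)"
  shows "(\<integral>\<^sup>+x. ennreal \<bar>LINT s:S|lborel. (LINT y|lborel. Gx (t - s) (x - y) * h s y)\<bar> \<partial>lborel)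
     \<le> ennreal (LINT s:S|lborel. 800 * (t - s) powr (-1/2) * c s)"
proof -
  have [measurable (raw)]: "(\<lambda>w. h (f w) (g w)) \<in> borel_measurable M" if "f \<in> borel_measurable M" "g \<in> borel_measurable M" for f g M
    using measurable_compose[OF measurable_Pair[OF that] hm] by simp
  note [measurable] = S(1)
  define k where "k s x = indicator S s * (\<integral>\<^sup>+y. ennreal \<bar>Gx (t - s) (x - y) * h s y\<bar> \<partial>lborel)" for s x
  have "(\<integral>\<^sup>+x. ennreal \<bar>LINT s:S|lborel. (LINT y|lborel. Gx (t - s) (x - y) * h s y)\<bar> \<partial>lborel)
     \<le> (\<integral>\<^sup>+s. ennreal (indicator S s * (800 * (t - s) powr (-1/2) * c s)) \<partial>lborel)"
  proof (rule nn_integral_kernel_le[OF sigma_finite_lborel, where k = k])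
    show "(\<lambda>(s, x). k s x) \<in> borel_measurable (lborel \<Otimes>\<^sub>M lborel)" unfolding k_def by measurable
    fix x
    have "ennreal \<bar>LINT s:S|lborel. (LINT y|lborel. Gx (t - s) (x - y) * h s y)\<bar> \<le>
       (\<integral>\<^sup>+s. ennreal \<bar>indicator S s * (LINT y|lborel. Gx (t - s) (x - y) * h s y)\<bar> \<partial>lborel)"
      unfolding set_lebesgue_integral_def real_scaleR_def by (rule ennreal_abs_integral_le)
    also have "\<dots> \<le> (\<integral>\<^sup>+s. k s x \<partial>lborel)"
      unfolding k_def using ennreal_abs_integral_le by (intro nn_integral_mono) (auto simp: indicator_def)
    finally show "ennreal \<bar>LINT s:S|lborel. (LINT y|lborel. Gx (t - s) (x - y) * h s y)\<bar> \<le> (\<integral>\<^sup>+s. k s x \<partial>lborel)" .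
  next
    fix s
    show "(\<integral>\<^sup>+x. k s x \<partial>lborel) \<le> ennreal (indicator S s * (800 * (t - s) powr (-1/2) * c s))"
    proof (cases "s \<in> S")
      case True
      then have ts: "0 < t - s" using S by auto
      have "(\<integral>\<^sup>+x. k s x \<partial>lborel) = (\<integral>\<^sup>+x. (\<integral>\<^sup>+y. ennreal \<bar>Gx (t - s) (x - y) * h s y\<bar> \<partial>lborel) \<partial>lborel)"
        using True by (simp add: k_def)
      also have "\<dots> = (\<integral>\<^sup>+y. (\<integral>\<^sup>+x. ennreal \<bar>Gx (t - s) (x - y) * h s y\<bar> \<partial>lborel) \<partial>lborel)"
        by (rule lborel_pair.Fubini') measurable
      also have "\<dots> = (\<integral>\<^sup>+y. ennreal \<bar>h s y\<bar> * (\<integral>\<^sup>+x. ennreal \<bar>Gx (t - s) (x - y)\<bar> \<partial>lborel) \<partial>lborel)"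
        by (intro nn_integral_cong, subst nn_integral_cmult[symmetric]) (auto simp: abs_mult ennreal_mult mult.commute)
      also have "\<dots> \<le> (\<integral>\<^sup>+y. ennreal \<bar>h s y\<bar> * ennreal (800 * (t - s) powr (-1/2)) \<partial>lborel)"
        by (intro nn_integral_mono mult_left_mono Gx_nn_integral ts) auto
      also have "\<dots> = ennreal (LINT y|lborel. \<bar>h s y\<bar>) * ennreal (800 * (t - s) powr (-1/2))"
        using c(1)[OF True] by (subst nn_integral_multc) (auto simp: nn_integral_eq_integral)
      also have "\<dots> \<le> ennreal (c s) * ennreal (800 * (t - s) powr (-1/2))"
        by (intro mult_right_mono ennreal_leI c(2)[OF True]) auto
      also have "\<dots> = ennreal (indicator S s * (800 * (t - s) powr (-1/2) * c s))"
        using True c(3)[OF True] by (simp add: mult.commute flip: ennreal_mult)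
      finally show ?thesis .
    next
      case False
      then show ?thesis by (simp add: k_def)
    qed
  qed
  also have "\<dots> = ennreal (LINT s:S|lborel. 800 * (t - s) powr (-1/2) * c s)"
    using i c(3) unfolding set_lebesgue_integral_def set_integrable_def
    by (subst nn_integral_eq_integral) (auto simp: indicator_def)
  finally show ?thesis .
qed

lemma sqrt_kernel_integral:
  assumes t: "0 < (t::real)"
  shows "(LINT s:{0<..<t}|lborel. (t - s) powr (-1/2)) = 2 * t powr (1/2)"
proof -
  have "(LINT s:{0<..<t}|lborel. (t - s) powr (-1/2)) = (LINT s|lborel. indicator {0<..<t} (t - s) * (t - s) powr (-1/2))"
    unfolding set_lebesgue_integral_def by (intro Bochner_Integration.integral_cong) (auto simp: indicator_def)
  also have "\<dots> = (LINT s:{0<..<t}|lborel. s powr (-1/2))"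
    using integral_reflect[of "\<lambda>s. indicator {0<..<t} s * s powr (-1/2)" t] by (simp add: set_lebesgue_integral_def)
  also have "\<dots> = 2 * t powr (1/2)" using powr_has_integral(2)[of "-1/2" t] t by simp
  finally show ?thesis .
qed

text \<open>On each side of t/2 one factor is bounded by its value at t/2 and the other is
  integrated exactly. The constant 16 = 2 * 4 + 4 * 2 is a crude substitute for the beta function
  value.\<close>

lemma beta_integral_le:
  assumes t: "0 < (t::real)"
  shows "set_integrable lborel {0<..<t} (\<lambda>s. (t - s) powr (-1/2) * s powr (-3/4))"
    and "(LINT s:{0<..<t}|lborel. (t - s) powr (-1/2) * s powr (-3/4)) \<le> 16 * t powr (-1/4)"
proof -
  define g where "g = (\<lambda>s. (t/2) powr (-1/2) * s powr (-3/4) + (t/2) powr (-3/4) * (t - s) powr (-1/2))"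
  note i1 = powr_has_integral[of "-3/4" t] and i2 = powr_reflect_integrable[of "-1/2" t]
  have gi: "set_integrable lborel {0<..<t} g"
    unfolding g_def using i1 i2 t by (intro set_integral_add set_integrable_mult_right) auto
  have le: "(t - s) powr (-1/2) * s powr (-3/4) \<le> g s" if s: "s \<in> {0<..<t}" for s
  proof (cases "s \<le> t / 2")
    case True
    then have "(t - s) powr (-1/2) \<le> (t/2) powr (-1/2)" using t by (intro powr_mono2') auto
    then have "(t - s) powr (-1/2) * s powr (-3/4) \<le> (t/2) powr (-1/2) * s powr (-3/4)" by (intro mult_right_mono) auto
    then show ?thesis by (simp add: g_def add_increasing2)
  next
    case False
    then have "s powr (-3/4) \<le> (t/2) powr (-3/4)" using t by (intro powr_mono2') auto
    then have "(t - s) powr (-1/2) * s powr (-3/4) \<le> (t - s) powr (-1/2) * (t/2) powr (-3/4)" by (intro mult_left_mono) auto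
    then show ?thesis by (simp add: g_def add_increasing mult.commute)
  qed
  show i: "set_integrable lborel {0<..<t} (\<lambda>s. (t - s) powr (-1/2) * s powr (-3/4))"
    unfolding set_integrable_def
  proof (rule Bochner_Integration.integrable_bound[OF gi[unfolded set_integrable_def]])
    show "AE s in lborel. norm (indicator {0<..<t} s *\<^sub>R ((t - s) powr (-1/2) * s powr (-3/4))) \<le> norm (indicator {0<..<t} s *\<^sub>R g s)"
      using le by (intro AE_I2) (auto simp: indicator_def intro: order_trans[OF _ abs_ge_self])
  qed measurable
  note r = sqrt_kernel_integral[OF t]
  have "(LINT s:{0<..<t}|lborel. (t - s) powr (-1/2) * s powr (-3/4)) \<le> (LINT s:{0<..<t}|lborel. g s)"
    by (rule set_integral_mono[OF i gi le]) auto
  also have "\<dots> = (t/2) powr (-1/2) * (4 * t powr (1/4)) + (t/2) powr (-3/4) * (2 * t powr (1/2))"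
    unfolding g_def using i1 i2 t r by (subst set_integral_add) auto
  also have "\<dots> \<le> (2 * t powr (-1/2)) * (4 * t powr (1/4)) + (4 * t powr (-3/4)) * (2 * t powr (1/2))"
  proof (intro add_mono mult_right_mono)
    have two: "(t/2) powr (- a) = 2 powr a * t powr (- a)" for a using t by (simp add: powr_divide powr_minus_divide)
    have "2 powr (1/2) \<le> (2::real) powr 1" "2 powr (3/4) \<le> (2::real) powr 2" by (intro powr_mono; simp)+
    then have p2: "2 powr (1/2) \<le> (2::real)" "2 powr (3/4) \<le> (4::real)" by (simp_all add: powr_numeral)
    show "(t/2) powr (-1/2) \<le> 2 * t powr (-1/2)" using two[of "1/2"] mult_right_mono[OF p2(1), of "t powr (-1/2)"] by simp
    show "(t/2) powr (-3/4) \<le> 4 * t powr (-3/4)" using two[of "3/4"] mult_right_mono[OF p2(2), of "t powr (-3/4)"] by simp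
  qed auto
  also have "\<dots> = 16 * t powr (-1/4)" using t by (simp add: mult_ac flip: powr_add)
  finally show "(LINT s:{0<..<t}|lborel. (t - s) powr (-1/2) * s powr (-3/4)) \<le> 16 * t powr (-1/4)" .
qed

context flow
begin

lemma source_flux: "0 < t \<Longrightarrow> \<exists>c. source flux A0 t c"
proof -
  assume t: "0 < t"
  obtain c where c: "0 \<le> c" "\<And>s y. s \<in> {t/2..t} \<Longrightarrow> \<bar>vx s y\<bar> \<le> c" using vx_sup[OF t] by blast
  have "source flux A0 t (\<beta> * c + \<bar>d\<bar> * (D0 * (t/2) powr (-1/2)) ^ 3)"
  proof
    fix s y assume s: "t / 2 \<le> s" "s < t"
    have "\<bar>b y * vx s y\<bar> \<le> \<beta> * c"
      unfolding abs_mult using c(1) \<beta>_nonneg s by (intro mult_mono b_bound c(2)) auto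
    moreover have "\<bar>d * v s y ^ 3\<bar> \<le> \<bar>d\<bar> * (D0 * (t/2) powr (-1/2)) ^ 3"
      unfolding abs_mult by (rule mult_left_mono[OF v_cube_sup[OF t s(1)]]) simp
    ultimately show "\<bar>flux s y\<bar> \<le> \<beta> * c + \<bar>d\<bar> * (D0 * (t/2) powr (-1/2)) ^ 3" unfolding flux_def by linarith
  qed (use t flux_bounds in auto)
  then show ?thesis by blast
qed

lemma potx_flux:
  assumes t: "0 < t"
  shows "potx flux t x = potx (\<lambda>s y. b y * vx s y) t x + d * potx (\<lambda>s y. v s y ^ 3) t x"
proof -
  obtain c where "source (\<lambda>s y. b y * vx s y) (sqrt (sq b * D0)) t c" using source_bvx[OF t] by blast
  then interpret B: source "\<lambda>s y. b y * vx s y" "sqrt (sq b * D0)" t c .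
  interpret V: source "\<lambda>s y. v s y ^ 3" "D0\<^sup>2 * L1_cap" t "(D0 * (t/2) powr (-1/2)) ^ 3" by (rule source_v3[OF t])
  have "potx flux t x = (LINT s:{0<..<t}|lborel. (LINT y|lborel. Gx (t - s) (x - y) * (b y * vx s y)) + d * (LINT y|lborel. Gx (t - s) (x - y) * v s y ^ 3))"
    unfolding potx_def
  proof (rule set_lebesgue_integral_cong)
    show "\<forall>s. s \<in> {0<..<t} \<longrightarrow> (LINT y|lborel. Gx (t - s) (x - y) * flux s y) =
       (LINT y|lborel. Gx (t - s) (x - y) * (b y * vx s y)) + d * (LINT y|lborel. Gx (t - s) (x - y) * v s y ^ 3)"
    proof (intro allI impI)
      fix s assume s: "s \<in> {0<..<t}"
      have "(LINT y|lborel. Gx (t - s) (x - y) * flux s y) = (LINT y|lborel. Gx (t - s) (x - y) * (b y * vx s y) + d * (Gx (t - s) (x - y) * v s y ^ 3))"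
        by (intro Bochner_Integration.integral_cong) (auto simp: flux_def algebra_simps)
      then show "(LINT y|lborel. Gx (t - s) (x - y) * flux s y) =
       (LINT y|lborel. Gx (t - s) (x - y) * (b y * vx s y)) + d * (LINT y|lborel. Gx (t - s) (x - y) * v s y ^ 3)"
        using B.kernels_le_kernel_majorant(3)[of s x] V.kernels_le_kernel_majorant(3)[of s x] s by simp
    qed
  qed auto
  also have "\<dots> = potx (\<lambda>s y. b y * vx s y) t x + d * potx (\<lambda>s y. v s y ^ 3) t x"
    unfolding potx_def using B.potx_integrable[of x] V.potx_integrable[of x]
    by (subst set_integral_add) auto
  finally show ?thesis .
qed

text \<open>\<open>duhamel_deriv\<close> holds only strictly between 0 and t, so it is integrated
  over [e_n, t - e_n] and the ends are let go. At the lower end L1 convergence to \<open>u0\<close>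
  suffices, as the kernel is bounded there. At the upper end the kernel is an approximate identity;
  uniform convergence in time is combined with a Lipschitz bound in space.\<close>

lemma duhamel:
  assumes t: "0 < t"
  shows "v t x = (LINT y|lborel. G t (x - y) * u0 y) + potx flux t x"
proof -
  obtain c where "source flux A0 t c" using source_flux[OF t] by blast
  then interpret S: source flux A0 t c .
  define g where "g = (\<lambda>s. LINT y|lborel. G (t - s) (x - y) * v s y)"
  define I where "I = (\<lambda>s. LINT y|lborel. Gx (t - s) (x - y) * flux s y)"
  \<comment> \<open>The summand 3 gives e_n \<le> t/3, so the interval is nonempty for every n and
    e_n stays below t/2.\<close>
  define e where "e = (\<lambda>n. t / (real n + 3))"
  have e: "0 < e n" "e n \<le> t / 3" for n
    using t by (auto simp: e_def field_simps)
  have e_lim: "e \<longlonglongrightarrow> 0"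
  proof -
    have "(\<lambda>n. t * inverse (real (n + 3))) \<longlonglongrightarrow> t * 0"
      by (intro tendsto_intros LIMSEQ_ignore_initial_segment[of "\<lambda>n. inverse (real n)" 0 3] lim_inverse_n)
    then show ?thesis by (simp add: e_def divide_inverse add.commute)
  qed
  have Ii: "set_integrable lborel {0<..<t} I" unfolding I_def by (rule S.potx_integrable)
  have ftc: "(LINT s:{e n..t - e n}|lborel. I s) = g (t - e n) - g (e n)" for n
  proof -
    have "(I has_integral (g (t - e n) - g (e n))) {e n..t - e n}"
    proof (rule fundamental_theorem_of_calculus)
      show "e n \<le> t - e n" using e[of n] t by linarith
      fix s assume "s \<in> {e n..t - e n}"
      then have s: "0 < s" "s < t" using e(1)[of n] by (auto simp del: e(1))
      show "(g has_vector_derivative I s) (at s within {e n..t - e n})"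
        using duhamel_deriv[OF s, of x] unfolding g_def I_def
        by (simp add: has_field_derivative_at_within flip: has_real_derivative_iff_has_vector_derivative)
    qed
    moreover have "set_integrable lborel {e n..t - e n} I"
      by (rule set_integrable_subset[OF Ii]) (use e(1)[of n] in auto)
    ultimately show ?thesis using set_borel_integral_eq_integral(2) by (metis integral_unique)
  qed
  have lim1: "(\<lambda>n. LINT s:{e n..t - e n}|lborel. I s) \<longlonglongrightarrow> potx flux t x"
    unfolding potx_def I_def[symmetric] set_lebesgue_integral_def
  proof (rule integral_dominated_convergence[where w = "\<lambda>s. norm (indicator {0<..<t} s *\<^sub>R I s)"])
    have mI: "(\<lambda>s. indicator {0<..<t} s *\<^sub>R I s) \<in> borel_measurable lborel"
      using Ii unfolding set_integrable_def by (rule borel_measurable_integrable)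
    then show "(\<lambda>s. indicator {0<..<t} s *\<^sub>R I s) \<in> borel_measurable lborel" .
    show "integrable lborel (\<lambda>s. norm (indicator {0<..<t} s *\<^sub>R I s))"
      using Ii unfolding set_integrable_def by (rule integrable_norm)
    show "(\<lambda>s. indicator {e n..t - e n} s *\<^sub>R I s) \<in> borel_measurable lborel" for n
    proof -
      have "set_integrable lborel {e n..t - e n} I"
        by (rule set_integrable_subset[OF Ii]) (use e(1)[of n] in auto)
      then show ?thesis unfolding set_integrable_def by (rule borel_measurable_integrable)
    qed
    show "AE s in lborel. norm (indicator {e n..t - e n} s *\<^sub>R I s) \<le> norm (indicator {0<..<t} s *\<^sub>R I s)" for n
      using e(1)[of n] by (intro AE_I2) (auto simp: indicator_def)
    show "AE s in lborel. (\<lambda>n. indicator {e n..t - e n} s *\<^sub>R I s) \<longlonglongrightarrow> indicator {0<..<t} s *\<^sub>R I s"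
    proof (rule AE_I2)
      fix s
      show "(\<lambda>n. indicator {e n..t - e n} s *\<^sub>R I s) \<longlonglongrightarrow> indicator {0<..<t} s *\<^sub>R I s"
      proof (cases "s \<in> {0<..<t}")
        case True
        then have "0 < min s (t - s)" by auto
        then have "\<forall>\<^sub>F n in sequentially. e n < min s (t - s)" using order_tendstoD(2)[OF e_lim] by blast
        then have "\<forall>\<^sub>F n in sequentially. indicator {e n..t - e n} s *\<^sub>R I s = indicator {0<..<t} s *\<^sub>R I s"
          by eventually_elim (use True in \<open>auto simp: indicator_def\<close>)
        then show ?thesis by (rule tendsto_eventually)
      next
        case False
        then have "s \<notin> {e n..t - e n}" for n using e(1)[of n] by auto
        then show ?thesis using False by simp
      qed
    qed
  qed
  have lim2: "(\<lambda>n. g (e n)) \<longlonglongrightarrow> (LINT y|lborel. G t (x - y) * u0 y)"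
  proof (rule LIM_zero_cancel, rule Lim_null_comparison)
    \<comment> \<open>The first summand accounts for replacing the solution at time s by
      \<open>u0\<close>, the second for moving the kernel from time t - s to time t.\<close>
    define k where "k = (\<lambda>s. (t/2) powr (-1/2) * (LINT y|lborel. \<bar>v s y - u0 y\<bar>) + (3200 * t powr (-1) * s * t powr (-1/2)) * (LINT y|lborel. \<bar>u0 y\<bar>))"
    have flux: "filterlim e (at_right 0) sequentially"
      by (rule tendsto_imp_filterlim_at_right[OF e_lim]) (use e in auto)
    have "(\<lambda>n. k (e n)) \<longlonglongrightarrow> (t/2) powr (-1/2) * 0 + (3200 * t powr (-1) * 0 * t powr (-1/2)) * (LINT y|lborel. \<bar>u0 y\<bar>)"
      unfolding k_def by (intro tendsto_intros e_lim filterlim_compose[OF v_initial flux])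
    then show "(\<lambda>n. k (e n)) \<longlonglongrightarrow> 0" by simp
    show "\<forall>\<^sub>F n in sequentially. norm (g (e n) - (LINT y|lborel. G t (x - y) * u0 y)) \<le> k (e n)"
    proof (intro always_eventually allI)
      fix n
      define s where "s = e n"
      have s: "0 < s" "s < t" "s \<le> t / 2" using e[of n] t by (auto simp: s_def)
      have ts: "0 < t - s" using s by simp
      have [measurable]: "v s \<in> borel_measurable borel" using v_meas[OF s(1)] .
      have i0: "integrable lborel (\<lambda>y. v s y - u0 y)" using v_int[OF s(1)] u0_int by simp
      have le1: "\<bar>G (t - s) z\<bar> \<le> (t/2) powr (-1/2)" for z
      proof -
        have "(t - s) powr (-1/2) \<le> (t/2) powr (-1/2)" using s t by (intro powr_mono2') auto
        then show ?thesis using G_le[OF ts, of z] by simp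
      qed
      have le2: "\<bar>G (t - s) z - G t z\<bar> \<le> 3200 * t powr (-1) * s * t powr (-1/2)" for z
      proof -
        have "\<bar>G (t - s) z - G t z\<bar> \<le> 3200 * t powr (-1) * s * G (4 * t) z"
          using G_time_expansion(2)[OF t, of "t - s" z] s by simp
        also have "\<dots> \<le> 3200 * t powr (-1) * s * t powr (-1/2)"
          using s heat_pair_sup[OF t, of 0 z] by (intro mult_left_mono) (auto simp: heat_pair_def)
        finally show ?thesis .
      qed
      note j1 = conv_bounds[OF i0, of "G (t - s)" "(t/2) powr (-1/2)" x, OF _ le1]
      note j2 = conv_bounds[OF u0_int, of "\<lambda>z. G (t - s) z - G t z" _ x, OF _ le2]
      have iG: "integrable lborel (\<lambda>y. G r (x - y) * u0 y)" if "0 < r" for r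
        by (rule conv_bounds(1)[OF u0_int, where c = "r powr (-1/2)"]) (use G_le[OF that] in auto)
      have iv: "integrable lborel (\<lambda>y. G (t - s) (x - y) * v s y)"
        by (rule conv_bounds(1)[OF v_int[OF s(1)], where c = "(t - s) powr (-1/2)"]) (use G_le[OF ts] in auto)
      have "g s - (LINT y|lborel. G t (x - y) * u0 y) = (LINT y|lborel. G (t - s) (x - y) * v s y - G t (x - y) * u0 y)"
        unfolding g_def using iv iG[OF t] by simp
      also have "\<dots> = (LINT y|lborel. G (t - s) (x - y) * (v s y - u0 y) + (G (t - s) (x - y) - G t (x - y)) * u0 y)"
        by (intro Bochner_Integration.integral_cong) (auto simp: algebra_simps)
      also have "\<dots> = (LINT y|lborel. G (t - s) (x - y) * (v s y - u0 y)) + (LINT y|lborel. (G (t - s) (x - y) - G t (x - y)) * u0 y)"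
        using j1(1) j2(1) by (intro Bochner_Integration.integral_add) auto
      finally have "\<bar>g s - (LINT y|lborel. G t (x - y) * u0 y)\<bar> \<le> k s"
        using j1(2) j2(2) unfolding k_def by simp
      then show "norm (g (e n) - (LINT y|lborel. G t (x - y) * u0 y)) \<le> k (e n)" by (simp add: s_def)
    qed
  qed
  obtain V where V: "0 \<le> V" "\<And>y. \<bar>vx t y\<bar> \<le> V" using vx_sup[OF t] t by fastforce
  have lim3: "(\<lambda>n. g (t - e n)) \<longlonglongrightarrow> v t x"
  proof (rule LIM_zero_cancel, rule Lim_null_comparison)
    define r where "r = (\<lambda>s. sqrt (2 * sqrt (sq (\<lambda>x. v s x - v t x) * sq (\<lambda>x. vx s x - vx t x))))"
    have r: "isCont r t" "r t = 0" "\<And>s x. 0 < s \<Longrightarrow> \<bar>v s x - v t x\<bar> \<le> r s"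
      unfolding r_def by (rule sup_diff_tendsto[where H = v and h = vx]; use v_cont vx_cont v_prim v_L2 vx_L2 t in auto)+
    have lip: "\<bar>v t y - v t x\<bar> \<le> V * \<bar>y - x\<bar>" for y
      using field_differentiable_bound[of UNIV "v t" "vx t" V y x] v_deriv_x[OF t] V by simp
    have "(\<lambda>n. t - e n) \<longlonglongrightarrow> t - 0" by (intro tendsto_intros e_lim)
    then have te: "(\<lambda>n. t - e n) \<longlonglongrightarrow> t" by simp
    have "(\<lambda>n. r (t - e n) + V * (1600 * (e n) powr (1/2))) \<longlonglongrightarrow> r t + V * (1600 * 0 powr (1/2))"
      using e by (intro tendsto_intros isCont_tendsto_compose[OF r(1) te] tendsto_powr' e_lim) (auto simp: less_imp_le)
    then show "(\<lambda>n. r (t - e n) + V * (1600 * (e n) powr (1/2))) \<longlonglongrightarrow> 0" by (simp add: r)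
    show "\<forall>\<^sub>F n in sequentially. norm (g (t - e n) - v t x) \<le> r (t - e n) + V * (1600 * (e n) powr (1/2))"
    proof (intro always_eventually allI)
      fix n
      define h where "h = e n"
      define s where "s = t - h"
      have h: "0 < h" using e[of n] by (simp add: h_def)
      have s: "0 < s" using e[of n] t unfolding s_def h_def by linarith
      have [measurable]: "v s \<in> borel_measurable borel" using v_meas[OF s] .
      have iG: "integrable lborel (\<lambda>y. G h (x - y))" by (rule integrable_reflect[OF G_integrable[OF h]])
      have IG: "(LINT y|lborel. G h (x - y)) = 1" using integral_reflect[of "G h" x] G_integral[OF h] by simp
      have iv: "integrable lborel (\<lambda>y. G h (x - y) * v s y)"
        by (rule conv_bounds(1)[OF v_int[OF s], where c = "h powr (-1/2)"]) (use G_le[OF h] in auto)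
      \<comment> \<open>The first absolute moment of the kernel is read off from the known L1 norm
        of \<open>Gx\<close>; it is of order h^(1/2).\<close>
      have Gxa: "G h (x - y) * \<bar>y - x\<bar> = 2 * h * \<bar>Gx h (x - y)\<bar>" for y
        using h by (simp add: Gx_def abs_mult abs_divide abs_minus_commute)
      have iGx: "integrable lborel (\<lambda>y. \<bar>Gx h (x - y)\<bar>)"
        using integrable_reflect[OF Gx_integrable[OF h], of x] by simp
      have IGx: "(LINT y|lborel. \<bar>Gx h (x - y)\<bar>) \<le> 800 * h powr (-1/2)"
        using integral_reflect[of "\<lambda>y. \<bar>Gx h y\<bar>" x] Gx_L1[OF h] by simp
      have "\<bar>g s - v t x\<bar> = \<bar>LINT y|lborel. G h (x - y) * v s y - G h (x - y) * v t x\<bar>"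
        using iv iG IG by (simp add: g_def s_def)
      also have "\<dots> \<le> (LINT y|lborel. \<bar>G h (x - y) * v s y - G h (x - y) * v t x\<bar>)" by (rule integral_abs_bound)
      also have "\<dots> \<le> (LINT y|lborel. r s * G h (x - y) + V * (2 * h) * \<bar>Gx h (x - y)\<bar>)"
      proof (rule integral_mono)
        show "integrable lborel (\<lambda>y. \<bar>G h (x - y) * v s y - G h (x - y) * v t x\<bar>)" using iv iG by simp
        show "integrable lborel (\<lambda>y. r s * G h (x - y) + V * (2 * h) * \<bar>Gx h (x - y)\<bar>)" using iG iGx by simp
        fix y
        have "\<bar>v s y - v t x\<bar> \<le> r s + V * \<bar>y - x\<bar>" using r(3)[OF s, of y] lip[of y] by linarith
        then have "G h (x - y) * \<bar>v s y - v t x\<bar> \<le> G h (x - y) * (r s + V * \<bar>y - x\<bar>)" by (intro mult_left_mono) auto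
        also have "\<dots> = r s * G h (x - y) + V * (G h (x - y) * \<bar>y - x\<bar>)" by (simp add: algebra_simps)
        also have "\<dots> = r s * G h (x - y) + V * (2 * h) * \<bar>Gx h (x - y)\<bar>" unfolding Gxa by simp
        finally show "\<bar>G h (x - y) * v s y - G h (x - y) * v t x\<bar> \<le> r s * G h (x - y) + V * (2 * h) * \<bar>Gx h (x - y)\<bar>"
          by (simp add: abs_mult flip: right_diff_distrib)
      qed
      also have "\<dots> = r s + V * (2 * h) * (LINT y|lborel. \<bar>Gx h (x - y)\<bar>)"
        using iG iGx IG by simp
      also have "\<dots> \<le> r s + V * (2 * h) * (800 * h powr (-1/2))"
        using IGx V h by (intro add_left_mono mult_left_mono) auto
      also have "V * (2 * h) * (800 * h powr (-1/2)) = V * (1600 * h powr (1/2))"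
        using h powr_add[of h 1 "-1/2"] by simp
      finally show "norm (g (t - e n) - v t x) \<le> r (t - e n) + V * (1600 * (e n) powr (1/2))"
        by (simp add: s_def h_def)
    qed
  qed
  have "(\<lambda>n. LINT s:{e n..t - e n}|lborel. I s) \<longlonglongrightarrow> v t x - (LINT y|lborel. G t (x - y) * u0 y)"
    unfolding ftc by (rule tendsto_diff[OF lim3 lim2])
  from LIMSEQ_unique[OF lim1 this] show ?thesis by simp
qed

end

subsection \<open>Comparison with the heat kernel\<close>

context flow
begin

definition M0 :: real where "M0 = mass u0"

definition moment1 :: real where "moment1 = (LINT y|lborel. \<bar>y\<bar> * \<bar>u0 y\<bar>)"

lemma moment_int: "integrable lborel (\<lambda>y. \<bar>y\<bar> * \<bar>u0 y\<bar>)" "integrable lborel (\<lambda>y. y * u0 y)"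
proof -
  show "integrable lborel (\<lambda>y. \<bar>y\<bar> * \<bar>u0 y\<bar>)"
    by (rule integrable_le[OF u0_moment]) (auto simp: algebra_simps)
  show "integrable lborel (\<lambda>y. y * u0 y)"
    by (rule integrable_le[OF u0_moment]) (auto simp: algebra_simps abs_mult)
qed

lemma moment1_nonneg: "0 \<le> moment1" by (simp add: moment1_def)

lemma conv_u0_integrable: "0 < t \<Longrightarrow> integrable lborel (\<lambda>y. G t (x - y) * u0 y)"
  by (rule conv_bounds(1)[OF u0_int, where c = "t powr (-1/2)"]) (use G_le[of t] in auto)

text \<open>Zeroth-order expansion of the kernel about y = 0. Bounding \<open>cutoff\<close> by |y|
  / sqrt t spends the whole first moment on a rate.\<close>

lemma heat_L1:
  assumes t: "0 < t"
  shows "(\<integral>\<^sup>+x. ennreal \<bar>(LINT y|lborel. G t (x - y) * u0 y) - M0 * G t x\<bar> \<partial>lborel) \<le> ennreal (12800 * moment1 * t powr (-1/2))"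
proof -
  define w where "w = (\<lambda>y. 6400 * (t powr (-1/2) * (\<bar>y\<bar> * \<bar>u0 y\<bar>)))"
  have sp: "1 / sqrt t = t powr (-1/2)" using t by (simp add: powr_minus_divide powr_half_sqrt)
  have "(\<integral>\<^sup>+x. ennreal \<bar>(LINT y|lborel. G t (x - y) * u0 y) - M0 * G t x\<bar> \<partial>lborel) \<le> ennreal (2 * integral\<^sup>L lborel w)"
  proof (rule heat_pair_average(2)[OF sigma_finite_lborel _ _ _ t, where Y = "\<lambda>y. y"])
    show "integrable lborel w" unfolding w_def using moment_int(1) by simp
    show "0 \<le> w y" for y by (simp add: w_def)
    fix x
    have "(LINT y|lborel. G t (x - y) * u0 y) - M0 * G t x = (LINT y|lborel. G t (x - y) * u0 y - G t x * u0 y)"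
      using conv_u0_integrable[OF t, of x] u0_int by (simp add: M0_def mass_def)
    then have "ennreal \<bar>(LINT y|lborel. G t (x - y) * u0 y) - M0 * G t x\<bar> \<le> (\<integral>\<^sup>+y. ennreal \<bar>G t (x - y) * u0 y - G t x * u0 y\<bar> \<partial>lborel)"
      using ennreal_abs_integral_le by metis
    also have "\<dots> \<le> (\<integral>\<^sup>+y. ennreal (w y * heat_pair t y x) \<partial>lborel)"
    proof (intro nn_integral_mono ennreal_leI)
      fix y
      have "\<bar>G t (x - y) * u0 y - G t x * u0 y\<bar> = \<bar>G t (x - y) - G t x\<bar> * \<bar>u0 y\<bar>" by (simp add: left_diff_distrib flip: abs_mult)
      also have "\<dots> \<le> (6400 * cutoff t y * heat_pair t y x) * \<bar>u0 y\<bar>" by (rule mult_right_mono[OF G_diff[OF t]]) simp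
      also have "\<dots> \<le> (6400 * (\<bar>y\<bar> * (1 / sqrt t)) * heat_pair t y x) * \<bar>u0 y\<bar>"
        using cutoff_bounds(3)[of t y] by (intro mult_right_mono mult_left_mono) auto
      also have "\<dots> = w y * heat_pair t y x" by (simp add: w_def sp)
      finally show "\<bar>G t (x - y) * u0 y - G t x * u0 y\<bar> \<le> w y * heat_pair t y x" .
    qed
    finally show "ennreal \<bar>(LINT y|lborel. G t (x - y) * u0 y) - M0 * G t x\<bar> \<le> (\<integral>\<^sup>+y. ennreal (w y * heat_pair t y x) \<partial>lborel)" .
  qed simp
  also have "2 * integral\<^sup>L lborel w = 12800 * moment1 * t powr (-1/2)" by (simp add: w_def moment1_def)
  finally show ?thesis .
qed

lemma A0_nonneg: "0 \<le> A0"
  using D0(1) L1_cap_pos by (simp add: A0_def)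

lemma flux_joint: "(\<lambda>(s, y). flux s y) \<in> borel_measurable (borel \<Otimes>\<^sub>M borel)" by measurable

lemma potx_flux_L1:
  assumes t: "0 < t"
  shows "(\<integral>\<^sup>+x. ennreal \<bar>potx flux t x\<bar> \<partial>lborel) \<le> ennreal (12800 * A0 * t powr (-1/4))"
proof -
  have eq: "(\<lambda>s. 800 * (t - s) powr (-1/2) * (A0 * s powr (-3/4))) = (\<lambda>s. (800 * A0) * ((t - s) powr (-1/2) * s powr (-3/4)))"
    by (auto simp: mult_ac)
  have "(\<integral>\<^sup>+x. ennreal \<bar>potx flux t x\<bar> \<partial>lborel) \<le> ennreal (LINT s:{0<..<t}|lborel. 800 * (t - s) powr (-1/2) * (A0 * s powr (-3/4)))"
    unfolding potx_def
  proof (rule potential_L1[OF flux_joint])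
    show "set_integrable lborel {0<..<t} (\<lambda>s. 800 * (t - s) powr (-1/2) * (A0 * s powr (-3/4)))"
      unfolding eq by (intro set_integrable_mult_right beta_integral_le(1) t)
  qed (use flux_bounds A0_nonneg in auto)
  also have "(LINT s:{0<..<t}|lborel. 800 * (t - s) powr (-1/2) * (A0 * s powr (-3/4))) = 800 * A0 * (LINT s:{0<..<t}|lborel. (t - s) powr (-1/2) * s powr (-3/4))"
    unfolding eq by simp
  also have "\<dots> \<le> 800 * A0 * (16 * t powr (-1/4))"
    using beta_integral_le(2)[OF t] A0_nonneg by (intro mult_left_mono) auto
  finally show ?thesis by (simp add: ennreal_leI mult.assoc)
qed

definition deviation :: "real \<Rightarrow> real \<Rightarrow> real" where "deviation t x = v t x - M0 * G t x"

definition C1 :: real where "C1 = 12800 * moment1 + 12800 * A0"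

text \<open>The rate t^(-1/4) is that of the perturbation, whose L1 norm is bounded by a multiple of
  s^(-3/4). For t \<ge> 1 it absorbs the faster rate t^(-1/2) of the heat flow of the initial
  value.\<close>

lemma deviation_L1:
  assumes t: "1 \<le> t"
  shows "integrable lborel (deviation t)" "(LINT x|lborel. \<bar>deviation t x\<bar>) \<le> C1 * t powr (-1/4)"
proof -
  have t0: "0 < t" using t by simp
  obtain c where "source flux A0 t c" using source_flux[OF t0] by blast
  then interpret S: source flux A0 t c .
  note [measurable] = S.potx_measurable
  show i: "integrable lborel (deviation t)" unfolding deviation_def[abs_def] using v_int[OF t0] G_integrable[OF t0] by simp
  have "ennreal (LINT x|lborel. \<bar>deviation t x\<bar>) = (\<integral>\<^sup>+x. ennreal \<bar>deviation t x\<bar> \<partial>lborel)"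
    using i by (subst nn_integral_eq_integral) auto
  also have "\<dots> \<le> (\<integral>\<^sup>+x. ennreal \<bar>(LINT y|lborel. G t (x - y) * u0 y) - M0 * G t x\<bar> + ennreal \<bar>potx flux t x\<bar> \<partial>lborel)"
  proof (intro nn_integral_mono)
    fix x
    have "\<bar>deviation t x\<bar> \<le> \<bar>(LINT y|lborel. G t (x - y) * u0 y) - M0 * G t x\<bar> + \<bar>potx flux t x\<bar>"
      unfolding deviation_def duhamel[OF t0, of x] by linarith
    then show "ennreal \<bar>deviation t x\<bar> \<le> ennreal \<bar>(LINT y|lborel. G t (x - y) * u0 y) - M0 * G t x\<bar> + ennreal \<bar>potx flux t x\<bar>"
      by (simp add: ennreal_leI flip: ennreal_plus)
  qed
  also have "\<dots> = (\<integral>\<^sup>+x. ennreal \<bar>(LINT y|lborel. G t (x - y) * u0 y) - M0 * G t x\<bar> \<partial>lborel) + (\<integral>\<^sup>+x. ennreal \<bar>potx flux t x\<bar> \<partial>lborel)"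
    by (rule nn_integral_add) measurable
  also have "\<dots> \<le> ennreal (12800 * moment1 * t powr (-1/2)) + ennreal (12800 * A0 * t powr (-1/4))"
    by (intro add_mono heat_L1 potx_flux_L1 t0)
  also have "\<dots> = ennreal (12800 * moment1 * t powr (-1/2) + 12800 * A0 * t powr (-1/4))"
    using moment1_nonneg A0_nonneg by (simp add: ennreal_plus)
  finally have "(LINT x|lborel. \<bar>deviation t x\<bar>) \<le> 12800 * moment1 * t powr (-1/2) + 12800 * A0 * t powr (-1/4)"
    using moment1_nonneg A0_nonneg by (subst (asm) ennreal_le_iff) auto
  also have "\<dots> \<le> 12800 * moment1 * t powr (-1/4) + 12800 * A0 * t powr (-1/4)"
    using moment1_nonneg t by (intro add_right_mono mult_left_mono powr_mono) auto
  finally show "(LINT x|lborel. \<bar>deviation t x\<bar>) \<le> C1 * t powr (-1/4)" by (simp add: C1_def algebra_simps)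
qed

lemma C1_nonneg: "0 \<le> C1" using moment1_nonneg A0_nonneg by (simp add: C1_def)

definition C3 :: real where "C3 = root 3 (4 * C1 * (2 * D0 + 1280000 * M0\<^sup>2))"

text \<open>Interpolation between the L1 rate t^(-1/4) and the rate t^(-3/2) for the squared L2 norm
  of the derivative: 7/12 = (1/4 + 3/2) / 3. The gain over the rate t^(-1/2) of either term is what
  later controls recent times in the supremum norm.\<close>

lemma deviation_sup:
  assumes t: "1 \<le> t"
  shows "\<bar>deviation t x\<bar> \<le> C3 * t powr (-7/12)"
proof -
  have t0: "0 < t" using t by simp
  have GL: "L2 (Gx t)" "sq (Gx t) \<le> 800 * t powr (-1) * (LINT x|lborel. \<bar>Gx t x\<bar>)"
    using L2_bounded_integrable[OF Gx_integrable[OF t0] Gx_sup[OF t0]] by auto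
  have "sq (Gx t) \<le> 800 * t powr (-1) * (800 * t powr (-1/2))"
    by (rule order_trans[OF GL(2) mult_left_mono[OF Gx_L1[OF t0]]]) simp
  also have "\<dots> = 640000 * (t powr (-1) * t powr (-1/2))" by simp
  also have "t powr (-1) * t powr (-1/2) = t powr (-3/2)" by (subst powr_add[symmetric]) simp
  finally have g: "sq (Gx t) \<le> 640000 * t powr (-3/2)" .
  define wx where "wx = (\<lambda>x. vx t x + - M0 * Gx t x)"
  have LM: "L2 (\<lambda>x. - M0 * Gx t x)" by (rule L2_cmult[OF GL(1)])
  have wxL: "L2 wx" unfolding wx_def by (rule L2_add[OF vx_L2[OF t0] LM])
  have "sq wx \<le> 2 * sq (vx t) + 2 * sq (\<lambda>x. - M0 * Gx t x)"
    unfolding wx_def by (rule sq_add_le[OF vx_L2[OF t0] LM])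
  also have "\<dots> = 2 * sq (vx t) + 2 * (M0\<^sup>2 * sq (Gx t))" using sq_cmult[of "- M0" "Gx t"] by simp
  also have "\<dots> \<le> 2 * (D0 * t powr (-3/2)) + 2 * (M0\<^sup>2 * (640000 * t powr (-3/2)))"
    by (intro add_mono mult_left_mono D0(4)[OF t0] g) auto
  also have "\<dots> = (2 * D0 + 1280000 * M0\<^sup>2) * t powr (-3/2)" by (simp add: algebra_simps)
  finally have wx: "sq wx \<le> (2 * D0 + 1280000 * M0\<^sup>2) * t powr (-3/2)" .
  have pw: "prim (deviation t) wx"
  proof -
    have cG: "continuous_on UNIV (Gx t)" using t0 unfolding Gx_def[abs_def] G_def by (auto intro!: continuous_intros)
    from prim_add[OF v_prim[OF t0] prim_cmult[OF prim_C1[OF G_deriv_x[OF t0] cG], of "- M0"]]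
    show ?thesis by (simp add: deviation_def[abs_def] wx_def)
  qed
  have wL: "L2 (deviation t)"
    unfolding deviation_def[abs_def] by (intro L2_diff L2_cmult v_L2 G_L2 t0)
  have "\<bar>deviation t x\<bar> ^ 3 \<le> 4 * (LINT z|lborel. \<bar>deviation t z\<bar>) * sq wx"
    by (rule prim_sup_L1_L2[OF pw wL wxL deviation_L1(1)[OF t]])
  also have "\<dots> \<le> 4 * (C1 * t powr (-1/4)) * ((2 * D0 + 1280000 * M0\<^sup>2) * t powr (-3/2))"
    using deviation_L1(2)[OF t] wx C1_nonneg by (intro mult_mono mult_left_mono) auto
  also have "\<dots> = (4 * C1 * (2 * D0 + 1280000 * M0\<^sup>2)) * (t powr (-1/4) * t powr (-3/2))" by simp
  also have "t powr (-1/4) * t powr (-3/2) = (t powr (-7/12)) ^ 3" using t0 by (simp add: powr_power flip: powr_add)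
  also have "4 * C1 * (2 * D0 + 1280000 * M0\<^sup>2) = C3 ^ 3"
    unfolding C3_def using C1_nonneg D0(1) by (intro real_root_pow_pos2[symmetric]) auto
  finally have "\<bar>deviation t x\<bar> ^ 3 \<le> (C3 * t powr (-7/12)) ^ 3" by (simp only: power_mult_distrib)
  then have "\<bar>deviation t x\<bar> ^ Suc 2 \<le> (C3 * t powr (-7/12)) ^ Suc 2" by (simp only: numeral_3_eq_3 numeral_2_eq_2)
  moreover have "0 \<le> C3" unfolding C3_def using C1_nonneg D0(1) by simp
  ultimately show ?thesis using power_le_imp_le_base by (metis mult_nonneg_nonneg powr_ge_zero)
qed

section \<open>The difference between the cubes of the solution and of its heat profile\<close>

text \<open>The cube of \<open>M0 * G s\<close> has mass of order \<open>1 / s\<close>, so it can be subtracted only away from \<open>s = 0\<close>.\<close>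

definition defect :: "real \<Rightarrow> real \<Rightarrow> real" where
  "defect s y = v s y ^ 3 - (if 1 \<le> s then (M0 * G s y) ^ 3 else 0)"

lemma defect_measurable [measurable (raw)]:
  assumes "f \<in> borel_measurable M" "g \<in> borel_measurable M"
  shows "(\<lambda>w. defect (f w) (g w)) \<in> borel_measurable M"
  using assms unfolding defect_def by measurable

lemma defect_joint: "(\<lambda>(s, y). defect s y) \<in> borel_measurable (borel \<Otimes>\<^sub>M borel)" by measurable

definition C4 :: real where "C4 = 3 * (D0 + \<bar>M0\<bar>)\<^sup>2"
definition C5 :: real where "C5 = C4 * C1 + C4 * C3 + D0\<^sup>2 * L1_cap"

lemma C_nonneg: "0 \<le> C3" "0 \<le> C4" "0 \<le> C5" "C4 * C1 \<le> C5" "C4 * C3 \<le> C5" "D0\<^sup>2 * L1_cap \<le> C5"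
proof -
  show 3: "0 \<le> C3" unfolding C3_def using C1_nonneg D0(1) by simp
  show 4: "0 \<le> C4" by (simp add: C4_def)
  have "0 \<le> C4 * C1" "0 \<le> C4 * C3" "0 \<le> D0\<^sup>2 * L1_cap" using 3 4 C1_nonneg L1_cap_pos by auto
  then show "0 \<le> C5" "C4 * C1 \<le> C5" "C4 * C3 \<le> C5" "D0\<^sup>2 * L1_cap \<le> C5" by (auto simp: C5_def)
qed

text \<open>From p^3 - r^3 = (p^2 + p r + r^2)(p - r), where p and r are both of size s^(-1/2); the
  three terms are the 3 in \<open>C4\<close>.\<close>

lemma defect_le_deviation:
  assumes s: "1 \<le> s" shows "\<bar>defect s y\<bar> \<le> C4 * s powr (-1) * \<bar>deviation s y\<bar>"
proof -
  have s0: "0 < s" using s by simp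
  define p where "p = v s y"
  define r where "r = M0 * G s y"
  define c where "c = (D0 + \<bar>M0\<bar>) * s powr (-1/2)"
  have c: "\<bar>p\<bar> \<le> c" "\<bar>r\<bar> \<le> c" "0 \<le> c"
  proof -
    have "\<bar>p\<bar> \<le> D0 * s powr (-1/2)" unfolding p_def by (rule D0(2)[OF s0])
    then show "\<bar>p\<bar> \<le> c" unfolding c_def by (simp add: distrib_right add_increasing2)
    have "\<bar>r\<bar> \<le> \<bar>M0\<bar> * s powr (-1/2)" unfolding r_def abs_mult using G_le[OF s0, of y] by (intro mult_left_mono) auto
    then show "\<bar>r\<bar> \<le> c" unfolding c_def using D0(1) by (simp add: distrib_right add_increasing)
    show "0 \<le> c" unfolding c_def using D0(1) by simp
  qed
  have "defect s y = (p * p + p * r + r * r) * deviation s y"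
    using s by (simp add: defect_def deviation_def p_def r_def power3_eq_cube algebra_simps)
  then have "\<bar>defect s y\<bar> = \<bar>p * p + p * r + r * r\<bar> * \<bar>deviation s y\<bar>" by (simp only: abs_mult)
  also have "\<dots> \<le> (c * c + c * c + c * c) * \<bar>deviation s y\<bar>"
  proof (rule mult_right_mono)
    have "\<bar>p * p\<bar> \<le> c * c" "\<bar>p * r\<bar> \<le> c * c" "\<bar>r * r\<bar> \<le> c * c" unfolding abs_mult by (intro mult_mono c abs_ge_zero)+
    then show "\<bar>p * p + p * r + r * r\<bar> \<le> c * c + c * c + c * c" by linarith
  qed simp
  also have "c * c + c * c + c * c = C4 * s powr (-1)"
  proof -
    have "c * c = (D0 + \<bar>M0\<bar>)\<^sup>2 * (s powr (-1/2) * s powr (-1/2))" by (simp add: c_def power2_eq_square)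
    also have "s powr (-1/2) * s powr (-1/2) = s powr (-1)" by (subst powr_add[symmetric]) simp
    finally show ?thesis by (simp add: C4_def)
  qed
  finally show ?thesis .
qed

text \<open>The factor 1/s of \<open>defect_le_deviation\<close> raises the L1 exponent from 1/4 to
  5/4, integrable at infinity, and the supremum exponent from 7/12 to 19/12.\<close>

lemma defect_large:
  assumes s: "1 \<le> s"
  shows "integrable lborel (defect s)" "(LINT y|lborel. \<bar>defect s y\<bar>) \<le> C5 * s powr (-5/4)" "\<bar>defect s y\<bar> \<le> C5 * s powr (-19/12)"
proof -
  have s0: "0 < s" using s by simp
  have i: "integrable lborel (\<lambda>y. C4 * s powr (-1) * \<bar>deviation s y\<bar>)" using deviation_L1(1)[OF s] by simp
  show i': "integrable lborel (defect s)" by (rule integrable_le[OF i _ defect_le_deviation[OF s]]) measurable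
  have "(LINT y|lborel. \<bar>defect s y\<bar>) \<le> (LINT y|lborel. C4 * s powr (-1) * \<bar>deviation s y\<bar>)"
    by (rule integral_mono) (use i i' defect_le_deviation[OF s] in auto)
  also have "\<dots> = C4 * s powr (-1) * (LINT y|lborel. \<bar>deviation s y\<bar>)" by simp
  also have "\<dots> \<le> C4 * s powr (-1) * (C1 * s powr (-1/4))"
    using deviation_L1(2)[OF s] C_nonneg(2) by (intro mult_left_mono) auto
  also have "\<dots> = (C4 * C1) * (s powr (-1) * s powr (-1/4))" by simp
  also have "s powr (-1) * s powr (-1/4) = s powr (-5/4)" by (subst powr_add[symmetric]) simp
  also have "(C4 * C1) * s powr (-5/4) \<le> C5 * s powr (-5/4)" by (intro mult_right_mono C_nonneg) auto
  finally show "(LINT y|lborel. \<bar>defect s y\<bar>) \<le> C5 * s powr (-5/4)" .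
  have "\<bar>defect s y\<bar> \<le> C4 * s powr (-1) * (C3 * s powr (-7/12))"
    using deviation_sup[OF s, of y] C_nonneg(2) by (intro order_trans[OF defect_le_deviation[OF s] mult_left_mono]) auto
  also have "\<dots> = (C4 * C3) * (s powr (-1) * s powr (-7/12))" by simp
  also have "s powr (-1) * s powr (-7/12) = s powr (-19/12)" by (subst powr_add[symmetric]) simp
  also have "(C4 * C3) * s powr (-19/12) \<le> C5 * s powr (-19/12)" by (intro mult_right_mono C_nonneg) auto
  finally show "\<bar>defect s y\<bar> \<le> C5 * s powr (-19/12)" .
qed

lemma defect_small:
  assumes s: "0 < s" "s < 1"
  shows "integrable lborel (defect s)" "(LINT y|lborel. \<bar>defect s y\<bar>) \<le> C5 * s powr (-2/3)"
proof -
  have eq: "defect s = (\<lambda>y. v s y ^ 3)" using s by (auto simp: defect_def)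
  show "integrable lborel (defect s)" unfolding eq by (rule v3_bounds(1)[OF s(1)])
  have "(LINT y|lborel. \<bar>defect s y\<bar>) \<le> D0\<^sup>2 * L1_cap * s powr (-2/3)" unfolding eq by (rule v3_bounds(3)[OF s(1)])
  also have "\<dots> \<le> C5 * s powr (-2/3)" by (intro mult_right_mono C_nonneg) auto
  finally show "(LINT y|lborel. \<bar>defect s y\<bar>) \<le> C5 * s powr (-2/3)" .
qed

lemma defect_int: "0 < s \<Longrightarrow> integrable lborel (defect s)"
  using defect_small(1)[of s] defect_large(1)[of s] by (cases "s < 1") auto

lemma powr_tail_integrable: "set_integrable lborel {1..} (\<lambda>s::real. s powr (-5/4))"
proof -
  have "((\<lambda>x. x powr (-5/4)) has_integral - ((1::real) powr (-5/4 + 1)) / (-5/4 + 1)) {1..}"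
    by (rule has_integral_powr_to_inf) auto
  then have "(\<lambda>x::real. x powr (-5/4)) absolutely_integrable_on {1..}"
    by (intro nonnegative_absolutely_integrable_1) (auto simp: integrable_on_def)
  then have "set_integrable lebesgue {1..} (\<lambda>x::real. x powr (-5/4))" .
  then show ?thesis
    unfolding set_integrable_def by (subst (asm) integrable_completion) auto
qed

definition defect_majorant :: "real \<Rightarrow> real" where
  "defect_majorant s = C5 * (indicator {0<..<1} s * s powr (-2/3)) + C5 * (indicator {1..} s * s powr (-5/4))"

lemma defect_majorant_integrable: "integrable lborel defect_majorant"
  unfolding defect_majorant_def[abs_def]
  using powr_has_integral(1)[of "-2/3" 1] powr_tail_integrable by (simp add: set_integrable_def)

lemma defect_le_defect_majorant: "0 < s \<Longrightarrow> (LINT y|lborel. \<bar>defect s y\<bar>) \<le> defect_majorant s"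
  using defect_small(2)[of s] defect_large(2)[of s] by (cases "s < 1") (auto simp: defect_majorant_def)

lemma abs_defect_set_integrable: "set_integrable lborel {0<..} (\<lambda>s. LINT y|lborel. \<bar>defect s y\<bar>)"
  unfolding set_integrable_def
proof (rule Bochner_Integration.integrable_bound[OF defect_majorant_integrable])
  show "(\<lambda>s. indicator {0<..} s *\<^sub>R (LINT y|lborel. \<bar>defect s y\<bar>)) \<in> borel_measurable lborel" by measurable
  show "AE s in lborel. norm (indicator {0<..} s *\<^sub>R (LINT y|lborel. \<bar>defect s y\<bar>)) \<le> norm (defect_majorant s)"
    using defect_le_defect_majorant by (intro AE_I2) (auto simp: indicator_def intro: order_trans[OF _ abs_ge_self])
qed

lemma defect_set_integrable: "set_integrable lborel {0<..} (\<lambda>s. LINT y|lborel. defect s y)"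
  unfolding set_integrable_def
proof (rule Bochner_Integration.integrable_bound[OF abs_defect_set_integrable[unfolded set_integrable_def]])
  show "(\<lambda>s. indicator {0<..} s *\<^sub>R (LINT y|lborel. defect s y)) \<in> borel_measurable lborel" by measurable
  show "AE s in lborel. norm (indicator {0<..} s *\<^sub>R (LINT y|lborel. defect s y)) \<le> norm (indicator {0<..} s *\<^sub>R (LINT y|lborel. \<bar>defect s y\<bar>))"
    using integral_abs_bound[of lborel "defect _"] by (intro AE_I2) (auto simp: indicator_def)
qed

text \<open>Supplies the dominating function on space-time for the limit in
  \<open>early_remainder_small\<close>.\<close>

lemma defect_product_integrable: "integrable (lborel \<Otimes>\<^sub>M lborel) (\<lambda>p. indicator {0<..} (fst p) * \<bar>defect (fst p) (snd p)\<bar>)"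
proof (rule lborel_pair.Fubini_integrable)
  show "integrable lborel (\<lambda>s. LINT y|lborel. norm (indicator {0<..} (fst (s, y)) * \<bar>defect (fst (s, y)) (snd (s, y))\<bar>))"
    using abs_defect_set_integrable by (simp add: set_integrable_def)
  show "AE s in lborel. integrable lborel (\<lambda>y. indicator {0<..} (fst (s, y)) * \<bar>defect (fst (s, y)) (snd (s, y))\<bar>)"
    using defect_int by (intro AE_I2) (auto simp: indicator_def)
qed measurable

lemma source_defect:
  assumes t: "0 < t"
  shows "source defect C5 t ((D0 * (t/2) powr (-1/2)) ^ 3 + (\<bar>M0\<bar> * (t/2) powr (-1/2)) ^ 3)"
proof
  show "(\<lambda>(s, y). defect s y) \<in> borel_measurable (borel \<Otimes>\<^sub>M borel)" by (rule defect_joint)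
  show "0 < t" by fact
next
  fix s :: real assume s: "0 < s"
  show "integrable lborel (defect s)" by (rule defect_int[OF s])
  show "(LINT y|lborel. \<bar>defect s y\<bar>) \<le> C5 * s powr (-3/4)"
  proof (cases "s < 1")
    case True
    then have "s powr (-2/3) \<le> s powr (-3/4)" using s by (intro powr_mono') auto
    then show ?thesis using defect_small(2)[OF s True] mult_left_mono[OF _ C_nonneg(3)] by (meson order_trans)
  next
    case False
    then have "s powr (-5/4) \<le> s powr (-3/4)" by (intro powr_mono) auto
    then show ?thesis using defect_large(2)[of s] False mult_left_mono[OF _ C_nonneg(3)] by (meson not_less order_trans)
  qed
next
  fix s y :: real
  assume s: "t / 2 \<le> s"
  have "\<bar>(M0 * G s y) ^ 3\<bar> \<le> (\<bar>M0\<bar> * (t/2) powr (-1/2)) ^ 3"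
  proof -
    have "G s y \<le> s powr (-1/2)" using s t by (intro G_le) auto
    also have "\<dots> \<le> (t/2) powr (-1/2)" using s t by (intro powr_mono2') auto
    finally have "\<bar>M0 * G s y\<bar> \<le> \<bar>M0\<bar> * (t/2) powr (-1/2)" by (simp add: abs_mult mult_left_mono)
    then have "\<bar>M0 * G s y\<bar> ^ 3 \<le> (\<bar>M0\<bar> * (t/2) powr (-1/2)) ^ 3" by (intro power_mono) auto
    then show ?thesis by (simp only: power_abs)
  qed
  then show "\<bar>defect s y\<bar> \<le> (D0 * (t/2) powr (-1/2)) ^ 3 + (\<bar>M0\<bar> * (t/2) powr (-1/2)) ^ 3"
    using v_cube_sup[OF t s, of y] unfolding defect_def by (auto intro: order_trans[OF abs_triangle_ineq4])
qed

end

subsection \<open>Remainder terms\<close>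

text \<open>Sup norm \<open>o(1 / t)\<close> and \<open>L\<^sup>1\<close> norm \<open>o(1 / sqrt t)\<close>; all other \<open>L\<^sup>p\<close> norms follow by interpolation.\<close>

definition small :: "(real \<Rightarrow> real \<Rightarrow> real) \<Rightarrow> bool" where
  "small T \<longleftrightarrow> (\<exists>e. (e \<longlongrightarrow> 0) at_top \<and> (\<forall>\<^sub>F t in at_top. T t \<in> borel_measurable borel \<and>
     (\<forall>x. \<bar>T t x\<bar> \<le> e t * t powr (-1)) \<and> (\<integral>\<^sup>+x. ennreal \<bar>T t x\<bar> \<partial>lborel) \<le> ennreal (e t * t powr (-1/2))))"

lemma smallI:
  assumes "(e \<longlongrightarrow> 0) at_top"
    and "\<And>t. t0 \<le> t \<Longrightarrow> T t \<in> borel_measurable borel"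
    and "\<And>t x. t0 \<le> t \<Longrightarrow> \<bar>T t x\<bar> \<le> e t * t powr (-1)"
    and "\<And>t. t0 \<le> t \<Longrightarrow> (\<integral>\<^sup>+x. ennreal \<bar>T t x\<bar> \<partial>lborel) \<le> ennreal (e t * t powr (-1/2))"
  shows "small T"
  unfolding small_def
  using assms by (intro exI[of _ e] conjI eventually_mono[OF eventually_ge_at_top[of t0]]) auto

lemma small_add:
  assumes "small S" "small T" shows "small (\<lambda>t x. S t x + T t x)"
proof -
  obtain e where e: "(e \<longlongrightarrow> 0) at_top" "\<forall>\<^sub>F t in at_top. S t \<in> borel_measurable borel \<and>
     (\<forall>x. \<bar>S t x\<bar> \<le> e t * t powr (-1)) \<and> (\<integral>\<^sup>+x. ennreal \<bar>S t x\<bar> \<partial>lborel) \<le> ennreal (e t * t powr (-1/2))"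
    using assms(1) unfolding small_def by blast
  obtain r where r: "(r \<longlongrightarrow> 0) at_top" "\<forall>\<^sub>F t in at_top. T t \<in> borel_measurable borel \<and>
     (\<forall>x. \<bar>T t x\<bar> \<le> r t * t powr (-1)) \<and> (\<integral>\<^sup>+x. ennreal \<bar>T t x\<bar> \<partial>lborel) \<le> ennreal (r t * t powr (-1/2))"
    using assms(2) unfolding small_def by blast
  show ?thesis
    unfolding small_def
  proof (intro exI[of _ "\<lambda>t. e t + r t"] conjI)
    show "((\<lambda>t. e t + r t) \<longlongrightarrow> 0) at_top" using tendsto_add[OF e(1) r(1)] by simp
    show "\<forall>\<^sub>F t in at_top. (\<lambda>x. S t x + T t x) \<in> borel_measurable borel \<and> (\<forall>x. \<bar>S t x + T t x\<bar> \<le> (e t + r t) * t powr (-1)) \<and>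
      (\<integral>\<^sup>+x. ennreal \<bar>S t x + T t x\<bar> \<partial>lborel) \<le> ennreal ((e t + r t) * t powr (-1/2))"
      using e(2) r(2) eventually_gt_at_top[of 0]
    proof eventually_elim
      case (elim t)
      then have [measurable]: "S t \<in> borel_measurable borel" "T t \<in> borel_measurable borel" by auto
      have nn: "0 \<le> e t" "0 \<le> r t"
      proof -
        have "0 \<le> e t * t powr (-1)" "0 \<le> r t * t powr (-1)" using elim abs_ge_zero order_trans by blast+
        then show "0 \<le> e t" "0 \<le> r t" using elim by (simp_all add: zero_le_mult_iff zero_le_divide_iff)
      qed
      have "\<bar>S t x + T t x\<bar> \<le> (e t + r t) * t powr (-1)" for x
        using elim abs_triangle_ineq[of "S t x" "T t x"] unfolding distrib_right by (meson add_mono order_trans)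
      moreover have "(\<integral>\<^sup>+x. ennreal \<bar>S t x + T t x\<bar> \<partial>lborel) \<le> ennreal ((e t + r t) * t powr (-1/2))"
      proof -
        have "(\<integral>\<^sup>+x. ennreal \<bar>S t x + T t x\<bar> \<partial>lborel) \<le> (\<integral>\<^sup>+x. ennreal \<bar>S t x\<bar> + ennreal \<bar>T t x\<bar> \<partial>lborel)"
          by (intro nn_integral_mono) (simp add: abs_triangle_ineq ennreal_leI flip: ennreal_plus)
        also have "\<dots> = (\<integral>\<^sup>+x. ennreal \<bar>S t x\<bar> \<partial>lborel) + (\<integral>\<^sup>+x. ennreal \<bar>T t x\<bar> \<partial>lborel)"
          by (rule nn_integral_add) measurable
        also have "\<dots> \<le> ennreal (e t * t powr (-1/2)) + ennreal (r t * t powr (-1/2))"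
          using elim by (intro add_mono) auto
        also have "\<dots> = ennreal ((e t + r t) * t powr (-1/2))"
          using nn by (simp add: distrib_right flip: ennreal_plus)
        finally show ?thesis .
      qed
      ultimately show ?case by simp
    qed
  qed
qed

lemma small_cmult:
  assumes "small T" shows "small (\<lambda>t x. c * T t x)"
proof -
  obtain r where r: "(r \<longlongrightarrow> 0) at_top" "\<forall>\<^sub>F t in at_top. T t \<in> borel_measurable borel \<and>
     (\<forall>x. \<bar>T t x\<bar> \<le> r t * t powr (-1)) \<and> (\<integral>\<^sup>+x. ennreal \<bar>T t x\<bar> \<partial>lborel) \<le> ennreal (r t * t powr (-1/2))"
    using assms unfolding small_def by blast
  show ?thesis
    unfolding small_def
  proof (intro exI[of _ "\<lambda>t. \<bar>c\<bar> * r t"] conjI)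
    show "((\<lambda>t. \<bar>c\<bar> * r t) \<longlongrightarrow> 0) at_top" using tendsto_mult_left[OF r(1), of "\<bar>c\<bar>"] by simp
    show "\<forall>\<^sub>F t in at_top. (\<lambda>x. c * T t x) \<in> borel_measurable borel \<and> (\<forall>x. \<bar>c * T t x\<bar> \<le> \<bar>c\<bar> * r t * t powr (-1)) \<and>
      (\<integral>\<^sup>+x. ennreal \<bar>c * T t x\<bar> \<partial>lborel) \<le> ennreal (\<bar>c\<bar> * r t * t powr (-1/2))"
      using r(2)
    proof eventually_elim
      case (elim t)
      then have [measurable]: "T t \<in> borel_measurable borel" by auto
      have "\<bar>c * T t x\<bar> \<le> \<bar>c\<bar> * r t * t powr (-1)" for x
        using elim mult_left_mono[of "\<bar>T t x\<bar>" "r t * t powr (-1)" "\<bar>c\<bar>"] by (simp add: abs_mult mult.assoc)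
      moreover have "(\<integral>\<^sup>+x. ennreal \<bar>c * T t x\<bar> \<partial>lborel) \<le> ennreal (\<bar>c\<bar> * r t * t powr (-1/2))"
      proof -
        have "(\<integral>\<^sup>+x. ennreal \<bar>c * T t x\<bar> \<partial>lborel) = ennreal \<bar>c\<bar> * (\<integral>\<^sup>+x. ennreal \<bar>T t x\<bar> \<partial>lborel)"
          by (subst nn_integral_cmult[symmetric]) (auto simp: abs_mult ennreal_mult)
        also have "\<dots> \<le> ennreal \<bar>c\<bar> * ennreal (r t * t powr (-1/2))" using elim by (intro mult_left_mono) auto
        also have "\<dots> = ennreal (\<bar>c\<bar> * r t * t powr (-1/2))" by (simp add: mult.assoc ennreal_mult')
        finally show ?thesis .
      qed
      ultimately show ?case by simp
    qed
  qed
qed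

lemma cutoff_tendsto: "((\<lambda>t. cutoff t y) \<longlongrightarrow> 0) at_top"
proof (rule Lim_null_comparison)
  show "((\<lambda>t. \<bar>y\<bar> / sqrt t) \<longlongrightarrow> 0) at_top"
    by (intro tendsto_divide_0[OF tendsto_const] filterlim_at_top_imp_at_infinity sqrt_at_top)
  show "\<forall>\<^sub>F t in at_top. norm (cutoff t y) \<le> \<bar>y\<bar> / sqrt t"
    using eventually_gt_at_top[of 0] by eventually_elim (use cutoff_bounds in auto)
qed

lemma powr_tendsto_0: "a < 0 \<Longrightarrow> ((\<lambda>t::real. c * t powr a) \<longlongrightarrow> 0) at_top"
  using tendsto_mult_right_zero[OF tendsto_neg_powr[OF _ filterlim_ident]] by blast

lemma set_integral_abs_le:
  fixes f g :: "real \<Rightarrow> real"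
  assumes "set_integrable lborel S f" "set_integrable lborel S g" "\<And>s. s \<in> S \<Longrightarrow> \<bar>f s\<bar> \<le> g s"
  shows "\<bar>LINT s:S|lborel. f s\<bar> \<le> (LINT s:S|lborel. g s)"
proof -
  have "\<bar>LINT s:S|lborel. f s\<bar> \<le> (LINT s|lborel. \<bar>indicator S s *\<^sub>R f s\<bar>)"
    unfolding set_lebesgue_integral_def by (rule integral_abs_bound)
  also have "\<dots> \<le> (LINT s:S|lborel. g s)"
    unfolding set_lebesgue_integral_def
    by (rule integral_mono) (use assms in \<open>auto simp: set_integrable_def indicator_def\<close>)
  finally show ?thesis .
qed

lemma set_integral_mono_set:
  fixes g :: "real \<Rightarrow> real"
  assumes "set_integrable lborel S g" "R \<in> sets borel" "R \<subseteq> S" "\<And>s. s \<in> S \<Longrightarrow> 0 \<le> g s"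
  shows "(LINT s:R|lborel. g s) \<le> (LINT s:S|lborel. g s)"
proof -
  have "set_integrable lborel R g" by (rule set_integrable_subset[OF assms(1)]) (use assms in auto)
  then show ?thesis
    unfolding set_lebesgue_integral_def
    by (intro integral_mono) (use assms in \<open>auto simp: set_integrable_def indicator_def\<close>)
qed

lemma set_integrable_bounded:
  fixes f :: "real \<Rightarrow> real"
  assumes "f \<in> borel_measurable borel" "\<And>s. a < s \<Longrightarrow> s < b \<Longrightarrow> \<bar>f s\<bar> \<le> c"
  shows "set_integrable lborel {a<..<b} f"
  unfolding set_integrable_def
proof (rule Bochner_Integration.integrable_bound[of _ "\<lambda>s. c * indicator {a..b} s"])
  show "integrable lborel (\<lambda>s. c * indicator {a..b} s)"
    by (cases "a \<le> b") (auto simp: integrable_indicator_iff)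
  show "(\<lambda>s. indicator {a<..<b} s *\<^sub>R f s) \<in> borel_measurable lborel" using assms(1) by measurable
  show "AE s in lborel. norm (indicator {a<..<b} s *\<^sub>R f s) \<le> norm (c * indicator {a..b} s)"
    using assms(2) by (intro AE_I2) (auto simp: indicator_def intro: order_trans[OF _ abs_ge_self])
qed

context flow
begin

definition m0 :: real where "m0 = first_moment u0"

definition heat_remainder :: "real \<Rightarrow> real \<Rightarrow> real" where
  "heat_remainder t x = (LINT y|lborel. G t (x - y) * u0 y) - M0 * G t x + m0 * Gx t x"

text \<open>A first moment alone gives no rate beyond the critical one: the weight |y| |u0(y)|
  \<open>cutoff t y\<close> tends to 0 pointwise and is dominated by |y| |u0(y)|. Of the two factors
  t^(-1/2) in the supremum bound one comes from the Taylor remainder, the other from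
  \<open>heat_pair\<close>.\<close>

lemma heat_remainder_small: "small heat_remainder"
proof (rule smallI[where ?t0.0 = 1])
  define W where "W t = (LINT y|lborel. (\<bar>y\<bar> * \<bar>u0 y\<bar>) * cutoff t y)" for t
  have "((\<lambda>t. LINT y|lborel. (\<bar>y\<bar> * \<bar>u0 y\<bar>) * cutoff t y) \<longlongrightarrow> (LINT y|(lborel :: real measure). (0::real))) at_top"
  proof (rule integral_dominated_convergence_at_top[where w = "\<lambda>y. \<bar>y\<bar> * \<bar>u0 y\<bar>"])
    show "AE y in lborel. ((\<lambda>t. (\<bar>y\<bar> * \<bar>u0 y\<bar>) * cutoff t y) \<longlongrightarrow> 0) at_top"
      by (intro AE_I2 tendsto_mult_right_zero cutoff_tendsto)
    show "\<forall>\<^sub>F t in at_top. AE y in lborel. norm ((\<bar>y\<bar> * \<bar>u0 y\<bar>) * cutoff t y) \<le> \<bar>y\<bar> * \<bar>u0 y\<bar>"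
      using eventually_gt_at_top[of 0]
    proof eventually_elim
      case (elim t)
      show ?case using cutoff_bounds(1)[OF elim] cutoff_bounds(2)[of t] by (intro AE_I2) (simp add: abs_mult mult_left_le)
    qed
  qed (use moment_int in auto)
  then show "((\<lambda>t. 12800 * W t) \<longlongrightarrow> 0) at_top"
    unfolding W_def using tendsto_mult_right_zero by fastforce
  fix t :: real assume "1 \<le> t"
  then have t: "0 < t" by simp
  show "heat_remainder t \<in> borel_measurable borel" unfolding heat_remainder_def[abs_def] by measurable
  define w where "w = (\<lambda>y. 6400 * t powr (-1/2) * ((\<bar>y\<bar> * \<bar>u0 y\<bar>) * cutoff t y))"
  have wi: "integrable lborel (\<lambda>y. (\<bar>y\<bar> * \<bar>u0 y\<bar>) * cutoff t y)"
    by (rule integrable_le[OF moment_int(1)]) (use cutoff_bounds[of t] t in \<open>auto simp: abs_mult mult_left_le\<close>)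
  then have w: "integrable lborel w" "\<And>y. 0 \<le> w y" "integral\<^sup>L lborel w = 6400 * t powr (-1/2) * W t"
    using cutoff_bounds(1)[OF t] by (auto simp: w_def W_def)
  have T: "ennreal \<bar>heat_remainder t x\<bar> \<le> (\<integral>\<^sup>+y. ennreal (w y * heat_pair t y x) \<partial>lborel)" for x
  proof -
    have "heat_remainder t x = (LINT y|lborel. G t (x - y) * u0 y - G t x * u0 y + Gx t x * (y * u0 y))"
      using conv_u0_integrable[OF t, of x] u0_int moment_int(2)
      by (simp add: heat_remainder_def M0_def mass_def m0_def first_moment_def)
    then have "ennreal \<bar>heat_remainder t x\<bar> \<le> (\<integral>\<^sup>+y. ennreal \<bar>G t (x - y) * u0 y - G t x * u0 y + Gx t x * (y * u0 y)\<bar> \<partial>lborel)"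
      using ennreal_abs_integral_le by metis
    also have "\<dots> \<le> (\<integral>\<^sup>+y. ennreal (w y * heat_pair t y x) \<partial>lborel)"
    proof (intro nn_integral_mono ennreal_leI)
      fix y
      have "\<bar>G t (x - y) * u0 y - G t x * u0 y + Gx t x * (y * u0 y)\<bar> = \<bar>G t (x - y) - G t x + y * Gx t x\<bar> * \<bar>u0 y\<bar>"
        by (simp add: algebra_simps flip: abs_mult)
      also have "\<dots> \<le> (6400 * t powr (-1/2) * \<bar>y\<bar> * cutoff t y * heat_pair t y x) * \<bar>u0 y\<bar>"
        by (rule mult_right_mono[OF G_diff2[OF t]]) simp
      also have "\<dots> = w y * heat_pair t y x" by (simp add: w_def)
      finally show "\<bar>G t (x - y) * u0 y - G t x * u0 y + Gx t x * (y * u0 y)\<bar> \<le> w y * heat_pair t y x" .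
    qed
    finally show ?thesis .
  qed
  note A = heat_pair_average[OF sigma_finite_lborel w(1,2) _ t T, simplified w(3)]
  have "\<bar>heat_remainder t x\<bar> \<le> 2 * t powr (-1/2) * (6400 * t powr (-1/2) * W t)" for x by (rule A(1)) simp
  moreover have "2 * t powr (-1/2) * (6400 * t powr (-1/2) * W t) = 12800 * W t * (t powr (-1/2) * t powr (-1/2))" by simp
  moreover have "t powr (-1/2) * t powr (-1/2) = t powr (-1)" by (subst powr_add[symmetric]) simp
  ultimately show "\<bar>heat_remainder t x\<bar> \<le> 12800 * W t * t powr (-1)" for x by (simp only:)
  have "(\<integral>\<^sup>+x. ennreal \<bar>heat_remainder t x\<bar> \<partial>lborel) \<le> ennreal (2 * (6400 * t powr (-1/2) * W t))" by (rule A(2)) simp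
  moreover have "2 * (6400 * t powr (-1/2) * W t) = 12800 * W t * t powr (-1/2)" by simp
  ultimately show "(\<integral>\<^sup>+x. ennreal \<bar>heat_remainder t x\<bar> \<partial>lborel) \<le> ennreal (12800 * W t * t powr (-1/2))" by (simp only:)
qed

text \<open>Error of freezing the kernel at time \<open>t\<close> and position \<open>x\<close> for
  the sources of the first half of the time interval.\<close>

definition early_remainder :: "real \<Rightarrow> real \<Rightarrow> real" where
  "early_remainder t x = (LINT s:{0<..<t/2}|lborel. (LINT y|lborel. (Gx (t - s) (x - y) - Gx t x) * defect s y))"

text \<open>For s < t/2 the kernel varies on the scales of t and sqrt t, and its increment carries
  the weight s/t + \<open>cutoff t y\<close>, which is at most 2 and tends to 0 at each point (s,
  y). Dominated convergence on space-time does the rest.\<close>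

lemma early_remainder_small: "small early_remainder"
proof (rule smallI[where ?t0.0 = 1])
  let ?N = "lborel \<Otimes>\<^sub>M lborel :: (real \<times> real) measure"
  define g where "g t p = indicator {0<..<t/2} (fst p) * ((fst p / t + cutoff t (snd p)) * \<bar>defect (fst p) (snd p)\<bar>)" for t and p :: "real \<times> real"
  define W where "W t = (LINT p|?N. g t p)" for t
  define dom where "dom = (\<lambda>p. 2 * (indicator {0<..} (fst p) * \<bar>defect (fst p) (snd p)\<bar>))"
  have dom: "integrable ?N dom" unfolding dom_def using defect_product_integrable by simp
  have gm [measurable]: "g t \<in> borel_measurable ?N" for t unfolding g_def by measurable
  have g: "0 \<le> g t p \<and> g t p \<le> dom p" if t: "0 < t" for t p
  proof (cases "fst p \<in> {0<..<t/2}")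
    case True
    then have "0 \<le> fst p / t" "fst p / t \<le> 1" using t by (auto simp: field_simps)
    then have "0 \<le> fst p / t + cutoff t (snd p)" "fst p / t + cutoff t (snd p) \<le> 2"
      using cutoff_bounds(1)[OF t, of "snd p"] cutoff_bounds(2)[of t "snd p"] by auto
    then show ?thesis using True by (auto simp: g_def dom_def mult_right_mono)
  next
    case False
    then show ?thesis by (simp add: g_def dom_def)
  qed
  have "((\<lambda>t. LINT p|?N. g t p) \<longlongrightarrow> (LINT p|?N. (0::real))) at_top"
  proof (rule integral_dominated_convergence_at_top[OF _ gm dom])
    show "AE p in ?N. ((\<lambda>t. g t p) \<longlongrightarrow> 0) at_top"
    proof (rule AE_I2, rule Lim_null_comparison)
      fix p :: "real \<times> real"
      have "((\<lambda>t. \<bar>fst p\<bar> / t) \<longlongrightarrow> 0) at_top"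
        by (intro tendsto_divide_0[OF tendsto_const] filterlim_at_top_imp_at_infinity filterlim_ident)
      from tendsto_mult_left_zero[OF tendsto_add_zero[OF this cutoff_tendsto]]
      show "((\<lambda>t. (\<bar>fst p\<bar> / t + cutoff t (snd p)) * \<bar>defect (fst p) (snd p)\<bar>) \<longlongrightarrow> 0) at_top" .
      show "\<forall>\<^sub>F t in at_top. norm (g t p) \<le> (\<bar>fst p\<bar> / t + cutoff t (snd p)) * \<bar>defect (fst p) (snd p)\<bar>"
        using eventually_gt_at_top[of 0]
      proof eventually_elim
        case (elim t)
        have "0 \<le> (\<bar>fst p\<bar> / t + cutoff t (snd p)) * \<bar>defect (fst p) (snd p)\<bar>"
          using cutoff_bounds(1)[OF elim, of "snd p"] elim by simp
        then show ?case using g[OF elim, of p] by (auto simp: g_def indicator_def)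
      qed
    qed
    show "\<forall>\<^sub>F t in at_top. AE p in ?N. norm (g t p) \<le> dom p"
      using eventually_gt_at_top[of 0] by eventually_elim (use g in auto)
  qed simp
  then have W0: "(W \<longlongrightarrow> 0) at_top" by (simp add: W_def[abs_def])
  show "((\<lambda>t. 25600 * W t) \<longlongrightarrow> 0) at_top" using tendsto_mult_right_zero[OF W0] .
  fix t :: real assume "1 \<le> t"
  then have t: "0 < t" by simp
  show "early_remainder t \<in> borel_measurable borel" unfolding early_remainder_def[abs_def] set_lebesgue_integral_def by measurable
  define w where "w = (\<lambda>p. 12800 * t powr (-1/2) * g t p)"
  have gi: "integrable ?N (g t)"
    by (rule Bochner_Integration.integrable_bound[OF dom]) (use g[OF t] in \<open>auto intro!: AE_I2 intro: order_trans[OF _ abs_ge_self]\<close>)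
  then have w: "integrable ?N w" "\<And>p. 0 \<le> w p" "integral\<^sup>L ?N w = 12800 * t powr (-1/2) * W t"
    using g[OF t] by (auto simp: w_def W_def)
  have wm [measurable]: "w \<in> borel_measurable ?N" unfolding w_def by measurable
  have T: "ennreal \<bar>early_remainder t x\<bar> \<le> (\<integral>\<^sup>+p. ennreal (w p * heat_pair t (snd p) x) \<partial>?N)" for x
  proof -
    have "ennreal \<bar>early_remainder t x\<bar> \<le> (\<integral>\<^sup>+s. ennreal \<bar>indicator {0<..<t/2} s * (LINT y|lborel. (Gx (t - s) (x - y) - Gx t x) * defect s y)\<bar> \<partial>lborel)"
      unfolding early_remainder_def set_lebesgue_integral_def real_scaleR_def by (rule ennreal_abs_integral_le)
    also have "\<dots> \<le> (\<integral>\<^sup>+s. (\<integral>\<^sup>+y. ennreal (w (s, y) * heat_pair t (snd (s, y)) x) \<partial>lborel) \<partial>lborel)"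
    proof (rule nn_integral_mono)
      fix s
      show "ennreal \<bar>indicator {0<..<t/2} s * (LINT y|lborel. (Gx (t - s) (x - y) - Gx t x) * defect s y)\<bar> \<le> (\<integral>\<^sup>+y. ennreal (w (s, y) * heat_pair t (snd (s, y)) x) \<partial>lborel)"
      proof (cases "s \<in> {0<..<t/2}")
        case True
        then have "ennreal \<bar>indicator {0<..<t/2} s * (LINT y|lborel. (Gx (t - s) (x - y) - Gx t x) * defect s y)\<bar> \<le> (\<integral>\<^sup>+y. ennreal \<bar>(Gx (t - s) (x - y) - Gx t x) * defect s y\<bar> \<partial>lborel)"
          using ennreal_abs_integral_le by simp
        also have "\<dots> \<le> (\<integral>\<^sup>+y. ennreal (w (s, y) * heat_pair t (snd (s, y)) x) \<partial>lborel)"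
        proof (intro nn_integral_mono ennreal_leI)
          fix y
          have "\<bar>(Gx (t - s) (x - y) - Gx t x) * defect s y\<bar> \<le> (12800 * t powr (-1/2) * (s / t + cutoff t y) * heat_pair t y x) * \<bar>defect s y\<bar>"
            unfolding abs_mult by (rule mult_right_mono[OF Gx_space_time_diff[OF t]]) (use True in auto)
          also have "\<dots> = w (s, y) * heat_pair t (snd (s, y)) x" using True by (simp add: w_def g_def)
          finally show "\<bar>(Gx (t - s) (x - y) - Gx t x) * defect s y\<bar> \<le> w (s, y) * heat_pair t (snd (s, y)) x" .
        qed
        finally show ?thesis .
      qed simp
    qed
    also have "\<dots> = (\<integral>\<^sup>+p. ennreal (w p * heat_pair t (snd p) x) \<partial>?N)"
      by (rule lborel.nn_integral_fst[where f = "\<lambda>p. ennreal (w p * heat_pair t (snd p) x)"]) measurable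
    finally show ?thesis .
  qed
  have sf: "sigma_finite_measure ?N" by (intro sigma_finite_pair_measure sigma_finite_lborel)
  note A = heat_pair_average[OF sf w(1,2) _ t T, simplified w(3)]
  have "\<bar>early_remainder t x\<bar> \<le> 2 * t powr (-1/2) * (12800 * t powr (-1/2) * W t)" for x by (rule A(1)) measurable
  moreover have "2 * t powr (-1/2) * (12800 * t powr (-1/2) * W t) = 25600 * W t * (t powr (-1/2) * t powr (-1/2))" by simp
  moreover have "t powr (-1/2) * t powr (-1/2) = t powr (-1)" by (subst powr_add[symmetric]) simp
  ultimately show "\<bar>early_remainder t x\<bar> \<le> 25600 * W t * t powr (-1)" for x by (simp only:)
  have "(\<integral>\<^sup>+x. ennreal \<bar>early_remainder t x\<bar> \<partial>lborel) \<le> ennreal (2 * (12800 * t powr (-1/2) * W t))" by (rule A(2)) measurable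
  moreover have "2 * (12800 * t powr (-1/2) * W t) = 25600 * W t * t powr (-1/2)" by simp
  ultimately show "(\<integral>\<^sup>+x. ennreal \<bar>early_remainder t x\<bar> \<partial>lborel) \<le> ennreal (25600 * W t * t powr (-1/2))" by (simp only:)
qed

definition late_remainder :: "real \<Rightarrow> real \<Rightarrow> real" where
  "late_remainder t x = (LINT s:{t/2..<t}|lborel. (LINT y|lborel. Gx (t - s) (x - y) * defect s y))"

text \<open>No cancellation is used: for s \<ge> t/2 the decay of the defect suffices. The time
  integral of the kernel's L1 norm contributes t^(1/2), so the supremum is of order t^(1/2 - 19/12)
  = t^(-13/12) and the L1 norm of order t^(1/2 - 5/4) = t^(-3/4); both are written with the common
  gain t^(-1/12). Starting at t = 2 ensures s \<ge> 1.\<close>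

lemma late_remainder_small: "small late_remainder"
proof (rule smallI[where ?t0.0 = 2])
  show "((\<lambda>t. 6400 * C5 * t powr (-1/12)) \<longlongrightarrow> 0) at_top" by (rule powr_tendsto_0) simp
  fix t :: real assume t2: "2 \<le> t"
  then have t: "0 < t" by simp
  interpret S: source defect C5 t "(D0 * (t/2) powr (-1/2)) ^ 3 + (\<bar>M0\<bar> * (t/2) powr (-1/2)) ^ 3" by (rule source_defect[OF t])
  show "late_remainder t \<in> borel_measurable borel" unfolding late_remainder_def[abs_def] set_lebesgue_integral_def by measurable
  have half: "(t/2) powr (-a) \<le> 4 * t powr (-a)" if "0 \<le> a" "a \<le> 2" for a
  proof -
    have "(t/2) powr (-a) = 2 powr a * t powr (-a)" using t by (simp add: powr_divide powr_minus_divide)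
    moreover have "2 powr a \<le> (2::real) powr 2" using that by (intro powr_mono) auto
    ultimately show ?thesis by (simp add: powr_numeral mult_right_mono)
  qed
  have ki: "set_integrable lborel {0<..<t} (\<lambda>s. (t - s) powr (-1/2))" using powr_reflect_integrable[of "-1/2" t] t by simp
  have sub: "{t/2..<t} \<subseteq> {0<..<t}" using t by auto
  have ki2: "set_integrable lborel {t/2..<t} (\<lambda>s. (t - s) powr (-1/2))" by (rule set_integrable_subset[OF ki _ sub]) simp
  have kint: "(LINT s:{t/2..<t}|lborel. (t - s) powr (-1/2)) \<le> 2 * t powr (1/2)"
    using set_integral_mono_set[OF ki _ sub] sqrt_kernel_integral[OF t] by simp
  have main: "(LINT s:{t/2..<t}|lborel. 800 * (t - s) powr (-1/2) * (C5 * (t/2) powr (-a))) \<le> 6400 * C5 * (t powr (1/2) * t powr (-a))"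
    if a: "0 \<le> a" "a \<le> 2" for a
  proof -
    have "(LINT s:{t/2..<t}|lborel. 800 * (t - s) powr (-1/2) * (C5 * (t/2) powr (-a))) = (LINT s:{t/2..<t}|lborel. (800 * C5 * (t/2) powr (-a)) * (t - s) powr (-1/2))"
      by (intro set_lebesgue_integral_cong) auto
    also have "\<dots> = (800 * C5 * (t/2) powr (-a)) * (LINT s:{t/2..<t}|lborel. (t - s) powr (-1/2))" by simp
    also have "\<dots> \<le> (800 * C5 * (4 * t powr (-a))) * (2 * t powr (1/2))"
      using kint half[OF a] C_nonneg(3) by (intro mult_mono mult_left_mono) (auto simp: set_lebesgue_integral_def intro!: integral_nonneg_AE)
    finally show ?thesis by (simp add: mult_ac)
  qed
  have bi: "set_integrable lborel {t/2..<t} (\<lambda>s. 800 * (t - s) powr (-1/2) * c)" for c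
    by (intro set_integrable_mult_left set_integrable_mult_right ki2)
  have Ti: "set_integrable lborel {t/2..<t} (\<lambda>s. LINT y|lborel. Gx (t - s) (x - y) * defect s y)" for x
    by (rule set_integrable_subset[OF S.potx_integrable _ sub]) simp
  have decay: "s powr (-a) \<le> (t/2) powr (-a)" if "s \<in> {t/2..<t}" "0 \<le> a" for s a
    using that t by (intro powr_mono2') auto
  show "\<bar>late_remainder t x\<bar> \<le> 6400 * C5 * t powr (-1/12) * t powr (-1)" for x
  proof -
    have "\<bar>late_remainder t x\<bar> \<le> (LINT s:{t/2..<t}|lborel. 800 * (t - s) powr (-1/2) * (C5 * (t/2) powr (-19/12)))"
      unfolding late_remainder_def
    proof (rule set_integral_abs_le[OF Ti bi])
      fix s assume s: "s \<in> {t/2..<t}"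
      then have ts: "0 < t - s" and s1: "1 \<le> s" using t2 by auto
      have "\<bar>defect s y\<bar> \<le> C5 * (t/2) powr (-19/12)" for y
        using defect_large(3)[OF s1, of y] mult_left_mono[OF decay[OF s, of "19/12"] C_nonneg(3)] by simp
      then have "\<bar>LINT y|lborel. Gx (t - s) (x - y) * defect s y\<bar> \<le> (C5 * (t/2) powr (-19/12)) * (LINT y|lborel. \<bar>Gx (t - s) y\<bar>)"
        by (intro conv_bounds_sup(2)[OF Gx_integrable[OF ts]]) measurable
      also have "\<dots> \<le> (C5 * (t/2) powr (-19/12)) * (800 * (t - s) powr (-1/2))"
        using C_nonneg(3) by (intro mult_left_mono Gx_L1 ts) auto
      finally show "\<bar>LINT y|lborel. Gx (t - s) (x - y) * defect s y\<bar> \<le> 800 * (t - s) powr (-1/2) * (C5 * (t/2) powr (-19/12))"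
        by (simp only: mult.commute)
    qed
    also have "\<dots> \<le> 6400 * C5 * (t powr (1/2) * t powr (-19/12))" using main[of "19/12"] by simp
    also have "t powr (1/2) * t powr (-19/12) = t powr (-1/12) * t powr (-1)" by (subst (1 2) powr_add[symmetric]) simp
    finally show ?thesis by simp
  qed
  have "(\<integral>\<^sup>+x. ennreal \<bar>late_remainder t x\<bar> \<partial>lborel) \<le> ennreal (LINT s:{t/2..<t}|lborel. 800 * (t - s) powr (-1/2) * (C5 * (t/2) powr (-5/4)))"
    unfolding late_remainder_def
  proof (rule potential_L1[OF defect_joint _ sub _ _ _ bi])
    fix s assume s: "s \<in> {t/2..<t}"
    then have s1: "1 \<le> s" using t2 by auto
    show "integrable lborel (defect s)" by (rule defect_large(1)[OF s1])
    show "(LINT y|lborel. \<bar>defect s y\<bar>) \<le> C5 * (t/2) powr (-5/4)"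
      using defect_large(2)[OF s1] mult_left_mono[OF decay[OF s, of "5/4"] C_nonneg(3)] by simp
    show "0 \<le> C5 * (t/2) powr (-5/4)" using C_nonneg(3) by simp
  qed simp
  also have "\<dots> \<le> ennreal (6400 * C5 * t powr (-1/12) * t powr (-1/2))"
  proof (rule ennreal_leI)
    have "(LINT s:{t/2..<t}|lborel. 800 * (t - s) powr (-1/2) * (C5 * (t/2) powr (-5/4))) \<le> 6400 * C5 * (t powr (1/2) * t powr (-5/4))"
      using main[of "5/4"] by simp
    also have "t powr (1/2) * t powr (-5/4) = t powr (-3/4)" by (subst powr_add[symmetric]) simp
    also have "6400 * C5 * t powr (-3/4) \<le> 6400 * C5 * t powr (-7/12)"
      using C_nonneg(3) t2 by (intro mult_left_mono powr_mono) auto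
    also have "t powr (-7/12) = t powr (-1/12) * t powr (-1/2)" by (subst powr_add[symmetric]) simp
    finally show "(LINT s:{t/2..<t}|lborel. 800 * (t - s) powr (-1/2) * (C5 * (t/2) powr (-5/4))) \<le> 6400 * C5 * t powr (-1/12) * t powr (-1/2)"
      by simp
  qed
  finally show "(\<integral>\<^sup>+x. ennreal \<bar>late_remainder t x\<bar> \<partial>lborel) \<le> ennreal (6400 * C5 * t powr (-1/12) * t powr (-1/2))" .
qed

text \<open>The space-time mass of the defect; multiplied by \<open>d\<close> it is the constant
  \<open>calM\<close>.\<close>

definition calH :: real where "calH = (LINT s:{0<..}|lborel. (LINT y|lborel. defect s y))"
definition defect_tail :: "real \<Rightarrow> real" where "defect_tail t = calH - (LINT s:{0<..<t/2}|lborel. (LINT y|lborel. defect s y))"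
definition tail_remainder :: "real \<Rightarrow> real \<Rightarrow> real" where "tail_remainder t x = defect_tail t * Gx t x"

text \<open>\<open>Gx t\<close> has exactly the critical rates in both norms, so a scalar factor
  tending to 0 is enough, and the tail of a convergent integral is such a factor.\<close>

lemma tail_remainder_small: "small tail_remainder"
proof (rule smallI[where ?t0.0 = 1])
  have "((\<lambda>t. LINT s:{0<..<t/2}|lborel. (LINT y|lborel. defect s y)) \<longlongrightarrow> calH) at_top"
    unfolding calH_def set_lebesgue_integral_def
  proof (rule integral_dominated_convergence_at_top[where w = "\<lambda>s. norm (indicator {0<..} s *\<^sub>R (LINT y|lborel. defect s y))"])
    show "integrable lborel (\<lambda>s. norm (indicator {0<..} s *\<^sub>R (LINT y|lborel. defect s y)))"
      using defect_set_integrable unfolding set_integrable_def by (rule integrable_norm)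
    show "AE s in lborel. ((\<lambda>t. indicator {0<..<t/2} s *\<^sub>R (LINT y|lborel. defect s y)) \<longlongrightarrow> indicator {0<..} s *\<^sub>R (LINT y|lborel. defect s y)) at_top"
    proof (intro AE_I2 tendsto_eventually)
      fix s :: real
      show "\<forall>\<^sub>F t in at_top. indicator {0<..<t/2} s *\<^sub>R (LINT y|lborel. defect s y) = indicator {0<..} s *\<^sub>R (LINT y|lborel. defect s y)"
        using eventually_gt_at_top[of "2 * s"] by eventually_elim (auto simp: indicator_def)
    qed
    show "\<forall>\<^sub>F t in at_top. AE s in lborel. norm (indicator {0<..<t/2} s *\<^sub>R (LINT y|lborel. defect s y)) \<le> norm (indicator {0<..} s *\<^sub>R (LINT y|lborel. defect s y))"
      by (intro always_eventually allI AE_I2) (auto simp: indicator_def)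
  qed measurable
  then have "(defect_tail \<longlongrightarrow> calH - calH) at_top" unfolding defect_tail_def[abs_def] by (intro tendsto_intros)
  then have "((\<lambda>t. 800 * \<bar>defect_tail t\<bar>) \<longlongrightarrow> 800 * \<bar>calH - calH\<bar>) at_top" by (intro tendsto_intros)
  then show "((\<lambda>t. 800 * \<bar>defect_tail t\<bar>) \<longlongrightarrow> 0) at_top" by simp
  fix t :: real assume "1 \<le> t"
  then have t: "0 < t" by simp
  show "tail_remainder t \<in> borel_measurable borel" unfolding tail_remainder_def[abs_def] by measurable
  show "\<bar>tail_remainder t x\<bar> \<le> 800 * \<bar>defect_tail t\<bar> * t powr (-1)" for x
    using mult_left_mono[OF Gx_sup[OF t, of x], of "\<bar>defect_tail t\<bar>"] by (simp add: tail_remainder_def abs_mult mult_ac)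
  have "(\<integral>\<^sup>+x. ennreal \<bar>tail_remainder t x\<bar> \<partial>lborel) = ennreal \<bar>defect_tail t\<bar> * (\<integral>\<^sup>+x. ennreal \<bar>Gx t (x - 0)\<bar> \<partial>lborel)"
    by (subst nn_integral_cmult[symmetric]) (auto simp: tail_remainder_def abs_mult ennreal_mult)
  also have "\<dots> \<le> ennreal \<bar>defect_tail t\<bar> * ennreal (800 * t powr (-1/2))"
    by (intro mult_left_mono Gx_nn_integral t) simp
  also have "\<dots> = ennreal (800 * \<bar>defect_tail t\<bar> * t powr (-1/2))" by (simp add: mult_ac flip: ennreal_mult)
  finally show "(\<integral>\<^sup>+x. ennreal \<bar>tail_remainder t x\<bar> \<partial>lborel) \<le> ennreal (800 * \<bar>defect_tail t\<bar> * t powr (-1/2))" .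
qed

lemma potx_defect:
  assumes t: "0 < t"
  shows "potx defect t x - calH * Gx t x = early_remainder t x + late_remainder t x - tail_remainder t x"
proof -
  interpret S: source defect C5 t "(D0 * (t/2) powr (-1/2)) ^ 3 + (\<bar>M0\<bar> * (t/2) powr (-1/2)) ^ 3" by (rule source_defect[OF t])
  define J where "J = (\<lambda>s. LINT y|lborel. Gx (t - s) (x - y) * defect s y)"
  have Ji: "set_integrable lborel {0<..<t} J" unfolding J_def by (rule S.potx_integrable)
  have J1: "set_integrable lborel {0<..<t/2} J" by (rule set_integrable_subset[OF Ji]) (use t in auto)
  have J2: "set_integrable lborel {t/2..<t} J" by (rule set_integrable_subset[OF Ji]) (use t in auto)
  have H1: "set_integrable lborel {0<..<t/2} (\<lambda>s. LINT y|lborel. defect s y)"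
    by (rule set_integrable_subset[OF defect_set_integrable]) auto
  have un: "{0<..<t} = {0<..<t/2} \<union> {t/2..<t}" using t by auto
  have "potx defect t x = (LINT s:{0<..<t/2}|lborel. J s) + late_remainder t x"
    unfolding potx_def J_def[symmetric] un late_remainder_def by (rule set_integral_Un[OF _ J1 J2]) auto
  moreover have "early_remainder t x = (LINT s:{0<..<t/2}|lborel. J s - Gx t x * (LINT y|lborel. defect s y))"
    unfolding early_remainder_def
  proof (rule set_lebesgue_integral_cong)
    show "\<forall>s. s \<in> {0<..<t/2} \<longrightarrow> (LINT y|lborel. (Gx (t - s) (x - y) - Gx t x) * defect s y) = J s - Gx t x * (LINT y|lborel. defect s y)"
    proof (intro allI impI)
      fix s assume "s \<in> {0<..<t/2}"
      then have s: "0 < s" "s < t" using t by auto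
      show "(LINT y|lborel. (Gx (t - s) (x - y) - Gx t x) * defect s y) = J s - Gx t x * (LINT y|lborel. defect s y)"
        using S.kernels_le_kernel_majorant(3)[OF s, of x] defect_int[OF s(1)] by (simp add: left_diff_distrib J_def)
    qed
  qed simp
  moreover have "\<dots> = (LINT s:{0<..<t/2}|lborel. J s) - Gx t x * (LINT s:{0<..<t/2}|lborel. (LINT y|lborel. defect s y))"
    using J1 H1 by (subst set_integral_diff) auto
  ultimately show ?thesis by (simp add: tail_remainder_def defect_tail_def algebra_simps)
qed

end

lemma small_cong:
  assumes "small S" "\<And>t x. t0 < t \<Longrightarrow> T t x = S t x" shows "small T"
proof -
  have eq: "\<forall>\<^sub>F t in at_top. T t = S t" using eventually_gt_at_top[of t0] by eventually_elim (use assms(2) in auto)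
  obtain e where e: "(e \<longlongrightarrow> 0) at_top" "\<forall>\<^sub>F t in at_top. S t \<in> borel_measurable borel \<and>
     (\<forall>x. \<bar>S t x\<bar> \<le> e t * t powr (-1)) \<and> (\<integral>\<^sup>+x. ennreal \<bar>S t x\<bar> \<partial>lborel) \<le> ennreal (e t * t powr (-1/2))"
    using assms(1) unfolding small_def by blast
  show ?thesis
    unfolding small_def
    by (intro exI[of _ e] conjI e(1)) (use e(2) eq in eventually_elim, simp)
qed

section \<open>The explicit cubic source\<close>

text \<open>
  The heat potential of \<open>G s ^ 3 = \<alpha>\<^sub>1 / s * G (s / 3)\<close> has the integrand \<open>\<alpha>\<^sub>1 / s * Gx (t - 2 * s / 3)\<close>;
  subtracting \<open>Gx t\<close> removes the singularity at \<open>s = 0\<close>.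
\<close>

definition time_quotient :: "real \<Rightarrow> real \<Rightarrow> real \<Rightarrow> real" where
  "time_quotient t x s = (Gx (t - 2 * s / 3) x - Gx t x) / s"

lemma time_quotient_measurable [measurable (raw)]:
  assumes "f \<in> borel_measurable M" "g \<in> borel_measurable M" "h \<in> borel_measurable M"
  shows "(\<lambda>w. time_quotient (f w) (g w) (h w)) \<in> borel_measurable M"
  using assms unfolding time_quotient_def by measurable

text \<open>For s \<le> 3t/4 the time shift 2s/3 is at most t/2, the range of
  \<open>Gx_time_diff\<close>, and the factor s/t obtained there cancels the division by s.\<close>

lemma time_quotient_early:
  assumes s: "0 < s" "s \<le> 3 * t / 4"
  shows "\<bar>time_quotient t x s\<bar> \<le> 12800 * t powr (-3/2) * G (4 * t) x"
proof -
  have t: "0 < t" using s by simp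
  have "\<bar>Gx (t - 2 * s / 3) x - Gx t x\<bar> \<le> 12800 * t powr (-1/2) * (2 * s / 3 / t) * G (4 * t) x"
    by (rule Gx_time_diff[OF t]) (use s in auto)
  also have "\<dots> \<le> 12800 * t powr (-1/2) * (s / t) * G (4 * t) x"
    using s t by (intro mult_left_mono mult_right_mono) (auto simp: field_simps)
  also have "\<dots> = 12800 * (t powr (-1/2) * t powr (-1)) * G (4 * t) x * s" using t by (simp add: powr_minus_divide)
  also have "t powr (-1/2) * t powr (-1) = t powr (-3/2)" by (subst powr_add[symmetric]) simp
  finally show ?thesis using s(1) by (simp add: time_quotient_def abs_divide pos_divide_le_eq)
qed

text \<open>The kernel time t - 2s/3 never drops below t/3, so there is no singularity at s = t; for
  s > 3t/4 the two kernels are bounded separately.\<close>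

lemma time_quotient_sup:
  assumes s: "0 < s" "s < t"
  shows "\<bar>time_quotient t x s\<bar> \<le> 12800 * t powr (-2)"
proof (cases "s \<le> 3 * t / 4")
  case True
  have t: "0 < t" using s by simp
  have "G (4 * t) x \<le> (4 * t) powr (-1/2)" using t by (intro G_le) auto
  also have "\<dots> \<le> t powr (-1/2)" using t by (intro powr_mono2') auto
  finally have "12800 * t powr (-3/2) * G (4 * t) x \<le> 12800 * (t powr (-3/2) * t powr (-1/2))" by (simp add: mult_left_mono)
  also have "t powr (-3/2) * t powr (-1/2) = t powr (-2)" by (subst powr_add[symmetric]) simp
  finally show ?thesis using time_quotient_early[OF s(1) True, of x] by linarith
next
  case False
  have t: "0 < t" using s by simp
  have "\<bar>Gx (t - 2 * s / 3) x - Gx t x\<bar> \<le> 800 * (t - 2 * s / 3) powr (-1) + 800 * t powr (-1)"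
    using Gx_sup[of "t - 2 * s / 3" x] Gx_sup[OF t, of x] s by (intro order_trans[OF abs_triangle_ineq4] add_mono) auto
  also have "(t - 2 * s / 3) powr (-1) \<le> (t / 3) powr (-1)" using s by (intro powr_mono2') auto
  finally have "\<bar>Gx (t - 2 * s / 3) x - Gx t x\<bar> \<le> 3200 / t" using t by (simp add: powr_minus_divide)
  then have "\<bar>time_quotient t x s\<bar> \<le> (3200 / t) / s" using s(1) divide_right_mono[of _ "3200 / t" s] by (simp only: time_quotient_def abs_divide abs_of_pos less_imp_le)
  also have "\<dots> \<le> (3200 / t) / (3 * t / 4)" using False t by (intro divide_left_mono) auto
  also have "\<dots> \<le> 12800 * t powr (-2)" using t by (simp add: powr_minus_divide powr_numeral power2_eq_square field_simps)
  finally show ?thesis .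
qed

lemma time_quotient_integrable: "set_integrable lborel {0<..<t} (time_quotient t x)"
  by (rule set_integrable_bounded[where c = "12800 * t powr (-2)"]) (measurable, rule time_quotient_sup)

text \<open>The piece by which the integral from 0, as in \<open>Psi\<close>, exceeds the integral
  from 1, where the cube of M G starts to be split off.\<close>

definition late_profile :: "real \<Rightarrow> real \<Rightarrow> real" where
  "late_profile t x = (LINT s:{0<..<1}|lborel. time_quotient t x s)"

text \<open>Over a time interval of fixed length both norms are better than critical by a full
  factor 1/t.\<close>

lemma late_profile_small: "small late_profile"
proof (rule smallI[where ?t0.0 = 2])
  show "((\<lambda>t::real. 12800 * t powr (-1)) \<longlongrightarrow> 0) at_top" by (rule powr_tendsto_0) simp
  fix t :: real assume t2: "2 \<le> t"
  then have t: "0 < t" by simp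
  show "late_profile t \<in> borel_measurable borel" unfolding late_profile_def[abs_def] set_lebesgue_integral_def by measurable
  have si: "set_integrable lborel {0<..<1} (time_quotient t x)" for x
    by (rule set_integrable_subset[OF time_quotient_integrable]) (use t2 in auto)
  have avg: "\<bar>late_profile t x\<bar> \<le> c" if "\<And>s. s \<in> {0<..<1} \<Longrightarrow> \<bar>time_quotient t x s\<bar> \<le> c" for c x
  proof -
    have "\<bar>late_profile t x\<bar> \<le> (LINT s:{0<..<1::real}|lborel. c)"
      unfolding late_profile_def by (rule set_integral_abs_le[OF si]) (use that in \<open>auto simp: set_integrable_def\<close>)
    also have "\<dots> = c" by (simp add: set_lebesgue_integral_def)
    finally show ?thesis .
  qed
  show "\<bar>late_profile t x\<bar> \<le> 12800 * t powr (-1) * t powr (-1)" for x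
  proof -
    have "\<bar>late_profile t x\<bar> \<le> 12800 * t powr (-2)" by (rule avg, rule time_quotient_sup) (use t2 in auto)
    also have "t powr (-2) = t powr (-1) * t powr (-1)" by (subst powr_add[symmetric]) simp
    finally show ?thesis by simp
  qed
  have "(\<integral>\<^sup>+x. ennreal \<bar>late_profile t x\<bar> \<partial>lborel) \<le> (\<integral>\<^sup>+x. ennreal (12800 * t powr (-3/2)) * ennreal (G (4 * t) (x - 0)) \<partial>lborel)"
  proof (intro nn_integral_mono)
    fix x
    have "\<bar>late_profile t x\<bar> \<le> 12800 * t powr (-3/2) * G (4 * t) x" by (rule avg, rule time_quotient_early) (use t2 in auto)
    then show "ennreal \<bar>late_profile t x\<bar> \<le> ennreal (12800 * t powr (-3/2)) * ennreal (G (4 * t) (x - 0))"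
      by (simp add: ennreal_leI flip: ennreal_mult)
  qed
  also have "\<dots> = ennreal (12800 * t powr (-3/2))" using G_nn_integral[of "4 * t" 0] t by (subst nn_integral_cmult) auto
  also have "t powr (-3/2) = t powr (-1) * t powr (-1/2)" by (subst powr_add[symmetric]) simp
  finally show "(\<integral>\<^sup>+x. ennreal \<bar>late_profile t x\<bar> \<partial>lborel) \<le> ennreal (12800 * t powr (-1) * t powr (-1/2))" by (simp add: mult.assoc)
qed

lemma ln_set_integral:
  fixes t :: real
  assumes "1 \<le> t"
  shows "set_integrable lborel {1..<t} (\<lambda>s. 1 / s)" "(LINT s:{1..<t}|lborel. 1 / s) = ln t"
proof -
  have "((\<lambda>s. 1 / s) has_integral (ln t - ln 1)) {1..t}"
  proof (rule fundamental_theorem_of_calculus[where a = 1 and b = t])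
    show "1 \<le> t" by fact
  next
    fix s assume "s \<in> {1..t}"
    then show "(ln has_vector_derivative 1 / s) (at s within {1..t})"
      by (auto intro!: derivative_eq_intros simp flip: has_real_derivative_iff_has_vector_derivative)
  qed
  then have hi: "((\<lambda>s. 1 / s) has_integral ln t) {1..t}" by simp
  have "continuous_on {1..t} (\<lambda>s. 1 / s)" by (intro continuous_intros) auto
  then have si: "set_integrable lborel {1..t} (\<lambda>s. 1 / s)"
    unfolding set_integrable_def by (intro borel_integrable_compact) auto
  show "set_integrable lborel {1..<t} (\<lambda>s. 1 / s)" by (rule set_integrable_subset[OF si]) auto
  have "(LINT s:{1..<t}|lborel. 1 / s) = (LINT s:{1..t}|lborel. 1 / s)"
    unfolding set_lebesgue_integral_def
  proof (rule integral_cong_AE)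
    show "AE s in lborel. indicator {1..<t} s *\<^sub>R (1 / s) = indicator {1..t} s *\<^sub>R (1 / s)"
      using AE_lborel_singleton[of t] by eventually_elim (auto simp: indicator_def)
  qed measurable
  also have "\<dots> = ln t"
    using set_borel_integral_eq_integral(2)[OF si] integral_unique[OF hi] by simp
  finally show "(LINT s:{1..<t}|lborel. 1 / s) = ln t" .
qed

context flow
begin

text \<open>For s \<ge> 1 the semigroup law merges the kernel at time t - s with G(s/3) into the
  kernel at time t - 2s/3. Writing this as \<open>Gx t x\<close> plus s times the time quotient
  separates the logarithm, the integral of 1/s from 1 to t, from an integral without
  singularity.\<close>

lemma potx_v3:
  assumes t: "1 < t"
  shows "potx (\<lambda>s y. v s y ^ 3) t x = potx defect t x + M0 ^ 3 * \<alpha>\<^sub>1 * (ln t * Gx t x + (LINT s:{1..<t}|lborel. time_quotient t x s))"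
proof -
  have t0: "0 < t" using t by simp
  interpret S: source defect C5 t "(D0 * (t/2) powr (-1/2)) ^ 3 + (\<bar>M0\<bar> * (t/2) powr (-1/2)) ^ 3" by (rule source_defect[OF t0])
  have sp: "(LINT y|lborel. Gx (t - s) (x - y) * v s y ^ 3)
     = (LINT y|lborel. Gx (t - s) (x - y) * defect s y) + indicator {1..} s * (M0 ^ 3 * \<alpha>\<^sub>1 * (1 / s * Gx t x + time_quotient t x s))"
    if s: "0 < s" "s < t" for s
  proof (cases "1 \<le> s")
    case True
    have "(LINT y|lborel. Gx (t - s) (x - y) * v s y ^ 3)
      = (LINT y|lborel. Gx (t - s) (x - y) * defect s y + M0 ^ 3 * (\<alpha>\<^sub>1 / s) * (Gx (t - s) (x - y) * G (s / 3) y))"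
      using True by (intro Bochner_Integration.integral_cong) (auto simp: defect_def power_mult_distrib G_cube algebra_simps)
    also have "\<dots> = (LINT y|lborel. Gx (t - s) (x - y) * defect s y) + M0 ^ 3 * (\<alpha>\<^sub>1 / s) * (LINT y|lborel. Gx (t - s) (x - y) * G (s / 3) y)"
    proof (subst Bochner_Integration.integral_add)
      have "integrable lborel (\<lambda>y. Gx (t - s) (x - y) * G (s / 3) y)"
        by (rule conv_bounds(1)[OF G_integrable, where c = "800 * (t - s) powr (-1)"]) (use Gx_sup[of "t - s"] s in auto)
      then show "integrable lborel (\<lambda>y. M0 ^ 3 * (\<alpha>\<^sub>1 / s) * (Gx (t - s) (x - y) * G (s / 3) y))" by simp
    qed (use S.kernels_le_kernel_majorant(3)[OF s] in auto)
    also have "(LINT y|lborel. Gx (t - s) (x - y) * G (s / 3) y) = Gx ((t - s) + s / 3) x"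
      by (rule Gx_convolution) (use s in auto)
    also have "(t - s) + s / 3 = t - 2 * s / 3" by simp
    finally show ?thesis using True s by (simp add: time_quotient_def diff_divide_distrib algebra_simps)
  next
    case False
    then show ?thesis by (simp add: defect_def)
  qed
  have si: "set_integrable lborel {1..<t} (time_quotient t x)" by (rule set_integrable_subset[OF time_quotient_integrable]) auto
  note l = ln_set_integral[OF less_imp_le[OF t]]
  have ii: "set_integrable lborel {1..<t} (\<lambda>s. M0 ^ 3 * \<alpha>\<^sub>1 * (1 / s * Gx t x + time_quotient t x s))"
    by (intro set_integrable_mult_right set_integral_add set_integrable_mult_left l si)
  have ind: "(\<lambda>s. indicator {0<..<t} s *\<^sub>R (indicator {1..} s * (M0 ^ 3 * \<alpha>\<^sub>1 * (1 / s * Gx t x + time_quotient t x s))))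
    = (\<lambda>s. indicator {1..<t} s *\<^sub>R (M0 ^ 3 * \<alpha>\<^sub>1 * (1 / s * Gx t x + time_quotient t x s)))" by (auto simp: indicator_def)
  have "potx (\<lambda>s y. v s y ^ 3) t x = (LINT s:{0<..<t}|lborel. (LINT y|lborel. Gx (t - s) (x - y) * defect s y) + indicator {1..} s * (M0 ^ 3 * \<alpha>\<^sub>1 * (1 / s * Gx t x + time_quotient t x s)))"
    unfolding potx_def by (rule set_lebesgue_integral_cong) (use sp in auto)
  also have "\<dots> = potx defect t x + (LINT s:{0<..<t}|lborel. indicator {1..} s * (M0 ^ 3 * \<alpha>\<^sub>1 * (1 / s * Gx t x + time_quotient t x s)))"
    unfolding potx_def
    by (rule set_integral_add(2)[OF S.potx_integrable]) (use ii in \<open>simp only: set_integrable_def ind\<close>)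
  also have "(LINT s:{0<..<t}|lborel. indicator {1..} s * (M0 ^ 3 * \<alpha>\<^sub>1 * (1 / s * Gx t x + time_quotient t x s)))
    = (LINT s:{1..<t}|lborel. M0 ^ 3 * \<alpha>\<^sub>1 * (1 / s * Gx t x + time_quotient t x s))"
    unfolding set_lebesgue_integral_def ind ..
  also have "\<dots> = M0 ^ 3 * \<alpha>\<^sub>1 * ((LINT s:{1..<t}|lborel. 1 / s * Gx t x) + (LINT s:{1..<t}|lborel. time_quotient t x s))"
    using set_integral_add(2)[OF set_integrable_mult_left[OF l(1), of "Gx t x"] si] by simp
  also have "(LINT s:{1..<t}|lborel. 1 / s * Gx t x) = ln t * Gx t x"
    unfolding l(2)[symmetric] by (rule set_integral_mult_left)
  finally show ?thesis .
qed

definition bvx_total :: "real \<Rightarrow> real" where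
  "bvx_total t = (LINT s:{0<..<t}|lborel. (LINT y|lborel. b y * vx s y))"

text \<open>This and \<open>Psi'\<close> are the two profiles in the original variables, free of
  similarity scaling and of chosen weak derivatives; their agreement with \<open>Phi\<close> and
  \<open>Psi\<close> is shown separately.\<close>

definition Phi' :: "real \<Rightarrow> real \<Rightarrow> real" where
  "Phi' t x = potx (\<lambda>s y. b y * vx s y) t x - bvx_total t * Gx t x"

definition Psi' :: "real \<Rightarrow> real \<Rightarrow> real" where
  "Psi' t x = d * \<alpha>\<^sub>1 * (LINT s:{0<..<t}|lborel. time_quotient t x s)"

definition remainder :: "real \<Rightarrow> real \<Rightarrow> real" where
  "remainder t x = v t x - M0 * G t x - (bvx_total t + \<alpha>\<^sub>1 * d * M0 ^ 3 * ln t) * Gx t x - (d * calH - m0) * Gx t x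
     - M0 ^ 3 * Psi' t x - Phi' t x"

lemma remainder_eq:
  assumes t: "1 < t"
  shows "remainder t x = heat_remainder t x + (d * (early_remainder t x + (late_remainder t x + - 1 * tail_remainder t x)) + - (d * M0 ^ 3 * \<alpha>\<^sub>1) * late_profile t x)"
proof -
  have t0: "0 < t" using t by simp
  have un: "{0<..<t} = {0<..<1} \<union> {1..<t}" using t by auto
  have "(LINT s:{0<..<t}|lborel. time_quotient t x s) = late_profile t x + (LINT s:{1..<t}|lborel. time_quotient t x s)"
    unfolding un late_profile_def by (rule set_integral_Un) (use t in \<open>auto intro: set_integrable_subset[OF time_quotient_integrable]\<close>)
  then have "potx (\<lambda>s y. v s y ^ 3) t x = potx defect t x + M0 ^ 3 * \<alpha>\<^sub>1 * (ln t * Gx t x + ((LINT s:{0<..<t}|lborel. time_quotient t x s) - late_profile t x))"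
    using potx_v3[OF t, of x] by simp
  moreover have "potx defect t x = calH * Gx t x + early_remainder t x + late_remainder t x - tail_remainder t x" using potx_defect[OF t0, of x] by simp
  ultimately have e: "potx (\<lambda>s y. v s y ^ 3) t x = calH * Gx t x + early_remainder t x + late_remainder t x - tail_remainder t x
     + M0 ^ 3 * \<alpha>\<^sub>1 * (ln t * Gx t x + ((LINT s:{0<..<t}|lborel. time_quotient t x s) - late_profile t x))" by simp
  show ?thesis
    unfolding remainder_def Phi'_def Psi'_def heat_remainder_def duhamel[OF t0, of x] potx_flux[OF t0] e by (simp add: algebra_simps)
qed

lemma remainder_small: "small remainder"
proof -
  have "small (\<lambda>t x. heat_remainder t x + (d * (early_remainder t x + (late_remainder t x + - 1 * tail_remainder t x)) + - (d * M0 ^ 3 * \<alpha>\<^sub>1) * late_profile t x))"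
    by (intro small_add small_cmult heat_remainder_small early_remainder_small late_remainder_small tail_remainder_small late_profile_small)
  then show ?thesis by (rule small_cong) (use remainder_eq in auto)
qed

end

subsection \<open>The terms of the expansion\<close>

lemma set_integral_rescale:
  fixes f :: "real \<Rightarrow> real"
  assumes "0 < t"
  shows "(LINT s:{0<..<t}|lborel. f s) = t * (LINT r:{0<..<1}|lborel. f (t * r))"
proof -
  have "indicator {0<..<t} (0 + t * r) = (indicator {0<..<1} r :: real)" for r
    using assms by (auto simp: indicator_def zero_less_mult_iff)
  then show ?thesis
    unfolding set_lebesgue_integral_def
    using lborel_integral_real_affine[of t "\<lambda>s. indicator {0<..<t} s *\<^sub>R f s" 0] assms by simp
qed

lemma G_scale: "0 < t \<Longrightarrow> G (t * r) x = 1 / sqrt t * G r (x / sqrt t)"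
  by (simp add: G_def powr_mult powr_minus_divide powr_half_sqrt power_divide mult.left_commute[of t 4])

lemma Gx_scale: "0 < t \<Longrightarrow> Gx (t * r) x = 1 / t * Gx r (x / sqrt t)"
  by (simp add: Gx_def G_scale)

text \<open>\<open>F s\<close> is the cube of the heat kernel minus its mass
  \<open>\<alpha>\<^sub>1 / s\<close> times the heat kernel, hence of mass 0.\<close>

lemma F_eq:
  assumes s: "0 < s"
  shows "F s y = \<alpha>\<^sub>1 / s * (G (s / 3) y - G s y)"
proof -
  have 1: "s powr (-3/2) = 1 / (s * sqrt s)" "pi powr (3/2) = pi * sqrt pi" "3 powr (-1/2) = 1 / sqrt (3::real)"
    using s powr_add[of s 1 "1/2"] powr_add[of pi 1 "1/2"] by (auto simp: powr_minus_divide powr_half_sqrt)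
  have e: "- 3 * (y / sqrt s)\<^sup>2 / 4 = - y\<^sup>2 / (4 * (s / 3))" "- (y / sqrt s)\<^sup>2 / 4 = - y\<^sup>2 / (4 * s)"
    using s by (auto simp: power_divide)
  have r: "sqrt (4 * pi * (s / 3)) = 2 * sqrt pi * sqrt s / sqrt 3" "sqrt (4 * pi * s) = 2 * sqrt pi * sqrt s"
    by (auto simp: real_sqrt_mult real_sqrt_divide)
  have "F s y = 1 / (s * sqrt s) * (1 / (8 * (pi * sqrt pi)) * (exp (- y\<^sup>2 / (4 * (s / 3))) - 1 / sqrt 3 * exp (- y\<^sup>2 / (4 * s))))"
    unfolding F_def F_star_def 1 e ..
  also have "\<dots> = 1 / (4 * pi) * (1 / sqrt 3) / s * (exp (- y\<^sup>2 / (4 * (s / 3))) / (2 * sqrt pi * sqrt s / sqrt 3) - exp (- y\<^sup>2 / (4 * s)) / (2 * sqrt pi * sqrt s))"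
    using s by (simp add: field_simps)
  also have "\<dots> = \<alpha>\<^sub>1 / s * (G (s / 3) y - G s y)"
    using s by (simp only: \<alpha>\<^sub>1_def 1 r G_eq zero_less_divide_iff zero_less_numeral simp_thms)
  finally show ?thesis .
qed

lemma convolution_F:
  assumes s: "0 < s" "s < 1"
  shows "Defs.convolution (G (1 - s)) (F s) z = \<alpha>\<^sub>1 * ((G (1 - 2 * s / 3) z - G 1 z) / s)"
proof -
  have i: "integrable lborel (\<lambda>y. G (1 - s) (z - y) * G r y)" if "0 < r" for r
    by (rule conv_bounds(1)[OF G_integrable[OF that], where c = "(1 - s) powr (-1/2)"]) (use G_le[of "1 - s"] s in auto)
  have "Defs.convolution (G (1 - s)) (F s) z
    = (LINT y|lborel. \<alpha>\<^sub>1 / s * (G (1 - s) (z - y) * G (s / 3) y - G (1 - s) (z - y) * G s y))"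
    unfolding Defs.convolution_def F_eq[OF s(1)] by (intro Bochner_Integration.integral_cong) (auto simp: algebra_simps)
  also have "\<dots> = \<alpha>\<^sub>1 / s * (Defs.convolution (G (1 - s)) (G (s / 3)) z - Defs.convolution (G (1 - s)) (G s) z)"
    unfolding Defs.convolution_def using i s by simp
  also have "Defs.convolution (G (1 - s)) (G (s / 3)) z = G (1 - s + s / 3) z" by (rule G_convolution) (use s in auto)
  also have "Defs.convolution (G (1 - s)) (G s) z = G (1 - s + s) z" by (rule G_convolution) (use s in auto)
  finally show ?thesis by (simp add: right_diff_distrib diff_divide_distrib)
qed

text \<open>On [1/3, 1] the time derivative of the kernel is at most 800 * 3 * 2 = 4800 for all z,
  and the time shift 2s/3 cancels the division by s.\<close>

lemma G_time_quotient:
  assumes s: "0 < s" "s < 1"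
  shows "\<bar>(G (1 - 2 * s / 3) z - G 1 z) / s\<bar> \<le> 4800"
proof -
  have "norm (G (1 - 2 * s / 3) z - G 1 z) \<le> 4800 * norm ((1 - 2 * s / 3) - 1)"
  proof (rule field_differentiable_bound[of "{1/3..1}" "\<lambda>t. G t z" "\<lambda>t. Gxx t z"])
    fix r :: real assume r: "r \<in> {1/3..1}"
    show "((\<lambda>t. G t z) has_real_derivative Gxx r z) (at r within {1/3..1})"
      by (rule has_field_derivative_at_within[OF G_deriv_t]) (use r in auto)
    have "\<bar>Gxx r z\<bar> \<le> 800 * r powr (-1) * G (2 * r) z" by (rule kernel_bounds(3)) (use r in auto)
    also have "\<dots> \<le> 800 * 3 * 2"
    proof (intro mult_mono mult_left_mono)
      show "r powr (-1) \<le> 3" using r by (auto simp: powr_minus_divide field_simps)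
      have "G (2 * r) z \<le> (2 * r) powr (-1/2)" using r by (intro G_le) auto
      also have "\<dots> \<le> (1/4) powr (-1/2)" using r by (intro powr_mono2') auto
      also have "\<dots> = 2" by (simp add: powr_minus_divide powr_half_sqrt real_sqrt_divide)
      finally show "G (2 * r) z \<le> 2" .
    qed auto
    finally show "norm (Gxx r z) \<le> 4800" by simp
  qed (use s in auto)
  then show ?thesis using s by (simp add: abs_divide pos_divide_le_eq)
qed

text \<open>The semigroup law evaluates the convolution in closed form as a difference quotient of G
  in time. It is bounded in s, and its z-derivative, the time quotient of \<open>Gx\<close>, is
  bounded as well, so differentiation goes under the integral.\<close>

lemma Psi_star_eq: "Psi_star d z = d * \<alpha>\<^sub>1 * (LINT s:{0<..<1}|lborel. time_quotient 1 z s)"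
proof -
  have "((\<lambda>z. LINT s:{0<..<1}|lborel. (G (1 - 2 * s / 3) z - G 1 z) / s) has_real_derivative (LINT s:{0<..<1}|lborel. time_quotient 1 z s)) (at z)"
  proof (rule set_integral_has_real_derivative)
    fix s x :: real assume s: "s \<in> {0<..<1}"
    show "((\<lambda>x. (G (1 - 2 * s / 3) x - G 1 x) / s) has_real_derivative time_quotient 1 x s) (at x)"
      unfolding time_quotient_def by (intro DERIV_cdivide DERIV_diff G_deriv_x) (use s in auto)
    show "\<bar>time_quotient 1 x s\<bar> \<le> 12800" using time_quotient_sup[of s 1 x] s by simp
  next
    show "set_integrable lborel {0<..<1} (\<lambda>s::real. 12800::real)" by (simp add: set_integrable_def)
    fix x show "set_integrable lborel {0<..<1} (\<lambda>s. (G (1 - 2 * s / 3) x - G 1 x) / s)"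
      by (rule set_integrable_bounded[where c = 4800]) (measurable, rule G_time_quotient)
  qed measurable
  moreover have "(\<lambda>z. LINT s:{0<..<1}|lborel. Defs.convolution (G (1 - s)) (F s) z)
      = (\<lambda>z. \<alpha>\<^sub>1 * (LINT s:{0<..<1}|lborel. (G (1 - 2 * s / 3) z - G 1 z) / s))"
  proof
    fix z
    have "(LINT s:{0<..<1}|lborel. Defs.convolution (G (1 - s)) (F s) z) = (LINT s:{0<..<1}|lborel. \<alpha>\<^sub>1 * ((G (1 - 2 * s / 3) z - G 1 z) / s))"
      by (rule set_lebesgue_integral_cong) (auto simp: convolution_F)
    also note set_integral_mult_right
    finally show "(LINT s:{0<..<1}|lborel. Defs.convolution (G (1 - s)) (F s) z) = \<alpha>\<^sub>1 * (LINT s:{0<..<1}|lborel. (G (1 - 2 * s / 3) z - G 1 z) / s)" .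
  qed
  ultimately have "((\<lambda>z. LINT s:{0<..<1}|lborel. Defs.convolution (G (1 - s)) (F s) z) has_real_derivative
      \<alpha>\<^sub>1 * (LINT s:{0<..<1}|lborel. time_quotient 1 z s)) (at z)"
    by (simp only: DERIV_cmult)
  then show ?thesis unfolding Psi_star_def by (simp add: DERIV_imp_deriv)
qed

text \<open>Self-similarity: the substitution s = t r maps the integral over (0, t) to (0, 1), and
  \<open>Gx\<close> scales by 1/t in the variable x / sqrt t.\<close>

lemma Psi_eq:
  assumes t: "0 < t"
  shows "Psi d t x = d * \<alpha>\<^sub>1 * (LINT s:{0<..<t}|lborel. time_quotient t x s)"
proof -
  have sc: "t * time_quotient t x (t * r) = 1 / t * time_quotient 1 (x / sqrt t) r" for r
  proof -
    have "t - 2 * (t * r) / 3 = t * (1 - 2 * r / 3)" by (simp add: algebra_simps)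
    then show ?thesis
      unfolding time_quotient_def using Gx_scale[OF t, of "1 - 2 * r / 3" x] Gx_scale[OF t, of 1 x] t by (simp add: field_simps)
  qed
  have "(LINT s:{0<..<t}|lborel. time_quotient t x s) = (LINT r:{0<..<1}|lborel. t * time_quotient t x (t * r))"
    using set_integral_rescale[OF t] by simp
  also have "\<dots> = 1 / t * (LINT r:{0<..<1}|lborel. time_quotient 1 (x / sqrt t) r)" unfolding sc by (rule set_integral_mult_right)
  finally show ?thesis by (simp add: Psi_def Psi_star_eq)
qed

section \<open>The profile generated by the linear source\<close>

context flow
begin

definition bvx_mass :: "real \<Rightarrow> real" where "bvx_mass s = (LINT y|lborel. b y * vx s y)"

text \<open>The source \<open>phi\<close> with the representative \<open>vx\<close> in place of the
  weak derivative; its mass vanishes at every positive time.\<close>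

definition centred_source :: "real \<Rightarrow> real \<Rightarrow> real" where "centred_source s y = b y * vx s y - bvx_mass s * G s y"

lemma bvx_mass_le: "0 < s \<Longrightarrow> \<bar>bvx_mass s\<bar> \<le> (LINT y|lborel. \<bar>b y * vx s y\<bar>)"
  unfolding bvx_mass_def by (rule integral_abs_bound)

lemma bvx_mass_measurable [measurable]: "bvx_mass \<in> borel_measurable borel"
  unfolding bvx_mass_def[abs_def] by measurable

lemma bvx_mass_integrable: "0 < t \<Longrightarrow> set_integrable lborel {0<..<t} bvx_mass"
  unfolding set_integrable_def
proof (rule Bochner_Integration.integrable_bound)
  assume t: "0 < t"
  show "integrable lborel (\<lambda>s. indicator {0<..<t} s *\<^sub>R (sqrt (sq b * D0) * s powr (-3/4)))"
    using set_integrable_mult_right[of "sqrt (sq b * D0)" lborel "{0<..<t}" "\<lambda>s. s powr (-3/4)"] powr_has_integral(1)[of "-3/4" t] t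
    by (simp add: set_integrable_def)
  show "AE s in lborel. norm (indicator {0<..<t} s *\<^sub>R bvx_mass s) \<le> norm (indicator {0<..<t} s *\<^sub>R (sqrt (sq b * D0) * s powr (-3/4)))"
    using order_trans[OF order_trans[OF bvx_mass_le bvx_bounds(2)] abs_ge_self] by (intro AE_I2) (auto simp: indicator_def)
qed measurable

lemma source_centred_source: "0 < t \<Longrightarrow> \<exists>c. source centred_source (2 * sqrt (sq b * D0)) t c"
proof -
  assume t: "0 < t"
  obtain c where "source (\<lambda>s y. b y * vx s y) (sqrt (sq b * D0)) t c" using source_bvx[OF t] by blast
  then interpret B: source "\<lambda>s y. b y * vx s y" "sqrt (sq b * D0)" t c .
  have "source centred_source (2 * sqrt (sq b * D0)) t (c + sqrt (sq b * D0) * (t/2) powr (-3/4) * (t/2) powr (-1/2))"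
  proof
    show "(\<lambda>(s, y). centred_source s y) \<in> borel_measurable (borel \<Otimes>\<^sub>M borel)" unfolding centred_source_def by measurable
    show "0 < t" by fact
  next
    fix s :: real assume s: "0 < s"
    show i: "integrable lborel (centred_source s)"
      unfolding centred_source_def[abs_def] using bvx_bounds(1)[OF s] G_integrable[OF s] by simp
    have "(LINT y|lborel. \<bar>centred_source s y\<bar>) \<le> (LINT y|lborel. \<bar>b y * vx s y\<bar> + \<bar>bvx_mass s\<bar> * G s y)"
    proof (rule integral_mono)
      show "integrable lborel (\<lambda>y. \<bar>b y * vx s y\<bar> + \<bar>bvx_mass s\<bar> * G s y)" using bvx_bounds(1)[OF s] G_integrable[OF s] by simp
      show "\<bar>centred_source s y\<bar> \<le> \<bar>b y * vx s y\<bar> + \<bar>bvx_mass s\<bar> * G s y" for y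
        unfolding centred_source_def using abs_triangle_ineq4[of "b y * vx s y" "bvx_mass s * G s y"] by (simp add: abs_mult)
    qed (use i in simp)
    also have "\<dots> = (LINT y|lborel. \<bar>b y * vx s y\<bar>) + \<bar>bvx_mass s\<bar>"
      using bvx_bounds(1)[OF s] G_integrable[OF s] G_integral[OF s] by simp
    also have "\<dots> \<le> 2 * (sqrt (sq b * D0) * s powr (-3/4))" using bvx_mass_le[OF s] bvx_bounds(2)[OF s] by linarith
    finally show "(LINT y|lborel. \<bar>centred_source s y\<bar>) \<le> 2 * sqrt (sq b * D0) * s powr (-3/4)" by simp
  next
    fix s y assume s: "t / 2 \<le> s" "s < t"
    then have s0: "0 < s" using t by simp
    have "\<bar>bvx_mass s\<bar> \<le> sqrt (sq b * D0) * s powr (-3/4)" by (rule order_trans[OF bvx_mass_le[OF s0] bvx_bounds(2)[OF s0]])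
    also have "\<dots> \<le> sqrt (sq b * D0) * (t/2) powr (-3/4)"
      using s t D0(1) by (intro mult_left_mono powr_mono2') auto
    finally have 1: "\<bar>bvx_mass s\<bar> \<le> sqrt (sq b * D0) * (t/2) powr (-3/4)" .
    have 2: "G s y \<le> (t/2) powr (-1/2)"
      by (rule order_trans[OF G_le[OF s0]]) (use s t in \<open>auto intro!: powr_mono2'\<close>)
    have "\<bar>bvx_mass s\<bar> * G s y \<le> sqrt (sq b * D0) * (t/2) powr (-3/4) * (t/2) powr (-1/2)"
      by (rule mult_mono[OF 1 2]) (use D0(1) in auto)
    then show "\<bar>centred_source s y\<bar> \<le> c + sqrt (sq b * D0) * (t/2) powr (-3/4) * (t/2) powr (-1/2)"
      unfolding centred_source_def using abs_triangle_ineq4[of "b y * vx s y" "bvx_mass s * G s y"] B.h_sup[OF s, of y]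
      by (simp add: abs_mult)
  qed
  then show ?thesis by blast
qed

text \<open>The convolution of Gx(t - s) with G(s) is Gx(t) whatever s is, so the subtracted masses
  simply integrate to \<open>bvx_total t\<close>.\<close>

lemma potx_centred_source:
  assumes t: "0 < t"
  shows "potx centred_source t x = Phi' t x"
proof -
  obtain c where "source (\<lambda>s y. b y * vx s y) (sqrt (sq b * D0)) t c" using source_bvx[OF t] by blast
  then interpret B: source "\<lambda>s y. b y * vx s y" "sqrt (sq b * D0)" t c .
  have "potx centred_source t x = (LINT s:{0<..<t}|lborel. (LINT y|lborel. Gx (t - s) (x - y) * (b y * vx s y)) - bvx_mass s * Gx t x)"
    unfolding potx_def
  proof (rule set_lebesgue_integral_cong)
    show "\<forall>s. s \<in> {0<..<t} \<longrightarrow> (LINT y|lborel. Gx (t - s) (x - y) * centred_source s y) = (LINT y|lborel. Gx (t - s) (x - y) * (b y * vx s y)) - bvx_mass s * Gx t x"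
    proof (intro allI impI)
      fix s assume "s \<in> {0<..<t}"
      then have s: "0 < s" "s < t" by auto
      have i: "integrable lborel (\<lambda>y. Gx (t - s) (x - y) * G s y)"
        by (rule conv_bounds(1)[OF G_integrable, where c = "800 * (t - s) powr (-1)"]) (use Gx_sup[of "t - s"] s in auto)
      have "(LINT y|lborel. Gx (t - s) (x - y) * centred_source s y) = (LINT y|lborel. Gx (t - s) (x - y) * (b y * vx s y) - bvx_mass s * (Gx (t - s) (x - y) * G s y))"
        by (intro Bochner_Integration.integral_cong) (auto simp: centred_source_def algebra_simps)
      also have "\<dots> = (LINT y|lborel. Gx (t - s) (x - y) * (b y * vx s y)) - bvx_mass s * (LINT y|lborel. Gx (t - s) (x - y) * G s y)"
        using B.kernels_le_kernel_majorant(3)[OF s, of x] i by simp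
      also have "(LINT y|lborel. Gx (t - s) (x - y) * G s y) = Gx (t - s + s) x" by (rule Gx_convolution) (use s in auto)
      finally show "(LINT y|lborel. Gx (t - s) (x - y) * centred_source s y) = (LINT y|lborel. Gx (t - s) (x - y) * (b y * vx s y)) - bvx_mass s * Gx t x" by simp
    qed
  qed simp
  also have "\<dots> = potx (\<lambda>s y. b y * vx s y) t x - (LINT s:{0<..<t}|lborel. bvx_mass s * Gx t x)"
    unfolding potx_def by (rule set_integral_diff(2)[OF B.potx_integrable set_integrable_mult_left[OF bvx_mass_integrable[OF t]]])
  also have "(LINT s:{0<..<t}|lborel. bvx_mass s * Gx t x) = bvx_total t * Gx t x"
    unfolding bvx_total_def bvx_mass_def[symmetric] by (rule set_integral_mult_left)
  finally show ?thesis by (simp add: Phi'_def)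
qed

section \<open>Transfer to the given solution\<close>

text \<open>\<open>u\<close> is tied to \<open>v\<close> at positive times and up to null sets,
  which suffices because every term of the expansion other than \<open>u t\<close> itself sees it
  only through integrals.\<close>

context
  fixes u :: "real \<Rightarrow> real \<Rightarrow> real"
  assumes u: "\<And>t. 0 < t \<Longrightarrow> u t \<in> borel_measurable borel" "\<And>t. 0 < t \<Longrightarrow> AE x in lborel. u t x = v t x"
    and ux: "\<And>t. 0 < t \<Longrightarrow> weak_deriv (u t) \<in> borel_measurable borel" "\<And>t. 0 < t \<Longrightarrow> AE x in lborel. weak_deriv (u t) x = vx t x"
begin

lemma bvx_mass_eq: "0 < s \<Longrightarrow> (LINT y|lborel. b y * weak_deriv (u s) y) = bvx_mass s"
  unfolding bvx_mass_def by (rule integral_cong_AE) (use ux[of s] in \<open>auto elim: eventually_mono\<close>)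

lemma K_eq:
  assumes t: "1 < t"
  shows "K b u t * ln t = bvx_total t"
proof -
  have "(LINT s:{0<..<t}|lborel. (LINT y|lborel. b y * weak_deriv (u s) y)) = bvx_total t"
    unfolding bvx_total_def bvx_mass_def[symmetric] by (rule set_lebesgue_integral_cong) (auto simp: bvx_mass_eq)
  then show ?thesis using t by (simp add: K_def)
qed

lemma u_cube: "0 < s \<Longrightarrow> AE y in lborel. \<bar>u s y\<bar>\<^sup>2 * u s y = v s y ^ 3"
  using u(2)[of s] by (auto elim!: eventually_mono simp: power3_eq_cube power2_eq_square)

text \<open>The two time intervals of \<open>calM\<close> miss only the instant 1 of the positive
  half-line, a null set. On the first the defect is the cube of the solution, on the second the
  difference of the cubes.\<close>

lemma calM_eq: "calM d M0 u = d * calH"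
proof -
  let ?H = "\<lambda>s. LINT y|lborel. defect s y"
  have 1: "(LINT s:{0<..<1}|lborel. (LINT y|lborel. \<bar>u s y\<bar>\<^sup>2 * u s y)) = (LINT s:{0<..<1}|lborel. ?H s)"
  proof (rule set_lebesgue_integral_cong)
    show "\<forall>s. s \<in> {0<..<1} \<longrightarrow> (LINT y|lborel. \<bar>u s y\<bar>\<^sup>2 * u s y) = ?H s"
    proof (intro allI impI, rule integral_cong_AE)
      fix s :: real assume s: "s \<in> {0<..<1}"
      have [measurable]: "u s \<in> borel_measurable borel" using u(1)[of s] s by simp
      show "(\<lambda>y. \<bar>u s y\<bar>\<^sup>2 * u s y) \<in> borel_measurable lborel" by measurable
      show "defect s \<in> borel_measurable lborel" by measurable
      show "AE y in lborel. \<bar>u s y\<bar>\<^sup>2 * u s y = defect s y"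
        using u_cube[of s] s by (auto simp: defect_def)
    qed
  qed simp
  have 2: "(LINT s:{1<..}|lborel. (LINT y|lborel. \<bar>u s y\<bar>\<^sup>2 * u s y - \<bar>M0 * G s y\<bar>\<^sup>2 * (M0 * G s y))) = (LINT s:{1<..}|lborel. ?H s)"
  proof (rule set_lebesgue_integral_cong)
    show "\<forall>s. s \<in> {1<..} \<longrightarrow> (LINT y|lborel. \<bar>u s y\<bar>\<^sup>2 * u s y - \<bar>M0 * G s y\<bar>\<^sup>2 * (M0 * G s y)) = ?H s"
    proof (intro allI impI, rule integral_cong_AE)
      fix s :: real assume s: "s \<in> {1<..}"
      have [measurable]: "u s \<in> borel_measurable borel" using u(1)[of s] s by simp
      show "(\<lambda>y. \<bar>u s y\<bar>\<^sup>2 * u s y - \<bar>M0 * G s y\<bar>\<^sup>2 * (M0 * G s y)) \<in> borel_measurable lborel" by measurable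
      show "defect s \<in> borel_measurable lborel" by measurable
      have "0 < s" using s by simp
      from u_cube[OF this] show "AE y in lborel. \<bar>u s y\<bar>\<^sup>2 * u s y - \<bar>M0 * G s y\<bar>\<^sup>2 * (M0 * G s y) = defect s y"
        by eventually_elim (use s in \<open>simp add: defect_def power3_eq_cube power2_eq_square\<close>)
    qed
  qed simp
  have i1: "set_integrable lborel {0<..<1} ?H" by (rule set_integrable_subset[OF defect_set_integrable]) auto
  have i2: "set_integrable lborel {1<..} ?H" by (rule set_integrable_subset[OF defect_set_integrable]) auto
  have "calH = (LINT s:{0<..<1} \<union> {1<..}|lborel. ?H s)"
    unfolding calH_def set_lebesgue_integral_def
  proof (rule integral_cong_AE)
    show "AE s in lborel. indicator {0<..} s *\<^sub>R ?H s = indicator ({0<..<1} \<union> {1<..}) s *\<^sub>R ?H s"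
      using AE_lborel_singleton[of 1] by eventually_elim (auto simp: indicator_def)
  qed measurable
  also have "\<dots> = (LINT s:{0<..<1}|lborel. ?H s) + (LINT s:{1<..}|lborel. ?H s)"
    by (rule set_integral_Un[OF _ i1 i2]) auto
  finally show ?thesis unfolding calM_def 1 2 by (simp add: algebra_simps)
qed

text \<open>The substitution of sqrt t * y for y undoes the similarity scaling; its Jacobian sqrt t
  is compensated by the scaling of \<open>G\<close>.\<close>

lemma rescaled_convolution:
  assumes t: "0 < t" and s: "0 < s"
  shows "Defs.convolution (G (1 - s)) (\<lambda>y. phi b u (t * s) (sqrt t * y)) z = (LINT y|lborel. G (t - t * s) (sqrt t * z - y) * centred_source (t * s) y)"
proof -
  have ts: "0 < t * s" and st: "sqrt t \<noteq> 0" using t s by auto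
  have sc: "sqrt t * G (t - t * s) (sqrt t * z - (0 + sqrt t * y)) = G (1 - s) (z - y)" for y
  proof -
    have "sqrt t * z - (0 + sqrt t * y) = sqrt t * (z - y)" "t - t * s = t * (1 - s)" by (auto simp: algebra_simps)
    then show ?thesis using G_scale[OF t, of "1 - s" "sqrt t * (z - y)"] t by simp
  qed
  have "(LINT y|lborel. G (t - t * s) (sqrt t * z - y) * phi b u (t * s) y)
    = (LINT y|lborel. sqrt t * (G (t - t * s) (sqrt t * z - (0 + sqrt t * y)) * phi b u (t * s) (0 + sqrt t * y)))"
    using t by (subst lborel_integral_real_affine[OF st, where t = 0]) simp
  also have "\<dots> = Defs.convolution (G (1 - s)) (\<lambda>y. phi b u (t * s) (sqrt t * y)) z"
    unfolding Defs.convolution_def mult.assoc[symmetric] sc by simp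
  finally have "Defs.convolution (G (1 - s)) (\<lambda>y. phi b u (t * s) (sqrt t * y)) z = (LINT y|lborel. G (t - t * s) (sqrt t * z - y) * phi b u (t * s) y)" ..
  also have "\<dots> = (LINT y|lborel. G (t - t * s) (sqrt t * z - y) * centred_source (t * s) y)"
  proof (rule integral_cong_AE)
    note [measurable] = ux(1)[OF ts]
    show "(\<lambda>y. G (t - t * s) (sqrt t * z - y) * phi b u (t * s) y) \<in> borel_measurable lborel" unfolding phi_def by measurable
    show "(\<lambda>y. G (t - t * s) (sqrt t * z - y) * centred_source (t * s) y) \<in> borel_measurable lborel" unfolding centred_source_def by measurable
    show "AE y in lborel. G (t - t * s) (sqrt t * z - y) * phi b u (t * s) y = G (t - t * s) (sqrt t * z - y) * centred_source (t * s) y"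
      using ux(2)[OF ts] by eventually_elim (simp add: phi_def centred_source_def bvx_mass_eq[OF ts])
  qed
  finally show ?thesis .
qed

text \<open>The powers of t balance: -1 and 3/2 from the definitions, -1 from the substitution in
  time, 1/2 from the chain rule in space.\<close>

lemma Phi_eq:
  assumes t: "0 < t"
  shows "Phi b u t x = Phi' t x"
proof -
  obtain c where "source centred_source (2 * sqrt (sq b * D0)) t c" using source_centred_source[OF t] by blast
  then interpret P: source centred_source "2 * sqrt (sq b * D0)" t c .
  have "(\<lambda>z. LINT s:{0<..<1}|lborel. Defs.convolution (G (1 - s)) (\<lambda>y. phi b u (t * s) (sqrt t * y)) z)
     = (\<lambda>z. 1 / t * pot centred_source t (sqrt t * z))"
  proof
    fix z
    have "(LINT s:{0<..<1}|lborel. Defs.convolution (G (1 - s)) (\<lambda>y. phi b u (t * s) (sqrt t * y)) z)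
       = (LINT s:{0<..<1}|lborel. (LINT y|lborel. G (t - t * s) (sqrt t * z - y) * centred_source (t * s) y))"
      by (rule set_lebesgue_integral_cong) (auto simp: rescaled_convolution[OF t])
    then show "(LINT s:{0<..<1}|lborel. Defs.convolution (G (1 - s)) (\<lambda>y. phi b u (t * s) (sqrt t * y)) z) = 1 / t * pot centred_source t (sqrt t * z)"
      unfolding pot_def using set_integral_rescale[OF t] t by simp
  qed
  moreover have "((\<lambda>z. 1 / t * pot centred_source t (sqrt t * z)) has_real_derivative (1 / t * (potx centred_source t x * sqrt t))) (at (x / sqrt t))"
  proof (rule DERIV_cmult)
    have "(pot centred_source t has_real_derivative potx centred_source t x) (at (sqrt t * (x / sqrt t)))" using P.pot_deriv[of x] t by simp
    from DERIV_chain2[OF this DERIV_cmult_Id]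
    show "((\<lambda>z. pot centred_source t (sqrt t * z)) has_real_derivative potx centred_source t x * sqrt t) (at (x / sqrt t))" .
  qed
  ultimately have "deriv (\<lambda>z. LINT s:{0<..<1}|lborel. Defs.convolution (G (1 - s)) (\<lambda>y. phi b u (t * s) (sqrt t * y)) z) (x / sqrt t) = 1 / t * (potx centred_source t x * sqrt t)"
    by (simp only: DERIV_imp_deriv)
  then have "Phi b u t x = 1 / t * (t powr (3/2) * (1 / t * (potx centred_source t x * sqrt t)))" by (simp add: Phi_def Phi_star_def)
  also have "t powr (3/2) = t * sqrt t" using powr_add[of t 1 "1/2"] t by (simp add: powr_half_sqrt)
  also have "1 / t * (t * sqrt t * (1 / t * (potx centred_source t x * sqrt t))) = potx centred_source t x" using t by (simp add: field_simps)
  finally show ?thesis by (simp add: potx_centred_source[OF t])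
qed

text \<open>The right side retains \<open>u t x - v t x\<close> because the two agree only almost
  everywhere; this difference disappears in the norm.\<close>

lemma expansion_error_eq:
  assumes t: "1 < t"
  shows "u t x - M0 * G t x - (K b u t + \<alpha>\<^sub>1 * d * M0 ^ 3) * ln t * deriv (G t) x
     - (calM d M0 u - m0) * deriv (G t) x - M0 ^ 3 * Psi d t x - Phi b u t x = u t x + (remainder t x - v t x)"
proof -
  have t0: "0 < t" using t by simp
  have "deriv (G t) x = Gx t x" by (rule DERIV_imp_deriv[OF G_deriv_x[OF t0]])
  moreover have "(K b u t + \<alpha>\<^sub>1 * d * M0 ^ 3) * ln t = bvx_total t + \<alpha>\<^sub>1 * d * M0 ^ 3 * ln t" by (simp add: distrib_right K_eq[OF t])
  moreover have "Psi d t x = Psi' t x" by (simp add: Psi_eq[OF t0] Psi'_def)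
  ultimately show ?thesis by (simp add: remainder_def calM_eq Phi_eq[OF t0])
qed

end

end

section \<open>Interpolation to all exponents and conclusion\<close>

text \<open>The bound of |f|^q by the supremum to the power q - 1 times |f| gives the power (-(q -
  1) - 1/2) / q = -1 + 1/(2q) of t, exactly the negative of the weight (1 - 1/q)/2 + 1/2.\<close>

lemma Lp_norm_interpolation:
  assumes m: "f \<in> borel_measurable borel" and t: "0 < t" and p: "1 \<le> p"
    and sup: "\<And>x. \<bar>f x\<bar> \<le> e * t powr (-1)" and L1: "(\<integral>\<^sup>+x. ennreal \<bar>f x\<bar> \<partial>lborel) \<le> ennreal (e * t powr (-1/2))"
  shows "ennreal (t powr (1/2 * (1 - enn2real (1 / p)) + 1/2)) * Lp_norm p f \<le> ennreal e"
proof -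
  note [measurable] = m
  have "0 \<le> e * t powr (-1)" using sup[of 0] by (rule order_trans[OF abs_ge_zero])
  then have e: "0 \<le> e" using t powr_gt_zero[of t "-1"] by (auto simp only: zero_le_mult_iff)
  show ?thesis
  proof (cases "p = \<infinity>")
    case True
    have "esssup lborel (\<lambda>x. ennreal \<bar>f x\<bar>) \<le> ennreal (e * t powr (-1))"
      by (rule esssup_I) (use sup in \<open>auto intro: ennreal_leI\<close>)
    then have "ennreal t * Lp_norm p f \<le> ennreal t * ennreal (e * t powr (-1))"
      using True by (intro mult_left_mono) (auto simp: Lp_norm_def)
    also have "\<dots> = ennreal e" using t e by (simp add: powr_minus_divide flip: ennreal_mult)
    \<comment> \<open>Here 1/p = 0, so the exponent of the weight is 1.\<close>
    finally show ?thesis using True t by simp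
  next
    case False
    then obtain q where q: "p = ennreal q" "0 \<le> q" by (cases p) auto
    then have q1: "1 \<le> q" using p by (simp add: ennreal_le_iff flip: ennreal_1)
    have pq: "enn2real p = q" "enn2real (1 / p) = 1 / q" using q q1 by (auto simp: divide_ennreal simp flip: ennreal_1)
    let ?A = "e * t powr (-1)" and ?B = "e * t powr (-1/2)"
    have "(\<integral>\<^sup>+x. ennreal (\<bar>f x\<bar> powr q) \<partial>lborel) \<le> (\<integral>\<^sup>+x. ennreal (?A powr (q - 1)) * ennreal \<bar>f x\<bar> \<partial>lborel)"
    proof (rule nn_integral_mono)
      fix x
      have "\<bar>f x\<bar> powr q = \<bar>f x\<bar> powr (q - 1) * \<bar>f x\<bar>"
        using powr_add[of "\<bar>f x\<bar>" "q - 1" 1] by (cases "f x = 0") auto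
      also have "\<dots> \<le> ?A powr (q - 1) * \<bar>f x\<bar>"
        using q1 sup by (intro mult_right_mono powr_mono2) auto
      finally show "ennreal (\<bar>f x\<bar> powr q) \<le> ennreal (?A powr (q - 1)) * ennreal \<bar>f x\<bar>"
        by (simp add: ennreal_leI flip: ennreal_mult)
    qed
    also have "\<dots> = ennreal (?A powr (q - 1)) * (\<integral>\<^sup>+x. ennreal \<bar>f x\<bar> \<partial>lborel)" by (rule nn_integral_cmult) measurable
    also have "\<dots> \<le> ennreal (?A powr (q - 1)) * ennreal ?B" by (intro mult_left_mono L1) simp
    also have "\<dots> = ennreal (?A powr (q - 1) * ?B)" using e by (simp flip: ennreal_mult)
    finally have I: "(\<integral>\<^sup>+x. ennreal (\<bar>f x\<bar> powr q) \<partial>lborel) \<le> ennreal (?A powr (q - 1) * ?B)" .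
    then have "enn2real (\<integral>\<^sup>+x. ennreal (\<bar>f x\<bar> powr q) \<partial>lborel) \<le> ?A powr (q - 1) * ?B"
      using e by (intro enn2real_leI) auto
    then have "Lp_norm p f \<le> ennreal ((?A powr (q - 1) * ?B) powr (1 / q))"
      using I False m q1 unfolding Lp_norm_def pq by (auto simp: Let_def top_unique intro!: ennreal_leI powr_mono2)
    then have "ennreal (t powr (1/2 * (1 - 1 / q) + 1/2)) * Lp_norm p f
      \<le> ennreal (t powr (1/2 * (1 - 1 / q) + 1/2)) * ennreal ((?A powr (q - 1) * ?B) powr (1 / q))"
      by (intro mult_left_mono) auto
    also have "\<dots> = ennreal (t powr (1/2 * (1 - 1 / q) + 1/2) * (?A powr (q - 1) * ?B) powr (1 / q))" by (simp flip: ennreal_mult)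
    also have "t powr (1/2 * (1 - 1 / q) + 1/2) * (?A powr (q - 1) * ?B) powr (1 / q) = e"
    proof (cases "e = 0")
      case False
      then have e0: "0 < e" using e by simp
      have "?A powr (q - 1) * ?B = (e powr (q - 1) * e powr 1) * (t powr (- (q - 1)) * t powr (-1/2))"
        unfolding powr_mult powr_powr using e0 by simp
      also have "\<dots> = e powr q * t powr (- (q - 1) + -1/2)" unfolding powr_add[symmetric] by simp
      finally have "(?A powr (q - 1) * ?B) powr (1 / q) = (e powr q) powr (1 / q) * (t powr (- (q - 1) + -1/2)) powr (1 / q)"
        using e0 t by (simp add: powr_mult)
      also have "\<dots> = e * t powr ((- (q - 1) + -1/2) / q)" using e0 t q1 by (simp add: powr_powr)
      finally have "t powr (1/2 * (1 - 1 / q) + 1/2) * (?A powr (q - 1) * ?B) powr (1 / q)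
         = e * (t powr (1/2 * (1 - 1 / q) + 1/2) * t powr ((- (q - 1) + -1/2) / q))" by simp
      also have "t powr (1/2 * (1 - 1 / q) + 1/2) * t powr ((- (q - 1) + -1/2) / q) = t powr 0"
        unfolding powr_add[symmetric] using q1 by (intro arg_cong2[of _ _ _ _ "(powr)"]) (auto simp: field_simps)
      finally show ?thesis using t by simp
    qed simp
    finally show ?thesis unfolding pq .
  qed
qed

lemma small_Lp_tendsto:
  assumes "small R" "1 \<le> p"
  shows "((\<lambda>t. ennreal (t powr (1/2 * (1 - enn2real (1 / p)) + 1/2)) * Lp_norm p (R t)) \<longlongrightarrow> 0) at_top"
proof -
  obtain e where e: "(e \<longlongrightarrow> 0) at_top" "\<forall>\<^sub>F t in at_top. R t \<in> borel_measurable borel \<and>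
     (\<forall>x. \<bar>R t x\<bar> \<le> e t * t powr (-1)) \<and> (\<integral>\<^sup>+x. ennreal \<bar>R t x\<bar> \<partial>lborel) \<le> ennreal (e t * t powr (-1/2))"
    using assms(1) unfolding small_def by blast
  have le: "((\<lambda>t. ennreal (e t)) \<longlongrightarrow> 0) at_top" using tendsto_ennrealI[OF e(1)] by simp
  show ?thesis
  proof (rule tendsto_sandwich[OF _ _ tendsto_const le])
    show "\<forall>\<^sub>F t in at_top. ennreal (t powr (1/2 * (1 - enn2real (1 / p)) + 1/2)) * Lp_norm p (R t) \<le> ennreal (e t)"
      using e(2) eventually_gt_at_top[of 0]
    proof eventually_elim
      case (elim t)
      then show ?case by (intro Lp_norm_interpolation assms(2)) blast+
    qed
  qed simp
qed

theorem theorem2p5: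
  fixes a b u0 :: "real \<Rightarrow> real" and d :: real
    and u :: "real \<Rightarrow> real \<Rightarrow> real" and p :: ennreal
  assumes "standing_assumptions a b"
    and "in_weighted_L1 u0" and "in_Lp \<infinity> u0"
    and "is_solution a d u0 u"
    and "1 \<le> p"
  defines "M \<equiv> mass u0" and "m \<equiv> first_moment u0"
  shows "((\<lambda>t. ennreal (t powr (1/2 * (1 - enn2real (1 / p)) + 1/2)) *
            Lp_norm p (\<lambda>x. u t x - M * G t x
              - (K b u t + \<alpha>\<^sub>1 * d * M ^ 3) * ln t * deriv (G t) x
              - (calM d M u - m) * deriv (G t) x
              - M ^ 3 * Psi d t x - Phi b u t x))
          \<longlongrightarrow> 0) at_top"
proof -
  obtain b' \<beta> B v vx vxx vt where flux: "flow b b' d \<beta> B u0 v vx vxx vt"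
    and uv: "\<forall>t>0. u t \<in> borel_measurable borel \<and> (AE x in lborel. u t x = v t x) \<and>
       weak_deriv (u t) \<in> borel_measurable borel \<and> (AE x in lborel. weak_deriv (u t) x = vx t x)"
    using solution_flow[OF assms(1-4)] by blast
  interpret flow b b' d \<beta> B u0 v vx vxx vt by (rule flux)
  have M: "M = M0" "m = m0" by (simp_all add: M_def m_def M0_def m0_def)
  have "\<forall>\<^sub>F t in at_top. remainder t \<in> borel_measurable borel"
    using remainder_small unfolding small_def by (auto elim: eventually_mono)
  then have "\<forall>\<^sub>F t in at_top. Lp_norm p (remainder t) = Lp_norm p (\<lambda>x. u t x - M * G t x
              - (K b u t + \<alpha>\<^sub>1 * d * M ^ 3) * ln t * deriv (G t) x
              - (calM d M u - m) * deriv (G t) x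
              - M ^ 3 * Psi d t x - Phi b u t x)"
    \<comment> \<open>\<open>K\<close> divides by ln t, so its identification requires t >
      1.\<close>
    using eventually_gt_at_top[of 1]
  proof eventually_elim
    case (elim t)
    then have t: "0 < t" by simp
    have eq: "(\<lambda>x. u t x - M * G t x - (K b u t + \<alpha>\<^sub>1 * d * M ^ 3) * ln t * deriv (G t) x
              - (calM d M u - m) * deriv (G t) x - M ^ 3 * Psi d t x - Phi b u t x) = (\<lambda>x. u t x + (remainder t x - v t x))"
      unfolding M by (rule ext, rule expansion_error_eq) (use uv elim in auto)
    show ?case
      unfolding eq
    \<comment> \<open>The error equals the remainder only almost everywhere, so the norms are
      equated through measurability of both; that of \<open>remainder t\<close> is part of
      \<open>small\<close>.\<close>
    proof (rule Lp_norm_cong_AE)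
      show "AE x in lborel. remainder t x = u t x + (remainder t x - v t x)"
        using uv t by (auto elim: eventually_mono)
      show "(\<lambda>x. u t x + (remainder t x - v t x)) \<in> borel_measurable borel"
        using uv t elim(1) v_int[OF t] by (intro borel_measurable_add borel_measurable_diff) auto
    qed (fact elim)
  qed
  then show ?thesis
    by (rule Lim_transform_eventually[OF small_Lp_tendsto[OF remainder_small assms(5)], rotated, OF eventually_mono]) simp
qed

end
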